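(* Let $0<p<\infty$ and $F\in H^p(\Omega_-)$. Then $F(w)$ has a non-tangential boundary limit $F(\zeta)\in L^p(\Gamma,|\mathrm{d}\zeta|)$ a.e. on $\Gamma$, $\lVert F\rVert_{L^p(\Gamma,|\mathrm{d}\zeta|)}\leqslant\lVert F\rVert_{H^p(\Omega_-)}$, and $\lVert F_{\sigma+\tau,-\tau}-\chi_\Gamma F\rVert_{L^p(\gamma,|\mathrm{d}\zeta|)}\to0$ as $\tau\to0$, where $0<\tau<\sigma$. Besides, if $1\leqslant p<\infty$, then $$\frac1{2\pi\mathrm{i}}\int_\Gamma\frac{F(\zeta)}{\zeta-w}\,\mathrm{d}\zeta=\begin{cases}0&\text{if } w\in\Omega_+,\\ -F(w)&\text{if } w\in\Omega_-.\end{cases}$$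
   Context: Fix $\sigma>0$. For $s>0$, $t\in\mathbb{R}$ let $D_{s,t}=\{u+\mathrm{i}v: |u|<s,\ v>t\}$ and let $\Gamma_{s,t}=\partial D_{s,t}=\Gamma_{s,t,1}\cup\Gamma_{s,t,2}\cup\Gamma_{s,t,3}$ with $\Gamma_{s,t,1}=\{-s+\mathrm{i}v: v>t\}$, $\Gamma_{s,t,2}=\{u+\mathrm{i}t: |u|\leqslant s\}$, $\Gamma_{s,t,3}=\{s+\mathrm{i}v: v>t\}$, oriented so that $D_{s,t}$ lies on its left. Put $\Omega_+=D_{\sigma,0}$, $\Omega_-=\mathbb{C}\setminus\overline{D_{\sigma,0}}$, $\Gamma=\Gamma_{\sigma,0}$, $\Gamma_j=\Gamma_{\sigma,0,j}$. $H^p(\Omega_-)$ is the set of $F$ analytic on $\Omega_-$ with $\lVert F\rVert_{H^p(\Omega_-)}=\sup_{s>\sigma,\,t<0}\big(\int_{\Gamma_{s,t}}|F(w)|^p|\mathrm{d}w|\big)^{1/p}<\infty$. For $0<p<1$, $\lVert\cdot\rVert_{L^p}$ and $\lVert\cdot\rVert_{H^p}$ are given by the same formulas though not norms. Non-tangential limits: for $\alpha>0$ and $\zeta\in\Gamma\setminus\{\pm\sigma\}$ let $\Omega_{\alpha-}(\zeta)$ be $\zeta-\{x+\mathrm{i}y: x>0,|y|<\alpha x\}$ if $\zeta\in\Gamma_1$, $\zeta-\{x+\mathrm{i}y: y>0,|x|<\alpha y\}$ if $\zeta\in\Gamma_2\setminus\{\pm\sigma\}$, $\zeta-\{x+\mathrm{i}y: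 x<0,|y|<-\alpha x\}$ if $\zeta\in\Gamma_3$. $F$ on $\Omega_-$ has non-tangential boundary limit $F(\zeta_0)$ at $\zeta_0$ if for all $\alpha>0$, $F(w)\to F(\zeta_0)$ as $w\to\zeta_0$, $w\in\Omega_{\alpha-}(\zeta_0)\cap\Omega_-$. Transported functions: let $\gamma_1=\{\mathrm{Re}\,w=-\sigma\}$, $\gamma_2=\mathbb{R}$, $\gamma_3=\{\mathrm{Re}\,w=\sigma\}$, $\gamma=\gamma_1\cup\gamma_2\cup\gamma_3$; $\gamma_{s,t,1}=\gamma_1\cap\{\mathrm{Im}\,w>t\}$, $\gamma_{s,t,2}=\gamma_2\cap\{|\mathrm{Re}\,w|\leqslant s\}$, $\gamma_{s,t,3}=\gamma_3\cap\{\mathrm{Im}\,w>t\}$, $\gamma_{s,t}=\bigcup_j\gamma_{s,t,j}$. Define $P_{s,t}:\gamma_{s,t}\to\Gamma_{s,t}$ (up to the null set $\{\pm\sigma\}$) by $P_{s,t}(\zeta)=\zeta+(\sigma-s)$ on $\gamma_{s,t,1}$, $\zeta+\mathrm{i}t$ on $\gamma_{s,t,2}$, $\zeta-(\sigma-s)$ on $\gamma_{s,t,3}$. For $G$ defined on $\Gamma_{s,t}$, $G_{s,t}(\zeta)=G(P_{s,t}(\zeta))$ for $\zeta\in\gamma_{s,t}$ and $G_{s,t}(\zeta)=0$ for $\zeta\in\gamma\setminus\gamma_{s,t}$. $\chi_\Gamma F$ denotes $F$ on $\Gamma\subset\gamma$ extended by $0$ to $\gamma$. *)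

theory Defs
  imports "HOL-Analysis.Analysis"
begin

section \<open>Half-strips and their boundaries\<close>

definition half_strip :: "real \<Rightarrow> real \<Rightarrow> complex set" where
  "half_strip s t = {w. \<bar>Re w\<bar> < s \<and> Im w > t}"

definition bdry1 :: "real \<Rightarrow> real \<Rightarrow> complex set" where
  "bdry1 s t = {w. Re w = - s \<and> Im w > t}"

definition bdry2 :: "real \<Rightarrow> real \<Rightarrow> complex set" where
  "bdry2 s t = {w. \<bar>Re w\<bar> \<le> s \<and> Im w = t}"

definition bdry3 :: "real \<Rightarrow> real \<Rightarrow> complex set" where
  "bdry3 s t = {w. Re w = s \<and> Im w > t}"

definition bdry :: "real \<Rightarrow> real \<Rightarrow> complex set" where
  "bdry s t = bdry1 s t \<union> bdry2 s t \<union> bdry3 s t"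

definition Omega_plus :: "real \<Rightarrow> complex set" where
  "Omega_plus \<sigma> = half_strip \<sigma> 0"

definition Omega_minus :: "real \<Rightarrow> complex set" where
  "Omega_minus \<sigma> = - closure (half_strip \<sigma> 0)"

text \<open>The unit speed parametrization of the boundary of the half-strip by the real line: down
  the left side, to the right along the bottom, up the right side, so that the half-strip lies on
  the left.\<close>

definition bdry_path :: "real \<Rightarrow> real \<Rightarrow> real \<Rightarrow> complex" where
  "bdry_path s t x =
    (if x < - s then Complex (- s) (t + (- s - x))
     else if x \<le> s then Complex x t
     else Complex s (t + (x - s)))"

text \<open>The measure \<open>|d\<zeta>|\<close> on the boundary is the image of Lebesgue measure under this
  parametrization, and \<open>d\<zeta>\<close>-integrals are (absolutely convergent) integrals along it. The
  derivative is unspecified at the two corners, which form a null set.\<close>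

definition bdry_measure :: "real \<Rightarrow> real \<Rightarrow> complex measure" where
  "bdry_measure s t = distr lborel borel (bdry_path s t)"

definition bdry_integrable :: "real \<Rightarrow> real \<Rightarrow> (complex \<Rightarrow> complex) \<Rightarrow> bool" where
  "bdry_integrable s t f \<longleftrightarrow>
    integrable lborel (\<lambda>x. f (bdry_path s t x) * vector_derivative (bdry_path s t) (at x))"

definition bdry_integral :: "real \<Rightarrow> real \<Rightarrow> (complex \<Rightarrow> complex) \<Rightarrow> complex" where
  "bdry_integral s t f =
    (LINT x|lborel. f (bdry_path s t x) * vector_derivative (bdry_path s t) (at x))"


section \<open>Lebesgue and Hardy spaces\<close>

text \<open>The case distinction extends the power \<open>I powr (1 / p)\<close> to \<open>I = \<infinity>\<close>.\<close>

definition Lp_norm :: "real \<Rightarrow> complex measure \<Rightarrow> (complex \<Rightarrow> complex) \<Rightarrow> ennreal" where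
  "Lp_norm p M f =
    (let I = (\<integral>\<^sup>+ w. ennreal (norm (f w) powr p) \<partial>M)
     in if I = \<infinity> then \<infinity> else ennreal (enn2real I powr (1 / p)))"

definition Lp_space :: "real \<Rightarrow> complex measure \<Rightarrow> (complex \<Rightarrow> complex) set" where
  "Lp_space p M = {f. f \<in> borel_measurable M \<and> Lp_norm p M f < \<infinity>}"

definition Hp_norm :: "real \<Rightarrow> real \<Rightarrow> (complex \<Rightarrow> complex) \<Rightarrow> ennreal" where
  "Hp_norm \<sigma> p F = (SUP (s, t) \<in> {\<sigma><..} \<times> {..<0}. Lp_norm p (bdry_measure s t) F)"

definition Hp_space :: "real \<Rightarrow> real \<Rightarrow> (complex \<Rightarrow> complex) set" where
  "Hp_space \<sigma> p = {F. F analytic_on Omega_minus \<sigma> \<and> Hp_norm \<sigma> p F < \<infinity>}"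


section \<open>Non-tangential limits\<close>

definition nt_region :: "real \<Rightarrow> real \<Rightarrow> complex \<Rightarrow> complex set" where
  "nt_region \<sigma> \<alpha> \<zeta> =
    (if \<zeta> \<in> bdry1 \<sigma> 0 then {\<zeta> - Complex x y | x y. x > 0 \<and> \<bar>y\<bar> < \<alpha> * x}
     else if \<zeta> \<in> bdry2 \<sigma> 0 then {\<zeta> - Complex x y | x y. y > 0 \<and> \<bar>x\<bar> < \<alpha> * y}
     else {\<zeta> - Complex x y | x y. x < 0 \<and> \<bar>y\<bar> < - \<alpha> * x})"

definition has_nt_limit :: "real \<Rightarrow> (complex \<Rightarrow> complex) \<Rightarrow> complex \<Rightarrow> complex \<Rightarrow> bool" where
  "has_nt_limit \<sigma> F \<zeta> l \<longleftrightarrow>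
    \<zeta> \<in> bdry \<sigma> 0 - {- of_real \<sigma>, of_real \<sigma>} \<and>
    (\<forall>\<alpha>>0. (F \<longlongrightarrow> l) (at \<zeta> within (nt_region \<sigma> \<alpha> \<zeta> \<inter> Omega_minus \<sigma>)))"


section \<open>Transport to three fixed lines\<close>

text \<open>The lines \<open>Re w = - \<sigma>\<close>, \<open>Im w = 0\<close> and \<open>Re w = \<sigma>\<close>, parametrized by
  arc length; the measure \<open>|d\<zeta>|\<close> on their union is the sum of the three arc length measures.\<close>

definition line :: "real \<Rightarrow> nat \<Rightarrow> real \<Rightarrow> complex" where
  "line \<sigma> j x = (if j = 1 then Complex (- \<sigma>) x else if j = 2 then Complex x 0 else Complex \<sigma> x)"

definition lines_measure :: "real \<Rightarrow> complex measure" where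
  "lines_measure \<sigma> = distr (count_space {1, 2, 3} \<Otimes>\<^sub>M lborel) borel (\<lambda>(j, x). line \<sigma> j x)"

definition gamma1 :: "real \<Rightarrow> real \<Rightarrow> real \<Rightarrow> complex set" where
  "gamma1 \<sigma> s t = {w. Re w = - \<sigma> \<and> Im w > t}"

definition gamma2 :: "real \<Rightarrow> real \<Rightarrow> real \<Rightarrow> complex set" where
  "gamma2 \<sigma> s t = {w. Im w = 0 \<and> \<bar>Re w\<bar> \<le> s}"

definition gamma3 :: "real \<Rightarrow> real \<Rightarrow> real \<Rightarrow> complex set" where
  "gamma3 \<sigma> s t = {w. Re w = \<sigma> \<and> Im w > t}"

text \<open>When \<open>\<plusminus>\<sigma>\<close> lies on two of the pieces, the vertical one takes precedence; this affects
  only a null set.\<close>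

definition transport_point :: "real \<Rightarrow> real \<Rightarrow> real \<Rightarrow> complex \<Rightarrow> complex" where
  "transport_point \<sigma> s t \<zeta> =
    (if \<zeta> \<in> gamma1 \<sigma> s t then \<zeta> + of_real (\<sigma> - s)
     else if \<zeta> \<in> gamma3 \<sigma> s t then \<zeta> - of_real (\<sigma> - s)
     else \<zeta> + \<i> * of_real t)"

definition transport ::
  "real \<Rightarrow> real \<Rightarrow> real \<Rightarrow> (complex \<Rightarrow> complex) \<Rightarrow> complex \<Rightarrow> complex" where
  "transport \<sigma> s t G \<zeta> =
    (if \<zeta> \<in> gamma1 \<sigma> s t \<union> gamma2 \<sigma> s t \<union> gamma3 \<sigma> s t
     then G (transport_point \<sigma> s t \<zeta>) else 0)"


section \<open>Consistency of the definitions\<close>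

lemma closure_half_strip:
  assumes "s > 0"
  shows "closure (half_strip s t) = {w. \<bar>Re w\<bar> \<le> s \<and> Im w \<ge> t}"
proof
  have "closed {w::complex. \<bar>Re w\<bar> \<le> s \<and> Im w \<ge> t}"
    by (intro closed_Collect_conj closed_Collect_le continuous_intros)
  then show "closure (half_strip s t) \<subseteq> {w. \<bar>Re w\<bar> \<le> s \<and> Im w \<ge> t}"
    by (rule closure_minimal[rotated]) (auto simp: half_strip_def)
  show "{w. \<bar>Re w\<bar> \<le> s \<and> Im w \<ge> t} \<subseteq> closure (half_strip s t)"
  proof
    fix w :: complex assume w: "w \<in> {w. \<bar>Re w\<bar> \<le> s \<and> Im w \<ge> t}"
    let ?g = "\<lambda>e::real. Complex ((1 - e) * Re w) (Im w + e)"
    have "((\<lambda>e. Complex ((1 - e) * Re w) (Im w + e)) \<longlongrightarrow> Complex ((1 - 0) * Re w) (Im w + 0)) (at_right 0)"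
      by (intro tendsto_intros)
    then have lim: "(?g \<longlongrightarrow> w) (at_right 0)" by simp
    have "\<forall>\<^sub>F e in at_right 0. e \<in> {0<..<(1::real)}"
      by (rule eventually_at_right_real) simp
    then have "\<forall>\<^sub>F e in at_right 0. ?g e \<in> half_strip s t"
    proof (rule eventually_mono)
      fix e :: real assume e: "e \<in> {0<..<1}"
      have "\<bar>(1 - e) * Re w\<bar> = (1 - e) * \<bar>Re w\<bar>" using e by (simp add: abs_mult)
      also have "\<dots> \<le> (1 - e) * s" using e w by (intro mult_left_mono) auto
      also have "\<dots> < s" using e assms by (simp add: algebra_simps)
      finally show "?g e \<in> half_strip s t" using e w by (simp add: half_strip_def)
    qed
    then have "\<forall>\<^sub>F e in at_right 0. ?g e \<in> closure (half_strip s t)"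
      by (rule eventually_mono) (use closure_subset in blast)
    from Lim_in_closed_set[OF closed_closure this _ lim]
    show "w \<in> closure (half_strip s t)" by simp
  qed
qed

lemma open_half_strip: "open (half_strip s t)"
  unfolding half_strip_def
  by (intro open_Collect_conj open_Collect_less continuous_intros)

lemma frontier_half_strip:
  assumes "s > 0"
  shows "frontier (half_strip s t) = bdry s t"
proof -
  have "frontier (half_strip s t) = {w. \<bar>Re w\<bar> \<le> s \<and> Im w \<ge> t} - half_strip s t"
    unfolding frontier_def closure_half_strip[OF assms] interior_open[OF open_half_strip] ..
  also have "\<dots> = bdry s t"
    using assms by (auto simp: half_strip_def bdry_def bdry1_def bdry2_def bdry3_def)
  finally show ?thesis .
qed

lemma range_bdry_path:
  assumes "s > 0"
  shows "range (bdry_path s t) = bdry s t"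
proof
  show "range (bdry_path s t) \<subseteq> bdry s t"
    by (auto simp: bdry_path_def bdry_def bdry1_def bdry2_def bdry3_def)
  have "w \<in> range (bdry_path s t)" if "w \<in> bdry s t" for w
  proof -
    consider "w \<in> bdry1 s t" | "w \<in> bdry2 s t" | "w \<in> bdry3 s t"
      using \<open>w \<in> bdry s t\<close> by (auto simp: bdry_def)
    then show ?thesis
    proof cases
      case 1
      then have "w = bdry_path s t (t - s - Im w)"
        by (simp add: bdry1_def bdry_path_def complex_eq_iff)
      then show ?thesis by blast
    next
      case 2
      then have "w = bdry_path s t (Re w)"
        by (auto simp: bdry2_def bdry_path_def complex_eq_iff)
      then show ?thesis by blast
    next
      case 3
      then have "w = bdry_path s t (Im w - t + s)"
        using assms by (simp add: bdry3_def bdry_path_def complex_eq_iff)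
      then show ?thesis by blast
    qed
  qed
  then show "bdry s t \<subseteq> range (bdry_path s t)" by blast
qed

lemma line_measurable:
  "(\<lambda>(j, x). line \<sigma> j x) \<in> (count_space {1, 2, 3} \<Otimes>\<^sub>M lborel) \<rightarrow>\<^sub>M borel"
proof -
  have "line \<sigma> j \<in> borel_measurable lborel" for j
    unfolding line_def Complex_eq by measurable
  then show ?thesis
    by (intro measurable_pair_measure_countable1) auto
qed

lemma nn_integral_lines_measure:
  assumes [measurable]: "f \<in> borel_measurable borel"
  shows "(\<integral>\<^sup>+ w. f w \<partial>lines_measure \<sigma>) =
    (\<integral>\<^sup>+ v. f (Complex (- \<sigma>) v) \<partial>lborel) + (\<integral>\<^sup>+ u. f (Complex u 0) \<partial>lborel)
    + (\<integral>\<^sup>+ v. f (Complex \<sigma> v) \<partial>lborel)"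
proof -
  note line_measurable[measurable]
  interpret C: sigma_finite_measure "count_space {1, 2, 3::nat}"
    by (rule sigma_finite_measure_count_space_finite) simp
  interpret pair_sigma_finite "count_space {1, 2, 3::nat}" "lborel :: real measure" ..
  have "(\<integral>\<^sup>+ w. f w \<partial>lines_measure \<sigma>) =
      (\<integral>\<^sup>+ z. f (case z of (j, x) \<Rightarrow> line \<sigma> j x) \<partial>(count_space {1, 2, 3} \<Otimes>\<^sub>M lborel))"
    unfolding lines_measure_def by (rule nn_integral_distr) measurable
  also have "\<dots> = (\<integral>\<^sup>+ j. \<integral>\<^sup>+ x. f (line \<sigma> j x) \<partial>lborel \<partial>count_space {1, 2, 3})"
    using measurable_compose[OF line_measurable assms]
    by (subst lborel.nn_integral_fst[symmetric]) (simp_all add: case_prod_beta)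
  also have "\<dots> = (\<Sum>j\<in>{1, 2, 3}. \<integral>\<^sup>+ x. f (line \<sigma> j x) \<partial>lborel)"
    by (rule nn_integral_count_space_finite) simp
  also have "\<dots> = (\<integral>\<^sup>+ v. f (Complex (- \<sigma>) v) \<partial>lborel) + (\<integral>\<^sup>+ u. f (Complex u 0) \<partial>lborel)
      + (\<integral>\<^sup>+ v. f (Complex \<sigma> v) \<partial>lborel)"
    by (simp add: line_def add.assoc)
  finally show ?thesis .
qed

end

theory Submission
  imports Defs "HOL-Complex_Analysis.Complex_Analysis" "HOL-Probability.Sinc_Integral"
begin

text \<open>
  The exterior of the half-strip contains the three half-planes \<open>Re w < - \<sigma>\<close>, \<open>Im w < 0\<close> and
  \<open>Re w > \<sigma>\<close>, and each side of the boundary lies on the edge of one of them. Letting the half-strips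
  in the definition of the norm widen or descend without bound shows that \<open>F\<close> belongs to the
  classical Hardy space of each half-plane (\<open>hardy_fL\<close>, \<open>hardy_fB\<close>, \<open>hardy_fR\<close>). The boundary limits,
  the norm inequality and the \<open>L\<^sup>p\<close> convergence are therefore statements about the upper half-plane
  (\<open>hardy_upper_boundary\<close>); the transported contours overhang the sides only by segments of
  length \<open>\<tau>\<close>, on which an integrable function has little mass (\<open>Lp_truncate\<close>).

  In the upper half-plane the case \<open>p = 2\<close> comes first. Shifting a contour shows that the inner
  product of \<open>f(\<cdot> + ia)\<close> and \<open>f(\<cdot> + ib)\<close> depends on \<open>a + b\<close> only. Hence the energy of \<open>f\<close> on horizontal lines
  is a bounded midpoint convex function of the height, so it decreases, and the functions
  \<open>f(\<cdot> + ia)\<close> are Cauchy in \<open>L\<^sup>2\<close> as \<open>a \<longlonglongrightarrow> 0\<close> (\<open>hardy2_cauchy\<close>). Poisson's formula and a Vitali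
  covering give a weak-type bound for the nontangential maximal function (\<open>weak_type\<close>). As
  \<open>f(\<cdot> + ia)\<close> is continuous up to the real line and approximates \<open>f\<close>, the set where \<open>f\<close> oscillates
  in a cone is null (\<open>hardy2_nontangential_limit\<close>). Bounded functions follow, since they
  lie in \<open>H\<^sup>2\<close> after division by \<open>z + \<i>\<close>.

  For general \<open>p\<close> there is a \<open>W\<close> in \<open>H\<^sup>2\<close> with positive real part and \<open>\<bar>f\<bar> powr (p/2) \<le> \<bar>W\<bar>\<close> (\<open>hardy_majorant\<close>): essentially, the analytic
  function whose real part is the Poisson integral of \<open>\<bar>f\<bar> powr (p/2)\<close>. The inequality is the
  maximum principle for the analytic function \<open>f / W powr (2/p)\<close>. Now \<open>f\<close> is the product of a
  bounded function and a power of \<open>W\<close>, both with nontangential limits almost everywhere, and \<open>\<bar>f\<bar> powr p \<le> \<bar>W\<bar>\<^sup>2\<close>, where \<open>W\<close> converges in \<open>L\<^sup>2\<close>,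
  gives the domination needed for convergence in \<open>L\<^sup>p\<close>.

  For the Cauchy formula, the part of a large square outside a slightly larger half-strip is cut
  into three rectangles, each contained in one of the half-planes. The common edges cancel, the far
  edges contribute nothing in the limit because \<open>F\<close> vanishes at infinity away from the boundary, and the
  contour is finally moved to the boundary by pairing the \<open>L\<^sup>p\<close> convergence with a kernel of size
  \<open>1 / (1 + \<bar>x\<bar>)\<close> (\<open>integral_kernel_limit\<close>).
\<close>

section \<open>Cauchy's theorem on rectangles\<close>

lemma has_contour_integral_linepath_same_Im:
  assumes "a < b" and "(f has_contour_integral I) (linepath (Complex a c) (Complex b c))"
  shows "((\<lambda>x. f (Complex x c)) has_integral I) {a..b}"
proof -
  have "((\<lambda>z. f (z + \<i> * of_real c)) has_contour_integral I) (linepath (of_real a) (of_real b))"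
  proof -
    have "linepath (of_real a) (of_real b) x + \<i> * of_real c = linepath (Complex a c) (Complex b c) x" for x
      by (simp add: linepath_def complex_eq_iff algebra_simps)
    moreover have "complex_of_real b - of_real a = Complex b c - Complex a c" by (simp add: complex_eq_iff)
    ultimately show ?thesis using assms(2) by (simp only: has_contour_integral_linepath)
  qed
  then have "((\<lambda>x. f (of_real x + \<i> * of_real c)) has_integral I) {a..b}"
    using assms(1) by (subst (asm) has_contour_integral_linepath_Reals_iff) auto
  then show ?thesis by (simp only: Complex_eq)
qed

text \<open>Contour integrals over rectangles are rewritten as Lebesgue integrals over intervals, since
  these are what survives the passage to infinite lines.\<close>

lemma has_contour_integral_rectpath_set_integrals:
  assumes ab: "a < b" "c < d"
    and cont: "continuous_on (path_image (rectpath (Complex a c) (Complex b d))) g"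
    and I: "(g has_contour_integral I) (rectpath (Complex a c) (Complex b d))"
  shows "I = (LINT x:{a..b}|lborel. g (Complex x c)) - (LINT x:{a..b}|lborel. g (Complex x d))
    + \<i> * ((LINT y:{c..d}|lborel. g (Complex b y)) - (LINT y:{c..d}|lborel. g (Complex a y)))"
proof -
  have pim: "path_image (rectpath (Complex a c) (Complex b d)) =
     {z. Re z \<in> {a, b} \<and> Im z \<in> {c..d}} \<union> {z. Im z \<in> {c, d} \<and> Re z \<in> {a..b}}"
    using path_image_rectpath[of "Complex a c" "Complex b d"] ab by simp
  have H: "(LINT x:{a..b}|lborel. g (Complex x e)) = integral {a..b} (\<lambda>x. g (Complex x e))"
    if "e \<in> {c,d}" for e
  proof (rule set_borel_integral_eq_integral, rule borel_integrable_atLeastAtMost')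
    show "continuous_on {a..b} (\<lambda>x. g (Complex x e))"
      by (rule continuous_on_compose2[OF cont, where f="\<lambda>x. Complex x e"])
        (use that in \<open>auto simp: pim intro!: continuous_on_Complex continuous_intros\<close>)
  qed
  have V: "(LINT x:{c..d}|lborel. g (Complex e x)) = integral {c..d} (\<lambda>x. g (Complex e x))"
    if "e \<in> {a,b}" for e
  proof (rule set_borel_integral_eq_integral, rule borel_integrable_atLeastAtMost')
    show "continuous_on {c..d} (\<lambda>x. g (Complex e x))"
      by (rule continuous_on_compose2[OF cont, where f="\<lambda>x. Complex e x"])
        (use that in \<open>auto simp: pim intro!: continuous_on_Complex continuous_intros\<close>)
  qed
  define G where "G u v = contour_integral (linepath u v) g" for u v
  have seg: "(g has_contour_integral G u v) (linepath u v)" 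
    if "closed_segment u v \<subseteq> path_image (rectpath (Complex a c) (Complex b d))" for u v
    unfolding G_def
    by (rule has_contour_integral_integral, rule contour_integrable_continuous_linepath)
       (rule continuous_on_subset[OF cont that])
  have s1: "closed_segment (Complex a c) (Complex b c) \<subseteq> path_image (rectpath (Complex a c) (Complex b d))"
    and s2: "closed_segment (Complex b c) (Complex b d) \<subseteq> path_image (rectpath (Complex a c) (Complex b d))"
    and s3: "closed_segment (Complex b d) (Complex a d) \<subseteq> path_image (rectpath (Complex a c) (Complex b d))"
    and s4: "closed_segment (Complex a d) (Complex a c) \<subseteq> path_image (rectpath (Complex a c) (Complex b d))"
    by (auto simp: rectpath_def Let_def path_image_join)
  have s3': "closed_segment (Complex a d) (Complex b d) \<subseteq> path_image (rectpath (Complex a c) (Complex b d))"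
    and s4': "closed_segment (Complex a c) (Complex a d) \<subseteq> path_image (rectpath (Complex a c) (Complex b d))"
    using s3 s4 by (simp_all add: closed_segment_commute)
  have "(g has_contour_integral (G (Complex a c) (Complex b c) + (G (Complex b c) (Complex b d) +
      (G (Complex b d) (Complex a d) + G (Complex a d) (Complex a c))))) (rectpath (Complex a c) (Complex b d))"
    unfolding rectpath_def Let_def complex.sel
    by (intro has_contour_integral_join seg s1 s2 s3 s4) auto
  then have I_eq: "I = G (Complex a c) (Complex b c) + (G (Complex b c) (Complex b d) +
      (G (Complex b d) (Complex a d) + G (Complex a d) (Complex a c)))"
    using I has_contour_integral_unique by blast
  have r: "G (Complex b d) (Complex a d) = - G (Complex a d) (Complex b d)"
     "G (Complex a d) (Complex a c) = - G (Complex a c) (Complex a d)"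
    unfolding G_def using s3 s4
    by (auto intro!: contour_integral_reverse_linepath continuous_on_subset[OF cont])
  have h: "G (Complex a e) (Complex b e) = integral {a..b} (\<lambda>x. g (Complex x e))" if "e \<in> {c,d}" for e
  proof -
    have "((\<lambda>x. g (Complex x e)) has_integral G (Complex a e) (Complex b e)) {a..b}"
      by (rule has_contour_integral_linepath_same_Im[OF ab(1) seg]) (use that s1 s3' in auto)
    then show ?thesis by (simp add: integral_unique)
  qed
  have v: "G (Complex e c) (Complex e d) = \<i> * integral {c..d} (\<lambda>x. g (Complex e x))" if e: "e \<in> {a,b}" for e
  proof -
    have "((\<lambda>x. g (Complex e x)) has_integral (-\<i> * G (Complex e c) (Complex e d))) {c..d}"
      using has_contour_integral_linepath_same_Re_iff[of "Complex e c" e "Complex e d" c d g "G (Complex e c) (Complex e d)"]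
        seg[of "Complex e c" "Complex e d"] s2 s4' e ab by auto
    then show ?thesis by (simp add: integral_unique)
  qed
  show ?thesis
    unfolding I_eq r using h v H V by (simp add: algebra_simps)
qed

lemma Cauchy_theorem_rectangle:
  assumes ab: "a < b" "c < d" and "open U" "g holomorphic_on U"
    "cbox (Complex a c) (Complex b d) \<subseteq> U"
  shows "(LINT x:{a..b}|lborel. g (Complex x c)) - (LINT x:{a..b}|lborel. g (Complex x d))
    + \<i> * ((LINT y:{c..d}|lborel. g (Complex b y)) - (LINT y:{c..d}|lborel. g (Complex a y))) = 0"
proof -
  have im: "path_image (rectpath (Complex a c) (Complex b d)) \<subseteq> cbox (Complex a c) (Complex b d)"
    using ab by (intro path_image_rectpath_subset_cbox) auto
  have hol: "g holomorphic_on cbox (Complex a c) (Complex b d)"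
    using assms holomorphic_on_subset by blast
  have "(g has_contour_integral 0) (rectpath (Complex a c) (Complex b d))"
    by (rule Cauchy_theorem_convex_simple[OF hol]) (use im in auto)
  from has_contour_integral_rectpath_set_integrals[OF ab _ this]
  show ?thesis using holomorphic_on_imp_continuous_on[OF hol] im continuous_on_subset by metis
qed

lemma Cauchy_formula_rectangle:
  assumes ab: "a < b" "c < d" and "open U" "f holomorphic_on U"
    "cbox (Complex a c) (Complex b d) \<subseteq> U" and w: "w \<in> box (Complex a c) (Complex b d)"
  defines "g \<equiv> \<lambda>z. f z / (z - w)"
  shows "(LINT x:{a..b}|lborel. g (Complex x c)) - (LINT x:{a..b}|lborel. g (Complex x d))
    + \<i> * ((LINT y:{c..d}|lborel. g (Complex b y)) - (LINT y:{c..d}|lborel. g (Complex a y))) 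
    = 2 * of_real pi * \<i> * f w"
proof -
  have im: "path_image (rectpath (Complex a c) (Complex b d)) \<subseteq> cbox (Complex a c) (Complex b d) - {w}"
    using ab w path_image_rectpath_cbox_minus_box[of "Complex a c" "Complex b d"] by auto
  have hol: "f holomorphic_on cbox (Complex a c) (Complex b d)"
    using assms holomorphic_on_subset by blast
  have int: "w \<in> interior (cbox (Complex a c) (Complex b d))"
    using w by (simp add: interior_cbox)
  have "(g has_contour_integral (2*pi * \<i> * winding_number (rectpath (Complex a c) (Complex b d)) w * f w))
     (rectpath (Complex a c) (Complex b d))"
    unfolding g_def by (rule Cauchy_integral_formula_convex_simple[OF _ hol int]) (use im in auto)
  moreover have "winding_number (rectpath (Complex a c) (Complex b d)) w = 1"
    using w by (rule winding_number_rectpath)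
  ultimately have "(g has_contour_integral 2*pi * \<i> * f w) (rectpath (Complex a c) (Complex b d))" by simp
  from has_contour_integral_rectpath_set_integrals[OF ab _ this] 
  have *: "continuous_on (path_image (rectpath (Complex a c) (Complex b d))) g \<Longrightarrow> ?thesis" by simp
  have "continuous_on (cbox (Complex a c) (Complex b d) - {w}) g"
    unfolding g_def using holomorphic_on_imp_continuous_on[OF hol]
    by (auto intro!: continuous_intros elim: continuous_on_subset)
  then show ?thesis using * continuous_on_subset im by blast
qed

section \<open>Pointwise bounds by means of powers\<close>

abbreviation uhp :: "complex set" where "uhp \<equiv> {z. 0 < Im z}"

lemma Complex_measurable2 [measurable]:
  "(\<lambda>(x, y). Complex x y) \<in> borel_measurable (lborel \<Otimes>\<^sub>M lborel)"
  unfolding Complex_eq by measurable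

lemma Complex_measurable1: "(\<lambda>x. Complex x y) \<in> borel_measurable borel"
  "(\<lambda>y. Complex x y) \<in> borel_measurable borel"
  unfolding Complex_eq by measurable

definition square :: "complex \<Rightarrow> real \<Rightarrow> complex set" where
  "square z r = {w. \<bar>Re w - Re z\<bar> \<le> r \<and> \<bar>Im w - Im z\<bar> \<le> r}"

lemma square_eq_cbox: "square z r = cbox (Complex (Re z - r) (Im z - r)) (Complex (Re z + r) (Im z + r))"
  by (auto simp: square_def in_cbox_complex_iff)

lemma nn_integral_lborel_shift_reflect:
  fixes B :: "real \<Rightarrow> ennreal"
  assumes [measurable]: "B \<in> borel_measurable borel"
  shows "(\<integral>\<^sup>+ r. B (a + r) \<partial>lborel) = (\<integral>\<^sup>+ r. B r \<partial>lborel)"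
    "(\<integral>\<^sup>+ r. B (a - r) \<partial>lborel) = (\<integral>\<^sup>+ r. B r \<partial>lborel)"
  using nn_integral_real_affine[OF assms, of 1 a] nn_integral_real_affine[OF assms, of "-1" a]
  by simp_all

lemma norm_set_lborel_le_nn:
  fixes h :: "real \<Rightarrow> complex"
  assumes "\<And>x. x \<in> A \<Longrightarrow> ennreal (norm (h x)) \<le> k x"
  shows "ennreal (norm (LINT x:A|lborel. h x)) \<le> (\<integral>\<^sup>+ x. k x \<partial>lborel)"
proof (cases "integrable lborel (\<lambda>x. indicat_real A x *\<^sub>R h x)")
  case True
  have "ennreal (norm (LINT x:A|lborel. h x)) \<le> (\<integral>\<^sup>+ x. ennreal (norm (indicat_real A x *\<^sub>R h x)) \<partial>lborel)"
    unfolding set_lebesgue_integral_def by (rule integral_norm_bound_ennreal[OF True])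
  also have "\<dots> \<le> (\<integral>\<^sup>+ x. k x \<partial>lborel)"
    by (rule nn_integral_mono) (use assms in \<open>auto simp: indicator_def\<close>)
  finally show ?thesis .
next
  case False
  then show ?thesis by (simp add: set_lebesgue_integral_def not_integrable_integral_eq)
qed

text \<open>Cauchy's formula bounds \<open>\<bar>f z0\<bar>\<close> by a mean over the boundary of a square;
  averaging over the size of the square turns this into an area mean. Squares take the place of
  discs because Tonelli's theorem then applies in Cartesian coordinates.\<close>

lemma square_mean_value_bound:
  assumes U: "open U" "f holomorphic_on U" "square z0 r \<subseteq> U" and r: "r > 0"
  shows "ennreal (r\<^sup>2 * norm (f z0)) \<le> 
    4 * (\<integral>\<^sup>+ (x, y). ennreal (norm (f (Complex x y))) * indicator (square z0 r) (Complex x y) \<partial>(lborel \<Otimes>\<^sub>M lborel))"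
proof -
  define Q where "Q = square z0 r"
  have cont: "continuous_on Q f" 
    using U holomorphic_on_imp_continuous_on holomorphic_on_subset unfolding Q_def by blast
  have Qb: "Q \<in> sets borel" unfolding Q_def square_eq_cbox by simp
  define F where "F z = indicat_real Q z *\<^sub>R f z" for z
  have F[measurable]: "F \<in> borel_measurable borel"
    unfolding F_def by (rule borel_measurable_continuous_on_indicator[OF Qb cont])
  define k where "k = (\<lambda>(x, y). ennreal (norm (F (Complex x y))))"
  have k[measurable]: "k \<in> borel_measurable (lborel \<Otimes>\<^sub>M lborel)"
    unfolding k_def using measurable_compose[OF Complex_measurable2 F] by (simp add: case_prod_beta) 
  define T where "T = (\<integral>\<^sup>+ p. k p \<partial>(lborel \<Otimes>\<^sub>M lborel))"
  define B where "B y = (\<integral>\<^sup>+ x. k (x, y) \<partial>lborel)" for y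
  define V where "V x = (\<integral>\<^sup>+ y. k (x, y) \<partial>lborel)" for x
  have [measurable]: "B \<in> borel_measurable borel" "V \<in> borel_measurable borel"
    unfolding B_def V_def by measurable
  have BT: "(\<integral>\<^sup>+ y. B y \<partial>lborel) = T"
    unfolding B_def T_def by (rule lborel_pair.nn_integral_snd) simp
  have VT: "(\<integral>\<^sup>+ x. V x \<partial>lborel) = T"
    unfolding V_def T_def by (rule lborel.nn_integral_fst) simp
  define x0 y0 where "x0 = Re z0" and "y0 = Im z0"
  have z0: "z0 = Complex x0 y0" by (simp add: x0_def y0_def)
  \<comment> \<open>On the square of half-side \<open>\<rho>\<close> the kernel of Cauchy's formula is at most
    \<open>2 / r\<close>.\<close>
  have bound: "ennreal (pi * r * norm (f z0)) \<le> B (y0 - \<rho>) + B (y0 + \<rho>) + V (x0 + \<rho>) + V (x0 - \<rho>)"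
    if \<rho>: "r / 2 \<le> \<rho>" "\<rho> \<le> r" for \<rho>
  proof -
    have \<rho>0: "\<rho> > 0" using \<rho> r by simp
    let ?g = "\<lambda>z. f z / (z - z0)"
    have sub: "cbox (Complex (x0 - \<rho>) (y0 - \<rho>)) (Complex (x0 + \<rho>) (y0 + \<rho>)) \<subseteq> U"
    proof
      fix z assume "z \<in> cbox (Complex (x0 - \<rho>) (y0 - \<rho>)) (Complex (x0 + \<rho>) (y0 + \<rho>))"
      then have "z \<in> square z0 r" using \<rho> unfolding square_def by (auto simp: in_cbox_complex_iff x0_def y0_def)
      then show "z \<in> U" using U(3) by blast
    qed
    define I1 where "I1 = (LINT x:{x0-\<rho>..x0+\<rho>}|lborel. ?g (Complex x (y0-\<rho>)))"
    define I2 where "I2 = (LINT x:{x0-\<rho>..x0+\<rho>}|lborel. ?g (Complex x (y0+\<rho>)))"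
    define I3 where "I3 = (LINT y:{y0-\<rho>..y0+\<rho>}|lborel. ?g (Complex (x0+\<rho>) y))"
    define I4 where "I4 = (LINT y:{y0-\<rho>..y0+\<rho>}|lborel. ?g (Complex (x0-\<rho>) y))"
    have "I1 - I2 + \<i> * (I3 - I4) = 2 * of_real pi * \<i> * f z0"
      unfolding I1_def I2_def I3_def I4_def
      by (rule Cauchy_formula_rectangle[OF _ _ U(1,2) sub]) 
        (use \<rho>0 in \<open>auto simp: in_box_complex_iff x0_def y0_def\<close>)
    then have "norm (2 * of_real pi * \<i> * f z0) \<le> norm (I1 - I2) + norm (\<i> * (I3 - I4))"
      by (metis norm_triangle_ineq)
    also have "\<dots> \<le> norm I1 + norm I2 + norm I3 + norm I4"
      using norm_triangle_ineq4[of I1 I2] norm_triangle_ineq4[of I3 I4] by (simp add: norm_mult)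
    finally have *: "2 * pi * norm (f z0) \<le> norm I1 + norm I2 + norm I3 + norm I4"
      by (simp add: norm_mult)
    have le: "ennreal (norm (?g z)) \<le> ennreal (2 / r) * ennreal (norm (F z))" 
      if "z \<in> Q" "\<rho> \<le> norm (z - z0)" for z
    proof -
      have "norm (?g z) \<le> norm (f z) / \<rho>"
        using that \<rho>0 by (auto simp: norm_divide intro!: frac_le)
      also have "\<dots> \<le> norm (f z) / (r / 2)"
        using \<rho> r by (intro divide_left_mono) auto
      finally show ?thesis using that r by (simp add: F_def mult.commute flip: ennreal_mult)
    qed
    have n: "\<bar>Re (z - z0)\<bar> \<le> norm (z - z0)" "\<bar>Im (z - z0)\<bar> \<le> norm (z - z0)" for z
      by (rule abs_Re_le_cmod, rule abs_Im_le_cmod)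
    have H: "ennreal (norm (LINT x:{x0-\<rho>..x0+\<rho>}|lborel. ?g (Complex x e))) \<le> ennreal (2 / r) * B e"
      if "e = y0 - \<rho> \<or> e = y0 + \<rho>" for e
    proof -
      have "ennreal (norm (LINT x:{x0-\<rho>..x0+\<rho>}|lborel. ?g (Complex x e))) \<le> 
         (\<integral>\<^sup>+ x. ennreal (2 / r) * k (x, e) \<partial>lborel)"
        unfolding k_def prod.case
      proof (rule norm_set_lborel_le_nn, rule le)
        fix x assume x: "x \<in> {x0-\<rho>..x0+\<rho>}"
        show "Complex x e \<in> Q" using x that \<rho>0 \<rho> by (auto simp: Q_def square_def x0_def y0_def)
        show "\<rho> \<le> norm (Complex x e - z0)" using n(2)[of "Complex x e"] that \<rho>0 by (auto simp: y0_def)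
      qed
      then show ?thesis unfolding B_def by (subst (asm) nn_integral_cmult) auto
    qed
    have W: "ennreal (norm (LINT y:{y0-\<rho>..y0+\<rho>}|lborel. ?g (Complex e y))) \<le> ennreal (2 / r) * V e"
      if "e = x0 - \<rho> \<or> e = x0 + \<rho>" for e
    proof -
      have "ennreal (norm (LINT y:{y0-\<rho>..y0+\<rho>}|lborel. ?g (Complex e y))) \<le> 
         (\<integral>\<^sup>+ y. ennreal (2 / r) * k (e, y) \<partial>lborel)"
        unfolding k_def prod.case
      proof (rule norm_set_lborel_le_nn, rule le)
        fix y assume y: "y \<in> {y0-\<rho>..y0+\<rho>}"
        show "Complex e y \<in> Q" using y that \<rho>0 \<rho> by (auto simp: Q_def square_def x0_def y0_def)
        show "\<rho> \<le> norm (Complex e y - z0)" using n(1)[of "Complex e y"] that \<rho>0 by (auto simp: x0_def)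
      qed
      then show ?thesis unfolding V_def by (subst (asm) nn_integral_cmult) auto
    qed
    have "ennreal (2 * pi * norm (f z0)) \<le> ennreal (norm I1 + norm I2 + norm I3 + norm I4)"
      using * by (intro ennreal_leI)
    also have "\<dots> = ennreal (norm I1) + ennreal (norm I2) + ennreal (norm I3) + ennreal (norm I4)"
      by simp
    also have "\<dots> \<le> ennreal (2 / r) * B (y0 - \<rho>) + ennreal (2 / r) * B (y0 + \<rho>) 
       + ennreal (2 / r) * V (x0 + \<rho>) + ennreal (2 / r) * V (x0 - \<rho>)"
      unfolding I1_def I2_def I3_def I4_def by (intro add_mono H W) auto
    finally have "ennreal (r/2) * ennreal (2 * pi * norm (f z0)) \<le> ennreal (r/2) * (ennreal (2 / r) * B (y0 - \<rho>) + ennreal (2 / r) * B (y0 + \<rho>) 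
       + ennreal (2 / r) * V (x0 + \<rho>) + ennreal (2 / r) * V (x0 - \<rho>))" by (rule mult_left_mono) simp
    also have "\<dots> = B (y0 - \<rho>) + B (y0 + \<rho>) + V (x0 + \<rho>) + V (x0 - \<rho>)"
      using r by (simp add: distrib_left mult.assoc[symmetric] flip: ennreal_mult)
    also have "ennreal (r/2) * ennreal (2 * pi * norm (f z0)) = ennreal (pi * r * norm (f z0))"
      using r by (simp add: mult_ac flip: ennreal_mult)
    finally show ?thesis .
  qed
  have "ennreal (r\<^sup>2 * norm (f z0)) \<le> ennreal (pi * r * norm (f z0)) * ennreal (r / 2)"
  proof -
    have "r\<^sup>2 * norm (f z0) * 2 \<le> r\<^sup>2 * norm (f z0) * pi"
      using pi_ge_two by (intro mult_left_mono) auto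
    then have "r\<^sup>2 * norm (f z0) \<le> (pi * r * norm (f z0)) * (r / 2)"
      by (simp add: power2_eq_square mult_ac)
    then show ?thesis using r by (simp add: ennreal_leI flip: ennreal_mult)
  qed
  also have "\<dots> = (\<integral>\<^sup>+ \<rho>. ennreal (pi * r * norm (f z0)) * indicator {r/2..r} \<rho> \<partial>lborel)"
    using r by (subst nn_integral_cmult_indicator) auto
  also have "\<dots> \<le> (\<integral>\<^sup>+ \<rho>. (B (y0 - \<rho>) + B (y0 + \<rho>) + V (x0 + \<rho>) + V (x0 - \<rho>)) \<partial>lborel)"
    by (rule nn_integral_mono) (use bound in \<open>auto simp: indicator_def\<close>)
  also have "\<dots> = T + T + T + T"
    by (simp add: nn_integral_add nn_integral_lborel_shift_reflect BT VT)
  also have "\<dots> = (1 + 1 + 1 + 1) * T" by (simp only: distrib_right mult_1)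
  also have "(1 + 1 + 1 + 1 :: ennreal) = 4" by simp
  also have "T = (\<integral>\<^sup>+ (x, y). ennreal (norm (f (Complex x y))) * indicator (square z0 r) (Complex x y) \<partial>(lborel \<Otimes>\<^sub>M lborel))"
    unfolding T_def k_def by (intro nn_integral_cong) (auto simp: F_def Q_def indicator_def)
  finally show ?thesis .
qed

text \<open>The bound follows from the case \<open>p = 1\<close>: at a maximum of \<open>\<bar>f\<bar> powr
  p\<close> weighted by the squared distance to the boundary, \<open>\<bar>f\<bar>\<close> is
  comparable on a whole smaller square with its value at the centre, so that
  \<open>\<bar>f\<bar>\<close> is there at most a constant times \<open>\<bar>f\<bar> powr
  p\<close>.\<close>

lemma square_powr_bound_le1:
  assumes U: "open U" "f holomorphic_on U" "square z0 d \<subseteq> U" and d: "d > 0" and p: "0 < p" "p \<le> 1"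
  shows "ennreal (d\<^sup>2 * norm (f z0) powr p) \<le> 
    ennreal (4 powr (1 + 1/p)) * 
    (\<integral>\<^sup>+ (x, y). ennreal (norm (f (Complex x y)) powr p) * indicator (square z0 d) (Complex x y) \<partial>(lborel \<Otimes>\<^sub>M lborel))"
    (is "_ \<le> _ * ?K")
proof -
  define \<delta> where "\<delta> z = d - max \<bar>Re z - Re z0\<bar> \<bar>Im z - Im z0\<bar>" for z
  \<comment> \<open>The weight vanishes on the boundary of the square, so the maximum lies inside or is zero.\<close>
  define \<phi> where "\<phi> z = (\<delta> z)\<^sup>2 * norm (f z) powr p" for z
  have \<delta>0: "\<delta> z0 = d" using d by (simp add: \<delta>_def)
  have \<delta>Q: "\<delta> z \<ge> 0 \<longleftrightarrow> z \<in> square z0 d" for z by (auto simp: \<delta>_def square_def)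
  have comp: "compact (square z0 d)" unfolding square_eq_cbox by simp
  have cont: "continuous_on (square z0 d) f" 
    using U holomorphic_on_imp_continuous_on holomorphic_on_subset by blast
  have "continuous_on (square z0 d) \<phi>"
    unfolding \<phi>_def \<delta>_def using p by (intro continuous_intros cont continuous_on_powr') auto
  moreover have z0: "z0 \<in> square z0 d" using d by (simp add: square_def)
  ultimately obtain z1 where z1: "z1 \<in> square z0 d" "\<And>z. z \<in> square z0 d \<Longrightarrow> \<phi> z \<le> \<phi> z1"
    using continuous_attains_sup[OF comp, of \<phi>] by blast
  show ?thesis
  proof (cases "\<phi> z1 \<le> 0")
    case True
    then have "\<phi> z0 \<le> 0" using z1(2)[OF z0] by linarith
    then show ?thesis using \<delta>0 by (simp add: \<phi>_def ennreal_neg)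
  next
    case False
    have f1: "f z1 \<noteq> 0" and dz1: "\<delta> z1 > 0"
      using False \<delta>Q[of z1] z1(1) by (auto simp: \<phi>_def less_le)
    define N where "N = norm (f z1)"
    have N: "N > 0" using f1 by (simp add: N_def)
    define r where "r = \<delta> z1 / 2"
    have r: "r > 0" using dz1 by (simp add: r_def)
    have ge: "\<delta> z \<ge> r" if "z \<in> square z1 r" for z
    proof -
      have "\<bar>Re z - Re z0\<bar> \<le> \<bar>Re z1 - Re z0\<bar> + r" "\<bar>Im z - Im z0\<bar> \<le> \<bar>Im z1 - Im z0\<bar> + r"
        using that by (auto simp: square_def)
      then have "max \<bar>Re z - Re z0\<bar> \<bar>Im z - Im z0\<bar> \<le> max \<bar>Re z1 - Re z0\<bar> \<bar>Im z1 - Im z0\<bar> + r" by linarith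
      moreover have "\<delta> z1 = 2 * r" by (simp add: r_def)
      ultimately show ?thesis unfolding \<delta>_def by linarith
    qed
    have sub: "square z1 r \<subseteq> square z0 d"
    proof
      fix z assume "z \<in> square z1 r"
      from ge[OF this] r have "\<delta> z \<ge> 0" by linarith
      then show "z \<in> square z0 d" by (simp only: \<delta>Q)
    qed
    have fz: "norm (f z) \<le> 4 powr (1/p) * N" if "z \<in> square z1 r" for z
    proof -
      have "r\<^sup>2 * norm (f z) powr p \<le> (\<delta> z)\<^sup>2 * norm (f z) powr p"
        using ge[OF that] r by (intro mult_right_mono power_mono) auto
      also have "\<dots> \<le> \<phi> z1" using z1(2)[of z] sub that by (auto simp: \<phi>_def)
      also have "\<dots> = r\<^sup>2 * (4 * N powr p)" by (simp add: \<phi>_def r_def N_def power_divide)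
      finally have "norm (f z) powr p \<le> 4 * N powr p" using r by simp
      then have "(norm (f z) powr p) powr (1/p) \<le> (4 * N powr p) powr (1/p)"
        using p by (intro powr_mono2) auto
      then show ?thesis using p N by (simp add: powr_powr powr_mult)
    qed
    define L where "L = (4 powr (1/p) * N) powr (1 - p)"
    \<comment> \<open>This is where \<open>p \<le> 1\<close> is used.\<close>
    have fz2: "norm (f z) \<le> L * norm (f z) powr p" if "z \<in> square z1 r" for z
    proof (cases "f z = 0")
      case False
      have "norm (f z) = norm (f z) powr (1 - p) * norm (f z) powr p"
        using False by (simp flip: powr_add)
      also have "\<dots> \<le> L * norm (f z) powr p"
        unfolding L_def using fz[OF that] p by (intro mult_right_mono powr_mono2) auto
      finally show ?thesis .
    qed simp
    define k where "k = (\<lambda>(x, y). ennreal (norm (f (Complex x y)) powr p) * indicator (square z0 d) (Complex x y))"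
    have k[measurable]: "k \<in> borel_measurable (lborel \<Otimes>\<^sub>M lborel)"
    proof -
      have [measurable]: "(\<lambda>z. indicat_real (square z0 d) z *\<^sub>R f z) \<in> borel_measurable borel"
        by (rule borel_measurable_continuous_on_indicator[OF _ cont]) (simp add: square_eq_cbox)
      have "k = (\<lambda>p'. (\<lambda>z. ennreal (norm (indicat_real (square z0 d) z *\<^sub>R f z) powr p)) ((\<lambda>(x, y). Complex x y) p'))"
        using p by (auto simp: k_def indicator_def fun_eq_iff)
      then show ?thesis by (simp only:) measurable
    qed
    have "ennreal (r\<^sup>2 * N) \<le> 4 * (\<integral>\<^sup>+ (x, y). ennreal (norm (f (Complex x y))) * indicator (square z1 r) (Complex x y) \<partial>(lborel \<Otimes>\<^sub>M lborel))"
      unfolding N_def by (rule square_mean_value_bound[OF U(1,2) _ r]) (use U sub in auto)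
    also have "\<dots> \<le> 4 * (\<integral>\<^sup>+ q. ennreal L * k q \<partial>(lborel \<Otimes>\<^sub>M lborel))"
    proof (intro mult_left_mono nn_integral_mono)
      fix q :: "real \<times> real"
      obtain x y where q: "q = (x, y)" by force
      show "(case q of (x, y) \<Rightarrow> ennreal (norm (f (Complex x y))) * indicator (square z1 r) (Complex x y)) \<le> ennreal L * k q"
        using fz2[of "Complex x y"] sub by (auto simp: q k_def L_def indicator_def ennreal_leI simp flip: ennreal_mult)
    qed simp
    also have "\<dots> = 4 * (ennreal L * ?K)" by (subst nn_integral_cmult[OF k]) (simp add: k_def)
    finally have 1: "ennreal (r\<^sup>2 * N) \<le> ennreal (4 * L) * ?K" 
      by (simp add: ennreal_mult L_def mult.assoc)
    define c where "c = 4 * N powr (p - 1)"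
    have c: "c \<ge> 0" by (simp add: c_def)
    have "ennreal (d\<^sup>2 * norm (f z0) powr p) \<le> ennreal (\<phi> z1)"
      using z1(2)[OF z0] \<delta>0 by (intro ennreal_leI) (simp add: \<phi>_def)
    also have "\<phi> z1 = c * (r\<^sup>2 * N)"
    proof -
      have "N powr p = N powr (p - 1) * N" using N by (simp add: powr_diff)
      then show ?thesis by (simp add: \<phi>_def r_def N_def power_divide c_def)
    qed
    also have "ennreal \<dots> = ennreal c * ennreal (r\<^sup>2 * N)" using c N by (simp add: ennreal_mult)
    also have "\<dots> \<le> ennreal c * (ennreal (4 * L) * ?K)" by (rule mult_left_mono[OF 1]) simp
    also have "\<dots> = ennreal (c * (4 * L)) * ?K" using c by (simp add: ennreal_mult L_def mult.assoc)
    also have "c * (4 * L) = 4 powr (1 + 1/p)"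
    proof -
      have "c * (4 * L) = 16 * (N powr (p - 1) * N powr (1 - p)) * 4 powr (1/p * (1 - p))"
        using N by (simp add: c_def L_def powr_mult powr_powr)
      also have "N powr (p - 1) * N powr (1 - p) = 1" using N by (simp flip: powr_add)
      also have "1/p * (1 - p) = 1/p - 1" using p by (simp add: field_simps)
      also have "4 powr (1/p - 1) = 4 powr (1/p) / (4::real)" by (simp add: powr_diff)
      finally show ?thesis by (simp add: powr_add)
    qed
    finally show ?thesis .
  qed
qed

definition mean_bound_const :: "real \<Rightarrow> real" where
  "mean_bound_const p = 4 powr (1 + real (nat \<lceil>p\<rceil>) / p)"

lemma mean_bound_const_pos: "mean_bound_const p > 0" by (simp add: mean_bound_const_def)

text \<open>The case \<open>p > 1\<close> is that of the exponent \<open>p / m \<le> 1\<close> for the power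
  \<open>f ^ m\<close>.\<close>

lemma square_powr_bound:
  assumes p: "0 < p" and U: "open U" "f holomorphic_on U" "square z0 d \<subseteq> U" "d > 0"
  shows "ennreal (d\<^sup>2 * norm (f z0) powr p) \<le> ennreal (mean_bound_const p) *
    (\<integral>\<^sup>+ (x, y). ennreal (norm (f (Complex x y)) powr p) * indicator (square z0 d) (Complex x y) \<partial>(lborel \<Otimes>\<^sub>M lborel))"
proof -
  define m where "m = nat \<lceil>p\<rceil>"
  have m: "m > 0" "p \<le> m" using p by (auto simp: m_def)
  have pw: "norm (w ^ m) powr (p / m) = norm w powr p" for w :: complex
    using m by (cases "w = 0") (auto simp: norm_power powr_realpow[symmetric] powr_powr)
  have "(\<lambda>z. f z ^ m) holomorphic_on U" by (intro holomorphic_intros U)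
  from square_powr_bound_le1[OF U(1) this U(3,4), of "p / m"] m p
  show ?thesis by (simp only: pw) (simp add: mean_bound_const_def m_def)
qed

section \<open>Hardy spaces of the upper half-plane\<close>

abbreviation Lp_integral :: "real \<Rightarrow> (real \<Rightarrow> complex) \<Rightarrow> ennreal" where
  "Lp_integral p h \<equiv> \<integral>\<^sup>+ x. ennreal (norm (h x) powr p) \<partial>lborel"

abbreviation L2_integral :: "(real \<Rightarrow> complex) \<Rightarrow> ennreal" where
  "L2_integral h \<equiv> \<integral>\<^sup>+ x. ennreal ((norm (h x))\<^sup>2) \<partial>lborel"

text \<open>The bound \<open>K\<close> is on the integral of \<open>\<bar>f\<bar> powr p\<close>, that is,
  on the \<open>p\<close>-th power of the norm.\<close>

definition hardy_upper :: "real \<Rightarrow> real \<Rightarrow> (complex \<Rightarrow> complex) \<Rightarrow> bool" where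
  "hardy_upper p K f \<longleftrightarrow> f holomorphic_on uhp \<and> K \<ge> 0 \<and>
    (\<forall>y>0. (Lp_integral p (\<lambda>x. f (Complex x y))) \<le> ennreal K)"

lemma open_uhp: "open uhp" by (rule open_halfspace_Im_gt)

lemma uhp_indicator_measurable:
  assumes "f holomorphic_on uhp"
  shows "(\<lambda>z. indicat_real uhp z *\<^sub>R f z) \<in> borel_measurable borel"
  by (rule borel_measurable_continuous_on_indicator)
     (use assms open_uhp holomorphic_on_imp_continuous_on in auto)

text \<open>The majorant \<open>g\<close> of \<open>\<bar>f\<bar> powr p\<close> will be
  \<open>\<bar>f\<bar> powr p\<close> itself, cut off to a strip or to the ends of a strip.\<close>

lemma square_bound_strip:
  assumes f: "hardy_upper p K f" and p: "p > 0"
    and "(\<lambda>(x, y). g x y) \<in> borel_measurable (lborel \<Otimes>\<^sub>M lborel)"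
    and d: "0 < d" "d < Im z"
    and g: "\<And>x y. \<bar>x - Re z\<bar> \<le> d \<Longrightarrow> \<bar>y - Im z\<bar> \<le> d \<Longrightarrow> ennreal (norm (f (Complex x y)) powr p) \<le> g x y"
  shows "ennreal (d\<^sup>2 * norm (f z) powr p) \<le> ennreal (mean_bound_const p) * (\<integral>\<^sup>+ (x, y). g x y \<partial>(lborel \<Otimes>\<^sub>M lborel))"
proof -
  have "ennreal (d\<^sup>2 * norm (f z) powr p) \<le> ennreal (mean_bound_const p) * 
    (\<integral>\<^sup>+ (x, y). ennreal (norm (f (Complex x y)) powr p) * indicator (square z d) (Complex x y) \<partial>(lborel \<Otimes>\<^sub>M lborel))"
    by (rule square_powr_bound[OF p open_uhp]) (use f d in \<open>auto simp: hardy_upper_def square_def\<close>)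
  also have "\<dots> \<le> ennreal (mean_bound_const p) * (\<integral>\<^sup>+ (x, y). g x y \<partial>(lborel \<Otimes>\<^sub>M lborel))"
    by (intro mult_left_mono nn_integral_mono) (use g in \<open>auto simp: square_def indicator_def split: if_splits\<close>)
  finally show ?thesis .
qed

lemma hardy_upper_measurable2:
  assumes f: "f holomorphic_on uhp" and A: "A \<in> sets borel" "A \<subseteq> {0<..}"
  shows "(\<lambda>(x, y). ennreal (norm (f (Complex x y)) powr p) * indicator A y) \<in> borel_measurable (lborel \<Otimes>\<^sub>M lborel)"
proof -
  note uhp_indicator_measurable[OF f, measurable]
  have [measurable]: "A \<in> sets borel" by (rule A)
  have "(\<lambda>(x, y). ennreal (norm (f (Complex x y)) powr p) * indicator A y) = 
    (\<lambda>q. ennreal (norm ((\<lambda>z. indicat_real uhp z *\<^sub>R f z) ((\<lambda>(x, y). Complex x y) q)) powr p) * indicator A (snd q))"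
    using A(2) by (auto simp: indicator_def fun_eq_iff)
  also have "\<dots> \<in> borel_measurable (lborel \<Otimes>\<^sub>M lborel)"
    by measurable
  finally show ?thesis .
qed

lemma hardy_upper_strip_integral:
  assumes f: "hardy_upper p K f" and A: "0 < a" "a \<le> b"
  shows "(\<integral>\<^sup>+ (x, y). ennreal (norm (f (Complex x y)) powr p) * indicator {a..b} y \<partial>(lborel \<Otimes>\<^sub>M lborel)) \<le> ennreal ((b - a) * K)"
proof -
  have [measurable]: "(\<lambda>(x, y). ennreal (norm (f (Complex x y)) powr p) * indicator {a..b} y) \<in> borel_measurable (lborel \<Otimes>\<^sub>M lborel)"
    using f A by (intro hardy_upper_measurable2) (auto simp: hardy_upper_def)
  have "(\<integral>\<^sup>+ (x, y). ennreal (norm (f (Complex x y)) powr p) * indicator {a..b} y \<partial>(lborel \<Otimes>\<^sub>M lborel)) = 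
     (\<integral>\<^sup>+ y. \<integral>\<^sup>+ x. ennreal (norm (f (Complex x y)) powr p) * indicator {a..b} y \<partial>lborel \<partial>lborel)"
    by (subst lborel_pair.nn_integral_snd[symmetric]) simp_all
  also have "\<dots> \<le> (\<integral>\<^sup>+ y. ennreal K * indicator {a..b} y \<partial>lborel)"
  proof (rule nn_integral_mono)
    fix y :: real
    show "(\<integral>\<^sup>+ x. ennreal (norm (f (Complex x y)) powr p) * indicator {a..b} y \<partial>lborel) \<le> ennreal K * indicator {a..b} y"
      using f A by (cases "y \<in> {a..b}") (auto simp: hardy_upper_def)
  qed
  also have "\<dots> = ennreal ((b - a) * K)"
    using A f by (subst nn_integral_cmult_indicator) (auto simp: hardy_upper_def mult.commute simp flip: ennreal_mult)
  finally show ?thesis .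
qed

lemma hardy_upper_bound:
  assumes p: "p > 0" and f: "hardy_upper p K f" and z: "Im z > 0"
  shows "norm (f z) powr p \<le> 4 * mean_bound_const p * K / Im z"
proof -
  define C where "C = mean_bound_const p"
  have C: "C > 0" by (simp add: C_def mean_bound_const_pos)
  define d where "d = Im z / 2"
  have d: "0 < d" "d < Im z" using z by (auto simp: d_def)
  have "ennreal (d\<^sup>2 * norm (f z) powr p) \<le> ennreal C * (\<integral>\<^sup>+ (x, y). ennreal (norm (f (Complex x y)) powr p) * indicator {Im z - d..Im z + d} y \<partial>(lborel \<Otimes>\<^sub>M lborel))"
    unfolding C_def
  proof (rule square_bound_strip[OF f p _ d])
    show "(\<lambda>(x, y). ennreal (norm (f (Complex x y)) powr p) * indicator {Im z - d..Im z + d} y) \<in> borel_measurable (lborel \<Otimes>\<^sub>M lborel)"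
      by (rule hardy_upper_measurable2) (use f d in \<open>auto simp: hardy_upper_def\<close>)
    fix x y assume "\<bar>y - Im z\<bar> \<le> d"
    then have "y \<in> {Im z - d..Im z + d}" by (auto simp: abs_le_iff)
    then show "ennreal (norm (f (Complex x y)) powr p) \<le> ennreal (norm (f (Complex x y)) powr p) * indicator {Im z - d..Im z + d} y"
      by simp
  qed
  also have "\<dots> \<le> ennreal C * ennreal ((Im z + d - (Im z - d)) * K)"
    by (intro mult_left_mono hardy_upper_strip_integral[OF f]) (use d in auto)
  also have "\<dots> = ennreal (2 * C * d * K)" using C d f by (simp add: hardy_upper_def mult_ac flip: ennreal_mult)
  finally have "d\<^sup>2 * norm (f z) powr p \<le> 2 * C * d * K"
    using C d f by (subst (asm) ennreal_le_iff) (auto simp: hardy_upper_def)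
  then have "d * norm (f z) powr p \<le> 2 * C * K" using d by (simp add: power2_eq_square mult_ac)
  then show "norm (f z) powr p \<le> 4 * mean_bound_const p * K / Im z" using z by (simp add: d_def C_def field_simps)
qed

lemma hardy_upper_bounded:
  assumes p: "p > 0" and f: "hardy_upper p K f" and e: "e > 0"
  obtains B where "B > 0" "\<And>z. Im z \<ge> e \<Longrightarrow> norm (f z) \<le> B"
proof -
  define C where "C = 4 * mean_bound_const p"
  have C: "C > 0" "\<And>z. Im z > 0 \<Longrightarrow> norm (f z) powr p \<le> C * K / Im z"
    using hardy_upper_bound[OF p f] by (auto simp: C_def mean_bound_const_pos)
  have K: "K \<ge> 0" using f by (simp add: hardy_upper_def)
  show ?thesis
  proof (rule that)
    show "1 + (C * K / e) powr (1/p) > 0" by (smt (verit) powr_ge_zero)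
    fix z assume z: "Im z \<ge> e"
    have "norm (f z) powr p \<le> C * K / Im z" using C(2)[of z] z e by simp
    also have "\<dots> \<le> C * K / e" using z e C K by (intro divide_left_mono) auto
    finally have "(norm (f z) powr p) powr (1/p) \<le> (C * K / e) powr (1/p)" using p by (intro powr_mono2) auto
    then show "norm (f z) \<le> 1 + (C * K / e) powr (1/p)" using p by (simp add: powr_powr)
  qed
qed

text \<open>High up, the pointwise bound decays. At bounded height, a square around a far point lies in the
  end of a horizontal strip, and the integral over the ends of the strip tends to zero.\<close>

lemma hardy_upper_vanishes:
  assumes p: "p > 0" and f: "hardy_upper p K f" and e: "e > 0" and r: "r > 0"
  obtains R where "R > 0" "\<And>z. Im z \<ge> e \<Longrightarrow> norm z \<ge> R \<Longrightarrow> norm (f z) < r"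
proof -
  define C where "C = 4 * mean_bound_const p"
  have C: "C > 0" "\<And>z. Im z > 0 \<Longrightarrow> norm (f z) powr p \<le> C * K / Im z"
    using hardy_upper_bound[OF p f] by (auto simp: C_def mean_bound_const_pos)
  define D where "D = mean_bound_const p"
  have D: "D > 0" by (simp add: D_def mean_bound_const_pos)
  have K: "K \<ge> 0" using f by (simp add: hardy_upper_def)
  have powr_less: "norm w < r" if "norm w powr p < r powr p" for w :: complex
  proof (rule ccontr)
    assume "\<not> norm w < r"
    then have "r powr p \<le> norm w powr p" using p r by (intro powr_mono2) auto
    then show False using that by simp
  qed
  \<comment> \<open>Above height \<open>Y\<close> the pointwise bound is below \<open>r powr p\<close>.\<close>
  define Y where "Y = e + 2 * C * K / r powr p"
  have Y: "Y \<ge> e" using C K by (simp add: Y_def)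
  have high: "norm (f z) < r" if "Im z \<ge> Y" for z
  proof (rule powr_less)
    have z: "Im z > 0" using Y e that by simp
    have "norm (f z) powr p \<le> C * K / Im z" using C(2)[OF z] .
    also have "\<dots> < r powr p"
    proof -
      have "2 * C * K / r powr p \<le> Im z - e" using that by (simp add: Y_def)
      then have "2 * C * K \<le> (Im z - e) * r powr p" using r by (simp add: field_simps)
      also have "\<dots> < Im z * r powr p" using e r by simp
      finally have "2 * (C * K) < Im z * r powr p" by simp
      moreover have "C * K \<ge> 0" using C K by simp
      ultimately have "C * K < Im z * r powr p" by linarith
      then show ?thesis using z by (simp add: field_simps)
    qed
    finally show "norm (f z) powr p < r powr p" .
  qed
  define w where "w = (\<lambda>(x, y). ennreal (norm (f (Complex x y)) powr p) * indicator {e/2..Y+e} y)"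
  have w[measurable]: "w \<in> borel_measurable (lborel \<Otimes>\<^sub>M lborel)" unfolding w_def
    by (rule hardy_upper_measurable2) (use f e in \<open>auto simp: hardy_upper_def\<close>)
  have wfin: "(\<integral>\<^sup>+ q. w q \<partial>(lborel \<Otimes>\<^sub>M lborel)) < \<infinity>"
    unfolding w_def using hardy_upper_strip_integral[OF f, of "e/2" "Y+e"] Y e 
    by (simp add: order_le_less_trans)
  have "(\<lambda>n. \<integral>\<^sup>+ q. w q * indicator {q. \<bar>fst q\<bar> \<ge> real n} q \<partial>(lborel \<Otimes>\<^sub>M lborel)) \<longlonglongrightarrow> (\<integral>\<^sup>+ q. 0 \<partial>(lborel \<Otimes>\<^sub>M (lborel::real measure) :: (real \<times> real) measure))"
  proof (rule nn_integral_dominated_convergence[where w = w])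
    show "AE q in lborel \<Otimes>\<^sub>M lborel. (\<lambda>n. w q * indicator {q. \<bar>fst q\<bar> \<ge> real n} q) \<longlonglongrightarrow> 0"
    proof (rule AE_I2)
      fix q :: "real \<times> real"
      obtain N where N: "\<bar>fst q\<bar> < real N" using reals_Archimedean2 by blast
      have "w q * indicator {q. \<bar>fst q\<bar> \<ge> real n} q = 0" if "n \<ge> N" for n
        using N that by (auto simp: indicator_def)
      then have "\<forall>\<^sub>F n in sequentially. w q * indicator {q. \<bar>fst q\<bar> \<ge> real n} q = 0"
        by (auto simp: eventually_sequentially)
      then show "(\<lambda>n. w q * indicator {q. \<bar>fst q\<bar> \<ge> real n} q) \<longlonglongrightarrow> 0"
        by (rule tendsto_eventually)
    qed
    show "\<And>j. (\<lambda>q. w q * indicator {q. \<bar>fst q\<bar> \<ge> real j} q) \<in> borel_measurable (lborel \<Otimes>\<^sub>M lborel)"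
      by measurable
  qed (use wfin in \<open>auto simp: indicator_def\<close>)
  then have lim: "(\<lambda>n. \<integral>\<^sup>+ q. w q * indicator {q. \<bar>fst q\<bar> \<ge> real n} q \<partial>(lborel \<Otimes>\<^sub>M lborel)) \<longlonglongrightarrow> 0" by simp
  define d where "d = e / 2"
  have d: "d > 0" using e by (simp add: d_def)
  define \<eta> where "\<eta> = d\<^sup>2 * r powr p / D"
  have \<eta>: "\<eta> > 0" using d r D by (simp add: \<eta>_def)
  obtain n where n: "(\<integral>\<^sup>+ q. w q * indicator {q. \<bar>fst q\<bar> \<ge> real n} q \<partial>(lborel \<Otimes>\<^sub>M lborel)) < ennreal \<eta>"
    using order_tendstoD(2)[OF lim, of "ennreal \<eta>"] \<eta> by (auto simp: eventually_sequentially)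
  show ?thesis
  proof (rule that)
    show "real n + d + Y + 1 > 0" using Y e d by simp
    fix z assume z: "Im z \<ge> e" "norm z \<ge> real n + d + Y + 1"
    show "norm (f z) < r"
    proof (cases "Im z \<ge> Y")
      case False
      have "norm z \<le> \<bar>Re z\<bar> + \<bar>Im z\<bar>" by (rule cmod_le)
      then have Re: "\<bar>Re z\<bar> \<ge> real n + d" using z False e by simp
      show ?thesis
      proof (rule powr_less)
        have "ennreal (d\<^sup>2 * norm (f z) powr p) \<le> ennreal (mean_bound_const p) * (\<integral>\<^sup>+ (x, y). w (x, y) * indicator {q. \<bar>fst q\<bar> \<ge> real n} (x, y) \<partial>(lborel \<Otimes>\<^sub>M lborel))"
        proof (rule square_bound_strip[OF f p])
          show "(\<lambda>(x, y). w (x, y) * indicator {q. \<bar>fst q\<bar> \<ge> real n} (x, y)) \<in> borel_measurable (lborel \<Otimes>\<^sub>M lborel)"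
            by (simp add: case_prod_beta')
          show "d < Im z" using z e by (simp add: d_def)
          fix x y assume xy: "\<bar>x - Re z\<bar> \<le> d" "\<bar>y - Im z\<bar> \<le> d"
          have "y - Im z \<le> e / 2" "Im z - y \<le> e / 2" using xy(2) unfolding d_def by linarith+
          then have "y \<in> {e/2..Y+e}" using z False e by simp
          moreover have "\<bar>x\<bar> \<ge> real n" using xy Re by linarith
          ultimately show "ennreal (norm (f (Complex x y)) powr p) \<le> w (x, y) * indicator {q. \<bar>fst q\<bar> \<ge> real n} (x, y)"
            by (simp add: w_def)
        qed (use d in auto)
        also have "\<dots> = ennreal (mean_bound_const p) * (\<integral>\<^sup>+ q. w q * indicator {q. \<bar>fst q\<bar> \<ge> real n} q \<partial>(lborel \<Otimes>\<^sub>M lborel))"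
          by (simp add: case_prod_beta')
        also have "\<dots> < ennreal D * ennreal \<eta>"
          unfolding D_def[symmetric] using n D by (intro ennreal_mult_strict_left_mono) auto
        also have "\<dots> = ennreal (d\<^sup>2 * r powr p)" using D \<eta> by (simp add: \<eta>_def flip: ennreal_mult)
        finally have "d\<^sup>2 * norm (f z) powr p < d\<^sup>2 * r powr p"
          by (subst (asm) ennreal_less_iff) auto
        then show "norm (f z) powr p < r powr p" using d by simp
      qed
    qed (use high in auto)
  qed
qed

section \<open>Shifting horizontal lines and the Poisson kernel\<close>

lemma set_integral_symmetric_limit:
  fixes g :: "real \<Rightarrow> complex"
  assumes "integrable lborel g"
  shows "(\<lambda>n::nat. LINT x:{- real n..real n}|lborel. g x) \<longlonglongrightarrow> (LINT x|lborel. g x)"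
  unfolding set_lebesgue_integral_def
proof (rule integral_dominated_convergence[where w = "\<lambda>x. norm (g x)"])
  show "AE x in lborel. (\<lambda>n. indicat_real {- real n..real n} x *\<^sub>R g x) \<longlonglongrightarrow> g x"
  proof (rule AE_I2)
    fix x :: real
    obtain N where N: "\<bar>x\<bar> \<le> real N" using real_arch_simple by blast
    have "\<forall>\<^sub>F n in sequentially. indicat_real {- real n..real n} x *\<^sub>R g x = g x"
      using eventually_ge_at_top[of N]
      by eventually_elim (use N in \<open>auto simp: indicator_def abs_le_iff\<close>)
    then show "(\<lambda>n. indicat_real {- real n..real n} x *\<^sub>R g x) \<longlonglongrightarrow> g x" by (rule tendsto_eventually)
  qed
  show "\<And>i. AE x in lborel. norm (indicat_real {- real i..real i} x *\<^sub>R g x) \<le> norm (g x)"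
    by (auto simp: indicator_def)
qed (use assms in auto)

lemma norm_set_integral_le:
  fixes h :: "real \<Rightarrow> complex"
  assumes "c \<le> d" "\<And>y. y \<in> {c..d} \<Longrightarrow> norm (h y) \<le> B"
  shows "norm (LINT y:{c..d}|lborel. h y) \<le> B * (d - c)"
proof -
  have B: "B \<ge> 0" using assms(2)[of c] assms(1) by (auto intro: order_trans[OF norm_ge_zero])
  have "ennreal (norm (LINT y:{c..d}|lborel. h y)) \<le> (\<integral>\<^sup>+ y. ennreal B * indicator {c..d} y \<partial>lborel)"
    by (rule norm_set_lborel_le_nn) (use assms in \<open>auto intro!: ennreal_leI\<close>)
  also have "\<dots> = ennreal (B * (d - c))"
    using assms(1) B by (subst nn_integral_cmult_indicator) (auto simp flip: ennreal_mult)
  finally show ?thesis using B assms(1) by (subst (asm) ennreal_le_iff) auto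
qed

text \<open>The vertical sides of a rectangle contribute nothing in the limit, as \<open>G\<close> vanishes
  at infinity in the strip.\<close>

lemma horizontal_integral_shift:
  assumes cd: "c < d" and U: "open U" "G holomorphic_on U" "{z. c \<le> Im z \<and> Im z \<le> d} \<subseteq> U"
    and decay: "\<And>r. r > 0 \<Longrightarrow> \<exists>R. \<forall>z. c \<le> Im z \<and> Im z \<le> d \<and> norm z \<ge> R \<longrightarrow> norm (G z) \<le> r"
    and int: "integrable lborel (\<lambda>x. G (Complex x c))" "integrable lborel (\<lambda>x. G (Complex x d))"
  shows "(LINT x|lborel. G (Complex x c)) = (LINT x|lborel. G (Complex x d))"
proof -
  define V where "V n = \<i> * ((LINT y:{c..d}|lborel. G (Complex (real n) y)) - (LINT y:{c..d}|lborel. G (Complex (- real n) y)))" for n :: nat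
  have eq: "(LINT x:{- real n..real n}|lborel. G (Complex x c)) - (LINT x:{- real n..real n}|lborel. G (Complex x d)) + V n = 0"
    if "n > 0" for n
    unfolding V_def
    by (rule Cauchy_theorem_rectangle[OF _ cd U(1,2)]) (use that U(3) in \<open>auto simp: in_cbox_complex_iff\<close>)
  have V0: "V \<longlonglongrightarrow> 0"
  proof (rule LIMSEQ_I)
    fix e :: real assume e: "e > 0"
    define r where "r = (e / 4) / (d - c)"
    have r: "r > 0" using e cd by (simp add: r_def)
    obtain R where R: "\<And>z. c \<le> Im z \<Longrightarrow> Im z \<le> d \<Longrightarrow> norm z \<ge> R \<Longrightarrow> norm (G z) \<le> r"
      using decay[OF r] by blast
    obtain N where N: "R \<le> real N" using real_arch_simple by blast
    show "\<exists>no. \<forall>n\<ge>no. norm (V n - 0) < e"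
    proof (intro exI allI impI)
      fix n assume n: "n \<ge> N"
      have *: "norm (LINT y:{c..d}|lborel. G (Complex s y)) \<le> r * (d - c)" if "\<bar>s\<bar> = real n" for s
      proof (rule norm_set_integral_le)
        fix y assume y: "y \<in> {c..d}"
        have "norm (Complex s y) \<ge> R" using abs_Re_le_cmod[of "Complex s y"] that n N by simp
        then show "norm (G (Complex s y)) \<le> r" using R y by simp
      qed (use cd in auto)
      have "norm (V n) \<le> r * (d - c) + r * (d - c)"
        unfolding V_def norm_mult using *[of "real n"] *[of "- real n"]
        by (auto intro!: order_trans[OF norm_triangle_ineq4])
      also have "r * (d - c) = e / 4" unfolding r_def using cd by (subst nonzero_eq_divide_eq[symmetric]) auto
      also have "e / 4 + e / 4 < e" using e by simp
      finally show "norm (V n - 0) < e" by simp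
    qed
  qed
  have "(\<lambda>n. (LINT x:{- real n..real n}|lborel. G (Complex x c)) - (LINT x:{- real n..real n}|lborel. G (Complex x d)) + V n)
     \<longlonglongrightarrow> (LINT x|lborel. G (Complex x c)) - (LINT x|lborel. G (Complex x d)) + 0"
    by (intro tendsto_intros set_integral_symmetric_limit int V0)
  moreover have "(\<lambda>n. (LINT x:{- real n..real n}|lborel. G (Complex x c)) - (LINT x:{- real n..real n}|lborel. G (Complex x d)) + V n)
     \<longlonglongrightarrow> 0"
    by (rule tendsto_eventually) (use eq in \<open>auto simp: eventually_sequentially intro!: exI[of _ 1]\<close>)
  ultimately show ?thesis using LIMSEQ_unique by fastforce
qed

definition poisson :: "real \<Rightarrow> real \<Rightarrow> real" where
  "poisson y s = y / (pi * (s\<^sup>2 + y\<^sup>2))"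

lemma poisson_pos: "y > 0 \<Longrightarrow> poisson y s > 0"
  unfolding poisson_def by (intro divide_pos_pos mult_pos_pos add_nonneg_pos) auto

lemma poisson_sym: "poisson y (a - b) = poisson y (b - a)"
  by (simp add: poisson_def power2_commute)

lemma poisson_measurable [measurable]: "poisson y \<in> borel_measurable borel"
  unfolding poisson_def by measurable

lemma
  assumes y: "y > 0"
  shows integrable_poisson: "integrable lborel (\<lambda>t. poisson y (t - x))"
    and integral_poisson: "(LINT t|lborel. poisson y (t - x)) = 1"
proof -
  have un: "einterval (-\<infinity>) \<infinity> = (UNIV :: real set)" by (auto simp: einterval_def)
  have i: "integrable lborel (\<lambda>x::real. inverse (1 + x\<^sup>2))"
    using integrable_inverse_1_plus_square by (simp add: un set_integrable_def)
  have v: "(LINT x|lborel. inverse (1 + x\<^sup>2)) = pi"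
    using LBINT_inverse_1_plus_square
    by (simp add: interval_lebesgue_integral_def un set_lebesgue_integral_def)
  have eq: "poisson y (t - x) = 1 / (pi * y) * inverse (1 + (- x / y + 1 / y * t)\<^sup>2)" for t
  proof -
    have "(- x / y + 1 / y * t)\<^sup>2 = (t - x)\<^sup>2 / y\<^sup>2" using y by (simp add: field_simps power2_eq_square)
    moreover have "(t - x)\<^sup>2 + y\<^sup>2 > 0" using y by (intro add_nonneg_pos) auto
    ultimately show ?thesis using y unfolding poisson_def by (simp add: field_simps power2_eq_square)
  qed
  show "integrable lborel (\<lambda>t. poisson y (t - x))"
    unfolding eq using lborel_integrable_real_affine[OF i, of "1 / y" "- x / y"] y by (intro integrable_mult_right) auto
  show "(LINT t|lborel. poisson y (t - x)) = 1"
  proof -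
    define I where "I = (LINT t|lborel. inverse (1 + (- x / y + 1 / y * t)\<^sup>2))"
    have "pi = \<bar>1 / y\<bar> *\<^sub>R I"
      unfolding I_def v[symmetric] by (rule lborel_integral_real_affine) (use y in auto)
    then have "I = pi * y" using y by (simp add: field_simps)
    then show ?thesis unfolding eq integral_mult_right_zero I_def[symmetric] using y by simp
  qed
qed

lemma nn_integral_poisson:
  assumes y: "y > 0"
  shows "(\<integral>\<^sup>+ t. ennreal (poisson y (t - x)) \<partial>lborel) = 1"
  using nn_integral_eq_integral[OF integrable_poisson[OF y, of x]] integral_poisson[OF y] poisson_pos[OF y]
  by (simp add: less_imp_le)

text \<open>The quotient of \<open>2 \<i> y f(\<zeta>)\<close> by \<open>\<zeta> - cnj z\<close> has value
  \<open>f z\<close> at \<open>z\<close> and is holomorphic near the closed half-plane. In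
  Cauchy's formula for it the denominator becomes \<open>\<bar>t - z\<bar>\<^sup>2\<close> on the
  real line, and its quadratic growth lets the large rectangle expand although \<open>f\<close> is
  merely bounded.\<close>

lemma poisson_formula_bounded:
  assumes U: "open U" "f holomorphic_on U" "{z. 0 \<le> Im z} \<subseteq> U"
    and B: "\<And>z. 0 \<le> Im z \<Longrightarrow> norm (f z) \<le> B" and y: "y > 0"
  shows "integrable lborel (\<lambda>t. of_real (poisson y (t - x)) * f (Complex t 0))"
    "f (Complex x y) = (LINT t|lborel. of_real (poisson y (t - x)) * f (Complex t 0))"
proof -
  define z where "z = Complex x y"
  define F where "F \<zeta> = f \<zeta> * (2 * \<i> * y) / (\<zeta> - cnj z)" for \<zeta>
  define g where "g \<zeta> = F \<zeta> / (\<zeta> - z)" for \<zeta>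
  define U' where "U' = U \<inter> {\<zeta>. Im \<zeta> > - y}"
  have U': "open U'" unfolding U'_def by (intro open_Int U open_halfspace_Im_gt)
  have F: "F holomorphic_on U'" unfolding F_def U'_def
    by (intro holomorphic_intros) (auto simp: z_def complex_eq_iff intro: holomorphic_on_subset[OF U(2)])
  have Fz: "F z = f z" using y by (auto simp: F_def z_def complex_eq_iff field_simps Complex_eq)
  have line: "continuous_on UNIV (\<lambda>t. f (Complex t 0))"
    by (rule continuous_on_compose2[OF holomorphic_on_imp_continuous_on[OF U(2)]])
      (use U(3) in \<open>auto intro!: continuous_intros\<close>)
  then have [measurable]: "(\<lambda>t. f (Complex t 0)) \<in> borel_measurable borel" by (rule borel_measurable_continuous_onI)
  have real: "g (Complex t 0) = 2 * \<i> * pi * (of_real (poisson y (t - x)) * f (Complex t 0))" for t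
  proof -
    have "(Complex t 0 - cnj z) * (Complex t 0 - z) = of_real ((t - x)\<^sup>2 + y\<^sup>2)"
      by (simp add: z_def complex_eq_iff power2_eq_square algebra_simps)
    then have "g (Complex t 0) = f (Complex t 0) * (2 * \<i> * y) / of_real ((t - x)\<^sup>2 + y\<^sup>2)"
      by (simp add: g_def F_def)
    then show ?thesis by (simp add: poisson_def)
  qed
  show int: "integrable lborel (\<lambda>t. of_real (poisson y (t - x)) * f (Complex t 0))"
  proof (rule Bochner_Integration.integrable_bound)
    show "integrable lborel (\<lambda>t. B * poisson y (t - x))" by (intro integrable_mult_right integrable_poisson y)
    show "AE t in lborel. norm (of_real (poisson y (t - x)) * f (Complex t 0)) \<le> norm (B * poisson y (t - x))"
    proof (rule AE_I2)
      fix t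
      have "norm (f (Complex t 0)) \<le> B" using B by simp
      moreover from this have "B \<ge> 0" using norm_ge_zero order_trans by blast
      ultimately show "norm (of_real (poisson y (t - x)) * f (Complex t 0)) \<le> norm (B * poisson y (t - x))"
        using poisson_pos[OF y, of "t - x"] by (simp add: norm_mult abs_mult mult.commute mult_right_mono)
    qed
  qed measurable
  define E where "E n = - (LINT t:{- real n..real n}|lborel. g (Complex t (real n))) + \<i> * ((LINT s:{0..real n}|lborel. g (Complex (real n) s)) - (LINT s:{0..real n}|lborel. g (Complex (- real n) s)))" for n :: nat
  have eq: "(LINT t:{- real n..real n}|lborel. g (Complex t 0)) + E n = 2 * of_real pi * \<i> * f z"
    if n: "real n > \<bar>x\<bar> + y" for n
  proof -
    have "(LINT t:{- real n..real n}|lborel. g (Complex t 0)) - (LINT t:{- real n..real n}|lborel. g (Complex t (real n)))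
    + \<i> * ((LINT s:{0..real n}|lborel. g (Complex (real n) s)) - (LINT s:{0..real n}|lborel. g (Complex (- real n) s))) 
    = 2 * of_real pi * \<i> * F z"
      unfolding g_def by (rule Cauchy_formula_rectangle[OF _ _ U' F])
        (use n y U(3) in \<open>auto simp: z_def in_box_complex_iff in_cbox_complex_iff U'_def\<close>)
    then show ?thesis unfolding E_def Fz by (simp add: algebra_simps)
  qed
  have B0: "B \<ge> 0" using B[of 0] by (auto intro: order_trans[OF norm_ge_zero])
  have gb: "norm (g \<zeta>) \<le> 8 * y * B / (real n)\<^sup>2" 
    if n: "real n > 2 * norm z" and \<zeta>: "Im \<zeta> \<ge> 0" "norm \<zeta> \<ge> real n" for \<zeta> n
  proof -
    have n0: "real n > 0" using n norm_ge_zero[of z] by linarith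
    have "norm (\<zeta> - z) \<ge> real n / 2" using norm_triangle_ineq2[of \<zeta> z] n \<zeta> by linarith
    moreover have "norm (\<zeta> - cnj z) \<ge> real n / 2" using norm_triangle_ineq2[of \<zeta> "cnj z"] n \<zeta> by simp
    ultimately have "norm (\<zeta> - cnj z) * norm (\<zeta> - z) \<ge> (real n / 2) * (real n / 2)"
      using n0 by (intro mult_mono) auto
    then have D: "norm (\<zeta> - cnj z) * norm (\<zeta> - z) \<ge> (real n)\<^sup>2 / 4" by (simp add: power2_eq_square)
    have "norm (g \<zeta>) = norm (f \<zeta>) * (2 * y) / (norm (\<zeta> - cnj z) * norm (\<zeta> - z))"
      using y by (simp add: g_def F_def norm_mult norm_divide)
    also have "\<dots> \<le> B * (2 * y) / ((real n)\<^sup>2 / 4)"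
      using D B[OF \<zeta>(1)] n0 y B0 by (intro frac_le mult_right_mono) auto
    finally show ?thesis by (simp add: field_simps)
  qed
  have Elim: "E \<longlonglongrightarrow> 0"
  proof (rule Lim_null_comparison)
    show "(\<lambda>n. 32 * y * B / real n) \<longlonglongrightarrow> 0" by (rule lim_const_over_n)
    have "\<forall>\<^sub>F n in sequentially. real n > 2 * norm z" 
      using filterlim_real_sequentially by (auto simp: filterlim_at_top_dense)
    then show "\<forall>\<^sub>F n in sequentially. norm (E n) \<le> 32 * y * B / real n"
    proof eventually_elim
      case (elim n)
      define M where "M = 8 * y * B / (real n)\<^sup>2"
      have n0: "real n > 0" using elim norm_ge_zero[of z] by linarith
      have 1: "norm (LINT t:{- real n..real n}|lborel. g (Complex t (real n))) \<le> M * (real n - (- real n))"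
      proof (rule norm_set_integral_le)
        fix t show "norm (g (Complex t (real n))) \<le> M"
          unfolding M_def by (rule gb[OF elim]) (use abs_Im_le_cmod[of "Complex t (real n)"] in auto)
      qed auto
      have 2: "norm (LINT s:{0..real n}|lborel. g (Complex e s)) \<le> M * (real n - 0)" if "\<bar>e\<bar> = real n" for e
      proof (rule norm_set_integral_le)
        fix s assume "s \<in> {0..real n}"
        then show "norm (g (Complex e s)) \<le> M"
          unfolding M_def by (intro gb[OF elim]) (use abs_Re_le_cmod[of "Complex e s"] that in auto)
      qed auto
      have "norm (E n) \<le> M * (2 * real n) + (M * real n + M * real n)"
        unfolding E_def using 1 2[of "real n"] 2[of "- real n"]
        by (intro order_trans[OF norm_triangle_ineq] add_mono)
          (auto simp: norm_mult intro!: order_trans[OF norm_triangle_ineq4])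
      also have "\<dots> = 32 * y * B / real n" using n0 by (simp add: M_def field_simps power2_eq_square)
      finally show ?case .
    qed
  qed
  have intg: "integrable lborel (\<lambda>t. g (Complex t 0))" unfolding real by (intro integrable_mult_right int)
  have "(\<lambda>n. (LINT t:{- real n..real n}|lborel. g (Complex t 0)) + E n) \<longlonglongrightarrow> (LINT t|lborel. g (Complex t 0)) + 0"
    by (intro tendsto_intros set_integral_symmetric_limit intg Elim)
  moreover have "(\<lambda>n. (LINT t:{- real n..real n}|lborel. g (Complex t 0)) + E n) \<longlonglongrightarrow> 2 * of_real pi * \<i> * f z"
  proof (rule tendsto_eventually)
    have "\<forall>\<^sub>F n in sequentially. real n > \<bar>x\<bar> + y" 
      using filterlim_real_sequentially by (auto simp: filterlim_at_top_dense)
    then show "\<forall>\<^sub>F n in sequentially. (LINT t:{- real n..real n}|lborel. g (Complex t 0)) + E n = 2 * of_real pi * \<i> * f z"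
      by eventually_elim (rule eq)
  qed
  ultimately have "(LINT t|lborel. g (Complex t 0)) = 2 * of_real pi * \<i> * f z" using LIMSEQ_unique by fastforce
  then have "2 * \<i> * pi * (LINT t|lborel. of_real (poisson y (t - x)) * f (Complex t 0)) = 2 * of_real pi * \<i> * f z"
    unfolding real by (simp only: integral_mult_right_zero)
  then show "f (Complex x y) = (LINT t|lborel. of_real (poisson y (t - x)) * f (Complex t 0))"
    unfolding z_def by simp
qed

section \<open>Square means on horizontal lines\<close>

lemma hardy_line_continuous:
  assumes "f holomorphic_on uhp" "y > 0"
  shows "continuous_on UNIV (\<lambda>x. f (Complex x y))"
  by (rule continuous_on_compose2[OF holomorphic_on_imp_continuous_on[OF assms(1)]])
     (use assms(2) in \<open>auto intro!: continuous_intros\<close>)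

lemma hardy_line_measurable:
  assumes "f holomorphic_on uhp" "y > 0"
  shows "(\<lambda>x. f (Complex x y)) \<in> borel_measurable borel"
  using hardy_line_continuous[OF assms] by (rule borel_measurable_continuous_onI)

lemma hardy2_nn:
  assumes "hardy_upper 2 K f" "y > 0"
  shows "(L2_integral (\<lambda>x. f (Complex x y))) \<le> ennreal K"
  using assms by (simp add: hardy_upper_def)

definition line_energy :: "(complex \<Rightarrow> complex) \<Rightarrow> real \<Rightarrow> real" where
  "line_energy f y = (LINT x|lborel. (norm (f (Complex x y)))\<^sup>2)"

lemma
  assumes f: "hardy_upper 2 K f" and y: "y > 0"
  shows hardy2_integrable: "integrable lborel (\<lambda>x. (norm (f (Complex x y)))\<^sup>2)"
    and line_energy_nn: "(L2_integral (\<lambda>x. f (Complex x y))) = ennreal (line_energy f y)"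
    and line_energy_le: "line_energy f y \<le> K"
proof -
  have [measurable]: "(\<lambda>x. f (Complex x y)) \<in> borel_measurable borel"
    using f y by (intro hardy_line_measurable) (auto simp: hardy_upper_def)
  show i: "integrable lborel (\<lambda>x. (norm (f (Complex x y)))\<^sup>2)"
    by (rule integrableI_bounded) (use hardy2_nn[OF f y] in \<open>auto intro: le_less_trans\<close>)
  show e: "(L2_integral (\<lambda>x. f (Complex x y))) = ennreal (line_energy f y)"
    unfolding line_energy_def by (rule nn_integral_eq_integral[OF i]) auto
  show "line_energy f y \<le> K" using hardy2_nn[OF f y] f unfolding e hardy_upper_def
    by (auto simp: ennreal_le_iff)
qed

lemma hardy2_prod_integrable:
  assumes f: "hardy_upper 2 K f" and g: "hardy_upper 2 L g" and ab: "a > 0" "b > 0"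
  shows "integrable lborel (\<lambda>x. f (Complex x a) * cnj (g (Complex x b)))"
proof (rule Bochner_Integration.integrable_bound)
  have [measurable]: "(\<lambda>x. f (Complex x a)) \<in> borel_measurable borel" "(\<lambda>x. g (Complex x b)) \<in> borel_measurable borel"
    using f g ab by (auto intro!: hardy_line_measurable simp: hardy_upper_def)
  show "(\<lambda>x. f (Complex x a) * cnj (g (Complex x b))) \<in> borel_measurable lborel"
    unfolding measurable_lborel1
    by (intro borel_measurable_times measurable_compose[OF _ borel_measurable_continuous_onI[OF continuous_on_cnj[OF continuous_on_id]]]) auto
  show "integrable lborel (\<lambda>x. (norm (f (Complex x a)))\<^sup>2 + (norm (g (Complex x b)))\<^sup>2)"
    by (intro Bochner_Integration.integrable_add hardy2_integrable[OF f] hardy2_integrable[OF g] ab)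
  have "u * v \<le> u\<^sup>2 + v\<^sup>2" if "u \<ge> 0" "v \<ge> 0" for u v :: real
    using that sum_squares_bound[of u v] mult_nonneg_nonneg[of u v] by linarith
  then show "AE x in lborel. norm (f (Complex x a) * cnj (g (Complex x b))) \<le> norm ((norm (f (Complex x a)))\<^sup>2 + (norm (g (Complex x b)))\<^sup>2)"
    by (auto simp: norm_mult)
qed

text \<open>Reflecting the second factor in the real line makes the integrand a holomorphic function of
  \<open>x\<close>, whose integral over horizontal lines does not depend on the height.\<close>

lemma hardy2_inner_product_shift:
  assumes f: "hardy_upper 2 K f" and ab: "a > 0" "b > 0"
  shows "(LINT x|lborel. f (Complex x a) * cnj (f (Complex x b))) = of_real (line_energy f ((a + b) / 2))"
proof -
  define m where "m = (a + b) / 2"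
  define \<eta> where "\<eta> = (a - b) / 2"
  define e where "e = min a b"
  have e: "e > 0" using ab by (simp add: e_def)
  have m: "m > 0" using ab by (simp add: m_def)
  have hol: "f holomorphic_on uhp" using f by (simp add: hardy_upper_def)
  \<comment> \<open>On the line \<open>Im z = h\<close> this is the product of \<open>f\<close> at height \<open>m +
    h\<close> and the conjugate of \<open>f\<close> at height \<open>m - h\<close>.\<close>
  define G where "G z = f (z + \<i> * m) * cnj (f (cnj z + \<i> * m))" for z
  define U where "U = {z. - m < Im z \<and> Im z < m}"
  have U: "open U" unfolding U_def by (intro open_Collect_conj open_halfspace_Im_gt open_halfspace_Im_lt)
  have "(\<lambda>z. f (z + \<i> * m)) holomorphic_on cnj ` U"
    by (intro holomorphic_on_compose[of "\<lambda>z. z + \<i> * m" _ f, unfolded o_def] holomorphic_intros holomorphic_on_subset[OF hol])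
       (auto simp: U_def)
  then have "cnj \<circ> (\<lambda>z. f (z + \<i> * m)) \<circ> cnj holomorphic_on U"
    using U by (rule holomorphic_on_compose_cnj_cnj)
  moreover have "(\<lambda>z. f (z + \<i> * m)) holomorphic_on U"
    by (intro holomorphic_on_compose[of "\<lambda>z. z + \<i> * m" _ f, unfolded o_def] holomorphic_intros holomorphic_on_subset[OF hol])
       (auto simp: U_def)
  ultimately have G: "G holomorphic_on U"
    unfolding G_def o_def by (intro holomorphic_intros)
  have G\<eta>: "G (Complex x h) = f (Complex x (m + h)) * cnj (f (Complex x (m - h)))" for x h
  proof -
    have "Complex x h + \<i> * m = Complex x (m + h)" "cnj (Complex x h) + \<i> * m = Complex x (m - h)"
      by (auto simp: complex_eq_iff)
    then show ?thesis unfolding G_def by (simp only:)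
  qed
  obtain B where B: "B > 0" "\<And>z. Im z \<ge> e \<Longrightarrow> norm (f z) \<le> B" using hardy_upper_bounded[OF _ f e] by auto
  have decay: "\<exists>R. \<forall>z. - \<bar>\<eta>\<bar> \<le> Im z \<and> Im z \<le> \<bar>\<eta>\<bar> \<and> norm z \<ge> R \<longrightarrow> norm (G z) \<le> r" if r: "r > 0" for r
  proof -
    obtain R where R: "R > 0" "\<And>z. Im z \<ge> e \<Longrightarrow> norm z \<ge> R \<Longrightarrow> norm (f z) < r / B"
      using hardy_upper_vanishes[OF _ f e, of "r / B"] r B by auto
    show ?thesis
    proof (intro exI allI impI)
      fix z assume z: "- \<bar>\<eta>\<bar> \<le> Im z \<and> Im z \<le> \<bar>\<eta>\<bar> \<and> norm z \<ge> R + m"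
      have ee: "e = m - \<bar>\<eta>\<bar>" by (simp add: e_def m_def \<eta>_def min_def field_simps)
      have "norm (f (z + \<i> * m)) < r / B"
      proof (rule R(2))
        show "e \<le> Im (z + \<i> * m)" using z ee by simp
        have "norm z \<le> norm (z + \<i> * m) + norm (\<i> * m)" using norm_triangle_ineq4[of "z + \<i> * m" "\<i> * m"] by simp
        then show "R \<le> norm (z + \<i> * m)" using z m by (simp add: norm_mult)
      qed
      moreover have "norm (f (cnj z + \<i> * m)) \<le> B" by (rule B(2)) (use z ee in simp)
      ultimately have "norm (f (z + \<i> * m)) * norm (f (cnj z + \<i> * m)) \<le> r / B * B"
        using r B by (intro mult_mono) auto
      then show "norm (G z) \<le> r" using B by (simp add: G_def norm_mult)
    qed
  qed
  have int: "integrable lborel (\<lambda>x. G (Complex x h))" if "\<bar>h\<bar> \<le> \<bar>\<eta>\<bar>" for h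
  proof -
    have "\<eta> < m" "- \<eta> < m" using ab by (simp_all add: \<eta>_def m_def field_simps)
    then have "\<bar>\<eta>\<bar> < m" by linarith
    then show ?thesis unfolding G\<eta> using that by (intro hardy2_prod_integrable[OF f f]) auto
  qed
  have "(LINT x|lborel. G (Complex x 0)) = (LINT x|lborel. G (Complex x \<eta>))"
  proof -
    have sub: "{z. - \<bar>\<eta>\<bar> \<le> Im z \<and> Im z \<le> \<bar>\<eta>\<bar>} \<subseteq> U"
    proof -
      have "\<eta> < m" "- \<eta> < m" using ab by (simp_all add: \<eta>_def m_def field_simps)
      then show ?thesis unfolding U_def by fastforce
    qed
    consider "\<eta> = 0" | "\<eta> > 0" | "\<eta> < 0" by linarith
    then show ?thesis
    proof cases
      case 2
      show ?thesis
      proof (rule horizontal_integral_shift[OF 2 U G])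
        show "\<exists>R. \<forall>z. 0 \<le> Im z \<and> Im z \<le> \<eta> \<and> norm z \<ge> R \<longrightarrow> norm (G z) \<le> r" if r: "r > 0" for r
          using decay[OF r] 2 by (metis abs_of_pos less_imp_le neg_le_0_iff_le order_trans)
        show "{z. 0 \<le> Im z \<and> Im z \<le> \<eta>} \<subseteq> U" using sub 2 by fastforce
      qed (use int 2 in auto)
    next
      case 3
      show ?thesis
      proof (rule sym, rule horizontal_integral_shift[OF 3 U G])
        show "\<exists>R. \<forall>z. \<eta> \<le> Im z \<and> Im z \<le> 0 \<and> norm z \<ge> R \<longrightarrow> norm (G z) \<le> r" if r: "r > 0" for r
          using decay[OF r] 3 by (metis abs_ge_zero abs_of_neg minus_minus order_trans)
        show "{z. \<eta> \<le> Im z \<and> Im z \<le> 0} \<subseteq> U" using sub 3 by fastforce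
      qed (use int 3 in auto)
    qed auto
  qed
  moreover have "G (Complex x 0) = of_real ((norm (f (Complex x m)))\<^sup>2)" for x
    unfolding G\<eta> by (simp only: complex_norm_square add_0_right diff_zero)
  moreover have "m + \<eta> = a" "m - \<eta> = b" by (auto simp: m_def \<eta>_def field_simps)
  ultimately show ?thesis unfolding line_energy_def G\<eta> m_def[symmetric]
    by (metis (mono_tags, lifting) Bochner_Integration.integral_cong integral_complex_of_real)
qed

lemma hardy2_line_difference:
  assumes f: "hardy_upper 2 K f" and ab: "a > 0" "b > 0"
  shows "(L2_integral (\<lambda>x. f (Complex x a) - f (Complex x b)))
     = ennreal (line_energy f a + line_energy f b - 2 * line_energy f ((a + b) / 2))"
    "line_energy f ((a + b) / 2) \<le> (line_energy f a + line_energy f b) / 2"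
proof -
  let ?P = "\<lambda>x. f (Complex x a) * cnj (f (Complex x b))"
  have expand: "(norm (f (Complex x a) - f (Complex x b)))\<^sup>2 = 
     (norm (f (Complex x a)))\<^sup>2 + (norm (f (Complex x b)))\<^sup>2 - 2 * Re (?P x)" for x
    unfolding cmod_power2 by (simp add: power2_eq_square algebra_simps)
  have i: "integrable lborel ?P" by (rule hardy2_prod_integrable[OF f f ab])
  have ire: "integrable lborel (\<lambda>x. Re (?P x))" by (rule integrable_Re[OF i])
  have re: "(LINT x|lborel. Re (?P x)) = line_energy f ((a + b) / 2)"
    using hardy2_inner_product_shift[OF f ab] by (subst integral_Re[OF i]) simp
  have int: "integrable lborel (\<lambda>x. (norm (f (Complex x a) - f (Complex x b)))\<^sup>2)"
    unfolding expand using hardy2_integrable[OF f ab(1)] hardy2_integrable[OF f ab(2)] ire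
    by (intro Bochner_Integration.integrable_diff Bochner_Integration.integrable_add integrable_mult_right)
  have val: "(LINT x|lborel. (norm (f (Complex x a) - f (Complex x b)))\<^sup>2) = line_energy f a + line_energy f b - 2 * line_energy f ((a + b) / 2)"
    unfolding expand
    by (subst Bochner_Integration.integral_diff Bochner_Integration.integral_add,
        intro hardy2_integrable[OF f] ab Bochner_Integration.integrable_add integrable_mult_right ire,
        (intro hardy2_integrable[OF f] ab Bochner_Integration.integrable_add integrable_mult_right ire)?)+
      (simp only: line_energy_def[of f a] line_energy_def[of f b] re integral_mult_right_zero)
  show "(L2_integral (\<lambda>x. f (Complex x a) - f (Complex x b)))
     = ennreal (line_energy f a + line_energy f b - 2 * line_energy f ((a + b) / 2))"
    unfolding val[symmetric] by (rule nn_integral_eq_integral[OF int]) auto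
  have "0 \<le> (LINT x|lborel. (norm (f (Complex x a) - f (Complex x b)))\<^sup>2)" by simp
  then show "line_energy f ((a + b) / 2) \<le> (line_energy f a + line_energy f b) / 2" unfolding val by simp
qed

text \<open>A midpoint convex function that increases once grows without bound along an arithmetic
  progression.\<close>

lemma line_energy_antimono:
  assumes f: "hardy_upper 2 K f" and ab: "0 < a" "a \<le> b"
  shows "line_energy f b \<le> line_energy f a"
proof (rule ccontr)
  assume neg: "\<not> ?thesis"
  define \<delta> where "\<delta> = line_energy f b - line_energy f a"
  define h where "h = b - a"
  have \<delta>: "\<delta> > 0" using neg by (simp add: \<delta>_def)
  have h: "h \<ge> 0" using ab by (simp add: h_def)
  define u where "u n = line_energy f (a + real n * h)" for n
  have pos: "a + real n * h > 0" for n using ab h by (simp add: add_pos_nonneg)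
  have step: "u (Suc n) - u n \<ge> \<delta>" for n
  proof (induction n)
    case 0 then show ?case by (simp add: u_def \<delta>_def h_def)
  next
    case (Suc n)
    have "(a + real n * h + (a + real (Suc (Suc n)) * h)) / 2 = a + real (Suc n) * h" by (simp add: field_simps)
    then have "u (Suc n) \<le> (u n + u (Suc (Suc n))) / 2"
      using hardy2_line_difference(2)[OF f pos[of n] pos[of "Suc (Suc n)"]] unfolding u_def by (simp only:)
    moreover have "\<delta> \<le> z - y" if "y \<le> (x + z) / 2" "\<delta> \<le> y - x" for x y z :: real
      using that by (simp add: field_simps)
    ultimately show ?case using Suc by blast
  qed
  have lin: "u n \<ge> u 0 + real n * \<delta>" for n
  proof (induction n)
    case (Suc n) then show ?case using step[of n] by (simp add: algebra_simps)
  qed simp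
  have "u n \<le> K" for n unfolding u_def by (rule line_energy_le[OF f pos])
  moreover have "u 0 \<ge> 0" by (simp add: u_def line_energy_def)
  moreover obtain n where "real n * \<delta> > K" using reals_Archimedean3[OF \<delta>] by blast
  ultimately show False using lin[of n] by (smt (verit))
qed

text \<open>Near height zero the energy is within \<open>e / 2\<close> of its supremum, and the squared
  distance of two horizontal lines is a second difference of the energy.\<close>

lemma hardy2_cauchy:
  assumes f: "hardy_upper 2 K f" and e: "e > 0"
  obtains \<eta> where "\<eta> > 0" 
    "\<And>a b. 0 < a \<Longrightarrow> a \<le> \<eta> \<Longrightarrow> 0 < b \<Longrightarrow> b \<le> \<eta> \<Longrightarrow> 
      (L2_integral (\<lambda>x. f (Complex x a) - f (Complex x b))) \<le> ennreal e"
proof -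
  define L where "L = (SUP y\<in>{0<..}. line_energy f y)"
  have bdd: "bdd_above (line_energy f ` {0<..})"
    using line_energy_le[OF f] by (auto intro!: bdd_aboveI[of _ K])
  have leL: "line_energy f y \<le> L" if "y > 0" for y
    unfolding L_def using that bdd by (intro cSUP_upper) auto
  have "\<exists>y\<in>{0<..}. L - e / 2 < line_energy f y"
    unfolding L_def by (subst less_cSUP_iff[symmetric]) (use bdd e in \<open>auto\<close>)
  then obtain \<eta> where \<eta>: "\<eta> > 0" "L - e / 2 < line_energy f \<eta>" by auto
  show ?thesis
  proof (rule that[OF \<eta>(1)])
    fix a b assume ab: "0 < a" "a \<le> \<eta>" "0 < b" "b \<le> \<eta>"
    have "line_energy f \<eta> \<le> line_energy f ((a + b) / 2)"
      by (rule line_energy_antimono[OF f]) (use ab in auto)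
    then have "line_energy f a + line_energy f b - 2 * line_energy f ((a + b) / 2) \<le> e"
      using leL[OF ab(1)] leL[OF ab(3)] \<eta>(2) by linarith
    then show "(L2_integral (\<lambda>x. f (Complex x a) - f (Complex x b))) \<le> ennreal e"
      unfolding hardy2_line_difference(1)[OF f ab(1) ab(3)] by (rule ennreal_leI)
  qed
qed

text \<open>The difference is again in \<open>H\<^sup>2\<close>, so its energy is largest near the real
  line, where the lines involved are close to each other.\<close>

lemma hardy2_shift_approx:
  assumes f: "hardy_upper 2 K f" and e: "e > 0"
  obtains \<epsilon> where "\<epsilon> > 0" "hardy_upper 2 e (\<lambda>z. f (z + \<i> * of_real \<epsilon>) - f z)"
proof -
  obtain \<eta> where \<eta>: "\<eta> > 0" "\<And>a b. 0 < a \<Longrightarrow> a \<le> \<eta> \<Longrightarrow> 0 < b \<Longrightarrow> b \<le> \<eta> \<Longrightarrow> 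
      (L2_integral (\<lambda>x. f (Complex x a) - f (Complex x b))) \<le> ennreal e"
    using hardy2_cauchy[OF f e] by metis
  define \<epsilon> where "\<epsilon> = \<eta> / 2"
  have \<epsilon>: "\<epsilon> > 0" using \<eta> by (simp add: \<epsilon>_def)
  define g where "g = (\<lambda>z. f (z + \<i> * of_real \<epsilon>) - f z)"
  have hol: "f holomorphic_on uhp" using f by (simp add: hardy_upper_def)
  have ghol: "g holomorphic_on uhp" unfolding g_def
    by (intro holomorphic_on_compose[of "\<lambda>z. z + \<i> * \<epsilon>" _ f, unfolded o_def] holomorphic_intros holomorphic_on_subset[OF hol])
       (use \<epsilon> in auto)
  have geq: "g (Complex x y) = f (Complex x (y + \<epsilon>)) - f (Complex x y)" for x y
  proof -
    have "Complex x y + \<i> * of_real \<epsilon> = Complex x (y + \<epsilon>)" by (simp add: complex_eq_iff)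
    then show ?thesis unfolding g_def by (simp only:)
  qed
  have gK: "hardy_upper 2 (4 * K) g"
    unfolding hardy_upper_def
  proof (intro conjI allI impI ghol)
    show "0 \<le> 4 * K" using f by (simp add: hardy_upper_def)
    fix y :: real assume y: "y > 0"
    have "line_energy f (y + \<epsilon>) + line_energy f y - 2 * line_energy f ((y + \<epsilon> + y) / 2) \<le> 4 * K"
    proof -
      have "line_energy f ((y + \<epsilon> + y) / 2) \<ge> 0" by (simp add: line_energy_def)
      moreover have "K \<ge> 0" using f by (simp add: hardy_upper_def)
      ultimately show ?thesis using line_energy_le[OF f, of y] line_energy_le[OF f, of "y + \<epsilon>"] y \<epsilon> by linarith
    qed
    then show "(Lp_integral 2 (\<lambda>x. g (Complex x y))) \<le> ennreal (4 * K)"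
      using hardy2_line_difference(1)[OF f, of "y + \<epsilon>" y] y \<epsilon> by (simp add: geq ennreal_leI)
  qed
  have "hardy_upper 2 e g"
    unfolding hardy_upper_def
  proof (intro conjI allI impI ghol)
    fix y :: real assume y: "y > 0"
    \<comment> \<open>Both \<open>y'\<close> and \<open>y' + \<epsilon>\<close> are at most \<open>\<eta>\<close>.\<close>
    define y' where "y' = min y \<epsilon>"
    have y': "y' > 0" "y' \<le> y" "y' \<le> \<epsilon>" using y \<epsilon> by (auto simp: y'_def)
    have "(Lp_integral 2 (\<lambda>x. g (Complex x y))) = ennreal (line_energy g y)"
      using line_energy_nn[OF gK y] by simp
    also have "\<dots> \<le> ennreal (line_energy g y')" by (intro ennreal_leI line_energy_antimono[OF gK] y')
    also have "\<dots> = (L2_integral (\<lambda>x. g (Complex x y')))"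
      using line_energy_nn[OF gK y'(1)] by simp
    also have "\<dots> \<le> ennreal e" unfolding geq by (rule \<eta>(2)) (use y' \<epsilon> \<epsilon>_def in auto)
    finally show "(Lp_integral 2 (\<lambda>x. g (Complex x y))) \<le> ennreal e" .
  qed (use e in simp)
  then show ?thesis using that \<epsilon> by (simp add: g_def)
qed

section \<open>The weak-type estimate and nontangential limits\<close>

text \<open>The inequality is Jensen's for the probability density \<open>poisson y\<close>: the integral of
  \<open>poisson y\<close> against \<open>(\<bar>f\<bar> - m)\<^sup>2\<close> is nonnegative,
  where \<open>m\<close> is the mean of \<open>\<bar>f\<bar>\<close>.\<close>

lemma poisson_square_bound:
  assumes U: "open U" "f holomorphic_on U" "{z. 0 \<le> Im z} \<subseteq> U"
    and B: "\<And>z. 0 \<le> Im z \<Longrightarrow> norm (f z) \<le> B" and y: "y > 0"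
  shows "ennreal ((norm (f (Complex x y)))\<^sup>2) \<le> (\<integral>\<^sup>+ t. ennreal (poisson y (t - x)) * ennreal ((norm (f (Complex t 0)))\<^sup>2) \<partial>lborel)"
proof -
  have "continuous_on UNIV (\<lambda>t. f (Complex t 0))"
    by (rule continuous_on_compose2[OF holomorphic_on_imp_continuous_on[OF U(2)]])
      (use U(3) in \<open>auto intro!: continuous_intros\<close>)
  then have [measurable]: "(\<lambda>t. f (Complex t 0)) \<in> borel_measurable borel" by (rule borel_measurable_continuous_onI)
  let ?P = "\<lambda>t. poisson y (t - x)"
  let ?F = "\<lambda>t. norm (f (Complex t 0))"
  note Pi = integrable_poisson[OF y, of x]
  have P0: "?P t > 0" for t using poisson_pos[OF y] .
  have FB: "?F t \<le> \<bar>B\<bar>" for t using B[of "Complex t 0"] by simp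
  have FB2: "(?F t)\<^sup>2 \<le> B\<^sup>2" for t using power_mono[OF FB[of t], of 2] by simp
  have i1: "integrable lborel (\<lambda>t. ?P t * ?F t)"
    by (rule Bochner_Integration.integrable_bound[where f="\<lambda>t. ?P t * B"])
      (use FB Pi in \<open>auto simp: abs_mult intro!: AE_I2 mult_left_mono\<close>)
  have i2: "integrable lborel (\<lambda>t. ?P t * (?F t)\<^sup>2)"
    by (rule Bochner_Integration.integrable_bound[where f="\<lambda>t. ?P t * B\<^sup>2"])
      (use FB2 Pi in \<open>auto simp: abs_mult intro!: AE_I2 mult_left_mono\<close>)
  define m where "m = (LINT t|lborel. ?P t * ?F t)"
  have "norm (f (Complex x y)) \<le> (LINT t|lborel. norm (of_real (?P t) * f (Complex t 0)))"
    using poisson_formula_bounded(2)[OF U B y, of x] integral_norm_bound[of lborel "\<lambda>t. of_real (?P t) * f (Complex t 0)"] by simp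
  also have "\<dots> = m" using P0 by (simp add: norm_mult less_imp_le m_def)
  finally have 1: "norm (f (Complex x y)) \<le> m" .
  have "0 \<le> (LINT t|lborel. ?P t * (?F t - m)\<^sup>2)" using P0 by (intro integral_nonneg_AE AE_I2) (simp add: less_imp_le)
  also have "\<dots> = (LINT t|lborel. (?P t * (?F t)\<^sup>2 - 2 * m * (?P t * ?F t)) + m\<^sup>2 * ?P t)"
    by (intro Bochner_Integration.integral_cong) (auto simp: power2_eq_square algebra_simps)
  also have "\<dots> = (LINT t|lborel. ?P t * (?F t)\<^sup>2) - 2 * m * m + m\<^sup>2"
    using i1 i2 Pi integral_poisson[OF y, of x] by (simp add: m_def[symmetric])
  finally have "m\<^sup>2 \<le> (LINT t|lborel. ?P t * (?F t)\<^sup>2)" by (simp add: power2_eq_square)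
  with 1 have "(norm (f (Complex x y)))\<^sup>2 \<le> (LINT t|lborel. ?P t * (?F t)\<^sup>2)"
    using power_mono[OF 1, of 2] by auto
  then have "ennreal ((norm (f (Complex x y)))\<^sup>2) \<le> ennreal (LINT t|lborel. ?P t * (?F t)\<^sup>2)" by (rule ennreal_leI)
  also have "\<dots> = (\<integral>\<^sup>+ t. ennreal (?P t * (?F t)\<^sup>2) \<partial>lborel)"
    by (rule nn_integral_eq_integral[OF i2, symmetric]) (intro AE_I2 mult_nonneg_nonneg less_imp_le[OF P0], simp)
  also have "\<dots> = (\<integral>\<^sup>+ t. ennreal (?P t) * ennreal ((?F t)\<^sup>2) \<partial>lborel)"
    using P0 by (simp add: ennreal_mult less_imp_le)
  finally show ?thesis .
qed

text \<open>The Poisson kernel is bounded by a multiple of \<open>4 ^ (- k) / y\<close> on the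
  \<open>k\<close>-th dyadic annulus.\<close>

lemma poisson_le_dyadic:
  assumes y: "y > 0"
  shows "ennreal (poisson y (t - x)) \<le> (\<Sum>k. ennreal (4 / (pi * y * 4 ^ k)) * indicator (ball x (2 ^ k * y)) t)"
proof -
  define s where "s = \<bar>t - x\<bar>"
  obtain n where "s / y < 2 ^ n" using real_arch_pow[of 2 "s / y"] by auto
  then have ex: "s < 2 ^ n * y" using y by (simp add: field_simps)
  define k where "k = (LEAST n. s < 2 ^ n * y)"
  have k: "s < 2 ^ k * y" unfolding k_def using ex by (rule LeastI)
  have "4 ^ k * y\<^sup>2 / 4 \<le> s\<^sup>2 + y\<^sup>2"
  proof (cases k)
    case 0 then show ?thesis by (simp add: field_simps)
  next
    case (Suc j)
    then have "\<not> s < 2 ^ j * y" unfolding k_def using not_less_Least[of j] by (metis lessI)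
    then have "(2 ^ j * y)\<^sup>2 \<le> s\<^sup>2" using y by (intro power_mono) auto
    moreover have "(4::real) ^ j = 2 ^ j * 2 ^ j" by (simp flip: power_mult_distrib)
    ultimately have "4 ^ j * y\<^sup>2 \<le> s\<^sup>2" by (simp add: power2_eq_square mult_ac)
    then show ?thesis using Suc by (simp add: add_increasing2)
  qed
  then have "poisson y (t - x) \<le> y / (pi * (4 ^ k * y\<^sup>2 / 4))"
    unfolding poisson_def s_def power2_abs using y by (intro divide_left_mono mult_left_mono mult_pos_pos add_nonneg_pos) auto
  also have "\<dots> = 4 / (pi * y * 4 ^ k)" using y by (simp add: field_simps power2_eq_square)
  finally have *: "poisson y (t - x) \<le> 4 / (pi * y * 4 ^ k)" .
  define a where "a j = ennreal (4 / (pi * y * 4 ^ j)) * indicator (ball x (2 ^ j * y)) t" for j :: nat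
  have "ennreal (poisson y (t - x)) \<le> a k"
    using k * by (auto simp: a_def indicator_def s_def dist_real_def abs_minus_commute intro!: ennreal_leI)
  also have "\<dots> \<le> (\<Sum>j. a j)" using sum_le_suminf[of a "{k}"] by simp
  finally show ?thesis unfolding a_def .
qed

text \<open>If all averages at scales \<open>R \<ge> y\<close> were small, then summing over dyadic balls,
  with weights decaying like \<open>2 ^ (- k)\<close>, would make the Poisson integral small.\<close>

lemma poisson_average_large:
  assumes [measurable]: "H \<in> borel_measurable borel" and y: "y > 0" and l: "l > 0"
    and gt: "ennreal l < (\<integral>\<^sup>+ t. ennreal (poisson y (t - x)) * H t \<partial>lborel)"
  obtains R where "R \<ge> y" "ennreal (pi / 8 * l * R) \<le> (\<integral>\<^sup>+ t. H t * indicator (ball x R) t \<partial>lborel)"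
proof (rule ccontr)
  assume "\<not> thesis"
  have [measurable]: "ball x R \<in> sets borel" for R by simp
  have small: "(\<integral>\<^sup>+ t. H t * indicator (ball x R) t \<partial>lborel) \<le> ennreal (pi / 8 * l * R)" if "R \<ge> y" for R
    using \<open>\<not> thesis\<close> that \<open>\<And>R. R \<ge> y \<Longrightarrow> _ \<Longrightarrow> thesis\<close> by (meson linorder_le_cases)
  have "(\<integral>\<^sup>+ t. ennreal (poisson y (t - x)) * H t \<partial>lborel) \<le>
    (\<integral>\<^sup>+ t. (\<Sum>k. ennreal (4 / (pi * y * 4 ^ k)) * (H t * indicator (ball x (2 ^ k * y)) t)) \<partial>lborel)"
  proof (rule nn_integral_mono)
    fix t
    have "ennreal (poisson y (t - x)) * H t \<le> (\<Sum>k. ennreal (4 / (pi * y * 4 ^ k)) * indicator (ball x (2 ^ k * y)) t) * H t"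
      by (rule mult_right_mono[OF poisson_le_dyadic[OF y]]) simp
    also have "\<dots> = (\<Sum>k. ennreal (4 / (pi * y * 4 ^ k)) * indicator (ball x (2 ^ k * y)) t * H t)"
      by (rule ennreal_suminf_multc[symmetric])
    also have "\<dots> = (\<Sum>k. ennreal (4 / (pi * y * 4 ^ k)) * (H t * indicator (ball x (2 ^ k * y)) t))"
      by (simp add: mult_ac)
    finally show "ennreal (poisson y (t - x)) * H t \<le> (\<Sum>k. ennreal (4 / (pi * y * 4 ^ k)) * (H t * indicator (ball x (2 ^ k * y)) t))" .
  qed
  also have "\<dots> = (\<Sum>k. \<integral>\<^sup>+ t. ennreal (4 / (pi * y * 4 ^ k)) * (H t * indicator (ball x (2 ^ k * y)) t) \<partial>lborel)"
    by (rule nn_integral_suminf) measurable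
  also have "\<dots> = (\<Sum>k. ennreal (4 / (pi * y * 4 ^ k)) * (\<integral>\<^sup>+ t. H t * indicator (ball x (2 ^ k * y)) t \<partial>lborel))"
    by (subst nn_integral_cmult) auto
  also have "\<dots> \<le> (\<Sum>k. ennreal (l * (1 / 2) ^ Suc k))"
  proof (rule suminf_le)
    fix k :: nat
    have "ennreal (4 / (pi * y * 4 ^ k)) * (\<integral>\<^sup>+ t. H t * indicator (ball x (2 ^ k * y)) t \<partial>lborel)
      \<le> ennreal (4 / (pi * y * 4 ^ k)) * ennreal (pi / 8 * l * (2 ^ k * y))"
      using y by (intro mult_left_mono small) (auto simp: mult_le_cancel_right1)
    also have "\<dots> = ennreal (4 / (pi * y * 4 ^ k) * (pi / 8 * l * (2 ^ k * y)))"
      using y l by (subst ennreal_mult) auto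
    also have "4 / (pi * y * 4 ^ k) * (pi / 8 * l * (2 ^ k * y)) = l * (1 / 2) ^ Suc k"
    proof -
      have "(4::real) ^ k = 2 ^ k * 2 ^ k" by (simp flip: power_mult_distrib)
      then show ?thesis using y by (simp add: field_simps)
    qed
    finally show "ennreal (4 / (pi * y * 4 ^ k)) * (\<integral>\<^sup>+ t. H t * indicator (ball x (2 ^ k * y)) t \<partial>lborel) \<le> ennreal (l * (1 / 2) ^ Suc k)" .
  qed auto
  also have "\<dots> = ennreal l"
  proof -
    have "(\<lambda>k. l * (1 / 2) ^ Suc k) sums (l * 1)" by (intro sums_mult power_half_series)
    then show ?thesis using l by (intro suminf_ennreal_eq) auto
  qed
  finally show False using gt by simp
qed

definition nt_cone :: "real \<Rightarrow> real \<Rightarrow> complex set" where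
  "nt_cone \<alpha> x = {z. \<bar>Re z - x\<bar> < \<alpha> * Im z}"

lemma nt_cone_Im_pos:
  assumes "z \<in> nt_cone \<alpha> x" "\<alpha> > 0"
  shows "Im z > 0"
proof -
  have "0 < \<alpha> * Im z" using assms(1) by (auto simp: nt_cone_def intro: le_less_trans[OF abs_ge_zero])
  then show ?thesis using assms(2) by (simp add: zero_less_mult_iff)
qed

lemma nt_cone_mono:
  assumes "\<alpha> > 0" "\<alpha> \<le> \<beta>"
  shows "nt_cone \<alpha> x \<subseteq> nt_cone \<beta> x"
proof
  fix z assume z: "z \<in> nt_cone \<alpha> x"
  have "\<alpha> * Im z \<le> \<beta> * Im z" using nt_cone_Im_pos[OF z assms(1)] assms(2) by (intro mult_right_mono) auto
  then show "z \<in> nt_cone \<beta> x" using z by (simp add: nt_cone_def)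
qed

text \<open>The superlevel set of a nontangential maximal function in which only heights above
  \<open>\<epsilon>\<close> count.\<close>

definition exceed_set :: "(complex \<Rightarrow> complex) \<Rightarrow> real \<Rightarrow> real \<Rightarrow> real \<Rightarrow> real set" where
  "exceed_set g \<alpha> l \<epsilon> = {x. \<exists>z \<in> nt_cone \<alpha> x. Im z > \<epsilon> \<and> norm (g z) > l}"

lemma open_exceed_set: "open (exceed_set g \<alpha> l \<epsilon>)"
proof -
  have "exceed_set g \<alpha> l \<epsilon> = (\<Union>z\<in>{z. Im z > \<epsilon> \<and> norm (g z) > l}. ball (Re z) (\<alpha> * Im z))"
    by (auto simp: exceed_set_def nt_cone_def dist_real_def)
  then show ?thesis by (auto intro!: open_UN)
qed

lemma emeasure_UN_countable_le:
  assumes "countable C" "\<And>i. i \<in> C \<Longrightarrow> X i \<in> sets M"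
  shows "emeasure M (\<Union>i\<in>C. X i) \<le> (\<integral>\<^sup>+ i. emeasure M (X i) \<partial>count_space C)"
proof -
  have "(\<Union>i\<in>C. X i) \<in> sets M" using assms by (intro sets.countable_UN') auto
  then have "emeasure M (\<Union>i\<in>C. X i) = (\<integral>\<^sup>+ x. indicator (\<Union>i\<in>C. X i) x \<partial>M)" by simp
  also have "\<dots> \<le> (\<integral>\<^sup>+ x. \<integral>\<^sup>+ i. indicator (X i) x \<partial>count_space C \<partial>M)"
  proof (rule nn_integral_mono)
    fix x
    show "indicator (\<Union>i\<in>C. X i) x \<le> (\<integral>\<^sup>+ i. indicator (X i) x \<partial>count_space C)"
    proof (cases "x \<in> (\<Union>i\<in>C. X i)")
      case True
      then obtain j where j: "j \<in> C" "x \<in> X j" by blast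
      have "indicator (X j) x \<le> (\<integral>\<^sup>+ i. indicator (X i) x \<partial>count_space C)"
        by (rule nn_integral_ge_point) (rule j)
      then have "1 \<le> (\<integral>\<^sup>+ i. indicator (X i) x \<partial>count_space C)" using j by simp
      then show ?thesis unfolding indicator_simps(1)[OF True] .
    qed simp
  qed
  also have "\<dots> = (\<integral>\<^sup>+ i. \<integral>\<^sup>+ x. indicator (X i) x \<partial>M \<partial>count_space C)"
    by (rule nn_integral_count_space_nn_integral) (use assms in auto)
  also have "\<dots> = (\<integral>\<^sup>+ i. emeasure M (X i) \<partial>count_space C)"
    by (rule nn_integral_cong) (use assms in auto)
  finally show ?thesis .
qed

text \<open>A point where the maximal function exceeds \<open>l\<close> lies in an interval over which the
  boundary energy is at least a constant times \<open>l\<^sup>2\<close> times its length. A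
  disjoint subfamily of these intervals covers a fixed fraction of the set. The truncation at
  height \<open>\<epsilon>\<close> permits using the line at height \<open>\<epsilon> / 2\<close>
  instead of boundary values.\<close>

lemma weak_type_above:
  assumes g: "hardy_upper 2 K g" and \<alpha>: "\<alpha> > 0" and l: "l > 0" and \<epsilon>: "\<epsilon> > 0"
  shows "emeasure lborel (exceed_set g \<alpha> l \<epsilon>) \<le> ennreal (80 * (1 + 2 * \<alpha>) / (pi * l\<^sup>2) * K)"
proof -
  define e where "e = \<epsilon> / 2"
  have e: "e > 0" using \<epsilon> by (simp add: e_def)
  have hol: "g holomorphic_on uhp" and K: "K \<ge> 0" using g by (auto simp: hardy_upper_def)
  define f where "f = (\<lambda>z. g (z + \<i> * e))"
  define H where "H t = ennreal ((norm (g (Complex t e)))\<^sup>2)" for t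
  have [measurable]: "(\<lambda>t. g (Complex t e)) \<in> borel_measurable borel" by (rule hardy_line_measurable[OF hol e])
  have H[measurable]: "H \<in> borel_measurable borel" unfolding H_def by measurable
  have HK: "(\<integral>\<^sup>+ t. H t \<partial>lborel) \<le> ennreal K" unfolding H_def by (rule hardy2_nn[OF g e])
  have feq: "f (Complex x y) = g (Complex x (y + e))" for x y
  proof -
    have "Complex x y + \<i> * e = Complex x (y + e)" by (simp add: complex_eq_iff)
    then show ?thesis unfolding f_def by (simp only:)
  qed
  obtain B where B: "B > 0" "\<And>z. Im z \<ge> e \<Longrightarrow> norm (g z) \<le> B" using hardy_upper_bounded[OF _ g e] by auto
  have fhol: "f holomorphic_on {z. Im z > - e}" unfolding f_def
    by (intro holomorphic_on_compose[of "\<lambda>z. z + \<i> * e" _ g, unfolded o_def] holomorphic_intros holomorphic_on_subset[OF hol]) auto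
  define c where "c = pi / 8 * l\<^sup>2"
  have c: "c > 0" using l by (simp add: c_def)
  define Z where "Z = {z. Im z > \<epsilon> \<and> norm (g z) > l}"
  have "\<exists>R \<ge> Im z - e. ennreal (c * R) \<le> (\<integral>\<^sup>+ t. H t * indicator (ball (Re z) R) t \<partial>lborel)" if z: "z \<in> Z" for z
  proof -
    have y: "Im z - e > 0" using z \<epsilon> by (auto simp: Z_def e_def)
    have "ennreal ((norm (f (Complex (Re z) (Im z - e))))\<^sup>2) \<le> (\<integral>\<^sup>+ t. ennreal (poisson (Im z - e) (t - Re z)) * ennreal ((norm (f (Complex t 0)))\<^sup>2) \<partial>lborel)"
      by (rule poisson_square_bound[OF _ fhol _ _ y, where B=B]) (use e B in \<open>auto simp: f_def open_halfspace_Im_gt\<close>)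
    then have "ennreal ((norm (g z))\<^sup>2) \<le> (\<integral>\<^sup>+ t. ennreal (poisson (Im z - e) (t - Re z)) * H t \<partial>lborel)"
      by (simp add: feq H_def)
    moreover have "ennreal (l\<^sup>2) < ennreal ((norm (g z))\<^sup>2)"
      using z l by (auto simp: Z_def ennreal_less_iff intro!: power_strict_mono)
    ultimately have "ennreal (l\<^sup>2) < (\<integral>\<^sup>+ t. ennreal (poisson (Im z - e) (t - Re z)) * H t \<partial>lborel)" by (rule less_le_trans[rotated])
    moreover have "l\<^sup>2 > 0" using l by simp
    ultimately obtain R where "R \<ge> Im z - e" "ennreal (pi / 8 * l\<^sup>2 * R) \<le> (\<integral>\<^sup>+ t. H t * indicator (ball (Re z) R) t \<partial>lborel)"
      using poisson_average_large[OF H y] by blast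
    then show ?thesis unfolding c_def by blast
  qed
  then obtain R where R: "\<And>z. z \<in> Z \<Longrightarrow> R z \<ge> Im z - e" "\<And>z. z \<in> Z \<Longrightarrow> ennreal (c * R z) \<le> (\<integral>\<^sup>+ t. H t * indicator (ball (Re z) (R z)) t \<partial>lborel)"
    by metis
  have Rpos: "R z > 0" "Im z \<le> 2 * R z" if "z \<in> Z" for z
    using R(1)[OF that] that \<epsilon> by (auto simp: Z_def e_def)
  have Rle: "R z \<le> K / c" if z: "z \<in> Z" for z
  proof -
    have "ennreal (c * R z) \<le> (\<integral>\<^sup>+ t. H t \<partial>lborel)"
      by (rule order_trans[OF R(2)[OF z]], rule nn_integral_mono) (auto simp: indicator_def)
    also have "\<dots> \<le> ennreal K" by (rule HK)
    finally have "c * R z \<le> K" using K by (subst (asm) ennreal_le_iff) auto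
    then show ?thesis using c by (simp add: field_simps)
  qed
  \<comment> \<open>The ball must contain the base of the cone over \<open>z\<close>, of radius \<open>\<alpha> Im z
    \<le> 2 \<alpha> R z\<close>, and the ball of radius \<open>R z\<close>.\<close>
  define r where "r z = (1 + 2 * \<alpha>) * R z" for z
  have rpos: "0 < r z \<and> r z \<le> (1 + 2 * \<alpha>) * (K / c)" if "z \<in> Z" for z
    using Rpos[OF that] Rle[OF that] \<alpha> unfolding r_def by (intro conjI mult_left_mono mult_pos_pos) auto
  have sub: "exceed_set g \<alpha> l \<epsilon> \<subseteq> (\<Union>z\<in>Z. ball (Re z) (r z))"
  proof
    fix x assume "x \<in> exceed_set g \<alpha> l \<epsilon>"
    then obtain z where z: "z \<in> Z" "\<bar>Re z - x\<bar> < \<alpha> * Im z" by (auto simp: exceed_set_def nt_cone_def Z_def)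
    have "\<alpha> * Im z \<le> \<alpha> * (2 * R z)" using Rpos(2)[OF z(1)] \<alpha> by (intro mult_left_mono) auto
    also have "\<dots> \<le> r z" using Rpos(1)[OF z(1)] by (simp add: r_def algebra_simps)
    finally show "x \<in> (\<Union>z\<in>Z. ball (Re z) (r z))" using z by (auto simp: dist_real_def intro!: bexI[of _ z])
  qed
  obtain C where C: "countable C" "C \<subseteq> Z" "pairwise (\<lambda>i j. disjnt (ball (Re i) (r i)) (ball (Re j) (r j))) C"
     "exceed_set g \<alpha> l \<epsilon> \<subseteq> (\<Union>i\<in>C. ball (Re i) (5 * r i))"
    by (rule Vitali_covering_lemma_balls[OF sub rpos]) 
  define q where "q = 10 * (1 + 2 * \<alpha>) / c"
  have q: "q \<ge> 0" using \<alpha> c by (simp add: q_def)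
  have "emeasure lborel (exceed_set g \<alpha> l \<epsilon>) \<le> emeasure lborel (\<Union>i\<in>C. ball (Re i) (5 * r i))"
    by (rule emeasure_mono[OF C(4)]) (auto intro!: borel_open)
  also have "\<dots> \<le> (\<integral>\<^sup>+ i. emeasure lborel (ball (Re i) (5 * r i)) \<partial>count_space C)"
    by (rule emeasure_UN_countable_le[OF C(1)]) auto
  also have "\<dots> \<le> (\<integral>\<^sup>+ i. ennreal q * emeasure (density lborel H) (ball (Re i) (r i)) \<partial>count_space C)"
  proof (rule nn_integral_mono)
    fix i assume "i \<in> space (count_space C)"
    then have i: "i \<in> Z" using C(2) by auto
    have "ball (Re i) (5 * r i) = {Re i - 5 * r i<..<Re i + 5 * r i}" by (simp add: ball_eq_greaterThanLessThan)
    then have "emeasure lborel (ball (Re i) (5 * r i)) = ennreal (10 * r i)" using rpos[OF i] by simp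
    also have "10 * r i = q * (c * R i)" using c by (simp add: q_def r_def)
    also have "ennreal \<dots> = ennreal q * ennreal (c * R i)" using q c Rpos[OF i] by (simp add: ennreal_mult)
    also have "\<dots> \<le> ennreal q * (\<integral>\<^sup>+ t. H t * indicator (ball (Re i) (R i)) t \<partial>lborel)"
      by (intro mult_left_mono R(2) i) simp
    also have "\<dots> \<le> ennreal q * (\<integral>\<^sup>+ t. H t * indicator (ball (Re i) (r i)) t \<partial>lborel)"
    proof (rule mult_left_mono, rule nn_integral_mono)
      have "R i \<le> r i" using Rpos(1)[OF i] \<alpha> by (simp add: r_def algebra_simps)
      then show "\<And>t. H t * indicator (ball (Re i) (R i)) t \<le> H t * indicator (ball (Re i) (r i)) t"
        by (auto simp: indicator_def)
    qed simp
    also have "(\<integral>\<^sup>+ t. H t * indicator (ball (Re i) (r i)) t \<partial>lborel) = emeasure (density lborel H) (ball (Re i) (r i))"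
      by (subst emeasure_density) auto
    finally show "emeasure lborel (ball (Re i) (5 * r i)) \<le> ennreal q * emeasure (density lborel H) (ball (Re i) (r i))" .
  qed
  also have "\<dots> = ennreal q * (\<integral>\<^sup>+ i. emeasure (density lborel H) (ball (Re i) (r i)) \<partial>count_space C)"
    by (rule nn_integral_cmult) simp
  also have "(\<integral>\<^sup>+ i. emeasure (density lborel H) (ball (Re i) (r i)) \<partial>count_space C) = emeasure (density lborel H) (\<Union>i\<in>C. ball (Re i) (r i))"
    by (rule emeasure_UN_countable[symmetric])
      (use C in \<open>auto simp: disjoint_family_on_def pairwise_def disjnt_def\<close>)
  also have "\<dots> \<le> emeasure (density lborel H) UNIV" by (rule emeasure_mono) auto
  also have "\<dots> = (\<integral>\<^sup>+ t. H t \<partial>lborel)" by (subst emeasure_density) auto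
  also have "\<dots> \<le> ennreal K" by (rule HK)
  finally have "emeasure lborel (exceed_set g \<alpha> l \<epsilon>) \<le> ennreal q * ennreal K" by (simp add: mult_left_mono)
  also have "\<dots> = ennreal (q * K)" using q K by (simp add: ennreal_mult)
  also have "q * K = 80 * (1 + 2 * \<alpha>) / (pi * l\<^sup>2) * K" using l by (simp add: q_def c_def field_simps)
  finally show ?thesis .
qed

lemma weak_type:
  assumes g: "hardy_upper 2 K g" and \<alpha>: "\<alpha> > 0" and l: "l > 0"
  shows "emeasure lborel (exceed_set g \<alpha> l 0) \<le> ennreal (80 * (1 + 2 * \<alpha>) / (pi * l\<^sup>2) * K)"
proof -
  let ?A = "\<lambda>n. exceed_set g \<alpha> l (1 / real (Suc n))"
  have inc: "incseq ?A"
  proof (rule incseq_SucI)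
    fix n
    have "1 / real (Suc (Suc n)) < 1 / real (Suc n)" by (intro divide_strict_left_mono) auto
    then show "?A n \<subseteq> ?A (Suc n)" unfolding exceed_set_def by (blast intro: less_trans)
  qed
  have un: "exceed_set g \<alpha> l 0 = (\<Union>n. ?A n)"
  proof
    show "exceed_set g \<alpha> l 0 \<subseteq> (\<Union>n. ?A n)"
    proof
      fix x assume "x \<in> exceed_set g \<alpha> l 0"
      then obtain z where z: "z \<in> nt_cone \<alpha> x" "Im z > 0" "norm (g z) > l" by (auto simp: exceed_set_def)
      obtain n where "1 / real (Suc n) < Im z" using nat_approx_posE[OF z(2)] by blast
      then show "x \<in> (\<Union>n. ?A n)" using z by (auto simp: exceed_set_def)
    qed
    have "1 / real (Suc n) > 0" for n by simp
    then show "(\<Union>n. ?A n) \<subseteq> exceed_set g \<alpha> l 0"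
      unfolding exceed_set_def by (blast intro: less_trans)
  qed
  have "emeasure lborel (exceed_set g \<alpha> l 0) = (SUP n. emeasure lborel (?A n))"
    unfolding un by (rule SUP_emeasure_incseq[symmetric]) (use inc open_exceed_set in auto)
  also have "\<dots> \<le> ennreal (80 * (1 + 2 * \<alpha>) / (pi * l\<^sup>2) * K)"
    by (intro SUP_least weak_type_above[OF g \<alpha> l]) simp
  finally show ?thesis .
qed

definition nontangential_limit :: "(complex \<Rightarrow> complex) \<Rightarrow> real \<Rightarrow> complex \<Rightarrow> bool" where
  "nontangential_limit f x l \<longleftrightarrow> (\<forall>\<alpha>>0. (f \<longlongrightarrow> l) (at (Complex x 0) within nt_cone \<alpha> x))"

text \<open>The factor \<open>4\<close> leaves room for the triangle inequality below.\<close>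

definition oscillation_set :: "(complex \<Rightarrow> complex) \<Rightarrow> real \<Rightarrow> real \<Rightarrow> real set" where
  "oscillation_set f \<alpha> r = {x. \<forall>h>0. \<exists>z\<in>nt_cone \<alpha> x. \<exists>w\<in>nt_cone \<alpha> x. Im z < h \<and> Im w < h \<and> norm (f z - f w) > 4 * r}"

text \<open>The function \<open>f(\<cdot> + i\<epsilon>)\<close> is continuous at the real line, so
  \<open>f\<close> can oscillate near \<open>x\<close> only if the difference of the two is large
  somewhere in the cone. The set of such \<open>x\<close> is small by the weak-type estimate.\<close>

lemma oscillation_set_null:
  assumes f: "hardy_upper 2 K f" and \<alpha>: "\<alpha> > 0" and r: "r > 0"
  shows "\<exists>N \<in> null_sets lborel. oscillation_set f \<alpha> r \<subseteq> N"
proof -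
  have hol: "f holomorphic_on uhp" using f by (simp add: hardy_upper_def)
  define c where "c = 80 * (1 + 2 * \<alpha>) / (pi * r\<^sup>2)"
  have c: "c > 0" using \<alpha> r by (simp add: c_def)
  have "\<exists>A. open A \<and> oscillation_set f \<alpha> r \<subseteq> A \<and> emeasure lborel A \<le> ennreal (1 / real (Suc n))" for n
  proof -
    define e where "e = 1 / real (Suc n) / c"
    have e: "e > 0" using c by (simp add: e_def)
    obtain \<epsilon> where \<epsilon>: "\<epsilon> > 0" "hardy_upper 2 e (\<lambda>z. f (z + \<i> * of_real \<epsilon>) - f z)"
      using hardy2_shift_approx[OF f e] by blast
    define g where "g = (\<lambda>z. f (z + \<i> * of_real \<epsilon>) - f z)"
    have "emeasure lborel (exceed_set g \<alpha> r 0) \<le> ennreal (c * e)"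
      unfolding c_def g_def by (rule weak_type[OF \<epsilon>(2) \<alpha> r])
    also have "c * e = 1 / real (Suc n)" using c by (simp add: e_def)
    finally have m: "emeasure lborel (exceed_set g \<alpha> r 0) \<le> ennreal (1 / real (Suc n))" .
    have "oscillation_set f \<alpha> r \<subseteq> exceed_set g \<alpha> r 0"
    proof (rule subsetI, rule ccontr)
      fix x assume x: "x \<in> oscillation_set f \<alpha> r" and nx: "x \<notin> exceed_set g \<alpha> r 0"
      have small: "norm (g z) \<le> r" if "z \<in> nt_cone \<alpha> x" for z
        using nx that nt_cone_Im_pos[OF that \<alpha>] by (auto simp: exceed_set_def not_less)
      define f\<epsilon> where "f\<epsilon> = (\<lambda>z. f (z + \<i> * of_real \<epsilon>))"
      define x0 where "x0 = Complex x 0"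
      have "f\<epsilon> holomorphic_on {z. Im z > - \<epsilon>}" unfolding f\<epsilon>_def
        by (intro holomorphic_on_compose[of "\<lambda>z. z + \<i> * \<epsilon>" _ f, unfolded o_def] holomorphic_intros holomorphic_on_subset[OF hol]) auto
      then have "continuous_on {z. Im z > - \<epsilon>} f\<epsilon>" by (rule holomorphic_on_imp_continuous_on)
      then have "isCont f\<epsilon> x0"
        using \<epsilon>(1) by (subst (asm) continuous_on_eq_continuous_at[OF open_halfspace_Im_gt]) (simp add: x0_def)
      then obtain d where d: "d > 0" "\<And>z. dist z x0 < d \<Longrightarrow> dist (f\<epsilon> z) (f\<epsilon> x0) < r"
        using r unfolding continuous_at_eps_delta by blast
      define h where "h = d / (1 + \<alpha>)"
      have h: "h > 0" using d \<alpha> by (simp add: h_def)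
      obtain z w where zw: "z \<in> nt_cone \<alpha> x" "w \<in> nt_cone \<alpha> x" "Im z < h" "Im w < h" "norm (f z - f w) > 4 * r"
        using x h unfolding oscillation_set_def by blast
      have near: "norm (f v - f\<epsilon> x0) < 2 * r" if v: "v \<in> nt_cone \<alpha> x" "Im v < h" for v
      proof -
        have "dist v x0 \<le> \<bar>Re v - x\<bar> + \<bar>Im v\<bar>" using cmod_le[of "v - x0"] by (simp add: x0_def dist_norm)
        also have "\<dots> < \<alpha> * Im v + Im v" using v nt_cone_Im_pos[OF v(1) \<alpha>] by (simp add: nt_cone_def)
        also have "\<dots> = (1 + \<alpha>) * Im v" by (simp add: algebra_simps)
        also have "\<dots> \<le> (1 + \<alpha>) * h" using v \<alpha> by (intro mult_left_mono) auto
        also have "\<dots> = d" using \<alpha> by (simp add: h_def)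
        finally have "norm (f\<epsilon> v - f\<epsilon> x0) < r" using d(2)[of v] by (simp add: dist_norm)
        moreover have "norm (f\<epsilon> v - f v) \<le> r" using small[OF v(1)] by (simp add: g_def f\<epsilon>_def)
        moreover have "norm (f v - f\<epsilon> x0) \<le> norm (f\<epsilon> v - f\<epsilon> x0) + norm (f\<epsilon> v - f v)"
          using norm_triangle_ineq4[of "f\<epsilon> v - f\<epsilon> x0" "f\<epsilon> v - f v"] by simp
        ultimately show ?thesis by linarith
      qed
      have "norm (f z - f w) \<le> norm (f z - f\<epsilon> x0) + norm (f w - f\<epsilon> x0)"
        using norm_triangle_ineq4[of "f z - f\<epsilon> x0" "f w - f\<epsilon> x0"] by simp
      then show False using near[OF zw(1,3)] near[OF zw(2,4)] zw(5) by linarith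
    qed
    then show ?thesis by (intro exI[of _ "exceed_set g \<alpha> r 0"] conjI open_exceed_set m)
  qed
  then obtain A where A: "\<And>n::nat. open (A n)" "\<And>n. oscillation_set f \<alpha> r \<subseteq> A n" "\<And>n. emeasure lborel (A n) \<le> ennreal (1 / real (Suc n))"
    by metis
  have Ab: "A n \<in> sets borel" for n using A(1) by simp
  have "emeasure lborel (\<Inter>n. A n) \<le> ennreal e" if e0: "e > 0" for e
  proof -
    obtain n where n: "1 / real (Suc n) < e" using nat_approx_posE[OF e0] by blast
    have "emeasure lborel (\<Inter>n. A n) \<le> emeasure lborel (A n)" by (rule emeasure_mono) (use Ab in auto)
    also have "\<dots> \<le> ennreal e" using A(3)[of n] n by (meson ennreal_leI less_imp_le order_trans)
    finally show ?thesis .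
  qed
  then have "emeasure lborel (\<Inter>n. A n) \<le> 0 + ennreal e" if "e > 0" for e using that by (simp only: add_0)
  then have "emeasure lborel (\<Inter>n. A n) \<le> 0" by (rule ennreal_le_epsilon)
  then have "emeasure lborel (\<Inter>n. A n) = 0" by (simp only: le_zero_eq)
  moreover have "(\<Inter>n. A n) \<in> sets lborel" using Ab by auto
  ultimately have "(\<Inter>n. A n) \<in> null_sets lborel" by (rule null_setsI)
  moreover have "oscillation_set f \<alpha> r \<subseteq> (\<Inter>n. A n)" by (rule INT_greatest) (rule A(2))
  ultimately show ?thesis by (rule bexI[rotated])
qed

text \<open>Off countably many null sets the Cauchy criterion holds in every cone, and cones with different
  apertures share the vertical line, hence the limit.\<close>

lemma hardy2_nontangential_limit:
  assumes f: "hardy_upper 2 K f"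
  shows "AE x in lborel. \<exists>l. nontangential_limit f x l"
proof -
  have "\<exists>N. \<forall>m j. N m j \<in> null_sets lborel \<and> oscillation_set f (real (Suc m)) (1 / real (Suc j)) \<subseteq> N m j"
  proof (intro choice allI)
    fix m j :: nat
    show "\<exists>N. N \<in> null_sets lborel \<and> oscillation_set f (real (Suc m)) (1 / real (Suc j)) \<subseteq> N"
      using oscillation_set_null[OF f, of "real (Suc m)" "1 / real (Suc j)"] by auto
  qed
  then obtain N where N: "\<And>m j. N m j \<in> null_sets lborel" "\<And>m j. oscillation_set f (real (Suc m)) (1 / real (Suc j)) \<subseteq> N m j"
    by blast
  have "(\<Union>m. \<Union>j. N m j) \<in> null_sets lborel" using N(1) by (intro null_sets_UN)
  then show ?thesis
  proof (rule AE_I')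
    show "{x \<in> space lborel. \<not> (\<exists>l. nontangential_limit f x l)} \<subseteq> (\<Union>m. \<Union>j. N m j)"
    proof (rule subsetI, rule ccontr)
      fix x assume x: "x \<in> {x \<in> space lborel. \<not> (\<exists>l. nontangential_limit f x l)}" and "x \<notin> (\<Union>m. \<Union>j. N m j)"
      then have nosc: "x \<notin> oscillation_set f (real (Suc m)) (1 / real (Suc j))" for m j using N(2) by blast
      have osc: "\<exists>h>0. \<forall>z\<in>nt_cone \<alpha> x. \<forall>w\<in>nt_cone \<alpha> x. Im z < h \<longrightarrow> Im w < h \<longrightarrow> norm (f z - f w) < e" if \<alpha>: "\<alpha> > 0" and e: "e > 0" for \<alpha> e
      proof -
        obtain m where m: "\<alpha> \<le> real (Suc m)" by (meson real_arch_simple le_SucI of_nat_le_iff order_trans)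
        obtain j where j: "1 / real (Suc j) < e / 4" using nat_approx_posE[of "e / 4"] e by auto
        from nosc[of m j] obtain h where "h > 0" and h: "\<And>z w. z \<in> nt_cone (real (Suc m)) x \<Longrightarrow> w \<in> nt_cone (real (Suc m)) x \<Longrightarrow> Im z < h \<Longrightarrow> Im w < h \<Longrightarrow> norm (f z - f w) \<le> 4 * (1 / real (Suc j))"
          unfolding oscillation_set_def by (force simp: not_less)
        have "norm (f z - f w) < e" if "z \<in> nt_cone \<alpha> x" "w \<in> nt_cone \<alpha> x" "Im z < h" "Im w < h" for z w
        proof -
          have "norm (f z - f w) \<le> 4 * (1 / real (Suc j))" using h that nt_cone_mono[OF \<alpha> m] by blast
          then show ?thesis using j by linarith
        qed
        then show ?thesis using \<open>h > 0\<close> by blast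
      qed
      define v where "v n = Complex x (1 / real (Suc n))" for n
      have vc: "v n \<in> nt_cone \<alpha> x" if "\<alpha> > 0" for \<alpha> n using that by (simp add: v_def nt_cone_def)
      have vlim: "\<exists>M. \<forall>n\<ge>M. Im (v n) < h" if h0: "h > 0" for h
      proof -
        obtain M where M: "1 / real (Suc M) < h" using nat_approx_posE[OF h0] by blast
        have "1 / real (Suc n) \<le> 1 / real (Suc M)" if "n \<ge> M" for n using that by (intro divide_left_mono) auto
        then show ?thesis using M by (intro exI[of _ M]) (auto simp: v_def intro: le_less_trans)
      qed
      have "Cauchy (\<lambda>n. f (v n))"
        unfolding Cauchy_def dist_norm
      proof (intro allI impI)
        fix e :: real assume e: "e > 0"
        obtain h where h: "h > 0" "\<forall>z\<in>nt_cone 1 x. \<forall>w\<in>nt_cone 1 x. Im z < h \<longrightarrow> Im w < h \<longrightarrow> norm (f z - f w) < e"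
          using osc[of 1 e] e by auto
        obtain M where "\<forall>n\<ge>M. Im (v n) < h" using vlim[OF h(1)] by blast
        then show "\<exists>M. \<forall>m\<ge>M. \<forall>n\<ge>M. norm (f (v m) - f (v n)) < e" using h vc[of 1] by (intro exI[of _ M]) simp
      qed
      then obtain l where l: "(\<lambda>n. f (v n)) \<longlonglongrightarrow> l" using Cauchy_convergent convergent_def by blast
      have "nontangential_limit f x l"
        unfolding nontangential_limit_def
      proof (intro allI impI tendstoI)
        fix \<alpha> e :: real assume \<alpha>: "\<alpha> > 0" and e: "e > 0"
        obtain h where h: "h > 0" "\<forall>z\<in>nt_cone \<alpha> x. \<forall>w\<in>nt_cone \<alpha> x. Im z < h \<longrightarrow> Im w < h \<longrightarrow> norm (f z - f w) < e / 2"
          using osc[OF \<alpha>, of "e / 2"] e by auto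
        obtain M where M: "\<forall>n\<ge>M. Im (v n) < h" using vlim[OF h(1)] by blast
        have "dist (f z) l < e" if z: "z \<in> nt_cone \<alpha> x" "dist z (Complex x 0) < h" for z
        proof -
          have "Im z < h" using z(2) abs_Im_le_cmod[of "z - Complex x 0"] by (simp add: dist_norm)
          then have "norm (f z - f (v n)) \<le> e / 2" if "n \<ge> M" for n using h z vc[OF \<alpha>] M that by (simp add: less_imp_le)
          then have "norm (f z - l) \<le> e / 2"
            by (intro LIMSEQ_le_const2[OF tendsto_norm[OF tendsto_diff[OF tendsto_const l]]]) auto
          then show ?thesis using e by (simp add: dist_norm)
        qed
        then show "\<forall>\<^sub>F z in at (Complex x 0) within nt_cone \<alpha> x. dist (f z) l < e"
          unfolding eventually_at using h(1) by auto
      qed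
      then show False using x by blast
    qed
  qed
qed

text \<open>This function serves twice: as the factor that moves bounded functions into
  \<open>H\<^sup>2\<close>, and as a summand in \<open>H\<^sup>2\<close> with strictly positive
  real part.\<close>

lemma hardy2_reciprocal: "hardy_upper 2 pi (\<lambda>z. \<i> / (z + \<i>))"
  unfolding hardy_upper_def
proof (intro conjI allI impI)
  show "(\<lambda>z. \<i> / (z + \<i>)) holomorphic_on uhp"
    by (intro holomorphic_intros) (auto simp: complex_eq_iff)
  fix y :: real assume y: "y > 0"
  have "norm (\<i> / (Complex x y + \<i>)) powr 2 = pi / (y + 1) * poisson (y + 1) (x - 0)" for x
  proof -
    have "norm (\<i> / (Complex x y + \<i>)) powr 2 = 1 / (norm (Complex x y + \<i>))\<^sup>2" by (simp add: norm_divide power_divide)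
    also have "(norm (Complex x y + \<i>))\<^sup>2 = x\<^sup>2 + (y + 1)\<^sup>2" by (simp add: cmod_power2)
    finally show ?thesis using y by (simp add: poisson_def)
  qed
  then have "ennreal (norm (\<i> / (Complex x y + \<i>)) powr 2) = ennreal (pi / (y + 1)) * ennreal (poisson (y + 1) (x - 0))" for x
    using y poisson_pos[of "y + 1" "x - 0"] by (subst ennreal_mult[symmetric]) (auto intro: less_imp_le)
  then have "(Lp_integral 2 (\<lambda>x. \<i> / (Complex x y + \<i>))) = (\<integral>\<^sup>+ x. ennreal (pi / (y + 1)) * ennreal (poisson (y + 1) (x - 0)) \<partial>lborel)"
    by (simp only:)
  also have "\<dots> = ennreal (pi / (y + 1))"
    using y nn_integral_poisson[of "y + 1" 0] by (subst nn_integral_cmult) auto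
  also have "\<dots> \<le> ennreal pi" using y by (intro ennreal_leI) (simp add: field_simps)
  finally show "(Lp_integral 2 (\<lambda>x. \<i> / (Complex x y + \<i>))) \<le> ennreal pi" .
qed simp

lemma nontangential_limit_transform:
  assumes "\<And>\<alpha>. \<alpha> > 0 \<Longrightarrow> (g \<longlongrightarrow> l) (at (Complex x 0) within nt_cone \<alpha> x)" "\<And>z. Im z > 0 \<Longrightarrow> f z = g z"
  shows "nontangential_limit f x l"
  unfolding nontangential_limit_def
proof (intro allI impI)
  fix \<alpha> :: real assume \<alpha>: "\<alpha> > 0"
  have "\<forall>\<^sub>F z in at (Complex x 0) within nt_cone \<alpha> x. z \<in> nt_cone \<alpha> x" by (simp add: eventually_at_filter)
  then have "\<forall>\<^sub>F z in at (Complex x 0) within nt_cone \<alpha> x. g z = f z"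
    by (rule eventually_mono) (use assms(2) nt_cone_Im_pos \<alpha> in metis)
  then show "(f \<longlongrightarrow> l) (at (Complex x 0) within nt_cone \<alpha> x)"
    by (rule Lim_transform_eventually[OF assms(1)[OF \<alpha>]])
qed

lemma bounded_nontangential_limit:
  assumes hol: "g holomorphic_on uhp" and b: "\<And>z. Im z > 0 \<Longrightarrow> norm (g z) \<le> 1"
  shows "AE x in lborel. \<exists>l. nontangential_limit g x l"
proof -
  define q where "q = (\<lambda>z. g z * (\<i> / (z + \<i>)))"
  have "hardy_upper 2 pi q"
    unfolding hardy_upper_def
  proof (intro conjI allI impI)
    show "q holomorphic_on uhp" unfolding q_def using hol
      by (intro holomorphic_intros) (auto simp: complex_eq_iff)
    fix y :: real assume y: "y > 0"
    have "norm (q (Complex x y)) \<le> norm (\<i> / (Complex x y + \<i>))" for x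
      unfolding q_def norm_mult using b[of "Complex x y"] y by (intro mult_left_le_one_le) auto
    then have "(Lp_integral 2 (\<lambda>x. q (Complex x y))) \<le> (Lp_integral 2 (\<lambda>x. \<i> / (Complex x y + \<i>)))"
      by (intro nn_integral_mono ennreal_leI powr_mono2) auto
    also have "\<dots> \<le> ennreal pi" using hardy2_reciprocal y by (simp add: hardy_upper_def)
    finally show "(Lp_integral 2 (\<lambda>x. q (Complex x y))) \<le> ennreal pi" .
  qed simp
  from hardy2_nontangential_limit[OF this] show ?thesis
  proof eventually_elim
    case (elim x)
    then obtain l where l: "nontangential_limit q x l" by blast
    have "nontangential_limit g x (l * ((Complex x 0 + \<i>) / \<i>))"
    proof (rule nontangential_limit_transform)
      fix \<alpha> :: real assume "\<alpha> > 0"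
      then show "((\<lambda>z. q z * ((z + \<i>) / \<i>)) \<longlongrightarrow> l * ((Complex x 0 + \<i>) / \<i>)) (at (Complex x 0) within nt_cone \<alpha> x)"
        using l unfolding nontangential_limit_def by (intro tendsto_intros) auto
      show "g z = q z * ((z + \<i>) / \<i>)" if "Im z > 0" for z
      proof -
        have "z + \<i> \<noteq> 0" using that by (auto simp: complex_eq_iff)
        then show ?thesis by (simp add: q_def)
      qed
    qed
    then show ?case by blast
  qed
qed

section \<open>Cauchy transforms with nonnegative real part\<close>

text \<open>If \<open>\<bar>G z\<bar> > 1\<close>, then \<open>\<bar>G\<bar>\<close> attains its maximum in
  a compact set, so \<open>G\<close> is constant, which contradicts the bound outside that set.\<close>

lemma maximum_principle_uhp:
  assumes hol: "G holomorphic_on uhp"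
    and outside: "\<And>e. e > 0 \<Longrightarrow> \<exists>S. compact S \<and> S \<subseteq> uhp \<and> (\<forall>z\<in>uhp - S. norm (G z) \<le> 1 + e)"
    and z: "Im z > 0"
  shows "norm (G z) \<le> 1"
proof (rule ccontr)
  assume "\<not> norm (G z) \<le> 1"
  define e where "e = (norm (G z) - 1) / 2"
  have e: "e > 0" "1 + e < norm (G z)" using \<open>\<not> norm (G z) \<le> 1\<close> by (auto simp: e_def field_simps)
  obtain S where S: "compact S" "S \<subseteq> uhp" "\<And>w. w \<in> uhp - S \<Longrightarrow> norm (G w) \<le> 1 + e"
    using outside[OF e(1)] by blast
  have zS: "z \<in> S" using S(3)[of z] z e(2) by auto
  have "continuous_on S (\<lambda>w. norm (G w))"
    using holomorphic_on_imp_continuous_on[OF hol] S(2) by (intro continuous_on_norm) (rule continuous_on_subset)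
  then obtain w where w: "w \<in> S" "\<And>v. v \<in> S \<Longrightarrow> norm (G v) \<le> norm (G w)"
    using continuous_attains_sup[OF S(1), of "\<lambda>w. norm (G w)"] zS by blast
  have max: "norm (G v) \<le> norm (G w)" if "v \<in> uhp" for v
    using w(2)[of v] S(3)[of v] w(2)[OF zS] e(2) that by (cases "v \<in> S") auto
  have "G constant_on uhp"
    by (rule maximum_modulus_principle[OF hol open_uhp _ open_uhp order_refl _ max])
      (use w S in \<open>auto simp: convex_halfspace_Im_gt convex_connected\<close>)
  then obtain c where c: "\<And>v. v \<in> uhp \<Longrightarrow> G v = c" by (auto simp: constant_on_def)
  obtain M where M: "\<And>v. v \<in> S \<Longrightarrow> norm v \<le> M" using compact_imp_bounded[OF S(1)] by (auto simp: bounded_iff)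
  have M0: "M \<ge> 0" using M[OF zS] norm_ge_zero order_trans by blast
  define v where "v = Complex 0 (M + 1)"
  have "norm v > M" using abs_Im_le_cmod[of v] M0 by (simp add: v_def)
  then have "v \<in> uhp - S" using M[of v] M0 by (auto simp: v_def)
  then show False using S(3)[of v] c[of v] c[of z] z e by auto
qed

locale cauchy_transform =
  fixes h :: "real \<Rightarrow> real" and R :: real
  assumes cont: "continuous_on UNIV h" and nonneg: "\<And>t. h t \<ge> 0" and supp: "\<And>t. \<bar>t\<bar> > R \<Longrightarrow> h t = 0" and R: "R > 0"
begin

text \<open>The analytic function with real part the Poisson integral of \<open>h\<close>.\<close>

definition W :: "complex \<Rightarrow> complex" where
  "W z = (LINT t:{-R..R}|lborel. 1 / (pi * \<i>) * (of_real (h t) / (of_real t - z)))"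

lemma h_measurable [measurable]: "h \<in> borel_measurable borel"
  using cont by (rule borel_measurable_continuous_onI)

lemma integrable_weighted:
  fixes k :: "real \<Rightarrow> 'a :: euclidean_space"
  assumes "continuous_on {-R..R} k"
  shows "integrable lborel (\<lambda>t. h t *\<^sub>R k t)"
proof -
  have "set_integrable lborel {-R..R} (\<lambda>t. h t *\<^sub>R k t)"
    by (intro borel_integrable_atLeastAtMost' continuous_intros assms continuous_on_subset[OF cont]) auto
  moreover have "indicat_real {-R..R} t *\<^sub>R (h t *\<^sub>R k t) = h t *\<^sub>R k t" for t
    using supp[of t] by (cases "t \<in> {-R..R}") auto
  ultimately show ?thesis unfolding set_integrable_def by (simp only:)
qed

lemma integrable_kernel:
  assumes "Im z > 0"
  shows "integrable lborel (\<lambda>t. 1 / (pi * \<i>) * (of_real (h t) / (of_real t - z)))"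
proof -
  have "integrable lborel (\<lambda>t. h t *\<^sub>R (1 / (pi * \<i>) * (1 / (of_real t - z))))"
    by (rule integrable_weighted, intro continuous_intros) (use assms in \<open>auto simp: complex_eq_iff\<close>)
  then show ?thesis by (simp add: scaleR_conv_of_real)
qed

lemma W_eq: "W z = (LINT t|lborel. 1 / (pi * \<i>) * (of_real (h t) / (of_real t - z)))"
  unfolding W_def set_lebesgue_integral_def
  by (rule Bochner_Integration.integral_cong) (use supp in \<open>auto simp: indicator_def\<close>)

lemma W_holomorphic: "W holomorphic_on uhp"
proof -
  have ne: "of_real t - z \<noteq> 0" if "Im z > 0" for t z using that by (auto simp: complex_eq_iff)
  have c: "continuous_on S (\<lambda>t. complex_of_real (h t))" for S
    by (intro continuous_intros continuous_on_subset[OF cont]) auto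
  have i: "continuous_on {-R..R} (\<lambda>t. 1 / (pi * \<i>) * (of_real (h t) / (of_real t - z)))" if "Im z > 0" for z
    by (intro continuous_intros c) (use ne that in auto)
  have "(\<lambda>z. integral (cbox (-R) R) (\<lambda>t. 1 / (pi * \<i>) * (of_real (h t) / (of_real t - z)))) holomorphic_on uhp"
  proof (rule leibniz_rule_holomorphic[where fx = "\<lambda>z t. 1 / (pi * \<i>) * (of_real (h t) / (of_real t - z)^2)"])
    show "((\<lambda>z. 1 / (pi * \<i>) * (of_real (h t) / (of_real t - z))) has_field_derivative 1 / (pi * \<i>) * (of_real (h t) / (of_real t - z)^2)) (at z within uhp)"
      if "z \<in> uhp" for z t
      using ne[of z t] that by (auto intro!: derivative_eq_intros simp: power2_eq_square)
    show "(\<lambda>t. 1 / (pi * \<i>) * (of_real (h t) / (of_real t - z))) integrable_on cbox (-R) R" if "z \<in> uhp" for z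
      using i that by (intro integrable_continuous) auto
    have "continuous_on (uhp \<times> cbox (-R) R) (\<lambda>q. complex_of_real (h (snd q)))"
      by (rule continuous_on_compose2[OF c[of UNIV] continuous_on_snd]) (auto intro!: continuous_intros)
    then show "continuous_on (uhp \<times> cbox (-R) R) (\<lambda>(z, t). 1 / (pi * \<i>) * (of_real (h t) / (of_real t - z)^2))"
      unfolding case_prod_beta by (intro continuous_intros) (use ne in auto)
  qed (rule convex_halfspace_Im_gt)
  also have "?this \<longleftrightarrow> ?thesis"
  proof (rule holomorphic_cong[OF refl])
    fix z assume "z \<in> uhp"
    then show "integral (cbox (-R) R) (\<lambda>t. 1 / (pi * \<i>) * (of_real (h t) / (of_real t - z))) = W z"
      unfolding W_def using i[of z] by (subst set_borel_integral_eq_integral) (auto intro: borel_integrable_atLeastAtMost')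
  qed
  finally show ?thesis .
qed

lemma poisson_h_integrable: "y > 0 \<Longrightarrow> integrable lborel (\<lambda>t. poisson y (t - x) * h t)"
proof -
  assume y: "y > 0"
  have "integrable lborel (\<lambda>t. h t *\<^sub>R poisson y (t - x))"
  proof (rule integrable_weighted)
    have "(t - x)\<^sup>2 + y\<^sup>2 \<noteq> 0" for t using y by (simp add: sum_power2_eq_zero_iff)
    then show "continuous_on {-R..R} (\<lambda>t. poisson y (t - x))"
      unfolding poisson_def by (intro continuous_intros) auto
  qed
  then show ?thesis by (simp add: mult.commute)
qed

lemma Re_W: 
  assumes y: "y > 0"
  shows "Re (W (Complex x y)) = (LINT t|lborel. poisson y (t - x) * h t)"
proof -
  have "Re (1 / (pi * \<i>) * (of_real (h t) / (of_real t - Complex x y))) = poisson y (t - x) * h t" for t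
  proof -
    have "Re (1 / (pi * \<i>) * w) = Im w / pi" for w
      by (simp add: Re_divide Im_divide power2_eq_square)
    then have "Re (1 / (pi * \<i>) * (of_real (h t) / (of_real t - Complex x y))) = Im (of_real (h t) / (of_real t - Complex x y)) / pi" .
    also have "Im (of_real (h t) / (of_real t - Complex x y)) = h t * y / ((t - x)\<^sup>2 + y\<^sup>2)"
      by (simp add: Im_divide)
    finally show ?thesis by (simp add: poisson_def mult.commute)
  qed
  then show ?thesis unfolding W_eq
    using integral_Re[OF integrable_kernel[of "Complex x y"]] y by simp
qed

lemma Re_W_nonneg:
  assumes "Im z > 0"
  shows "Re (W z) \<ge> 0"
proof -
  have "(LINT t|lborel. poisson (Im z) (t - Re z) * h t) \<ge> 0"
    by (intro integral_nonneg_AE AE_I2 mult_nonneg_nonneg nonneg less_imp_le[OF poisson_pos[OF assms]])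
  then show ?thesis using Re_W[OF assms, of "Re z"] by simp
qed

text \<open>A one-sided form of the approximate identity property is enough for the maximum principle below.
  It is uniform because \<open>h\<close> has compact support.\<close>

lemma Re_W_boundary:
  assumes e: "e > 0"
  obtains \<eta> where "\<eta> > 0" "\<And>x y. 0 < y \<Longrightarrow> y < \<eta> \<Longrightarrow> Re (W (Complex x y)) \<ge> h x - e"
proof -
  have "uniformly_continuous_on {-R-1..R+1} h"
    by (rule compact_uniformly_continuous) (auto intro: continuous_on_subset[OF cont])
  then obtain d where d: "d > 0" "\<And>x t. x \<in> {-R-1..R+1} \<Longrightarrow> t \<in> {-R-1..R+1} \<Longrightarrow> dist t x < d \<Longrightarrow> dist (h t) (h x) < e / 2"
    unfolding uniformly_continuous_on_def using e by (metis half_gt_zero)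
  define \<rho> where "\<rho> = min d 1"
  have \<rho>: "\<rho> > 0" using d by (simp add: \<rho>_def)
  have near: "h t \<ge> h x - e / 2" if "\<bar>t - x\<bar> < \<rho>" for x t
  proof (cases "\<bar>x\<bar> > R")
    case True then show ?thesis using supp[of x] nonneg[of t] e by simp
  next
    case False
    then have "x \<in> {-R-1..R+1}" "t \<in> {-R-1..R+1}" "dist t x < d"
      using that by (auto simp: dist_real_def \<rho>_def abs_le_iff abs_less_iff)
    from d(2)[OF this] show ?thesis using abs_ge_minus_self[of "h t - h x"] unfolding dist_real_def by linarith
  qed
  obtain M where M: "\<And>x. x \<in> {-R..R} \<Longrightarrow> h x \<le> M"
  proof -
    have "bounded (h ` {-R..R})"
      by (intro compact_imp_bounded compact_continuous_image continuous_on_subset[OF cont]) auto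
    then obtain M where "\<And>x. x \<in> {-R..R} \<Longrightarrow> norm (h x) \<le> M" unfolding bounded_iff by blast
    then show thesis by (intro that[of M]) (auto intro: order_trans[OF abs_ge_self])
  qed
  have M0: "M \<ge> 0" using M[of 0] nonneg[of 0] R by auto
  have M: "h x \<le> M" for x using M[of x] supp[of x] M0 by (cases "x \<in> {-R..R}") auto
  show ?thesis
  proof (rule that)
    show "\<rho> * (e / 2) / (2 * M + 1) > 0" using \<rho> e M0 by simp
    fix x y assume y: "0 < y" "y < \<rho> * (e / 2) / (2 * M + 1)"
    have "2 * M * y / \<rho> \<le> e / 2"
    proof -
      have "y * (2 * M + 1) < \<rho> * (e / 2)" using y M0 by (simp add: field_simps)
      then have "2 * M * y < \<rho> * (e / 2)" using y by (simp add: algebra_simps)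
      then show ?thesis using \<rho> by (simp add: field_simps)
    qed
    \<comment> \<open>At distance at least \<open>\<rho>\<close> from \<open>x\<close> the difference of \<open>h
      x\<close> and \<open>h t\<close> is only known to be at most \<open>M\<close>, but there the
      kernel is at most a multiple of \<open>y\<close> times the kernel of width
      \<open>\<rho>\<close>.\<close>
    have pt: "poisson y (t - x) * (h x - e / 2) - 2 * M * y / \<rho> * poisson \<rho> (t - x) \<le> poisson y (t - x) * h t" for t
    proof (cases "\<bar>t - x\<bar> < \<rho>")
      case True
      have "poisson y (t - x) * (h x - e / 2) \<le> poisson y (t - x) * h t"
        using near[OF True] poisson_pos[OF y(1)] by (intro mult_left_mono) (auto intro: less_imp_le)
      moreover have "2 * M * y / \<rho> * poisson \<rho> (t - x) \<ge> 0"
        using M0 y \<rho> poisson_pos[OF \<rho>, of "t - x"] by simp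
      ultimately show ?thesis by linarith
    next
      case False
      define s where "s = t - x"
      have "\<rho>\<^sup>2 \<le> \<bar>s\<bar>\<^sup>2" using False \<rho> by (intro power_mono) (auto simp: s_def)
      then have s: "\<rho>\<^sup>2 \<le> s\<^sup>2" by simp
      have s0: "s\<^sup>2 + \<rho>\<^sup>2 > 0" "s\<^sup>2 + y\<^sup>2 > 0" using \<rho> y by (auto intro!: add_nonneg_pos)
      have "poisson y s \<le> 2 * y / \<rho> * poisson \<rho> s"
      proof -
        have "s\<^sup>2 + \<rho>\<^sup>2 \<le> 2 * (s\<^sup>2 + y\<^sup>2)" using s zero_le_power2[of y] by (simp add: add_increasing2)
        then have "(s\<^sup>2 + \<rho>\<^sup>2) / 2 \<le> s\<^sup>2 + y\<^sup>2" by simp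
        then have "y / (pi * (s\<^sup>2 + y\<^sup>2)) \<le> y / (pi * ((s\<^sup>2 + \<rho>\<^sup>2) / 2))"
          using s0 y by (intro divide_left_mono mult_left_mono mult_pos_pos) auto
        also have "\<dots> = 2 * y / \<rho> * poisson \<rho> s" using \<rho> s0 by (simp add: poisson_def field_simps)
        finally show ?thesis by (simp add: poisson_def)
      qed
      then have "M * poisson y s \<le> M * (2 * y / \<rho> * poisson \<rho> s)" by (rule mult_left_mono) (rule M0)
      moreover have "poisson y s * (h x - e / 2) \<le> poisson y s * M"
        using M[of x] e poisson_pos[OF y(1), of s] by (intro mult_left_mono) auto
      moreover have "poisson y s * h t \<ge> 0" using nonneg poisson_pos[OF y(1), of s] by simp
      ultimately show ?thesis unfolding s_def[symmetric] by (simp add: mult_ac)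
    qed
    have "(LINT t|lborel. poisson y (t - x) * (h x - e / 2) - 2 * M * y / \<rho> * poisson \<rho> (t - x)) \<le> Re (W (Complex x y))"
      unfolding Re_W[OF y(1)] using pt
      by (intro integral_mono poisson_h_integrable y Bochner_Integration.integrable_diff integrable_mult_left integrable_mult_right integrable_poisson \<rho>) auto
    also have "(LINT t|lborel. poisson y (t - x) * (h x - e / 2) - 2 * M * y / \<rho> * poisson \<rho> (t - x)) = (h x - e / 2) - 2 * M * y / \<rho>"
      using integrable_poisson[OF y(1), of x] integrable_poisson[OF \<rho>, of x] integral_poisson[OF y(1), of x] integral_poisson[OF \<rho>, of x]
      by (subst Bochner_Integration.integral_diff) auto
    finally show "Re (W (Complex x y)) \<ge> h x - e" using \<open>2 * M * y / \<rho> \<le> e / 2\<close> by linarith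
  qed
qed

lemma W_decay:
  assumes Y: "Y > 0"
  obtains c where "c \<ge> 0" "\<And>z. Im z \<ge> Y \<Longrightarrow> (norm (W z))\<^sup>2 \<le> c / (norm z)\<^sup>2"
proof -
  define A where "A = (LINT t|lborel. h t)"
  have ih: "integrable lborel h" using integrable_weighted[of "\<lambda>_. 1::real"] by simp
  have A: "A \<ge> 0" unfolding A_def using nonneg by simp
  \<comment> \<open>This \<open>\<theta>\<close> is so small that the error \<open>\<theta> R\<^sup>2\<close>, from
    the position of \<open>t\<close> in the support, is absorbed by \<open>(Im z)\<^sup>2\<close>.\<close>
  define \<theta> where "\<theta> = min 1 (Y\<^sup>2 / (2 * R\<^sup>2))"
  have \<theta>: "\<theta> > 0" "\<theta> \<le> 1" "\<theta> * R\<^sup>2 \<le> Y\<^sup>2 / 2"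
  proof -
    show "\<theta> > 0" "\<theta> \<le> 1" using Y R by (auto simp: \<theta>_def)
    have "\<theta> * R\<^sup>2 \<le> Y\<^sup>2 / (2 * R\<^sup>2) * R\<^sup>2" by (intro mult_right_mono) (auto simp: \<theta>_def)
    then show "\<theta> * R\<^sup>2 \<le> Y\<^sup>2 / 2" using R by simp
  qed
  have dist: "(\<theta> / 2) * (norm z)\<^sup>2 \<le> (norm (of_real t - z))\<^sup>2" if z: "Im z \<ge> Y" and t: "\<bar>t\<bar> \<le> R" for z t
  proof -
    have "(Re z)\<^sup>2 \<le> 2 * (t - Re z)\<^sup>2 + 2 * t\<^sup>2"
      using zero_le_power2[of "2 * t - Re z"] by (simp add: power2_eq_square algebra_simps)
    moreover have "t\<^sup>2 \<le> R\<^sup>2" using power_mono[OF t, of 2] by simp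
    ultimately have "(Re z)\<^sup>2 / 2 \<le> (t - Re z)\<^sup>2 + R\<^sup>2" by linarith
    then have "\<theta> * ((Re z)\<^sup>2 / 2) \<le> \<theta> * ((t - Re z)\<^sup>2 + R\<^sup>2)" using \<theta> by (intro mult_left_mono) auto
    moreover have "\<theta> * (t - Re z)\<^sup>2 \<le> (t - Re z)\<^sup>2" using \<theta> by (intro mult_left_le_one_le) auto
    moreover have "Y\<^sup>2 \<le> (Im z)\<^sup>2" using z Y by (intro power_mono) auto
    moreover have "\<theta> * (Im z)\<^sup>2 \<le> (Im z)\<^sup>2" using \<theta> by (intro mult_left_le_one_le) auto
    ultimately have "\<theta> * ((Re z)\<^sup>2 / 2) + \<theta> * (Im z)\<^sup>2 / 2 \<le> (t - Re z)\<^sup>2 + (Im z)\<^sup>2"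
      using \<theta>(3) by (simp add: algebra_simps)
    then show ?thesis by (simp add: cmod_power2 algebra_simps power2_commute)
  qed
  define c where "c = (A / pi)\<^sup>2 * (2 / \<theta>)"
  show ?thesis
  proof (rule that)
    show "c \<ge> 0" using \<theta> by (simp add: c_def)
    fix z assume z: "Im z \<ge> Y"
    then have z0: "norm z > 0" using Y by (auto simp: complex_eq_iff)
    have zp: "Im z > 0" using z Y by simp
    define k where "k = sqrt (\<theta> / 2) * norm z"
    have k: "k > 0" using z0 \<theta> by (simp add: k_def)
    have kd: "k \<le> norm (of_real t - z)" if t: "\<bar>t\<bar> \<le> R" for t
    proof -
      have "k\<^sup>2 \<le> (norm (of_real t - z))\<^sup>2" using dist[OF z t] \<theta> by (simp add: k_def power_mult_distrib)
      then show ?thesis by (rule power2_le_imp_le) simp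
    qed
    have "norm (W z) \<le> (LINT t|lborel. norm (1 / (pi * \<i>) * (of_real (h t) / (of_real t - z))))"
      unfolding W_eq by (rule integral_norm_bound)
    also have "\<dots> \<le> (LINT t|lborel. (1 / (pi * k)) * h t)"
    proof (rule integral_mono)
      fix t
      show "norm (1 / (pi * \<i>) * (of_real (h t) / (of_real t - z))) \<le> 1 / (pi * k) * h t"
      proof (cases "\<bar>t\<bar> \<le> R")
        case True
        have "h t / norm (of_real t - z) \<le> h t / k" using kd[OF True] k nonneg[of t] by (intro frac_le) auto
        then have "1 / pi * (h t / norm (of_real t - z)) \<le> 1 / pi * (h t / k)" by (rule mult_left_mono) simp
        moreover have "norm (1 / (pi * \<i>) * (of_real (h t) / (of_real t - z))) = 1 / pi * (h t / norm (of_real t - z))"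
          unfolding norm_mult norm_divide using nonneg[of t] by simp
        ultimately show ?thesis by simp
      qed (use supp[of t] in simp)
    qed (use integrable_kernel[OF zp] ih in auto)
    also have "\<dots> = A / (pi * k)" by (simp add: A_def)
    finally have "(norm (W z))\<^sup>2 \<le> (A / (pi * k))\<^sup>2" by (rule power_mono) simp
    also have "\<dots> = c / (norm z)\<^sup>2" using \<theta> by (simp add: c_def k_def power_divide power_mult_distrib)
    finally show "(norm (W z))\<^sup>2 \<le> c / (norm z)\<^sup>2" .
  qed
qed

text \<open>The integral of \<open>W\<^sup>2\<close> does not depend on the height, and it is at most a
  constant divided by the height because \<open>\<bar>W z\<bar>\<^sup>2\<close> is at most a
  constant times \<open>1 / \<bar>z\<bar>\<^sup>2\<close>.\<close>

lemma W_line_square: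
  assumes y: "y > 0"
  shows "integrable lborel (\<lambda>x. (W (Complex x y))\<^sup>2)" "(LINT x|lborel. (W (Complex x y))\<^sup>2) = 0"
proof -
  obtain c where c: "c \<ge> 0" "\<And>z. Im z \<ge> y \<Longrightarrow> (norm (W z))\<^sup>2 \<le> c / (norm z)\<^sup>2"
    using W_decay[OF y] by blast
  have bound: "norm ((W (Complex x Y))\<^sup>2) \<le> c * pi / Y * poisson Y (x - 0)" if Y: "Y \<ge> y" for x Y
  proof -
    have "norm ((W (Complex x Y))\<^sup>2) \<le> c / (x\<^sup>2 + Y\<^sup>2)" using c(2)[of "Complex x Y"] Y by (simp add: norm_power cmod_power2)
    also have "\<dots> = c * pi / Y * poisson Y (x - 0)" using Y y by (simp add: poisson_def)
    finally show ?thesis .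
  qed
  have int: "integrable lborel (\<lambda>x. (W (Complex x Y))\<^sup>2)" if Y: "Y \<ge> y" for Y
  proof (rule Bochner_Integration.integrable_bound)
    show "integrable lborel (\<lambda>x. c * pi / Y * poisson Y (x - 0))"
      using Y y by (intro integrable_mult_right integrable_poisson) auto
    have [measurable]: "(\<lambda>x. W (Complex x Y)) \<in> borel_measurable borel"
      using W_holomorphic Y y by (intro hardy_line_measurable) auto
    show "(\<lambda>x. (W (Complex x Y))\<^sup>2) \<in> borel_measurable lborel" by measurable
    show "AE x in lborel. norm ((W (Complex x Y))\<^sup>2) \<le> norm (c * pi / Y * poisson Y (x - 0))"
      by (rule AE_I2, rule order_trans[OF bound[OF Y]]) (simp only: real_norm_def abs_ge_self)
  qed
  show "integrable lborel (\<lambda>x. (W (Complex x y))\<^sup>2)" using int by simp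
  have le: "norm (LINT x|lborel. (W (Complex x y))\<^sup>2) \<le> c * pi / Y" if Y: "Y > y" for Y
  proof -
    have "(LINT x|lborel. (W (Complex x y))\<^sup>2) = (LINT x|lborel. (W (Complex x Y))\<^sup>2)"
    proof (rule horizontal_integral_shift[where U = uhp and G = "\<lambda>z. (W z)\<^sup>2"])
      show "(\<lambda>z. (W z)\<^sup>2) holomorphic_on uhp" by (intro holomorphic_intros W_holomorphic)
      fix r :: real assume r: "r > 0"
      show "\<exists>T. \<forall>z. y \<le> Im z \<and> Im z \<le> Y \<and> norm z \<ge> T \<longrightarrow> norm ((W z)\<^sup>2) \<le> r"
      proof (intro exI allI impI)
        fix z assume z: "y \<le> Im z \<and> Im z \<le> Y \<and> norm z \<ge> sqrt (c / r) + 1"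
        have "(sqrt (c / r))\<^sup>2 \<le> (norm z)\<^sup>2" using z c r by (intro power_mono) auto
        then have "c / r \<le> (norm z)\<^sup>2" using c r by simp
        moreover have "norm z > 0" using z y by (auto simp: complex_eq_iff)
        ultimately have "c / (norm z)\<^sup>2 \<le> r" using r by (simp add: field_simps)
        then show "norm ((W z)\<^sup>2) \<le> r" using c(2)[of z] z by (simp add: norm_power)
      qed
    qed (use int Y y open_uhp in auto)
    also have "norm \<dots> \<le> (LINT x|lborel. norm ((W (Complex x Y))\<^sup>2))" by (rule integral_norm_bound)
    also have "\<dots> \<le> (LINT x|lborel. c * pi / Y * poisson Y (x - 0))"
    proof (rule integral_mono)
      show "integrable lborel (\<lambda>x. norm ((W (Complex x Y))\<^sup>2))" using int[of Y] Y by (intro integrable_norm) auto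
      show "integrable lborel (\<lambda>x. c * pi / Y * poisson Y (x - 0))"
        using Y y by (intro integrable_mult_right integrable_poisson) auto
    qed (use bound Y in auto)
    also have "\<dots> = c * pi / Y" using integral_poisson[of Y 0] Y y by simp
    finally show ?thesis .
  qed
  show "(LINT x|lborel. (W (Complex x y))\<^sup>2) = 0"
  proof (rule ccontr)
    assume "(LINT x|lborel. (W (Complex x y))\<^sup>2) \<noteq> 0"
    then have n: "norm (LINT x|lborel. (W (Complex x y))\<^sup>2) > 0" (is "?n > 0") by simp
    define Y where "Y = y + 1 + c * pi / ?n"
    have "c * pi / ?n \<ge> 0" using c by simp
    then have Y: "Y > y" "Y > 0" "Y > c * pi / ?n" using y unfolding Y_def by linarith+
    have "?n * Y \<le> c * pi" using le[OF Y(1)] Y(2) by (simp add: field_simps)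
    moreover have "c * pi < ?n * Y" using Y(3) n by (simp add: field_simps)
    ultimately show False by simp
  qed
qed

text \<open>As the integral of \<open>W\<^sup>2\<close> vanishes, the real and the imaginary part of
  \<open>W\<close> have the same energy, and that of the real part is at most that of
  \<open>h\<close> by Jensen's inequality.\<close>

lemma hardy2_W:
  assumes K: "(\<integral>\<^sup>+ t. ennreal ((h t)\<^sup>2) \<partial>lborel) \<le> ennreal K" "K \<ge> 0"
  shows "hardy_upper 2 (2 * K) W"
  unfolding hardy_upper_def
proof (intro conjI allI impI W_holomorphic)
  fix y :: real assume y: "y > 0"
  have [measurable]: "(\<lambda>x. W (Complex x y)) \<in> borel_measurable borel"
    using W_holomorphic y by (intro hardy_line_measurable) auto
  note Pi = integrable_poisson[OF y] and P0 = poisson_pos[OF y]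
  have jensen: "(Re (W (Complex x y)))\<^sup>2 \<le> (LINT t|lborel. poisson y (t - x) * (h t)\<^sup>2)" 
    and ih2: "integrable lborel (\<lambda>t. poisson y (t - x) * (h t)\<^sup>2)" for x
  proof -
    have "(t - x)\<^sup>2 + y\<^sup>2 \<noteq> 0" for t using y by (simp add: sum_power2_eq_zero_iff)
    then have "integrable lborel (\<lambda>t. h t *\<^sub>R (poisson y (t - x) * h t))"
      unfolding poisson_def by (intro integrable_weighted continuous_intros continuous_on_subset[OF cont]) auto
    then show i2: "integrable lborel (\<lambda>t. poisson y (t - x) * (h t)\<^sup>2)" by (simp add: power2_eq_square mult_ac)
    define m where "m = (LINT t|lborel. poisson y (t - x) * h t)"
    have "0 \<le> (LINT t|lborel. poisson y (t - x) * (h t - m)\<^sup>2)"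
      using P0 by (intro integral_nonneg_AE AE_I2) (simp add: less_imp_le)
    also have "\<dots> = (LINT t|lborel. (poisson y (t - x) * (h t)\<^sup>2 - 2 * m * (poisson y (t - x) * h t)) + m\<^sup>2 * poisson y (t - x))"
      by (intro Bochner_Integration.integral_cong) (auto simp: power2_eq_square algebra_simps)
    also have "\<dots> = (LINT t|lborel. poisson y (t - x) * (h t)\<^sup>2) - 2 * m * m + m\<^sup>2"
      using i2 Pi[of x] poisson_h_integrable[OF y, of x] integral_poisson[OF y, of x] by (simp add: m_def[symmetric])
    finally show "(Re (W (Complex x y)))\<^sup>2 \<le> (LINT t|lborel. poisson y (t - x) * (h t)\<^sup>2)"
      unfolding Re_W[OF y] m_def[symmetric] by (simp add: power2_eq_square)
  qed
  have U2: "(\<integral>\<^sup>+ x. ennreal ((Re (W (Complex x y)))\<^sup>2) \<partial>lborel) \<le> ennreal K"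
  proof -
    have "(\<integral>\<^sup>+ x. ennreal ((Re (W (Complex x y)))\<^sup>2) \<partial>lborel) \<le> (\<integral>\<^sup>+ x. \<integral>\<^sup>+ t. ennreal (poisson y (t - x)) * ennreal ((h t)\<^sup>2) \<partial>lborel \<partial>lborel)"
    proof (rule nn_integral_mono)
      fix x
      have "ennreal ((Re (W (Complex x y)))\<^sup>2) \<le> ennreal (LINT t|lborel. poisson y (t - x) * (h t)\<^sup>2)" by (rule ennreal_leI[OF jensen])
      also have "\<dots> = (\<integral>\<^sup>+ t. ennreal (poisson y (t - x) * (h t)\<^sup>2) \<partial>lborel)"
        by (rule nn_integral_eq_integral[OF ih2, symmetric]) (intro AE_I2 mult_nonneg_nonneg less_imp_le[OF P0], simp)
      also have "\<dots> = (\<integral>\<^sup>+ t. ennreal (poisson y (t - x)) * ennreal ((h t)\<^sup>2) \<partial>lborel)"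
        using P0 by (simp add: ennreal_mult less_imp_le)
      finally show "ennreal ((Re (W (Complex x y)))\<^sup>2) \<le> (\<integral>\<^sup>+ t. ennreal (poisson y (t - x)) * ennreal ((h t)\<^sup>2) \<partial>lborel)" .
    qed
    also have "\<dots> = (\<integral>\<^sup>+ t. \<integral>\<^sup>+ x. ennreal (poisson y (t - x)) * ennreal ((h t)\<^sup>2) \<partial>lborel \<partial>lborel)"
      by (rule lborel_pair.Fubini') simp
    also have "\<dots> = (\<integral>\<^sup>+ t. ennreal ((h t)\<^sup>2) \<partial>lborel)"
    proof (rule nn_integral_cong)
      fix t
      have "(\<integral>\<^sup>+ x. ennreal (poisson y (t - x)) * ennreal ((h t)\<^sup>2) \<partial>lborel) = (\<integral>\<^sup>+ x. ennreal (poisson y (x - t)) \<partial>lborel) * ennreal ((h t)\<^sup>2)"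
        by (subst nn_integral_multc) (auto simp: poisson_sym[of y t])
      then show "(\<integral>\<^sup>+ x. ennreal (poisson y (t - x)) * ennreal ((h t)\<^sup>2) \<partial>lborel) = ennreal ((h t)\<^sup>2)"
        by (simp add: nn_integral_poisson[OF y])
    qed
    finally show ?thesis using K(1) by (rule order_trans)
  qed
  have iU: "integrable lborel (\<lambda>x. (Re (W (Complex x y)))\<^sup>2)"
    by (rule integrableI_bounded) (use U2 in \<open>auto intro: le_less_trans\<close>)
  have vU: "(LINT x|lborel. (Re (W (Complex x y)))\<^sup>2) \<le> K"
    using U2 nn_integral_eq_integral[OF iU] K(2) by simp
  have eq: "(norm (W (Complex x y)))\<^sup>2 = 2 * (Re (W (Complex x y)))\<^sup>2 - Re ((W (Complex x y))\<^sup>2)" for x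
    unfolding cmod_power2 by (simp add: power2_eq_square)
  have i: "integrable lborel (\<lambda>x. (norm (W (Complex x y)))\<^sup>2)"
    unfolding eq by (intro Bochner_Integration.integrable_diff integrable_mult_right iU integrable_Re W_line_square y)
  have "(LINT x|lborel. (norm (W (Complex x y)))\<^sup>2) = 2 * (LINT x|lborel. (Re (W (Complex x y)))\<^sup>2) - (LINT x|lborel. Re ((W (Complex x y))\<^sup>2))"
    unfolding eq using iU integrable_Re[OF W_line_square(1)[OF y]] by (simp del: Re_power2)
  also have "(LINT x|lborel. Re ((W (Complex x y))\<^sup>2)) = 0"
    using integral_Re[OF W_line_square(1)[OF y]] W_line_square(2)[OF y] by simp
  finally have "(LINT x|lborel. (norm (W (Complex x y)))\<^sup>2) \<le> 2 * K" using vU by simp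
  then show "(Lp_integral 2 (\<lambda>x. W (Complex x y))) \<le> ennreal (2 * K)"
    using nn_integral_eq_integral[OF i] by (simp add: ennreal_leI)
qed (use K in simp)

end

section \<open>A square-integrable majorant\<close>

lemma hardy_upper_shift:
  assumes f: "hardy_upper p K f" and e: "\<epsilon> > 0"
  shows "(\<lambda>z. f (z + \<i> * of_real \<epsilon>)) holomorphic_on {z. Im z > - \<epsilon>}"
    "f (Complex x y + \<i> * of_real \<epsilon>) = f (Complex x (y + \<epsilon>))"
proof -
  have hol: "f holomorphic_on uhp" using f by (simp add: hardy_upper_def)
  show "(\<lambda>z. f (z + \<i> * of_real \<epsilon>)) holomorphic_on {z. Im z > - \<epsilon>}"
    by (intro holomorphic_on_compose[of "\<lambda>z. z + \<i> * \<epsilon>" _ f, unfolded o_def] holomorphic_intros holomorphic_on_subset[OF hol]) auto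
  have "Complex x y + \<i> * of_real \<epsilon> = Complex x (y + \<epsilon>)" by (simp add: complex_eq_iff)
  then show "f (Complex x y + \<i> * of_real \<epsilon>) = f (Complex x (y + \<epsilon>))" by (simp only:)
qed

lemma Re_reciprocal_pos: "Im z > 0 \<Longrightarrow> Re (\<i> / (z + \<i>)) > 0"
proof -
  assume z: "Im z > 0"
  have "Re (\<i> / (z + \<i>)) = (Im z + 1) / ((Re z)\<^sup>2 + (Im z + 1)\<^sup>2)" by (simp add: Re_divide)
  also have "\<dots> > 0" using z by (intro divide_pos_pos add_nonneg_pos) auto
  finally show ?thesis .
qed

lemma not_nonpos_Reals_Re_pos: "Re z > 0 \<Longrightarrow> z \<notin> \<real>\<^sub>\<le>\<^sub>0"
  by (auto simp: complex_nonpos_Reals_iff)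

lemma norm_quotient_powr:
  assumes "v \<noteq> 0"
  shows "norm (a * exp (- of_real r * Ln v)) = norm a * norm v powr (- r)"
  using assms by (simp add: norm_mult powr_def)

text \<open>The boundary function \<open>h\<close> is \<open>\<bar>f\<bar> powr (p/2)\<close> at height
  \<open>\<epsilon>\<close>, lowered by \<open>\<delta>\<close> so that its support is compact;
  the constant \<open>\<delta>\<close> is added back to \<open>W\<close>, where it also controls
  the quotient at infinity. The summand \<open>\<i> / (z + \<i>)\<close> is only there to keep the
  real part positive when \<open>\<delta>\<close> tends to zero.\<close>

lemma shifted_majorant:
  assumes p: "p > 0" and f: "hardy_upper p K f" and \<epsilon>: "\<epsilon> > 0" and \<delta>: "\<delta> > 0"
  obtains W where "W holomorphic_on uhp" "\<And>z. Im z > 0 \<Longrightarrow> Re (W z) \<ge> 0"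
    "hardy_upper 2 (2 * K) W"
    "\<And>z. Im z > 0 \<Longrightarrow> norm (f (z + \<i> * of_real \<epsilon>)) powr (p / 2) \<le> norm (W z + \<i> / (z + \<i>) + of_real \<delta>)"
proof -
  define q where "q = p / 2"
  have q: "q > 0" using p by (simp add: q_def)
  have K: "K \<ge> 0" using f by (simp add: hardy_upper_def)
  define fe where "fe z = f (z + \<i> * of_real \<epsilon>)" for z
  have hol: "fe holomorphic_on {z. Im z > - \<epsilon>}" unfolding fe_def by (rule hardy_upper_shift[OF f \<epsilon>])
  have feq: "fe (Complex x y) = f (Complex x (y + \<epsilon>))" for x y unfolding fe_def by (rule hardy_upper_shift[OF f \<epsilon>])
  define u where "u z = norm (fe z) powr q" for z
  have ucont: "continuous_on {z. Im z \<ge> 0} u" unfolding u_def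
    using holomorphic_on_imp_continuous_on[OF hol] \<epsilon> q
    by (intro continuous_on_powr' continuous_intros) (auto intro: continuous_on_subset)
  obtain R0 where R0: "R0 > 0" "\<And>z. Im z \<ge> \<epsilon> \<Longrightarrow> norm z \<ge> R0 \<Longrightarrow> norm (f z) < \<delta> powr (1 / q)"
    using hardy_upper_vanishes[OF p f \<epsilon>, of "\<delta> powr (1 / q)"] \<delta> by auto
  define R where "R = R0 + \<epsilon>"
  have R: "R > 0" using R0 \<epsilon> by (simp add: R_def)
  have uR: "u z \<le> \<delta>" if z: "Im z \<ge> 0" "norm z \<ge> R" for z
  proof -
    have "norm z \<le> norm (z + \<i> * of_real \<epsilon>) + norm (\<i> * of_real \<epsilon>)" using norm_triangle_ineq4[of "z + \<i> * of_real \<epsilon>" "\<i> * of_real \<epsilon>"] by simp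
    then have ge: "norm (z + \<i> * of_real \<epsilon>) \<ge> R0" using z \<epsilon> by (simp add: R_def norm_mult)
    have "norm (fe z) \<le> \<delta> powr (1 / q)" unfolding fe_def by (rule less_imp_le, rule R0(2)) (use z ge in auto)
    then have "u z \<le> (\<delta> powr (1 / q)) powr q" unfolding u_def using q by (intro powr_mono2) auto
    then show ?thesis using q \<delta> by (simp add: powr_powr)
  qed
  define h where "h t = max (u (Complex t 0) - \<delta>) 0" for t
  have hc: "continuous_on UNIV h" unfolding h_def
    by (intro continuous_intros continuous_on_compose2[OF ucont]) auto
  interpret cauchy_transform h R
  proof
    show "h t = 0" if "\<bar>t\<bar> > R" for t
      using uR[of "Complex t 0"] abs_Re_le_cmod[of "Complex t 0"] that by (simp add: h_def max_def)
  qed (use hc R in \<open>auto simp: h_def\<close>)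
  have h2: "(\<integral>\<^sup>+ t. ennreal ((h t)\<^sup>2) \<partial>lborel) \<le> ennreal K"
  proof -
    have "(h t)\<^sup>2 \<le> norm (f (Complex t \<epsilon>)) powr p" for t
    proof -
      have "h t \<le> u (Complex t 0)" using \<delta> by (simp add: h_def u_def)
      then have "(h t)\<^sup>2 \<le> (u (Complex t 0))\<^sup>2" using nonneg[of t] by (intro power_mono)
      also have "\<dots> = norm (f (Complex t \<epsilon>)) powr p"
        by (simp add: u_def feq power2_eq_square q_def flip: powr_add)
      finally show ?thesis .
    qed
    then have "(\<integral>\<^sup>+ t. ennreal ((h t)\<^sup>2) \<partial>lborel) \<le> (Lp_integral p (\<lambda>t. f (Complex t \<epsilon>)))"
      by (intro nn_integral_mono ennreal_leI)
    also have "\<dots> \<le> ennreal K" using f \<epsilon> by (simp add: hardy_upper_def)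
    finally show ?thesis .
  qed
  define V where "V z = W z + \<i> / (z + \<i>) + of_real \<delta>" for z
  have Vhol: "V holomorphic_on uhp" unfolding V_def
    by (intro holomorphic_intros W_holomorphic) (auto simp: complex_eq_iff)
  have ReV: "Re (V z) \<ge> Re (W z) + \<delta>" if "Im z > 0" for z
    using Re_reciprocal_pos[OF that] by (simp add: V_def)
  have ReVd: "Re (V z) \<ge> \<delta>" if "Im z > 0" for z
    using ReV[OF that] Re_W_nonneg[OF that] by simp
  have Vne: "V z \<noteq> 0" if "Im z > 0" for z using ReVd[OF that] \<delta> by auto
  define G where "G z = fe z * exp (- of_real (1 / q) * Ln (V z))" for z
  have Ghol: "G holomorphic_on uhp" unfolding G_def
  proof (intro holomorphic_intros Vhol)
    show "fe holomorphic_on uhp" by (rule holomorphic_on_subset[OF hol]) (use \<epsilon> in auto)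
    show "V z \<notin> \<real>\<^sub>\<le>\<^sub>0" if "z \<in> uhp" for z
      using ReVd[of z] that \<delta> by (intro not_nonpos_Reals_Re_pos) auto
  qed
  have normG: "norm (G z) = norm (fe z) * norm (V z) powr (- (1 / q))" if "Im z > 0" for z
    unfolding G_def using norm_quotient_powr[OF Vne[OF that], of "fe z" "1 / q"] by simp
  have G1: "norm (G z) \<le> 1" if z: "Im z > 0" for z
  proof (rule maximum_principle_uhp[OF Ghol _ z])
    fix e' :: real assume e': "e' > 0"
    \<comment> \<open>The margin \<open>e'\<close> for \<open>G\<close> translated into a margin for
      \<open>\<bar>G\<bar> powr q\<close>.\<close>
    define e where "e = (1 + e') powr q - 1"
    have e: "e > 0" using e' q powr_less_mono2[of q 1 "1 + e'"] by (simp add: e_def)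
    define e1 where "e1 = e * \<delta> / 2"
    have e1: "e1 > 0" using e \<delta> by (simp add: e1_def)
    have key: "norm (G z) \<le> 1 + e'" if z: "Im z > 0" and le: "u z \<le> (1 + e) * Re (V z)" for z
    proof -
      have "u z \<le> (1 + e) * norm (V z)"
        by (rule order_trans[OF le], rule mult_left_mono[OF complex_Re_le_cmod]) (use e in simp)
      then have "u z powr (1 / q) \<le> ((1 + e) * norm (V z)) powr (1 / q)"
        using q by (intro powr_mono2) (auto simp: u_def)
      then have "norm (fe z) \<le> (1 + e') * norm (V z) powr (1 / q)"
        using q e' by (simp add: u_def powr_powr powr_mult e_def)
      then have "norm (fe z) * norm (V z) powr (- (1 / q)) \<le> (1 + e') * norm (V z) powr (1 / q) * norm (V z) powr (- (1 / q))"
        by (rule mult_right_mono) simp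
      also have "\<dots> = 1 + e'" using Vne[OF z] by (simp add: powr_minus)
      finally show ?thesis unfolding normG[OF z] .
    qed
    obtain \<eta>1 where \<eta>1: "\<eta>1 > 0" "\<And>x y. 0 < y \<Longrightarrow> y < \<eta>1 \<Longrightarrow> Re (W (Complex x y)) \<ge> h x - e1"
      using Re_W_boundary[OF e1] by blast
    have "uniformly_continuous_on (cbox (Complex (-R) 0) (Complex R 1)) u"
      by (rule compact_uniformly_continuous) (auto intro!: continuous_on_subset[OF ucont] simp: in_cbox_complex_iff)
    then obtain d where d: "d > 0" "\<And>z w. z \<in> cbox (Complex (-R) 0) (Complex R 1) \<Longrightarrow> w \<in> cbox (Complex (-R) 0) (Complex R 1) \<Longrightarrow> dist w z < d \<Longrightarrow> dist (u w) (u z) < e1"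
      unfolding uniformly_continuous_on_def using e1 by metis
    define \<eta> where "\<eta> = min \<eta>1 (min d 1)"
    have \<eta>: "\<eta> > 0" "\<eta> \<le> \<eta>1" "\<eta> \<le> d" "\<eta> \<le> 1" using \<eta>1 d by (auto simp: \<eta>_def)
    define S where "S = cball 0 R \<inter> {z. Im z \<ge> \<eta>}"
    have "compact S" unfolding S_def
      by (intro compact_Int_closed closed_halfspace_Im_ge compact_cball)
    moreover have "S \<subseteq> uhp" using \<eta> by (auto simp: S_def)
    moreover have "norm (G z) \<le> 1 + e'" if zS: "z \<in> uhp - S" for z
    proof (rule key)
      show z: "Im z > 0" using zS by simp
      show "u z \<le> (1 + e) * Re (V z)"
      proof (cases "norm z \<ge> R")
        case True
        have "u z \<le> 1 * \<delta>" using uR True z by simp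
        also have "\<dots> \<le> (1 + e) * Re (V z)" using ReVd[OF z] e \<delta> by (intro mult_mono) auto
        finally show ?thesis .
      next
        case False
        then have y: "Im z < \<eta>" using zS z by (auto simp: S_def)
        define z0 where "z0 = Complex (Re z) 0"
        have "\<bar>Re z\<bar> \<le> R" using abs_Re_le_cmod[of z] False by simp
        then have "z \<in> cbox (Complex (-R) 0) (Complex R 1)" "z0 \<in> cbox (Complex (-R) 0) (Complex R 1)"
          using z y \<eta> by (auto simp: in_cbox_complex_iff z0_def)
        moreover have "dist z z0 < d"
        proof -
          have "z - z0 = \<i> * of_real (Im z)" by (simp add: z0_def complex_eq_iff)
          then show ?thesis using y z \<eta> by (simp add: dist_norm norm_mult)
        qed
        ultimately have "dist (u z) (u z0) < e1" using d(2) by blast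
        then have "u z < u z0 + e1" by (simp add: dist_real_def abs_less_iff)
        also have "u z0 \<le> h (Re z) + \<delta>" by (simp add: h_def z0_def)
        also have "h (Re z) \<le> Re (W z) + e1" using \<eta>1(2)[of "Im z" "Re z"] z y \<eta> by simp
        finally have "u z \<le> Re (V z) + 2 * e1" using ReV[OF z] by simp
        also have "2 * e1 \<le> e * Re (V z)" using ReVd[OF z] e by (simp add: e1_def mult_left_mono)
        finally show ?thesis by (simp add: algebra_simps)
      qed
    qed
    ultimately show "\<exists>S. compact S \<and> S \<subseteq> uhp \<and> (\<forall>z\<in>uhp - S. norm (G z) \<le> 1 + e')" by blast
  qed
  show ?thesis
  proof (rule that[of W])
    fix z assume z: "Im z > 0"
    have "norm (fe z) * norm (V z) powr (- (1 / q)) * norm (V z) powr (1 / q) \<le> 1 * norm (V z) powr (1 / q)"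
      using G1[OF z] unfolding normG[OF z] by (rule mult_right_mono) simp
    then have "norm (fe z) \<le> norm (V z) powr (1 / q)"
      using Vne[OF z] by (simp add: mult.assoc powr_minus)
    then have "norm (fe z) powr q \<le> (norm (V z) powr (1 / q)) powr q" using q by (intro powr_mono2) auto
    then show "norm (f (z + \<i> * of_real \<epsilon>)) powr (p / 2) \<le> norm (W z + \<i> / (z + \<i>) + of_real \<delta>)"
      using q by (simp add: powr_powr q_def[symmetric] fe_def V_def)
  qed (use W_holomorphic Re_W_nonneg hardy2_W[OF h2 K] in auto)
qed

lemma hardy2_limit:
  assumes F: "\<And>n. hardy_upper 2 K (F n)" and lim: "\<And>z. Im z > 0 \<Longrightarrow> (\<lambda>n. F n z) \<longlonglongrightarrow> g z" and g: "g holomorphic_on uhp"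
  shows "hardy_upper 2 K g"
  unfolding hardy_upper_def
proof (intro conjI allI impI g)
  show "K \<ge> 0" using F by (auto simp: hardy_upper_def)
  fix y :: real assume y: "y > 0"
  have [measurable]: "(\<lambda>x. F n (Complex x y)) \<in> borel_measurable borel" for n
    using F y by (intro hardy_line_measurable) (auto simp: hardy_upper_def)
  have "ennreal ((norm (g (Complex x y)))\<^sup>2) = liminf (\<lambda>n. ennreal ((norm (F n (Complex x y)))\<^sup>2))" for x
    by (rule lim_imp_Liminf[symmetric]) (use lim[of "Complex x y"] y in \<open>auto intro!: tendsto_intros\<close>)
  then have "(L2_integral (\<lambda>x. g (Complex x y))) = (\<integral>\<^sup>+ x. liminf (\<lambda>n. ennreal ((norm (F n (Complex x y)))\<^sup>2)) \<partial>lborel)" by simp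
  also have "\<dots> \<le> liminf (\<lambda>n. L2_integral (\<lambda>x. F n (Complex x y)))"
    by (rule nn_integral_liminf) measurable
  also have "\<dots> \<le> liminf (\<lambda>n::nat. ennreal K)" by (rule Liminf_mono) (use hardy2_nn[OF F y] in auto)
  also have "\<dots> = ennreal K" by (simp add: Liminf_const)
  finally show "(Lp_integral 2 (\<lambda>x. g (Complex x y))) \<le> ennreal K" by simp
qed

lemma hardy2_add:
  assumes f: "hardy_upper 2 K f" and g: "hardy_upper 2 L g"
  shows "hardy_upper 2 (2 * K + 2 * L) (\<lambda>z. f z + g z)"
  unfolding hardy_upper_def
proof (intro conjI allI impI)
  have hol: "f holomorphic_on uhp" "g holomorphic_on uhp" and KL: "K \<ge> 0" "L \<ge> 0" using f g by (auto simp: hardy_upper_def)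
  show "(\<lambda>z. f z + g z) holomorphic_on uhp" by (intro holomorphic_intros hol)
  show "2 * K + 2 * L \<ge> 0" using KL by simp
  fix y :: real assume y: "y > 0"
  have [measurable]: "(\<lambda>x. f (Complex x y)) \<in> borel_measurable borel" "(\<lambda>x. g (Complex x y)) \<in> borel_measurable borel"
    using hol y by (auto intro: hardy_line_measurable)
  have sq: "(norm (a + b))\<^sup>2 \<le> 2 * (norm a)\<^sup>2 + 2 * (norm b)\<^sup>2" for a b :: complex
  proof -
    have "(norm (a + b))\<^sup>2 \<le> (norm a + norm b)\<^sup>2" by (intro power_mono norm_triangle_ineq) simp
    also have "\<dots> \<le> 2 * (norm a)\<^sup>2 + 2 * (norm b)\<^sup>2"
      using sum_squares_bound[of "norm a" "norm b"] by (simp add: power2_sum)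
    finally show ?thesis .
  qed
  have "(L2_integral (\<lambda>x. f (Complex x y) + g (Complex x y))) \<le>
     (\<integral>\<^sup>+ x. ennreal 2 * ennreal ((norm (f (Complex x y)))\<^sup>2) + ennreal 2 * ennreal ((norm (g (Complex x y)))\<^sup>2) \<partial>lborel)"
  proof (rule nn_integral_mono)
    fix x
    show "ennreal ((norm (f (Complex x y) + g (Complex x y)))\<^sup>2) \<le> ennreal 2 * ennreal ((norm (f (Complex x y)))\<^sup>2) + ennreal 2 * ennreal ((norm (g (Complex x y)))\<^sup>2)"
      using ennreal_leI[OF sq[of "f (Complex x y)" "g (Complex x y)"]] by (simp only: ennreal_plus ennreal_mult zero_le_power2 mult_nonneg_nonneg zero_le_numeral)
  qed
  also have "\<dots> = ennreal 2 * (L2_integral (\<lambda>x. f (Complex x y))) + ennreal 2 * (L2_integral (\<lambda>x. g (Complex x y)))"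
    by (simp add: nn_integral_add nn_integral_cmult)
  also have "\<dots> \<le> ennreal 2 * ennreal K + ennreal 2 * ennreal L"
    by (intro add_mono mult_left_mono hardy2_nn[OF f y] hardy2_nn[OF g y]) auto
  also have "\<dots> = ennreal (2 * K + 2 * L)" using KL by (simp add: ennreal_mult)
  finally show "(Lp_integral 2 (\<lambda>x. f (Complex x y) + g (Complex x y))) \<le> ennreal (2 * K + 2 * L)" by simp
qed

text \<open>Montel's theorem provides a limit of the majorants as the shift and the correction tend to zero.\<close>

lemma hardy_majorant:
  assumes p: "p > 0" and f: "hardy_upper p K f"
  obtains W L where "hardy_upper 2 L W" "\<And>z. Im z > 0 \<Longrightarrow> Re (W z) > 0"
    "\<And>z. Im z > 0 \<Longrightarrow> norm (f z) powr (p / 2) \<le> norm (W z)"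
proof -
  have hol: "f holomorphic_on uhp" and K: "K \<ge> 0" using f by (auto simp: hardy_upper_def)
  define d where "d n = 1 / real (Suc n)" for n
  have d: "d n > 0" for n by (simp add: d_def)
  have d0: "d \<longlonglongrightarrow> 0" unfolding d_def using LIMSEQ_inverse_real_of_nat by (simp add: inverse_eq_divide)
  have "\<exists>W. W holomorphic_on uhp \<and> (\<forall>z. Im z > 0 \<longrightarrow> Re (W z) \<ge> 0) \<and> hardy_upper 2 (2 * K) W \<and>
    (\<forall>z. Im z > 0 \<longrightarrow> norm (f (z + \<i> * of_real (d n))) powr (p / 2) \<le> norm (W z + \<i> / (z + \<i>) + of_real (d n)))" for n
    by (rule shifted_majorant[OF p f d d, of n n]) blast
  then obtain W where W: "\<And>n. W n holomorphic_on uhp" "\<And>n z. Im z > 0 \<Longrightarrow> Re (W n z) \<ge> 0" "\<And>n. hardy_upper 2 (2 * K) (W n)"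
    "\<And>n z. Im z > 0 \<Longrightarrow> norm (f (z + \<i> * of_real (d n))) powr (p / 2) \<le> norm (W n z + \<i> / (z + \<i>) + of_real (d n))"
    by metis
  have bdd: "\<exists>B. \<forall>h\<in>range W. \<forall>z\<in>S. norm (h z) \<le> B" if S: "compact S" "S \<subseteq> uhp" for S
  proof (cases "S = {}")
    case False
    obtain z0 where z0: "z0 \<in> S" "\<And>z. z \<in> S \<Longrightarrow> Im z0 \<le> Im z"
      using continuous_attains_inf[OF S(1) False, of Im] continuous_on_Im[OF continuous_on_id] by auto
    have e: "Im z0 > 0" using z0 S by auto
    define B where "B = sqrt (4 * mean_bound_const 2 * (2 * K) / Im z0)"
    have "norm (W n z) \<le> B" if "z \<in> S" for n z
    proof -
      have z: "Im z > 0" "Im z0 \<le> Im z" using that z0 S by auto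
      have "norm (W n z) powr 2 \<le> 4 * mean_bound_const 2 * (2 * K) / Im z" by (rule hardy_upper_bound[OF _ W(3) z(1)]) simp
      also have "\<dots> \<le> 4 * mean_bound_const 2 * (2 * K) / Im z0"
        using z e K mean_bound_const_pos[of 2] by (intro divide_left_mono) auto
      finally show ?thesis unfolding B_def by (intro real_le_rsqrt) simp
    qed
    then show ?thesis by blast
  qed auto
  obtain g r where gr: "g holomorphic_on uhp" "strict_mono (r :: nat \<Rightarrow> nat)" "\<And>z. z \<in> uhp \<Longrightarrow> (\<lambda>n. W (r n) z) \<longlonglongrightarrow> g z"
  proof (rule Montel[OF open_uhp, of "range W" W])
    show "h holomorphic_on uhp" if "h \<in> range W" for h using that W(1) by blast
    show "\<exists>B. \<forall>h\<in>range W. \<forall>z\<in>S. norm (h z) \<le> B" if "compact S" "S \<subseteq> uhp" for S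
      using that by (rule bdd)
  qed auto
  have g2: "hardy_upper 2 (2 * K) g"
    by (rule hardy2_limit[of _ "\<lambda>n. W (r n)"]) (use W(3) gr in auto)
  have gRe: "Re (g z) \<ge> 0" if "Im z > 0" for z
    by (rule LIMSEQ_le_const[OF tendsto_Re[OF gr(3)]]) (use that W(2) in auto)
  have dr: "(\<lambda>n. d (r n)) \<longlonglongrightarrow> 0" using LIMSEQ_subseq_LIMSEQ[OF d0 gr(2)] by (simp add: o_def)
  show ?thesis
  proof (rule that)
    show "hardy_upper 2 (2 * (2 * K) + 2 * pi) (\<lambda>z. g z + \<i> / (z + \<i>))"
      by (rule hardy2_add[OF g2 hardy2_reciprocal])
    fix z assume z: "Im z > 0"
    show "Re (g z + \<i> / (z + \<i>)) > 0" using gRe[OF z] Re_reciprocal_pos[OF z] by simp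
    show "norm (f z) powr (p / 2) \<le> norm (g z + \<i> / (z + \<i>))"
    proof (rule LIMSEQ_le)
      have "isCont f z" using hol z continuous_on_eq_continuous_at[OF open_uhp] holomorphic_on_imp_continuous_on by blast
      moreover have "(\<lambda>n. z + \<i> * of_real (d (r n))) \<longlonglongrightarrow> z + \<i> * of_real 0" by (intro tendsto_intros dr)
      ultimately have "(\<lambda>n. f (z + \<i> * of_real (d (r n)))) \<longlonglongrightarrow> f z"
        using isCont_tendsto_compose by fastforce
      then show "(\<lambda>n. norm (f (z + \<i> * of_real (d (r n)))) powr (p / 2)) \<longlonglongrightarrow> norm (f z) powr (p / 2)"
        using p by (intro tendsto_powr' tendsto_intros) auto
      have "(\<lambda>n. norm (W (r n) z + \<i> / (z + \<i>) + of_real (d (r n)))) \<longlonglongrightarrow> norm (g z + \<i> / (z + \<i>) + of_real 0)"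
        by (intro tendsto_intros gr dr) (use z in auto)
      then show "(\<lambda>n. norm (W (r n) z + \<i> / (z + \<i>) + of_real (d (r n)))) \<longlonglongrightarrow> norm (g z + \<i> / (z + \<i>))" by simp
    qed (use W(4) z in auto)
  qed
qed

section \<open>Boundary values in the upper half-plane\<close>

lemma nontangential_limit_vertical:
  assumes "nontangential_limit f x l" "\<And>n::nat. y n > 0" "y \<longlonglongrightarrow> 0"
  shows "(\<lambda>n. f (Complex x (y n))) \<longlonglongrightarrow> l"
proof -
  have lim: "(f \<longlongrightarrow> l) (at (Complex x 0) within nt_cone 1 x)"
    using assms(1) by (simp add: nontangential_limit_def)
  have "(\<lambda>n. Complex x (y n)) \<longlonglongrightarrow> Complex x 0" by (intro tendsto_intros assms)
  then have "filterlim (\<lambda>n. Complex x (y n)) (at (Complex x 0) within nt_cone 1 x) sequentially"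
    using assms(2) by (auto simp: filterlim_at nt_cone_def less_imp_neq[symmetric])
  from filterlim_compose[OF lim this] show ?thesis .
qed

text \<open>The limit is taken along one sequence, which makes the boundary function measurable.\<close>

definition boundary_value :: "(complex \<Rightarrow> complex) \<Rightarrow> real \<Rightarrow> complex" where
  "boundary_value f x = lim (\<lambda>n. f (Complex x (1 / real (Suc n))))"

lemma inverse_Suc_tendsto: "(\<lambda>n. 1 / real (Suc n)) \<longlonglongrightarrow> 0"
  using LIMSEQ_inverse_real_of_nat by (simp add: inverse_eq_divide)

lemma boundary_value_eq:
  assumes "nontangential_limit f x l"
  shows "boundary_value f x = l"
  unfolding boundary_value_def
  by (rule limI, rule nontangential_limit_vertical[OF assms _ inverse_Suc_tendsto]) simp

lemma boundary_value_measurable: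
  assumes "f holomorphic_on uhp"
  shows "boundary_value f \<in> borel_measurable borel"
  unfolding boundary_value_def
  by (rule borel_measurable_lim_metric, rule hardy_line_measurable[OF assms]) simp

text \<open>Fatou's lemma turns the Cauchy property into convergence, once the limit is known to exist
  almost everywhere.\<close>

lemma hardy2_boundary_L2:
  assumes f: "hardy_upper 2 K f" and e: "e > 0"
  obtains \<eta> where "\<eta> > 0" "\<And>y. 0 < y \<Longrightarrow> y \<le> \<eta> \<Longrightarrow>
    (L2_integral (\<lambda>x. f (Complex x y) - boundary_value f x)) \<le> ennreal e"
proof -
  have hol: "f holomorphic_on uhp" using f by (simp add: hardy_upper_def)
  obtain \<eta> where \<eta>: "\<eta> > 0" "\<And>a b. 0 < a \<Longrightarrow> a \<le> \<eta> \<Longrightarrow> 0 < b \<Longrightarrow> b \<le> \<eta> \<Longrightarrow> 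
      (L2_integral (\<lambda>x. f (Complex x a) - f (Complex x b))) \<le> ennreal e"
    by (rule hardy2_cauchy[OF f e]) blast
  obtain N where N: "1 / real (Suc N) < \<eta>" using nat_approx_posE[OF \<eta>(1)] by blast
  define t where "t n = 1 / real (Suc (n + N))" for n
  have t: "t n > 0" "t n \<le> \<eta>" for n
  proof -
    show "t n > 0" by (simp add: t_def)
    have "t n \<le> 1 / real (Suc N)" unfolding t_def by (intro divide_left_mono) auto
    then show "t n \<le> \<eta>" using N by simp
  qed
  have t0: "t \<longlonglongrightarrow> 0" unfolding t_def using LIMSEQ_ignore_initial_segment[OF inverse_Suc_tendsto, of N] by simp
  show ?thesis
  proof (rule that[OF \<eta>(1)])
    fix y assume y: "0 < y" "y \<le> \<eta>"
    have [measurable]: "(\<lambda>x. f (Complex x a)) \<in> borel_measurable borel" if "a > 0" for a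
      using hol that by (rule hardy_line_measurable)
    have "(L2_integral (\<lambda>x. f (Complex x y) - boundary_value f x)) =
      (\<integral>\<^sup>+ x. liminf (\<lambda>n. ennreal ((norm (f (Complex x y) - f (Complex x (t n))))\<^sup>2)) \<partial>lborel)"
    proof (rule nn_integral_cong_AE)
      show "AE x in lborel. ennreal ((norm (f (Complex x y) - boundary_value f x))\<^sup>2) =
         liminf (\<lambda>n. ennreal ((norm (f (Complex x y) - f (Complex x (t n))))\<^sup>2))"
        using hardy2_nontangential_limit[OF f]
      proof eventually_elim
        case (elim x)
        then obtain l where l: "nontangential_limit f x l" by blast
        have "(\<lambda>n. f (Complex x (t n))) \<longlonglongrightarrow> boundary_value f x"
          unfolding boundary_value_eq[OF l] by (rule nontangential_limit_vertical[OF l t(1) t0])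
        then have "(\<lambda>n. ennreal ((norm (f (Complex x y) - f (Complex x (t n))))\<^sup>2)) \<longlonglongrightarrow> ennreal ((norm (f (Complex x y) - boundary_value f x))\<^sup>2)"
          by (intro tendsto_intros)
        then show ?case using lim_imp_Liminf[OF sequentially_bot] by metis
      qed
    qed
    also have "\<dots> \<le> liminf (\<lambda>n. L2_integral (\<lambda>x. f (Complex x y) - f (Complex x (t n))))"
      by (rule nn_integral_liminf) (use y t in measurable)
    also have "\<dots> \<le> liminf (\<lambda>n::nat. ennreal e)"
      by (rule Liminf_mono) (use \<eta>(2)[OF y t] in auto)
    also have "\<dots> = ennreal e" by (simp add: Liminf_const)
    finally show "(L2_integral (\<lambda>x. f (Complex x y) - boundary_value f x)) \<le> ennreal e" .
  qed
qed

text \<open>The limit \<open>m\<close> of \<open>W\<close> has nonnegative real part. Where \<open>m\<close>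
  is nonzero, the logarithm is continuous at \<open>m\<close>; where it is zero, \<open>f\<close>
  tends to zero because \<open>\<bar>f\<bar> \<le> \<bar>W\<bar> powr r\<close>.\<close>

lemma nontangential_limit_from_majorant:
  assumes W: "nontangential_limit W x m" and g: "nontangential_limit g x l" and r: "r > 0"
    and ReW: "\<And>z. Im z > 0 \<Longrightarrow> Re (W z) > 0"
    and fg: "\<And>z. Im z > 0 \<Longrightarrow> f z = g z * exp (of_real r * Ln (W z))"
    and le: "\<And>z. Im z > 0 \<Longrightarrow> norm (f z) \<le> norm (W z) powr r"
  shows "\<exists>l. nontangential_limit f x l"
proof (cases "m = 0")
  case True
  have "nontangential_limit f x 0"
    unfolding nontangential_limit_def
  proof (intro allI impI)
    fix \<alpha> :: real assume \<alpha>: "\<alpha> > 0"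
    have ev: "\<forall>\<^sub>F z in at (Complex x 0) within nt_cone \<alpha> x. z \<in> nt_cone \<alpha> x" by (simp add: eventually_at_filter)
    have "(W \<longlongrightarrow> 0) (at (Complex x 0) within nt_cone \<alpha> x)" using W True \<alpha> by (simp add: nontangential_limit_def)
    then have "((\<lambda>z. norm (W z) powr r) \<longlongrightarrow> norm (0::complex) powr r) (at (Complex x 0) within nt_cone \<alpha> x)"
      using r by (intro tendsto_powr' tendsto_intros) auto
    then have "((\<lambda>z. norm (W z) powr r) \<longlongrightarrow> 0) (at (Complex x 0) within nt_cone \<alpha> x)" by simp
    then show "(f \<longlongrightarrow> 0) (at (Complex x 0) within nt_cone \<alpha> x)"
      by (rule Lim_null_comparison[rotated])
        (rule eventually_mono[OF ev], use le nt_cone_Im_pos[OF _ \<alpha>] in blast)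
  qed
  then show ?thesis by blast
next
  case False
  have "(\<lambda>n. W (Complex x (1 / real (Suc n)))) \<longlonglongrightarrow> m"
    by (rule nontangential_limit_vertical[OF W _ inverse_Suc_tendsto]) simp
  then have "Re m \<ge> 0"
    by (rule LIMSEQ_le_const[OF tendsto_Re]) (use ReW in \<open>auto intro!: exI[of _ 0] less_imp_le\<close>)
  then have m: "m \<notin> \<real>\<^sub>\<le>\<^sub>0" using False by (auto simp: complex_nonpos_Reals_iff complex_eq_iff)
  have "nontangential_limit f x (l * exp (of_real r * Ln m))"
    by (rule nontangential_limit_transform[where g = "\<lambda>z. g z * exp (of_real r * Ln (W z))"])
      (use W g m fg in \<open>auto simp: nontangential_limit_def intro!: tendsto_intros tendsto_Ln\<close>)
  then show ?thesis by blast
qed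

lemma norm_diff_powr_le:
  fixes a b :: complex
  assumes "p > 0"
  shows "norm (a - b) powr p \<le> 2 powr p * (norm a powr p + norm b powr p)"
proof -
  define m where "m = max (norm a) (norm b)"
  have "norm (a - b) \<le> 2 * m" using norm_triangle_ineq4[of a b] by (simp add: m_def)
  then have "norm (a - b) powr p \<le> (2 * m) powr p" using assms by (intro powr_mono2) auto
  also have "\<dots> = 2 powr p * m powr p" by (rule powr_mult) 
  also have "m powr p \<le> norm a powr p + norm b powr p" by (simp add: m_def max_def)
  finally show ?thesis by simp
qed

text \<open>With \<open>\<bar>W\<bar> powr (2/p)\<close> dividing out all growth of \<open>f\<close>, the
  quotient is bounded. Its limits and those of \<open>W\<close> give the limits of
  \<open>f\<close>. For convergence in \<open>L\<^sup>p\<close>, the majorants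
  \<open>\<bar>W\<bar>\<^sup>2\<close> vary with the height but converge in
  \<open>L\<^sup>1\<close>, so dominated convergence applies after subtraction of their distance
  to the limit.\<close>

lemma hardy_upper_boundary:
  assumes p: "p > 0" and f: "hardy_upper p K f"
  defines "f0 \<equiv> boundary_value f"
  shows "AE x in lborel. nontangential_limit f x (f0 x)"
    and "f0 \<in> borel_measurable borel"
    and "(Lp_integral p (\<lambda>x. f0 x)) \<le> ennreal K"
    and "((\<lambda>y. Lp_integral p (\<lambda>x. f (Complex x y) - f0 x)) \<longlongrightarrow> 0) (at_right 0)"
proof -
  have hol: "f holomorphic_on uhp" using f by (simp add: hardy_upper_def)
  obtain W L where W: "hardy_upper 2 L W" and ReW: "\<And>z. Im z > 0 \<Longrightarrow> Re (W z) > 0"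
    and le: "\<And>z. Im z > 0 \<Longrightarrow> norm (f z) powr (p / 2) \<le> norm (W z)"
    by (rule hardy_majorant[OF p f]) blast
  have Whol: "W holomorphic_on uhp" and L: "L \<ge> 0" using W by (auto simp: hardy_upper_def)
  have Wne: "W z \<noteq> 0" if "Im z > 0" for z using ReW[OF that] by auto
  define r where "r = 2 / p"
  have r: "r > 0" using p by (simp add: r_def)
  have le': "norm (f z) \<le> norm (W z) powr r" if "Im z > 0" for z
  proof -
    have "(norm (f z) powr (p / 2)) powr r \<le> norm (W z) powr r" using le[OF that] r by (intro powr_mono2) auto
    then show ?thesis using p by (simp add: powr_powr r_def)
  qed
  have leW2: "norm (f z) powr p \<le> (norm (W z))\<^sup>2" if "Im z > 0" for z
  proof -
    have "(norm (f z) powr (p / 2))\<^sup>2 \<le> (norm (W z))\<^sup>2" using le[OF that] by (intro power_mono) auto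
    then show ?thesis by (simp add: power2_eq_square flip: powr_add)
  qed
  define g where "g z = f z * exp (- of_real r * Ln (W z))" for z
  have g1: "norm (g z) \<le> 1" if "Im z > 0" for z
  proof -
    have "norm (g z) = norm (f z) * norm (W z) powr (- r)" unfolding g_def by (rule norm_quotient_powr[OF Wne[OF that]])
    also have "\<dots> \<le> norm (W z) powr r * norm (W z) powr (- r)" by (intro mult_right_mono le' that) simp
    also have "\<dots> = 1" using Wne[OF that] by (simp add: powr_minus)
    finally show ?thesis .
  qed
  have ghol: "g holomorphic_on uhp" unfolding g_def
    by (intro holomorphic_intros hol Whol not_nonpos_Reals_Re_pos) (use ReW in auto)
  have fg: "f z = g z * exp (of_real r * Ln (W z))" for z
    by (simp add: g_def mult.assoc flip: exp_add)
  have ntg: "AE x in lborel. \<exists>l. nontangential_limit g x l"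
    by (rule bounded_nontangential_limit[OF ghol]) (rule g1)
  show nt: "AE x in lborel. nontangential_limit f x (f0 x)"
    using ntg hardy2_nontangential_limit[OF W]
  proof eventually_elim
    case (elim x)
    then obtain l m where lm: "nontangential_limit g x l" "nontangential_limit W x m" by blast
    have "\<exists>l. nontangential_limit f x l"
      by (rule nontangential_limit_from_majorant[OF lm(2,1) r ReW fg le'])
    then show ?case unfolding f0_def using boundary_value_eq by blast
  qed
  show f0m: "f0 \<in> borel_measurable borel" unfolding f0_def by (rule boundary_value_measurable[OF hol])
  define W0 where "W0 = boundary_value W"
  have W0m: "W0 \<in> borel_measurable borel" unfolding W0_def by (rule boundary_value_measurable[OF Whol])
  note [measurable] = f0m W0m
  have lm[measurable]: "(\<lambda>x. f (Complex x y)) \<in> borel_measurable borel" "(\<lambda>x. W (Complex x y)) \<in> borel_measurable borel" if "y > 0" for y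
    using hardy_line_measurable[OF hol that] hardy_line_measurable[OF Whol that] .
  have lims: "AE x in lborel. (\<forall>y. (\<forall>n::nat. y n > 0) \<longrightarrow> y \<longlonglongrightarrow> 0 \<longrightarrow> (\<lambda>n. f (Complex x (y n))) \<longlonglongrightarrow> f0 x \<and> (\<lambda>n. W (Complex x (y n))) \<longlonglongrightarrow> W0 x)"
    using nt hardy2_nontangential_limit[OF W]
  proof eventually_elim
    case (elim x)
    then obtain m where m: "nontangential_limit W x m" by blast
    then have "nontangential_limit W x (W0 x)" by (simp add: W0_def boundary_value_eq)
    then show ?case using elim(1) nontangential_limit_vertical by blast
  qed
  define t where "t n = 1 / real (Suc n)" for n
  have t: "t n > 0" "t \<longlonglongrightarrow> 0" for n unfolding t_def using inverse_Suc_tendsto by auto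
  show "(Lp_integral p (\<lambda>x. f0 x)) \<le> ennreal K"
  proof -
    have "(Lp_integral p (\<lambda>x. f0 x)) = (\<integral>\<^sup>+ x. liminf (\<lambda>n. ennreal (norm (f (Complex x (t n))) powr p)) \<partial>lborel)"
    proof (rule nn_integral_cong_AE)
      show "AE x in lborel. ennreal (norm (f0 x) powr p) = liminf (\<lambda>n. ennreal (norm (f (Complex x (t n))) powr p))"
        using lims
      proof eventually_elim
        case (elim x)
        then have "(\<lambda>n. f (Complex x (t n))) \<longlonglongrightarrow> f0 x" using t by blast
        then have "(\<lambda>n. ennreal (norm (f (Complex x (t n))) powr p)) \<longlonglongrightarrow> ennreal (norm (f0 x) powr p)"
          using p by (intro tendsto_ennrealI tendsto_powr' tendsto_intros) auto
        then show ?case using lim_imp_Liminf[OF sequentially_bot] by metis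
      qed
    qed
    also have "\<dots> \<le> liminf (\<lambda>n. Lp_integral p (\<lambda>x. f (Complex x (t n))))"
      by (rule nn_integral_liminf) (use t in measurable)
    also have "\<dots> \<le> liminf (\<lambda>n::nat. ennreal K)"
      by (rule Liminf_mono) (use f t in \<open>auto simp: hardy_upper_def\<close>)
    also have "\<dots> = ennreal K" by (simp add: Liminf_const)
    finally show ?thesis .
  qed
  define D where "D x = (norm (W0 x))\<^sup>2" for x
  have WL2: "\<exists>\<eta>>0. \<forall>y. 0 < y \<and> y \<le> \<eta> \<longrightarrow> (L2_integral (\<lambda>x. W (Complex x y) - W0 x)) \<le> ennreal e" if "e > 0" for e
    unfolding W0_def by (rule hardy2_boundary_L2[OF W that]) blast
  have sq: "(norm a)\<^sup>2 \<le> 2 * (norm (a - b))\<^sup>2 + 2 * (norm b)\<^sup>2" for a b :: complex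
  proof -
    have "(norm a)\<^sup>2 \<le> (norm (a - b) + norm b)\<^sup>2" using norm_triangle_ineq[of "a - b" b] by (intro power_mono) auto
    also have "\<dots> \<le> 2 * (norm (a - b))\<^sup>2 + 2 * (norm b)\<^sup>2"
      using sum_squares_bound[of "norm (a - b)" "norm b"] by (simp add: power2_sum)
    finally show ?thesis .
  qed
  have Dfin: "(\<integral>\<^sup>+ x. ennreal (D x) \<partial>lborel) < \<infinity>"
  proof -
    obtain y where y: "y > 0" "(L2_integral (\<lambda>x. W (Complex x y) - W0 x)) \<le> ennreal 1"
      using WL2[of 1] by force
    have "(\<integral>\<^sup>+ x. ennreal (D x) \<partial>lborel) \<le> (\<integral>\<^sup>+ x. 2 * ennreal ((norm (W (Complex x y) - W0 x))\<^sup>2) + 2 * ennreal ((norm (W (Complex x y)))\<^sup>2) \<partial>lborel)"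
    proof (rule nn_integral_mono)
      fix x
      have "D x \<le> 2 * (norm (W (Complex x y) - W0 x))\<^sup>2 + 2 * (norm (W (Complex x y)))\<^sup>2"
        unfolding D_def using sq[of "W0 x" "W (Complex x y)"] by (simp add: norm_minus_commute)
      from ennreal_leI[OF this] show "ennreal (D x) \<le> 2 * ennreal ((norm (W (Complex x y) - W0 x))\<^sup>2) + 2 * ennreal ((norm (W (Complex x y)))\<^sup>2)"
        by (simp add: ennreal_mult)
    qed
    also have "\<dots> = 2 * (L2_integral (\<lambda>x. W (Complex x y) - W0 x)) + 2 * (L2_integral (\<lambda>x. W (Complex x y)))"
      using y by (simp add: nn_integral_add nn_integral_cmult)
    also have "\<dots> \<le> 2 * ennreal 1 + 2 * ennreal L"
      by (intro add_mono mult_left_mono y hardy2_nn[OF W y(1)]) auto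
    also have "\<dots> < \<infinity>" by (simp add: ennreal_mult_less_top)
    finally show ?thesis .
  qed
  \<comment> \<open>The factor \<open>2 powr p\<close> is from the triangle inequality; \<open>3\<close> is from
    \<open>\<bar>W\<bar>\<^sup>2 + D \<le> 2 A + 3 D\<close>.\<close>
  define c where "c = 3 * 2 powr p"
  have c: "c > 0" by (simp add: c_def)
  show "((\<lambda>y. Lp_integral p (\<lambda>x. f (Complex x y) - f0 x)) \<longlongrightarrow> 0) (at_right 0)"
  proof (rule tendsto_at_right_sequentially[of 0 "1::real"])
    fix y :: "nat \<Rightarrow> real" assume y: "\<And>n. 0 < y n" "y \<longlonglongrightarrow> 0"
    note [measurable] = lm[OF y(1)]
    define \<psi> where "\<psi> n x = norm (f (Complex x (y n)) - f0 x) powr p" for n x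
    define A where "A n x = (norm (W (Complex x (y n)) - W0 x))\<^sup>2" for n x
    have Am[measurable]: "A n \<in> borel_measurable borel" and \<psi>m[measurable]: "\<psi> n \<in> borel_measurable borel"
      and Dm[measurable]: "D \<in> borel_measurable borel" for n
      unfolding A_def \<psi>_def D_def by measurable
    have A0: "A n x \<ge> 0" and D0: "D x \<ge> 0" and \<psi>0: "\<psi> n x \<ge> 0" for n x by (auto simp: A_def D_def \<psi>_def)
    \<comment> \<open>The part of the error that is not controlled by the \<open>L\<^sup>2\<close> distance
      \<open>A\<close>; it is dominated by a fixed function.\<close>
    define \<theta> where "\<theta> n x = max (\<psi> n x - c * A n x) 0" for n x
    have \<theta>m[measurable]: "\<theta> n \<in> borel_measurable borel" for n unfolding \<theta>_def by measurable
    have dom: "AE x in lborel. ennreal (\<theta> n x) \<le> ennreal (c * D x)" for n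
      using lims
    proof eventually_elim
      case (elim x)
      then have l: "(\<lambda>n. f (Complex x (y n))) \<longlonglongrightarrow> f0 x" "(\<lambda>n. W (Complex x (y n))) \<longlonglongrightarrow> W0 x"
        using y by blast+
      have "norm (f0 x) powr p \<le> (norm (W0 x))\<^sup>2"
      proof (rule LIMSEQ_le)
        show "(\<lambda>n. norm (f (Complex x (y n))) powr p) \<longlonglongrightarrow> norm (f0 x) powr p"
          using p by (intro tendsto_powr' tendsto_intros l) auto
        show "(\<lambda>n. (norm (W (Complex x (y n))))\<^sup>2) \<longlonglongrightarrow> (norm (W0 x))\<^sup>2"
          by (intro tendsto_intros l)
      qed (use leW2 y(1) in auto)
      moreover have "norm (f (Complex x (y n))) powr p \<le> (norm (W (Complex x (y n))))\<^sup>2" using leW2 y(1) by simp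
      ultimately have "\<psi> n x \<le> 2 powr p * ((norm (W (Complex x (y n))))\<^sup>2 + D x)"
        unfolding \<psi>_def D_def
        by (intro order_trans[OF norm_diff_powr_le[OF p]] mult_left_mono add_mono) auto
      also have "\<dots> \<le> 2 powr p * (3 * A n x + 3 * D x)"
      proof (rule mult_left_mono)
        have "(norm (W (Complex x (y n))))\<^sup>2 \<le> 2 * A n x + 2 * D x"
          using sq[of "W (Complex x (y n))" "W0 x"] by (simp add: A_def D_def)
        then show "(norm (W (Complex x (y n))))\<^sup>2 + D x \<le> 3 * A n x + 3 * D x"
          using A0[of n x] by linarith
      qed simp
      finally have "\<psi> n x \<le> c * A n x + c * D x" by (simp add: c_def algebra_simps)
      then show ?case using c D0[of x] by (intro ennreal_leI) (simp add: \<theta>_def)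
    qed
    have "(\<lambda>n. \<integral>\<^sup>+ x. ennreal (\<theta> n x) \<partial>lborel) \<longlonglongrightarrow> (\<integral>\<^sup>+ x. 0 \<partial>(lborel :: real measure))"
    proof (rule nn_integral_dominated_convergence[where w = "\<lambda>x. ennreal (c * D x)"])
      show "(\<integral>\<^sup>+ x. ennreal (c * D x) \<partial>lborel) < \<infinity>"
        using Dfin c by (simp add: ennreal_mult D0 nn_integral_cmult ennreal_mult_less_top)
      show "AE x in lborel. (\<lambda>n. ennreal (\<theta> n x)) \<longlonglongrightarrow> 0"
        using lims
      proof eventually_elim
        case (elim x)
        then have "(\<lambda>n. f (Complex x (y n))) \<longlonglongrightarrow> f0 x" using y by blast
        then have "(\<lambda>n. \<psi> n x) \<longlonglongrightarrow> norm (f0 x - f0 x) powr p"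
          unfolding \<psi>_def using p by (intro tendsto_powr' tendsto_intros) auto
        then have \<psi>lim: "(\<lambda>n. \<psi> n x) \<longlonglongrightarrow> 0" by simp
        have "(\<lambda>n. \<theta> n x) \<longlonglongrightarrow> 0"
        proof (rule tendsto_sandwich[OF _ _ tendsto_const \<psi>lim])
          show "\<forall>\<^sub>F n in sequentially. 0 \<le> \<theta> n x" by (simp add: \<theta>_def)
          have "\<theta> n x \<le> \<psi> n x" for n using A0[of n x] \<psi>0[of n x] c by (simp add: \<theta>_def)
          then show "\<forall>\<^sub>F n in sequentially. \<theta> n x \<le> \<psi> n x" by simp
        qed
        then show ?case using tendsto_ennrealI by fastforce
      qed
    qed (use dom in auto)
    then have \<theta>lim: "(\<lambda>n. \<integral>\<^sup>+ x. ennreal (\<theta> n x) \<partial>lborel) \<longlonglongrightarrow> 0" by simp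
    have Alim: "(\<lambda>n. \<integral>\<^sup>+ x. ennreal (A n x) \<partial>lborel) \<longlonglongrightarrow> 0"
    proof (rule order_tendstoI)
      fix a :: ennreal assume a: "0 < a"
      obtain e where e: "0 < e" "ennreal e < a"
      proof -
        obtain b where b: "0 < b" "b < a" using dense[OF a] by blast
        have "b < top" using b(2) by (rule less_le_trans) simp
        then obtain e where "b = ennreal e" "e \<ge> 0" by (cases b) auto
        then show thesis using b by (intro that[of e]) auto
      qed
      obtain \<eta> where \<eta>: "\<eta> > 0" "\<And>y. 0 < y \<Longrightarrow> y \<le> \<eta> \<Longrightarrow> (L2_integral (\<lambda>x. W (Complex x y) - W0 x)) \<le> ennreal e"
        using WL2[OF e(1)] by blast
      have "\<forall>\<^sub>F n in sequentially. y n < \<eta>" using order_tendstoD(2)[OF y(2) \<eta>(1)] .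
      then show "\<forall>\<^sub>F n in sequentially. (\<integral>\<^sup>+ x. ennreal (A n x) \<partial>lborel) < a"
      proof eventually_elim
        case (elim n)
        have "(\<integral>\<^sup>+ x. ennreal (A n x) \<partial>lborel) \<le> ennreal e" unfolding A_def using \<eta>(2)[OF y(1)] elim by simp
        then show ?case using e(2) by (rule le_less_trans)
      qed
    qed simp
    have "(\<lambda>n. (\<integral>\<^sup>+ x. ennreal (\<theta> n x) \<partial>lborel) + ennreal c * (\<integral>\<^sup>+ x. ennreal (A n x) \<partial>lborel)) \<longlonglongrightarrow> 0 + ennreal c * 0"
      by (intro tendsto_add \<theta>lim ennreal_tendsto_cmult Alim) simp
    then have lim0: "(\<lambda>n. (\<integral>\<^sup>+ x. ennreal (\<theta> n x) \<partial>lborel) + ennreal c * (\<integral>\<^sup>+ x. ennreal (A n x) \<partial>lborel)) \<longlonglongrightarrow> 0" by simp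
    have "(\<integral>\<^sup>+ x. ennreal (\<psi> n x) \<partial>lborel) \<le> (\<integral>\<^sup>+ x. ennreal (\<theta> n x) \<partial>lborel) + ennreal c * (\<integral>\<^sup>+ x. ennreal (A n x) \<partial>lborel)" for n
    proof -
      have "(\<integral>\<^sup>+ x. ennreal (\<psi> n x) \<partial>lborel) \<le> (\<integral>\<^sup>+ x. ennreal (\<theta> n x) + ennreal c * ennreal (A n x) \<partial>lborel)"
      proof (rule nn_integral_mono)
        fix x
        have "\<psi> n x \<le> \<theta> n x + c * A n x" by (simp add: \<theta>_def max_def)
        from ennreal_leI[OF this] show "ennreal (\<psi> n x) \<le> ennreal (\<theta> n x) + ennreal c * ennreal (A n x)"
          using c A0 by (simp add: \<theta>_def ennreal_mult)
      qed
      also have "\<dots> = (\<integral>\<^sup>+ x. ennreal (\<theta> n x) \<partial>lborel) + ennreal c * (\<integral>\<^sup>+ x. ennreal (A n x) \<partial>lborel)"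
        by (simp add: nn_integral_add nn_integral_cmult)
      finally show ?thesis .
    qed
    then have "(\<lambda>n. \<integral>\<^sup>+ x. ennreal (\<psi> n x) \<partial>lborel) \<longlonglongrightarrow> 0"
      by (intro tendsto_sandwich[OF _ _ tendsto_const lim0]) auto
    then show "(\<lambda>n. Lp_integral p (\<lambda>x. f (Complex x (y n)) - f0 x)) \<longlonglongrightarrow> 0"
      by (simp add: \<psi>_def)
  qed simp
qed

section \<open>Truncation and pairing with kernels\<close>

lemma nn_integral_exhaust:
  fixes g :: "real \<Rightarrow> ennreal"
  assumes [measurable]: "g \<in> borel_measurable borel" and A: "incseq A" "\<And>n::nat. A n \<in> sets borel" "(\<Union>n. A n) = UNIV"
    and le: "\<And>n. (\<integral>\<^sup>+ x. g x * indicator (A n) x \<partial>lborel) \<le> K"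
  shows "(\<integral>\<^sup>+ x. g x \<partial>lborel) \<le> K"
proof -
  have "(\<integral>\<^sup>+ x. g x \<partial>lborel) = emeasure (density lborel g) (\<Union>n. A n)"
    unfolding A(3) by (subst emeasure_density) auto
  also have "\<dots> = (SUP n. emeasure (density lborel g) (A n))"
    by (rule SUP_emeasure_incseq[symmetric]) (use A in auto)
  also have "\<dots> \<le> K"
    by (intro SUP_least) (use le A in \<open>simp add: emeasure_density\<close>)
  finally show ?thesis .
qed

text \<open>On \<open>A\<close> the difference is \<open>G \<tau> - g\<close>; on \<open>A\<^sub>\<tau> -
  A\<close>, a set that shrinks to nothing, it is \<open>G \<tau>\<close>, which is close to
  \<open>g\<close> in \<open>L\<^sup>p\<close>.\<close>

lemma Lp_truncate:
  fixes G :: "real \<Rightarrow> real \<Rightarrow> complex"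
  assumes p: "p > 0" and G: "\<And>\<tau>. \<tau> > 0 \<Longrightarrow> G \<tau> \<in> borel_measurable borel" and g[measurable]: "g \<in> borel_measurable borel"
    and lim: "((\<lambda>\<tau>. Lp_integral p (\<lambda>x. G \<tau> x - g x)) \<longlongrightarrow> 0) (at_right 0)"
    and fin: "(Lp_integral p (\<lambda>x. g x)) < \<infinity>"
    and A[measurable]: "A \<in> sets borel" "\<And>\<tau>. A' \<tau> \<in> sets borel" and sub: "\<And>\<tau>. \<tau> > 0 \<Longrightarrow> A \<subseteq> A' \<tau>"
    and ev: "\<And>x. x \<notin> A \<Longrightarrow> \<forall>\<^sub>F \<tau> in at_right 0. x \<notin> A' \<tau>"
  shows "((\<lambda>\<tau>. Lp_integral p (\<lambda>x. indicator (A' \<tau>) x *\<^sub>R G \<tau> x - indicator A x *\<^sub>R g x)) \<longlongrightarrow> 0) (at_right 0)"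
proof -
  have tail: "((\<lambda>\<tau>. \<integral>\<^sup>+ x. ennreal (norm (g x) powr p) * indicator (A' \<tau> - A) x \<partial>lborel) \<longlongrightarrow> 0) (at_right 0)"
  proof (rule tendsto_at_right_sequentially[of 0 "1::real"])
    fix S :: "nat \<Rightarrow> real" assume S: "\<And>n. 0 < S n" "S \<longlonglongrightarrow> 0"
    have "(\<lambda>n. \<integral>\<^sup>+ x. ennreal (norm (g x) powr p) * indicator (A' (S n) - A) x \<partial>lborel) \<longlonglongrightarrow> (\<integral>\<^sup>+ x. 0 \<partial>(lborel :: real measure))"
    proof (rule nn_integral_dominated_convergence[where w = "\<lambda>x. ennreal (norm (g x) powr p)"])
      show "AE x in lborel. (\<lambda>n. ennreal (norm (g x) powr p) * indicator (A' (S n) - A) x) \<longlonglongrightarrow> 0"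
      proof (rule AE_I2)
        fix x :: real
        have "\<forall>\<^sub>F n in sequentially. x \<notin> A' (S n) - A"
        proof (cases "x \<in> A")
          case False
          have "filterlim S (at_right 0) sequentially"
            using S by (auto simp: filterlim_at less_imp_neq[symmetric])
          from eventually_compose_filterlim[OF ev[OF False] this] show ?thesis by (rule eventually_mono) auto
        qed simp
        then have "\<forall>\<^sub>F n in sequentially. ennreal (norm (g x) powr p) * indicator (A' (S n) - A) x = 0"
          by (rule eventually_mono) simp
        then show "(\<lambda>n. ennreal (norm (g x) powr p) * indicator (A' (S n) - A) x) \<longlonglongrightarrow> 0" by (rule tendsto_eventually)
      qed
      show "\<And>j. (\<lambda>x. ennreal (norm (g x) powr p) * indicator (A' (S j) - A) x) \<in> borel_measurable lborel" by measurable
    qed (use fin in \<open>auto simp: indicator_def\<close>)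
    then show "(\<lambda>n. \<integral>\<^sup>+ x. ennreal (norm (g x) powr p) * indicator (A' (S n) - A) x \<partial>lborel) \<longlonglongrightarrow> 0" by simp
  qed simp
  have sum0: "((\<lambda>\<tau>. ennreal (2 powr p) * (Lp_integral p (\<lambda>x. G \<tau> x - g x)) + ennreal (2 powr p) * (\<integral>\<^sup>+ x. ennreal (norm (g x) powr p) * indicator (A' \<tau> - A) x \<partial>lborel)) \<longlongrightarrow> ennreal (2 powr p) * 0 + ennreal (2 powr p) * 0) (at_right 0)"
    by (intro tendsto_add ennreal_tendsto_cmult lim tail) auto
  show ?thesis
  proof (rule tendsto_sandwich[OF _ _ tendsto_const])
    show "((\<lambda>\<tau>. ennreal (2 powr p) * (Lp_integral p (\<lambda>x. G \<tau> x - g x)) + ennreal (2 powr p) * (\<integral>\<^sup>+ x. ennreal (norm (g x) powr p) * indicator (A' \<tau> - A) x \<partial>lborel)) \<longlongrightarrow> 0) (at_right 0)"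
      using sum0 by simp
    show "\<forall>\<^sub>F \<tau> in at_right 0. (Lp_integral p (\<lambda>x. indicator (A' \<tau>) x *\<^sub>R G \<tau> x - indicator A x *\<^sub>R g x)) \<le>
       ennreal (2 powr p) * (Lp_integral p (\<lambda>x. G \<tau> x - g x)) + ennreal (2 powr p) * (\<integral>\<^sup>+ x. ennreal (norm (g x) powr p) * indicator (A' \<tau> - A) x \<partial>lborel)"
      using eventually_at_right_less[of "0::real"]
    proof eventually_elim
      case (elim \<tau>)
      note [measurable] = G[OF elim]
      have one: "1 \<le> 2 powr p" using p by (simp add: ge_one_powr_ge_zero)
      have "(Lp_integral p (\<lambda>x. indicator (A' \<tau>) x *\<^sub>R G \<tau> x - indicator A x *\<^sub>R g x)) \<le>
        (\<integral>\<^sup>+ x. ennreal (2 powr p) * ennreal (norm (G \<tau> x - g x) powr p) + ennreal (2 powr p) * (ennreal (norm (g x) powr p) * indicator (A' \<tau> - A) x) \<partial>lborel)"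
      proof (rule nn_integral_mono)
        fix x
        consider "x \<in> A" | "x \<in> A' \<tau> - A" | "x \<notin> A' \<tau>" by blast
        then show "ennreal (norm (indicator (A' \<tau>) x *\<^sub>R G \<tau> x - indicator A x *\<^sub>R g x) powr p) \<le>
          ennreal (2 powr p) * ennreal (norm (G \<tau> x - g x) powr p) + ennreal (2 powr p) * (ennreal (norm (g x) powr p) * indicator (A' \<tau> - A) x)"
        proof cases
          case 1
          then have "x \<in> A' \<tau>" using sub[OF elim] by blast
          have "1 * norm (G \<tau> x - g x) powr p \<le> 2 powr p * norm (G \<tau> x - g x) powr p"
            by (rule mult_right_mono[OF one]) simp
          then show ?thesis using 1 \<open>x \<in> A' \<tau>\<close> by (simp add: ennreal_leI flip: ennreal_mult)
        next
          case 2
          have "norm (G \<tau> x) powr p \<le> 2 powr p * norm (G \<tau> x - g x) powr p + 2 powr p * norm (g x) powr p"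
            using norm_diff_powr_le[OF p, of "G \<tau> x - g x" "- g x"] by (simp add: algebra_simps)
          from ennreal_leI[OF this] show ?thesis using 2 by (simp add: ennreal_mult)
        next
          case 3
          then have "x \<notin> A" using sub[OF elim] by blast
          then show ?thesis using 3 p by simp
        qed
      qed
      also have "\<dots> = ennreal (2 powr p) * (Lp_integral p (\<lambda>x. G \<tau> x - g x)) + ennreal (2 powr p) * (\<integral>\<^sup>+ x. ennreal (norm (g x) powr p) * indicator (A' \<tau> - A) x \<partial>lborel)"
        by (simp add: nn_integral_add nn_integral_cmult)
      finally show ?case .
    qed
  qed auto
qed

lemma nn_integral_inverse_powr_finite:
  assumes q: "q > 1"
  obtains D where "D \<ge> 0" "(\<integral>\<^sup>+ x. ennreal ((1 + \<bar>x\<bar>) powr (- q)) \<partial>lborel) \<le> ennreal D"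
proof -
  define H where "H x = - ((1 + x) powr (1 - q)) / (q - 1)" for x :: real
  have half: "(\<integral>\<^sup>+ x. ennreal ((1 + x) powr (- q)) * indicator {0..} x \<partial>lborel) = ennreal (0 - H 0)"
  proof (rule nn_integral_FTC_atLeast)
    show "(\<lambda>x. (1 + x) powr (- q)) \<in> borel_measurable borel" by measurable
    show "(H has_real_derivative (1 + x) powr (- q)) (at x)" if "0 \<le> x" for x
    proof -
      have "((\<lambda>x. 1 + x) has_real_derivative 1) (at x)" by (auto intro!: derivative_eq_intros)
      from DERIV_cdivide[OF DERIV_minus[OF DERIV_fun_powr[OF this, of "1 - q"]], of "q - 1"] that
      have "(H has_real_derivative - ((1 - q) * (1 + x) powr (- q)) / (q - 1)) (at x)" unfolding H_def by simp
      also have "- ((1 - q) * (1 + x) powr (- q)) / (q - 1) = (q - 1) * (1 + x) powr (- q) / (q - 1)"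
        by (simp add: algebra_simps)
      also have "\<dots> = (1 + x) powr (- q)" using q by simp
      finally show ?thesis .
    qed
    have "((\<lambda>x. (1 + x) powr (1 - q)) \<longlongrightarrow> 0) at_top"
      by (rule tendsto_neg_powr) (use q in \<open>auto intro!: filterlim_tendsto_add_at_top[OF tendsto_const filterlim_ident]\<close>)
    then have "(H \<longlongrightarrow> - 0 / (q - 1)) at_top" unfolding H_def using q by (intro tendsto_intros) auto
    then show "(H \<longlongrightarrow> 0) at_top" by simp
  qed simp
  have m: "(\<lambda>x. ennreal ((1 + x) powr (- q)) * indicator {0..} x) \<in> borel_measurable borel" by measurable
  have "(\<integral>\<^sup>+ x. ennreal ((1 + \<bar>x\<bar>) powr (- q)) \<partial>lborel) \<le> (\<integral>\<^sup>+ x. ennreal ((1 + x) powr (- q)) * indicator {0..} x + ennreal ((1 + (0 - x)) powr (- q)) * indicator {0..} (0 - x) \<partial>lborel)"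
    by (rule nn_integral_mono) (auto simp: indicator_def)
  also have "\<dots> = ennreal (0 - H 0) + ennreal (0 - H 0)"
    using nn_integral_lborel_shift_reflect(2)[OF m, of 0] half by (subst nn_integral_add) auto
  also have "\<dots> = ennreal (2 / (q - 1))" using q by (simp add: H_def flip: ennreal_plus)
  finally show ?thesis using that[of "2 / (q - 1)"] q by simp
qed

text \<open>Young's inequality with a free parameter. The parameter \<open>c\<close> makes the contribution
  of the kernel small at the price of a large factor on the \<open>p\<close>-th power integral, so
  that convergence in \<open>L\<^sup>p\<close> implies convergence of the paired integrals.\<close>

lemma Lp_kernel:
  assumes p: "p \<ge> 1"
  obtains D where "D \<ge> 0" "\<And>(\<phi> :: real \<Rightarrow> complex) c. \<phi> \<in> borel_measurable borel \<Longrightarrow> 0 < c \<Longrightarrow> c \<le> 1 \<Longrightarrow>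
    (\<integral>\<^sup>+ x. ennreal (norm (\<phi> x) / (1 + \<bar>x\<bar>)) \<partial>lborel) \<le> ennreal (c powr (- p)) * (Lp_integral p (\<lambda>x. \<phi> x)) + ennreal (c * D)"
proof (cases "p = 1")
  case True
  show ?thesis
  proof (rule that[of 0])
    fix \<phi> :: "real \<Rightarrow> complex" and c :: real assume [measurable]: "\<phi> \<in> borel_measurable borel" and c: "0 < c" "c \<le> 1"
    have "(\<integral>\<^sup>+ x. ennreal (norm (\<phi> x) / (1 + \<bar>x\<bar>)) \<partial>lborel) \<le> (\<integral>\<^sup>+ x. ennreal (c powr (- p)) * ennreal (norm (\<phi> x) powr p) \<partial>lborel)"
    proof (rule nn_integral_mono)
      fix x
      have "norm (\<phi> x) / (1 + \<bar>x\<bar>) \<le> norm (\<phi> x) / 1" by (intro divide_left_mono) auto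
      also have "\<dots> \<le> norm (\<phi> x) / c" using c by (intro divide_left_mono) auto
      also have "\<dots> = c powr (- p) * norm (\<phi> x) powr p" using c True by (simp add: powr_minus field_simps)
      finally show "ennreal (norm (\<phi> x) / (1 + \<bar>x\<bar>)) \<le> ennreal (c powr (- p)) * ennreal (norm (\<phi> x) powr p)"
        by (simp add: ennreal_leI flip: ennreal_mult)
    qed
    then show "(\<integral>\<^sup>+ x. ennreal (norm (\<phi> x) / (1 + \<bar>x\<bar>)) \<partial>lborel) \<le> ennreal (c powr (- p)) * (Lp_integral p (\<lambda>x. \<phi> x)) + ennreal (c * 0)"
      by (simp add: nn_integral_cmult)
  qed simp
next
  case False
  then have p1: "p > 1" using p by simp
  define q where "q = p / (p - 1)"
  have q: "q > 1" "1 / p + 1 / q = 1" using p1 by (auto simp: q_def field_simps)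
  obtain D where D: "D \<ge> 0" "(\<integral>\<^sup>+ x. ennreal ((1 + \<bar>x\<bar>) powr (- q)) \<partial>lborel) \<le> ennreal D"
    using nn_integral_inverse_powr_finite[OF q(1)] by blast
  show ?thesis
  proof (rule that[OF D(1)])
    fix \<phi> :: "real \<Rightarrow> complex" and c :: real assume [measurable]: "\<phi> \<in> borel_measurable borel" and c: "0 < c" "c \<le> 1"
    have "(\<integral>\<^sup>+ x. ennreal (norm (\<phi> x) / (1 + \<bar>x\<bar>)) \<partial>lborel) \<le> (\<integral>\<^sup>+ x. ennreal (c powr (- p)) * ennreal (norm (\<phi> x) powr p) + ennreal c * ennreal ((1 + \<bar>x\<bar>) powr (- q)) \<partial>lborel)"
    proof (rule nn_integral_mono)
      fix x :: real
      have "norm (\<phi> x) / (1 + \<bar>x\<bar>) = (norm (\<phi> x) / c) * (c / (1 + \<bar>x\<bar>))" using c by simp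
      also have "\<dots> \<le> (norm (\<phi> x) / c) powr p / p + (c / (1 + \<bar>x\<bar>)) powr q / q"
        by (rule Youngs_inequality[OF p1 q(1) q(2)]) (use c in auto)
      also have "(norm (\<phi> x) / c) powr p / p \<le> c powr (- p) * norm (\<phi> x) powr p"
      proof -
        have "(norm (\<phi> x) / c) powr p / p \<le> (norm (\<phi> x) / c) powr p / 1" using p1 by (intro divide_left_mono) auto
        then show ?thesis using c by (simp add: powr_divide powr_minus field_simps)
      qed
      also have "(c / (1 + \<bar>x\<bar>)) powr q / q \<le> c * (1 + \<bar>x\<bar>) powr (- q)"
      proof -
        have "(c / (1 + \<bar>x\<bar>)) powr q / q \<le> (c / (1 + \<bar>x\<bar>)) powr q / 1" using q by (intro divide_left_mono) auto
        also have "\<dots> = c powr q * (1 + \<bar>x\<bar>) powr (- q)" using c by (simp add: powr_divide powr_minus field_simps)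
        also have "c powr q \<le> c powr 1" using c q by (intro powr_mono') auto
        finally show ?thesis using c by (simp add: mult_right_mono)
      qed
      finally have "norm (\<phi> x) / (1 + \<bar>x\<bar>) \<le> c powr (- p) * norm (\<phi> x) powr p + c * (1 + \<bar>x\<bar>) powr (- q)" by simp
      from ennreal_leI[OF this] show "ennreal (norm (\<phi> x) / (1 + \<bar>x\<bar>)) \<le> ennreal (c powr (- p)) * ennreal (norm (\<phi> x) powr p) + ennreal c * ennreal ((1 + \<bar>x\<bar>) powr (- q))"
        using c by (simp add: ennreal_mult)
    qed
    also have "\<dots> = ennreal (c powr (- p)) * (Lp_integral p (\<lambda>x. \<phi> x)) + ennreal c * (\<integral>\<^sup>+ x. ennreal ((1 + \<bar>x\<bar>) powr (- q)) \<partial>lborel)"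
      by (simp add: nn_integral_add nn_integral_cmult)
    also have "\<dots> \<le> ennreal (c powr (- p)) * (Lp_integral p (\<lambda>x. \<phi> x)) + ennreal c * ennreal D"
      by (intro add_left_mono mult_left_mono D) simp
    finally show "(\<integral>\<^sup>+ x. ennreal (norm (\<phi> x) / (1 + \<bar>x\<bar>)) \<partial>lborel) \<le> ennreal (c powr (- p)) * (Lp_integral p (\<lambda>x. \<phi> x)) + ennreal (c * D)"
      using c D by (simp add: ennreal_mult)
  qed
qed

lemma norm_mult_kernel_le:
  fixes a b :: complex
  assumes "norm b \<le> C / (1 + \<bar>x\<bar>)"
  shows "norm (a * b) \<le> C * (norm a / (1 + \<bar>x\<bar>))"
proof -
  have "norm a * norm b \<le> norm a * (C / (1 + \<bar>x\<bar>))" by (rule mult_left_mono[OF assms]) simp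
  then show ?thesis by (simp add: norm_mult mult.commute)
qed

lemma Lp_kernel_integrable:
  fixes a k :: "real \<Rightarrow> complex"
  assumes p: "p \<ge> 1" and [measurable]: "a \<in> borel_measurable borel" "k \<in> borel_measurable borel"
    and fin: "(Lp_integral p (\<lambda>x. a x)) < \<infinity>" and k: "\<And>x. norm (k x) \<le> C / (1 + \<bar>x\<bar>)"
  shows "integrable lborel (\<lambda>x. norm (a x) / (1 + \<bar>x\<bar>))" "integrable lborel (\<lambda>x. a x * k x)"
proof -
  obtain D where D: "D \<ge> 0" "\<And>(\<phi> :: real \<Rightarrow> complex) c. \<phi> \<in> borel_measurable borel \<Longrightarrow> 0 < c \<Longrightarrow> c \<le> 1 \<Longrightarrow>
    (\<integral>\<^sup>+ x. ennreal (norm (\<phi> x) / (1 + \<bar>x\<bar>)) \<partial>lborel) \<le> ennreal (c powr (- p)) * (Lp_integral p (\<lambda>x. \<phi> x)) + ennreal (c * D)"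
    by (rule Lp_kernel[OF p]) blast
  have "(\<integral>\<^sup>+ x. ennreal (norm (a x) / (1 + \<bar>x\<bar>)) \<partial>lborel) \<le> ennreal (1 powr (- p)) * (Lp_integral p (\<lambda>x. a x)) + ennreal (1 * D)"
    by (rule D(2)[OF assms(2)]) auto
  also have "\<dots> < \<infinity>" using fin by simp
  finally have "(\<integral>\<^sup>+ x. ennreal (norm (a x) / (1 + \<bar>x\<bar>)) \<partial>lborel) < \<infinity>"
    .
  then show i: "integrable lborel (\<lambda>x. norm (a x) / (1 + \<bar>x\<bar>))"
    by (intro integrableI_bounded) (auto simp: abs_of_nonneg)
  show "integrable lborel (\<lambda>x. a x * k x)"
  proof (rule Bochner_Integration.integrable_bound)
    show "integrable lborel (\<lambda>x. C * (norm (a x) / (1 + \<bar>x\<bar>)))" using i by (rule integrable_mult_right)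
    show "AE x in lborel. norm (a x * k x) \<le> norm (C * (norm (a x) / (1 + \<bar>x\<bar>)))"
      by (rule AE_I2, rule order_trans[OF norm_mult_kernel_le[OF k]]) (simp only: real_norm_def abs_ge_self)
  qed measurable
qed

text \<open>The kernels \<open>k\<^sub>n\<close> need to converge only where \<open>a\<close> is nonzero;
  this allows kernels that are cut off to varying sets.\<close>

lemma integral_kernel_limit:
  fixes a :: "real \<Rightarrow> complex" and A k' :: "nat \<Rightarrow> real \<Rightarrow> complex"
  assumes p: "p \<ge> 1" and a[measurable]: "a \<in> borel_measurable borel" and A[measurable]: "\<And>n. A n \<in> borel_measurable borel"
    and k[measurable]: "k \<in> borel_measurable borel" and k'[measurable]: "\<And>n. k' n \<in> borel_measurable borel"
    and fin: "(Lp_integral p (\<lambda>x. a x)) < \<infinity>" "\<And>n. (Lp_integral p (\<lambda>x. A n x)) < \<infinity>"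
    and lim: "(\<lambda>n. Lp_integral p (\<lambda>x. A n x - a x)) \<longlonglongrightarrow> 0"
    and kb: "\<And>x. norm (k x) \<le> C / (1 + \<bar>x\<bar>)" "\<And>n x. norm (k' n x) \<le> C / (1 + \<bar>x\<bar>)"
    and kl: "\<And>x. a x \<noteq> 0 \<Longrightarrow> (\<lambda>n. k' n x) \<longlonglongrightarrow> k x"
  shows "(\<lambda>n. LINT x|lborel. A n x * k' n x) \<longlonglongrightarrow> (LINT x|lborel. a x * k x)"
proof -
  have C: "C \<ge> 0" using order_trans[OF norm_ge_zero kb(1)[of 0]] by simp
  obtain D where D: "D \<ge> 0" "\<And>(\<phi> :: real \<Rightarrow> complex) c. \<phi> \<in> borel_measurable borel \<Longrightarrow> 0 < c \<Longrightarrow> c \<le> 1 \<Longrightarrow>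
    (\<integral>\<^sup>+ x. ennreal (norm (\<phi> x) / (1 + \<bar>x\<bar>)) \<partial>lborel) \<le> ennreal (c powr (- p)) * (Lp_integral p (\<lambda>x. \<phi> x)) + ennreal (c * D)"
    by (rule Lp_kernel[OF p]) blast
  have iA: "integrable lborel (\<lambda>x. A n x * k' n x)" for n by (rule Lp_kernel_integrable[OF p A k' fin(2) kb(2)])
  have ia': "integrable lborel (\<lambda>x. a x * k' n x)" for n by (rule Lp_kernel_integrable[OF p a k' fin(1) kb(2)])
  have ia: "integrable lborel (\<lambda>x. norm (a x) / (1 + \<bar>x\<bar>))" by (rule Lp_kernel_integrable[OF p a k fin(1) kb(1)])
  have "(\<lambda>n. LINT x|lborel. a x * k' n x) \<longlonglongrightarrow> (LINT x|lborel. a x * k x)"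
  proof (rule integral_dominated_convergence[where w = "\<lambda>x. C * (norm (a x) / (1 + \<bar>x\<bar>))"])
    show "integrable lborel (\<lambda>x. C * (norm (a x) / (1 + \<bar>x\<bar>)))" using ia by (rule integrable_mult_right)
    show "AE x in lborel. (\<lambda>n. a x * k' n x) \<longlonglongrightarrow> a x * k x"
    proof (rule AE_I2)
      fix x show "(\<lambda>n. a x * k' n x) \<longlonglongrightarrow> a x * k x"
        using kl[of x] by (cases "a x = 0") (auto intro!: tendsto_intros)
    qed
    show "\<And>n. AE x in lborel. norm (a x * k' n x) \<le> C * (norm (a x) / (1 + \<bar>x\<bar>))"
      by (rule AE_I2) (rule norm_mult_kernel_le[OF kb(2)])
  qed auto
  moreover have "(\<lambda>n. (LINT x|lborel. A n x * k' n x) - (LINT x|lborel. a x * k' n x)) \<longlonglongrightarrow> 0"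
  proof (rule LIMSEQ_I)
    fix e :: real assume e: "e > 0"
    \<comment> \<open>With this parameter the contribution of the kernel is at most \<open>e / 2\<close>, and
      \<open>\<eta>\<close> is chosen to make the rest smaller than \<open>e / 2\<close>.\<close>
    define c where "c = min 1 (e / (2 * ((C + 1) * (D + 1))))"
    have c: "0 < c" "c \<le> 1" using e C D by (auto simp: c_def)
    have cD: "C * (c * D) \<le> e / 2"
    proof -
      have "C * (c * D) = c * (C * D)" by simp
      also have "\<dots> \<le> c * ((C + 1) * (D + 1))" using c C D by (intro mult_left_mono mult_mono) auto
      also have "\<dots> \<le> e / (2 * ((C + 1) * (D + 1))) * ((C + 1) * (D + 1))"
        using C D by (intro mult_right_mono) (auto simp: c_def)
      also have "\<dots> = e / 2" using C D by (simp add: add_nonneg_eq_0_iff)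
      finally show ?thesis .
    qed
    define \<eta> where "\<eta> = e / 2 / ((C + 1) * c powr (- p))"
    have \<eta>: "\<eta> > 0" using e C c by (simp add: \<eta>_def)
    have "\<forall>\<^sub>F n in sequentially. (Lp_integral p (\<lambda>x. A n x - a x)) < ennreal \<eta>"
      using order_tendstoD(2)[OF lim, of "ennreal \<eta>"] \<eta> by simp
    then obtain N where N: "\<And>n. n \<ge> N \<Longrightarrow> (Lp_integral p (\<lambda>x. A n x - a x)) < ennreal \<eta>"
      by (auto simp: eventually_sequentially)
    have "norm ((LINT x|lborel. A n x * k' n x) - (LINT x|lborel. a x * k' n x)) < e" if n: "n \<ge> N" for n
    proof -
      have i: "integrable lborel (\<lambda>x. (A n x - a x) * k' n x)"
        using Bochner_Integration.integrable_diff[OF iA[of n] ia'[of n]] by (simp add: left_diff_distrib)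
      have "(LINT x|lborel. A n x * k' n x) - (LINT x|lborel. a x * k' n x) = (LINT x|lborel. (A n x - a x) * k' n x)"
        using iA ia' by (simp add: left_diff_distrib)
      then have "ennreal (norm ((LINT x|lborel. A n x * k' n x) - (LINT x|lborel. a x * k' n x))) \<le> (\<integral>\<^sup>+ x. ennreal (norm ((A n x - a x) * k' n x)) \<partial>lborel)"
        using integral_norm_bound_ennreal[OF i] by simp
      also have "\<dots> \<le> (\<integral>\<^sup>+ x. ennreal C * ennreal (norm (A n x - a x) / (1 + \<bar>x\<bar>)) \<partial>lborel)"
      proof (rule nn_integral_mono)
        fix x
        show "ennreal (norm ((A n x - a x) * k' n x)) \<le> ennreal C * ennreal (norm (A n x - a x) / (1 + \<bar>x\<bar>))"
          using ennreal_leI[OF norm_mult_kernel_le[OF kb(2), of "A n x - a x" n x]] C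
          by (subst ennreal_mult[symmetric]) auto
      qed
      also have "\<dots> = ennreal C * (\<integral>\<^sup>+ x. ennreal (norm (A n x - a x) / (1 + \<bar>x\<bar>)) \<partial>lborel)"
        by (rule nn_integral_cmult) measurable
      also have "\<dots> \<le> ennreal C * (ennreal (c powr (- p)) * (Lp_integral p (\<lambda>x. A n x - a x)) + ennreal (c * D))"
      proof (rule mult_left_mono[OF D(2)[OF _ c]])
        show "(\<lambda>x. A n x - a x) \<in> borel_measurable borel" by measurable
      qed simp
      also have "\<dots> \<le> ennreal C * (ennreal (c powr (- p)) * ennreal \<eta> + ennreal (c * D))"
        by (intro mult_left_mono add_right_mono less_imp_le[OF N[OF n]]) auto
      also have "\<dots> = ennreal (C * (c powr (- p) * \<eta> + c * D))"
        using C \<eta> c D by (simp add: ennreal_mult)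
      finally have "norm ((LINT x|lborel. A n x * k' n x) - (LINT x|lborel. a x * k' n x)) \<le> C * (c powr (- p) * \<eta> + c * D)"
        using C \<eta> c D by (subst (asm) ennreal_le_iff) auto
      also have "\<dots> = C * (c powr (- p) * \<eta>) + C * (c * D)" by (simp add: distrib_left)
      also have "C * (c powr (- p) * \<eta>) < (C + 1) * (c powr (- p) * \<eta>)" using c \<eta> by simp
      also have "(C + 1) * (c powr (- p) * \<eta>) = e / 2"
      proof -
        have "(C + 1) * c powr (- p) \<noteq> 0" using C c by simp
        moreover have "e / 2 / M * M = e / 2" if "M \<noteq> 0" for M using that by simp
        ultimately have "\<eta> * ((C + 1) * c powr (- p)) = e / 2" unfolding \<eta>_def by blast
        then show ?thesis by (simp only: mult_ac)
      qed
      finally show ?thesis using cD by linarith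
    qed
    then show "\<exists>no. \<forall>n\<ge>no. norm ((LINT x|lborel. A n x * k' n x) - (LINT x|lborel. a x * k' n x) - 0) < e" by auto
  qed
  ultimately show ?thesis using tendsto_add by fastforce
qed

section \<open>The three half-planes in the exterior of a half-strip\<close>

lemma bdry_path_measurable [measurable]: "bdry_path s t \<in> borel_measurable borel"
  unfolding bdry_path_def Complex_eq by measurable

lemma sets_bdry_measure [simp, measurable_cong]: "sets (bdry_measure s t) = sets borel"
  by (simp add: bdry_measure_def)

lemma nn_integral_bdry_measure:
  assumes g[measurable]: "g \<in> borel_measurable borel" and s: "s > 0"
  shows "(\<integral>\<^sup>+ w. g w \<partial>bdry_measure s t) = (\<integral>\<^sup>+ v. g (Complex (- s) v) * indicator {t<..} v \<partial>lborel)
    + (\<integral>\<^sup>+ u. g (Complex u t) * indicator {-s..s} u \<partial>lborel) + (\<integral>\<^sup>+ v. g (Complex s v) * indicator {t<..} v \<partial>lborel)"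
proof -
  note Complex_measurable1[measurable]
  define B1 where "B1 v = g (Complex (- s) v) * indicator {t<..} v" for v
  define B2 where "B2 u = g (Complex u t) * indicator {-s..s} u" for u
  define B3 where "B3 v = g (Complex s v) * indicator {t<..} v" for v
  have [measurable]: "B1 \<in> borel_measurable borel" "B2 \<in> borel_measurable borel" "B3 \<in> borel_measurable borel"
    unfolding B1_def B2_def B3_def by measurable
  have "(\<integral>\<^sup>+ w. g w \<partial>bdry_measure s t) = (\<integral>\<^sup>+ x. g (bdry_path s t x) \<partial>lborel)"
    unfolding bdry_measure_def by (subst nn_integral_distr) auto
  also have "\<dots> = (\<integral>\<^sup>+ x. B1 ((t - s) - x) + B2 x + B3 ((t - s) + x) \<partial>lborel)"
  proof (rule nn_integral_cong)
    fix x
    consider "x < - s" | "- s \<le> x" "x \<le> s" | "x > s" by linarith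
    then show "g (bdry_path s t x) = B1 ((t - s) - x) + B2 x + B3 ((t - s) + x)"
      using s by cases (auto simp: bdry_path_def B1_def B2_def B3_def algebra_simps)
  qed
  also have "\<dots> = (\<integral>\<^sup>+ x. B1 ((t - s) - x) \<partial>lborel) + (\<integral>\<^sup>+ x. B2 x \<partial>lborel) + (\<integral>\<^sup>+ x. B3 ((t - s) + x) \<partial>lborel)"
    by (simp add: nn_integral_add)
  also have "\<dots> = (\<integral>\<^sup>+ x. B1 x \<partial>lborel) + (\<integral>\<^sup>+ x. B2 x \<partial>lborel) + (\<integral>\<^sup>+ x. B3 x \<partial>lborel)"
    by (simp add: nn_integral_lborel_shift_reflect)
  finally show ?thesis unfolding B1_def B2_def B3_def .
qed

text \<open>A Borel left inverse of the parametrization \<open>bdry_path s 0\<close>.\<close>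

definition bdry_param :: "real \<Rightarrow> complex \<Rightarrow> real" where
  "bdry_param s \<zeta> = (if Im \<zeta> > 0 then (if Re \<zeta> < 0 then - s - Im \<zeta> else s + Im \<zeta>) else Re \<zeta>)"

lemma bdry_param_path: "s > 0 \<Longrightarrow> bdry_param s (bdry_path s 0 x) = x"
  by (auto simp: bdry_param_def bdry_path_def)

lemma bdry_param_measurable [measurable]: "bdry_param s \<in> borel_measurable borel"
  unfolding bdry_param_def by measurable

text \<open>The exceptional set of \<open>P\<close> need not be measurable, so a Borel null set of
  parameters is carried over through a left inverse of the parametrization.\<close>

lemma AE_bdry_measure:
  assumes s: "s > 0" and ae: "AE x in lborel. P (bdry_path s 0 x)"
  shows "AE \<zeta> in bdry_measure s 0. P \<zeta>"
proof -
  obtain N where N: "N \<in> null_sets lborel" "{x. \<not> P (bdry_path s 0 x)} \<subseteq> N"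
    using AE_E[OF ae] by (metis (no_types, lifting) null_setsI Collect_cong UNIV_I space_borel space_lborel)
  have Nb[measurable]: "N \<in> sets borel" using N by auto
  define N' where "N' = {\<zeta>. bdry_param s \<zeta> \<in> N \<or> bdry_path s 0 (bdry_param s \<zeta>) \<noteq> \<zeta>}"
  have m: "(\<lambda>\<zeta>. bdry_path s 0 (bdry_param s \<zeta>)) \<in> borel_measurable borel" by measurable
  have N'b: "N' \<in> sets borel"
  proof -
    have "{\<zeta>. bdry_path s 0 (bdry_param s \<zeta>) \<noteq> \<zeta>} \<in> sets borel"
    proof -
      have "(\<lambda>\<zeta>. bdry_path s 0 (bdry_param s \<zeta>) - \<zeta>) \<in> borel_measurable borel" using m by measurable
      from measurable_sets[OF this, of "- {0}"] show ?thesis by (simp add: vimage_def)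
    qed
    moreover have "{\<zeta>. bdry_param s \<zeta> \<in> N} \<in> sets borel"
      using measurable_sets[OF bdry_param_measurable Nb, of s] by (simp add: vimage_def)
    ultimately show ?thesis unfolding N'_def Collect_disj_eq by (rule sets.Un[rotated])
  qed
  have "emeasure (bdry_measure s 0) N' = emeasure lborel (bdry_path s 0 -` N' \<inter> space lborel)"
    unfolding bdry_measure_def by (rule emeasure_distr) (use N'b in auto)
  also have "bdry_path s 0 -` N' \<inter> space lborel = N"
    by (auto simp: N'_def bdry_param_path[OF s])
  also have "emeasure lborel N = 0" using N(1) by auto
  finally have "N' \<in> null_sets (bdry_measure s 0)" using N'b by (intro null_setsI) auto
  then show ?thesis
  proof (rule AE_I')
    show "{\<zeta> \<in> space (bdry_measure s 0). \<not> P \<zeta>} \<subseteq> N'"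
    proof
      fix \<zeta> assume "\<zeta> \<in> {\<zeta> \<in> space (bdry_measure s 0). \<not> P \<zeta>}"
      then have "\<not> P \<zeta>" by simp
      show "\<zeta> \<in> N'"
      proof (cases "bdry_path s 0 (bdry_param s \<zeta>) = \<zeta>")
        case True
        then have "\<not> P (bdry_path s 0 (bdry_param s \<zeta>))" using \<open>\<not> P \<zeta>\<close> by simp
        then show ?thesis using N(2) by (auto simp: N'_def)
      qed (simp add: N'_def)
    qed
  qed
qed

lemma Lp_norm_finite_bound:
  assumes p: "p > 0" and le: "Lp_norm p M f \<le> N" and N: "N < \<infinity>"
  shows "(\<integral>\<^sup>+ w. ennreal (norm (f w) powr p) \<partial>M) \<le> ennreal (enn2real N powr p)"
proof -
  define I where "I = (\<integral>\<^sup>+ w. ennreal (norm (f w) powr p) \<partial>M)"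
  have L: "Lp_norm p M f = (if I = \<infinity> then \<infinity> else ennreal (enn2real I powr (1 / p)))"
    by (simp add: Lp_norm_def I_def Let_def)
  have fin: "I \<noteq> \<infinity>" using le N unfolding L by (auto simp: top_unique split: if_splits)
  have Neq: "N = ennreal (enn2real N)" using N by simp
  have "ennreal (enn2real I powr (1 / p)) \<le> ennreal (enn2real N)" using le fin Neq unfolding L by simp
  then have "enn2real I powr (1 / p) \<le> enn2real N" by (subst (asm) ennreal_le_iff) auto
  then have "(enn2real I powr (1 / p)) powr p \<le> enn2real N powr p" using p by (intro powr_mono2) auto
  then have "enn2real I \<le> enn2real N powr p" using p by (simp add: powr_powr)
  then have "ennreal (enn2real I) \<le> ennreal (enn2real N powr p)" by (rule ennreal_leI)
  moreover have "ennreal (enn2real I) = I" using fin by (simp add: top.not_eq_extremum)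
  ultimately show ?thesis unfolding I_def by simp
qed

lemma Lp_norm_leI:
  assumes p: "p > 0" and N: "N < \<infinity>" and le: "(\<integral>\<^sup>+ w. ennreal (norm (f w) powr p) \<partial>M) \<le> ennreal (enn2real N powr p)"
  shows "Lp_norm p M f \<le> N"
proof -
  define I where "I = (\<integral>\<^sup>+ w. ennreal (norm (f w) powr p) \<partial>M)"
  have I: "I \<le> ennreal (enn2real N powr p)" using le by (simp add: I_def)
  then have fin: "I \<noteq> \<infinity>" by (auto simp: top_unique)
  have "enn2real I \<le> enn2real N powr p" using enn2real_mono[OF I] by simp
  then have "enn2real I powr (1 / p) \<le> (enn2real N powr p) powr (1 / p)" using p by (intro powr_mono2) auto
  then have "enn2real I powr (1 / p) \<le> enn2real N" using p by (simp add: powr_powr)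
  then have "ennreal (enn2real I powr (1 / p)) \<le> ennreal (enn2real N)" by (rule ennreal_leI)
  also have "ennreal (enn2real N) = N" using N by simp
  finally show ?thesis using fin by (simp add: Lp_norm_def I_def[symmetric] Let_def)
qed

lemma Lp_norm_tendsto_0:
  assumes p: "p > 0" and lim: "((\<lambda>\<tau>. \<integral>\<^sup>+ w. ennreal (norm (f \<tau> w) powr p) \<partial>M) \<longlongrightarrow> 0) A"
  shows "((\<lambda>\<tau>. Lp_norm p M (f \<tau>)) \<longlongrightarrow> 0) A"
proof -
  define I where "I \<tau> = (\<integral>\<^sup>+ w. ennreal (norm (f \<tau> w) powr p) \<partial>M)" for \<tau>
  have I0: "(I \<longlongrightarrow> 0) A" using lim by (simp add: I_def[abs_def])
  have ev: "\<forall>\<^sub>F \<tau> in A. I \<tau> < \<infinity>" by (rule order_tendstoD(2)[OF I0]) simp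
  have "((\<lambda>\<tau>. enn2real (I \<tau>)) \<longlongrightarrow> 0) A" by (rule tendsto_enn2real) (use I0 in auto)
  then have "((\<lambda>\<tau>. enn2real (I \<tau>) powr (1 / p)) \<longlongrightarrow> 0 powr (1 / p)) A"
    by (rule tendsto_powr'[OF _ tendsto_const]) (use p in auto)
  then have "((\<lambda>\<tau>. ennreal (enn2real (I \<tau>) powr (1 / p))) \<longlongrightarrow> ennreal 0) A" using p by (intro tendsto_ennrealI) simp
  then have "((\<lambda>\<tau>. ennreal (enn2real (I \<tau>) powr (1 / p))) \<longlongrightarrow> 0) A" by simp
  then show ?thesis
    by (rule Lim_transform_eventually) (rule eventually_mono[OF ev], auto simp: Lp_norm_def I_def[symmetric] Let_def)
qed

text \<open>A rigid motion carries cones in the upper half-plane to the approach regions at a side of the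
  half-strip.\<close>

lemma tendsto_via_rotation:
  fixes c a \<zeta> :: complex
  assumes nt: "nontangential_limit (\<lambda>z. F (a + c * z)) x l" and c: "c \<noteq> 0" and \<zeta>: "\<zeta> = a + c * of_real x" and \<alpha>: "\<alpha> > 0"
    and sub: "\<And>w. w \<in> S \<Longrightarrow> (w - a) / c \<in> nt_cone \<alpha> x"
  shows "(F \<longlongrightarrow> l) (at \<zeta> within S)"
proof -
  have "((\<lambda>z. F (a + c * z)) \<longlongrightarrow> l) (at (Complex x 0) within nt_cone \<alpha> x)"
    using nt \<alpha> by (simp add: nontangential_limit_def)
  moreover have "filterlim (\<lambda>w. (w - a) / c) (at (Complex x 0) within nt_cone \<alpha> x) (at \<zeta> within S)"
    unfolding filterlim_at
  proof
    have "((\<lambda>w. (w - a) / c) \<longlongrightarrow> (\<zeta> - a) / c) (at \<zeta> within S)" by (intro tendsto_intros c)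
    moreover have "(\<zeta> - a) / c = Complex x 0" using c \<zeta> by (simp add: complex_of_real_def)
    ultimately show "((\<lambda>w. (w - a) / c) \<longlongrightarrow> Complex x 0) (at \<zeta> within S)" by simp
    have "Complex x 0 \<notin> nt_cone \<alpha> x" by (simp add: nt_cone_def)
    then have "(w - a) / c \<noteq> Complex x 0" if "w \<in> S" for w using sub[OF that] by metis
    then show "\<forall>\<^sub>F w in at \<zeta> within S. (w - a) / c \<in> nt_cone \<alpha> x \<and> (w - a) / c \<noteq> Complex x 0"
      using sub by (auto simp: eventually_at_filter)
  qed
  ultimately have "((\<lambda>w. F (a + c * ((w - a) / c))) \<longlongrightarrow> l) (at \<zeta> within S)" by (rule filterlim_compose)
  then show ?thesis using c by simp
qed

locale exterior_hardy =
  fixes \<sigma> p :: real and F :: "complex \<Rightarrow> complex"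
  assumes \<sigma>: "\<sigma> > 0" and p: "p > 0" and FH: "F \<in> Hp_space \<sigma> p"
begin

abbreviation N :: ennreal where "N \<equiv> Hp_norm \<sigma> p F"
text \<open>The \<open>p\<close>-th power of the Hardy norm of \<open>F\<close>.\<close>

definition K :: real where "K = enn2real N powr p"

lemma N_finite: "N < \<infinity>" and F_analytic: "F analytic_on Omega_minus \<sigma>"
  using FH by (auto simp: Hp_space_def)

lemma Omega_minus_eq: "Omega_minus \<sigma> = {w. \<bar>Re w\<bar> > \<sigma> \<or> Im w < 0}"
  unfolding Omega_minus_def closure_half_strip[OF \<sigma>] by (auto simp: not_le)

lemma open_Omega_minus: "open (Omega_minus \<sigma>)"
  unfolding Omega_minus_def by (intro open_Compl closed_closure)

lemma F_holomorphic: "F holomorphic_on Omega_minus \<sigma>"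
  using F_analytic analytic_imp_holomorphic by blast

text \<open>The value of F off the domain is arbitrary, hence possibly not measurable.\<close>
definition Fz :: "complex \<Rightarrow> complex" where "Fz w = indicat_real (Omega_minus \<sigma>) w *\<^sub>R F w"

lemma Fz_measurable [measurable]: "Fz \<in> borel_measurable borel"
  unfolding Fz_def
  by (rule borel_measurable_continuous_on_indicator)
     (use open_Omega_minus F_holomorphic holomorphic_on_imp_continuous_on in auto)

lemma Fz_eq: "w \<in> Omega_minus \<sigma> \<Longrightarrow> Fz w = F w" by (simp add: Fz_def)

lemma contour_bound:
  assumes "s > \<sigma>" "t < 0"
  shows "(\<integral>\<^sup>+ v. ennreal (norm (Fz (Complex (- s) v)) powr p) * indicator {t<..} v \<partial>lborel)
    + (\<integral>\<^sup>+ u. ennreal (norm (Fz (Complex u t)) powr p) * indicator {-s..s} u \<partial>lborel)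
    + (\<integral>\<^sup>+ v. ennreal (norm (Fz (Complex s v)) powr p) * indicator {t<..} v \<partial>lborel) \<le> ennreal K"
proof -
  have "(\<integral>\<^sup>+ w. ennreal (norm (Fz w) powr p) \<partial>bdry_measure s t) \<le> (\<integral>\<^sup>+ w. ennreal (norm (F w) powr p) \<partial>bdry_measure s t)"
    by (rule nn_integral_mono) (auto simp: Fz_def indicator_def)
  also have "\<dots> \<le> ennreal K" unfolding K_def
  proof (rule Lp_norm_finite_bound[OF p _ N_finite])
    show "Lp_norm p (bdry_measure s t) F \<le> N"
      unfolding Hp_norm_def by (rule SUP_upper2[of "(s, t)"]) (use assms in auto)
  qed
  finally show ?thesis using assms \<sigma> by (subst (asm) nn_integral_bdry_measure) auto
qed

text \<open>Here \<open>F\<close> is pulled back from the left, lower and right half-plane to the upper one.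
  In all that follows the letters \<open>L\<close>, \<open>B\<close> and \<open>R\<close> stand
  for the left side, the bottom and the right side of the half-strip.\<close>

definition fL where "fL z = F (of_real (- \<sigma>) + \<i> * z)"
definition fB where "fB z = F (0 + (- 1) * z)"
definition fR where "fR z = F (of_real \<sigma> + (- \<i>) * z)"

lemma fL_Complex: "fL (Complex x y) = F (Complex (- \<sigma> - y) x)"
  and fB_Complex: "fB (Complex x y) = F (Complex (- x) (- y))"
  and fR_Complex: "fR (Complex x y) = F (Complex (\<sigma> + y) (- x))"
proof -
  have "of_real (- \<sigma>) + \<i> * Complex x y = Complex (- \<sigma> - y) x" "0 + (- 1) * Complex x y = Complex (- x) (- y)"
    "of_real \<sigma> + (- \<i>) * Complex x y = Complex (\<sigma> + y) (- x)" by (auto simp: complex_eq_iff)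
  then show "fL (Complex x y) = F (Complex (- \<sigma> - y) x)" "fB (Complex x y) = F (Complex (- x) (- y))"
    "fR (Complex x y) = F (Complex (\<sigma> + y) (- x))" unfolding fL_def fB_def fR_def by (simp_all only:)
qed

text \<open>The vertical half-lines of the contours exhaust the line as \<open>t \<longlonglongrightarrow>
  -\<infinity>\<close>.\<close>

lemma vertical_bound:
  assumes s: "\<bar>s\<bar> > \<sigma>"
  shows "(Lp_integral p (\<lambda>v. F (Complex s v))) \<le> ennreal K"
proof -
  note Complex_measurable1[measurable]
  have "(Lp_integral p (\<lambda>v. Fz (Complex s v))) \<le> ennreal K"
  proof (rule nn_integral_exhaust)
    show "incseq (\<lambda>n. {- real (Suc n)<..})" by (auto simp: incseq_def)
    show "(\<Union>n. {- real (Suc n)<..}) = UNIV"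
    proof -
      have "\<exists>n. - real (Suc n) < x" for x :: real
      proof -
        obtain n where "- x < real n" using reals_Archimedean2 by blast
        then show ?thesis by (intro exI[of _ n]) simp
      qed
      then show ?thesis by auto
    qed
    fix n
    show "(\<integral>\<^sup>+ v. ennreal (norm (Fz (Complex s v)) powr p) * indicator {- real (Suc n)<..} v \<partial>lborel) \<le> ennreal K"
      by (rule order_trans[OF _ contour_bound[of "\<bar>s\<bar>" "- real (Suc n)"]])
        (use s in \<open>auto simp: abs_if add_increasing add_increasing2\<close>)
  qed auto
  moreover have "Fz (Complex s v) = F (Complex s v)" for v using s by (intro Fz_eq) (simp add: Omega_minus_eq)
  ultimately show ?thesis by simp
qed

lemma horizontal_bound:
  assumes t: "t < 0"
  shows "(Lp_integral p (\<lambda>u. F (Complex u t))) \<le> ennreal K"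
proof -
  note Complex_measurable1[measurable]
  have "(Lp_integral p (\<lambda>u. Fz (Complex u t))) \<le> ennreal K"
  proof (rule nn_integral_exhaust)
    let ?A = "\<lambda>n. {- (\<sigma> + real (Suc n))..\<sigma> + real (Suc n)}"
    show "incseq ?A" by (auto simp: incseq_def)
    show "(\<Union>n. ?A n) = UNIV"
    proof -
      have "\<exists>n. x \<in> ?A n" for x :: real
      proof -
        obtain n where "\<bar>x\<bar> < real n" using reals_Archimedean2 by blast
        then show ?thesis using \<sigma> by (intro exI[of _ n]) auto
      qed
      then show ?thesis by auto
    qed
    fix n
    show "(\<integral>\<^sup>+ u. ennreal (norm (Fz (Complex u t)) powr p) * indicator (?A n) u \<partial>lborel) \<le> ennreal K"
      by (rule order_trans[OF _ contour_bound[of "\<sigma> + real (Suc n)" t]])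
        (use t in \<open>auto simp: add_increasing add_increasing2\<close>)
  qed auto
  moreover have "Fz (Complex u t) = F (Complex u t)" for u using t by (intro Fz_eq) (simp add: Omega_minus_eq)
  ultimately show ?thesis by simp
qed

lemma K_nonneg: "K \<ge> 0" by (simp add: K_def)

lemma reflect_nn_integral:
  "(Lp_integral p (\<lambda>x. h (- x))) = (Lp_integral p (\<lambda>x. h x))"
  if [measurable]: "h \<in> borel_measurable borel" for h :: "real \<Rightarrow> complex"
  using nn_integral_lborel_shift_reflect(2)[of "\<lambda>x. ennreal (norm (h x) powr p)" 0] by simp

lemma line_measurable_vertical: "\<bar>s\<bar> > \<sigma> \<Longrightarrow> (\<lambda>v. F (Complex s v)) \<in> borel_measurable borel"
proof -
  assume s: "\<bar>s\<bar> > \<sigma>"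
  note Complex_measurable1[measurable]
  have "(\<lambda>v. F (Complex s v)) = (\<lambda>v. Fz (Complex s v))" using s by (intro ext Fz_eq[symmetric]) (simp add: Omega_minus_eq)
  then show ?thesis by simp
qed

lemma line_measurable_horizontal: "t < 0 \<Longrightarrow> (\<lambda>u. F (Complex u t)) \<in> borel_measurable borel"
proof -
  assume t: "t < 0"
  note Complex_measurable1[measurable]
  have "(\<lambda>u. F (Complex u t)) = (\<lambda>u. Fz (Complex u t))" using t by (intro ext Fz_eq[symmetric]) (simp add: Omega_minus_eq)
  then show ?thesis by simp
qed

lemma hardy_fL: "hardy_upper p K fL" and hardy_fB: "hardy_upper p K fB" and hardy_fR: "hardy_upper p K fR"
proof -
  have hol: "(\<lambda>z. F (a + c * z)) holomorphic_on uhp" if "\<And>z. Im z > 0 \<Longrightarrow> a + c * z \<in> Omega_minus \<sigma>" for a c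
    by (intro holomorphic_on_compose[of "\<lambda>z. a + c * z" _ F, unfolded o_def] holomorphic_intros holomorphic_on_subset[OF F_holomorphic])
      (use that in auto)
  show "hardy_upper p K fL" unfolding hardy_upper_def
  proof (intro conjI allI impI K_nonneg)
    show "fL holomorphic_on uhp" unfolding fL_def by (rule hol) (auto simp: Omega_minus_eq)
    fix y :: real assume "y > 0"
    then show "(Lp_integral p (\<lambda>x. fL (Complex x y))) \<le> ennreal K"
      unfolding fL_Complex using \<sigma> by (intro vertical_bound) auto
  qed
  show "hardy_upper p K fB" unfolding hardy_upper_def
  proof (intro conjI allI impI K_nonneg)
    show "fB holomorphic_on uhp" unfolding fB_def by (rule hol) (auto simp: Omega_minus_eq)
    fix y :: real assume y: "y > 0"
    then show "(Lp_integral p (\<lambda>x. fB (Complex x y))) \<le> ennreal K"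
      unfolding fB_Complex using reflect_nn_integral[OF line_measurable_horizontal[of "- y"]] horizontal_bound[of "- y"] by simp
  qed
  show "hardy_upper p K fR" unfolding hardy_upper_def
  proof (intro conjI allI impI K_nonneg)
    show "fR holomorphic_on uhp" unfolding fR_def by (rule hol) (auto simp: Omega_minus_eq)
    fix y :: real assume y: "y > 0"
    then show "(Lp_integral p (\<lambda>x. fR (Complex x y))) \<le> ennreal K"
      unfolding fR_Complex using \<sigma> reflect_nn_integral[OF line_measurable_vertical[of "\<sigma> + y"]] vertical_bound[of "\<sigma> + y"] by simp
  qed
qed

text \<open>The signs undo the reflection of the parameter in the pulled back functions.\<close>

definition gL where "gL v = boundary_value fL v"
definition gB where "gB u = boundary_value fB (- u)"
definition gR where "gR v = boundary_value fR (- v)"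

lemma g_measurable [measurable]: "gL \<in> borel_measurable borel" "gB \<in> borel_measurable borel" "gR \<in> borel_measurable borel"
  unfolding gL_def gB_def gR_def
  using hardy_upper_boundary(2)[OF p hardy_fL] hardy_upper_boundary(2)[OF p hardy_fB] hardy_upper_boundary(2)[OF p hardy_fR]
  by measurable

lemma g_Lp: "(Lp_integral p (\<lambda>x. gL x)) \<le> ennreal K" "(Lp_integral p (\<lambda>x. gB x)) \<le> ennreal K"
  "(Lp_integral p (\<lambda>x. gR x)) \<le> ennreal K"
  unfolding gL_def gB_def gR_def
  using hardy_upper_boundary(3)[OF p hardy_fL] hardy_upper_boundary(3)[OF p hardy_fB] hardy_upper_boundary(3)[OF p hardy_fR]
    reflect_nn_integral[OF hardy_upper_boundary(2)[OF p hardy_fB]] reflect_nn_integral[OF hardy_upper_boundary(2)[OF p hardy_fR]]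
  by simp_all

lemma AE_reflect:
  assumes "AE x in lborel. P x" shows "AE x in lborel. P (- x :: real)"
proof -
  have "AE x in distr lborel borel uminus. P (x :: real)" unfolding lborel_distr_uminus using assms .
  then show ?thesis by (rule AE_distrD[rotated]) simp
qed

lemma g_nt: "AE v in lborel. nontangential_limit fL v (gL v)" "AE u in lborel. nontangential_limit fB (- u) (gB u)"
  "AE v in lborel. nontangential_limit fR (- v) (gR v)"
  unfolding gL_def gB_def gR_def
  using hardy_upper_boundary(1)[OF p hardy_fL] AE_reflect[OF hardy_upper_boundary(1)[OF p hardy_fB]] AE_reflect[OF hardy_upper_boundary(1)[OF p hardy_fR]]
  by simp_all

text \<open>The functions \<open>G \<tau>\<close> are \<open>F\<close> on the lines at distance
  \<open>\<tau>\<close> outside the sides, and the functions \<open>g\<close> are their boundary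
  values.\<close>

definition GL where "GL \<tau> v = F (Complex (- (\<sigma> + \<tau>)) v)"
definition GB where "GB \<tau> u = F (Complex u (- \<tau>))"
definition GR where "GR \<tau> v = F (Complex (\<sigma> + \<tau>) v)"

lemma G_measurable: "\<tau> > 0 \<Longrightarrow> GL \<tau> \<in> borel_measurable borel" "\<tau> > 0 \<Longrightarrow> GB \<tau> \<in> borel_measurable borel" "\<tau> > 0 \<Longrightarrow> GR \<tau> \<in> borel_measurable borel"
  unfolding GL_def GB_def GR_def using \<sigma>
  by (auto intro!: line_measurable_vertical line_measurable_horizontal)

lemma G_Lp: "\<tau> > 0 \<Longrightarrow> (Lp_integral p (\<lambda>x. GL \<tau> x)) \<le> ennreal K"
  "\<tau> > 0 \<Longrightarrow> (Lp_integral p (\<lambda>x. GB \<tau> x)) \<le> ennreal K"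
  "\<tau> > 0 \<Longrightarrow> (Lp_integral p (\<lambda>x. GR \<tau> x)) \<le> ennreal K"
  unfolding GL_def GB_def GR_def using \<sigma>
  by (auto intro!: vertical_bound horizontal_bound)

lemma G_lim: "((\<lambda>\<tau>. Lp_integral p (\<lambda>x. GL \<tau> x - gL x)) \<longlongrightarrow> 0) (at_right 0)"
  "((\<lambda>\<tau>. Lp_integral p (\<lambda>x. GB \<tau> x - gB x)) \<longlongrightarrow> 0) (at_right 0)"
  "((\<lambda>\<tau>. Lp_integral p (\<lambda>x. GR \<tau> x - gR x)) \<longlongrightarrow> 0) (at_right 0)"
proof -
  show "((\<lambda>\<tau>. Lp_integral p (\<lambda>x. GL \<tau> x - gL x)) \<longlongrightarrow> 0) (at_right 0)"
    using hardy_upper_boundary(4)[OF p hardy_fL] by (simp add: fL_Complex GL_def gL_def)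
  have ev: "\<forall>\<^sub>F \<tau> in at_right (0::real). \<tau> > 0" by (rule eventually_at_right_less)
  show "((\<lambda>\<tau>. Lp_integral p (\<lambda>x. GB \<tau> x - gB x)) \<longlongrightarrow> 0) (at_right 0)"
  proof (rule Lim_transform_eventually[OF hardy_upper_boundary(4)[OF p hardy_fB]])
    show "\<forall>\<^sub>F \<tau> in at_right 0. (Lp_integral p (\<lambda>x. fB (Complex x \<tau>) - boundary_value fB x)) = (Lp_integral p (\<lambda>x. GB \<tau> x - gB x))"
      using ev
    proof eventually_elim
      case (elim \<tau>)
      note [measurable] = G_measurable(2)[OF elim]
      have "(\<lambda>x. GB \<tau> x - gB x) \<in> borel_measurable borel" by measurable
      from reflect_nn_integral[OF this] show ?case by (simp add: fB_Complex GB_def gB_def)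
    qed
  qed
  show "((\<lambda>\<tau>. Lp_integral p (\<lambda>x. GR \<tau> x - gR x)) \<longlongrightarrow> 0) (at_right 0)"
  proof (rule Lim_transform_eventually[OF hardy_upper_boundary(4)[OF p hardy_fR]])
    show "\<forall>\<^sub>F \<tau> in at_right 0. (Lp_integral p (\<lambda>x. fR (Complex x \<tau>) - boundary_value fR x)) = (Lp_integral p (\<lambda>x. GR \<tau> x - gR x))"
      using ev
    proof eventually_elim
      case (elim \<tau>)
      note [measurable] = G_measurable(3)[OF elim]
      have "(\<lambda>x. GR \<tau> x - gR x) \<in> borel_measurable borel" by measurable
      from reflect_nn_integral[OF this] show ?case by (simp add: fR_Complex GR_def gR_def)
    qed
  qed
qed

definition Fb :: "complex \<Rightarrow> complex" where
  "Fb \<zeta> = (if Im \<zeta> > 0 then (if Re \<zeta> < 0 then gL (Im \<zeta>) else gR (Im \<zeta>)) else gB (Re \<zeta>))"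

lemma Fb_measurable [measurable]: "Fb \<in> borel_measurable borel"
  unfolding Fb_def by measurable

lemma truncated_limits:
  "((\<lambda>\<tau>. Lp_integral p (\<lambda>x. indicator {- \<tau><..} x *\<^sub>R GL \<tau> x - indicator {0<..} x *\<^sub>R gL x)) \<longlongrightarrow> 0) (at_right 0)"
  "((\<lambda>\<tau>. Lp_integral p (\<lambda>x. indicator {- (\<sigma> + \<tau>)..\<sigma> + \<tau>} x *\<^sub>R GB \<tau> x - indicator {- \<sigma>..\<sigma>} x *\<^sub>R gB x)) \<longlongrightarrow> 0) (at_right 0)"
  "((\<lambda>\<tau>. Lp_integral p (\<lambda>x. indicator {- \<tau><..} x *\<^sub>R GR \<tau> x - indicator {0<..} x *\<^sub>R gR x)) \<longlongrightarrow> 0) (at_right 0)"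
proof -
  have evneg: "\<forall>\<^sub>F \<tau> in at_right 0. x \<notin> {- \<tau><..}" if "x \<notin> {0..}" for x :: real
    using eventually_at_right_real[of 0 "- x"] that by (auto elim: eventually_mono)
  have evB: "\<forall>\<^sub>F \<tau> in at_right 0. x \<notin> {- (\<sigma> + \<tau>)..\<sigma> + \<tau>}" if "x \<notin> {- \<sigma>..\<sigma>}" for x :: real
  proof -
    have "\<sigma> < \<bar>x\<bar>" using that by (auto simp: abs_if split: if_splits)
    then have "\<forall>\<^sub>F \<tau> in at_right 0. \<tau> \<in> {0<..<\<bar>x\<bar> - \<sigma>}" by (intro eventually_at_right_real) simp
    then show ?thesis by (rule eventually_mono) (auto simp: abs_if split: if_splits)
  qed
  have fin: "(Lp_integral p (\<lambda>x. gL x)) < \<infinity>" "(Lp_integral p (\<lambda>x. gB x)) < \<infinity>"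
     "(Lp_integral p (\<lambda>x. gR x)) < \<infinity>"
    using g_Lp by (auto intro: le_less_trans)
  have conv: "(Lp_integral p (\<lambda>x. indicator {- \<tau><..} x *\<^sub>R a x - indicator {0..} x *\<^sub>R b x))
    = (Lp_integral p (\<lambda>x. indicator {- \<tau><..} x *\<^sub>R a x - indicator {0<..} x *\<^sub>R b x))" for \<tau> and a b :: "real \<Rightarrow> complex"
  proof (rule nn_integral_cong_AE)
    show "AE x in lborel. ennreal (norm (indicator {- \<tau><..} x *\<^sub>R a x - indicator {0..} x *\<^sub>R b x) powr p)
      = ennreal (norm (indicator {- \<tau><..} x *\<^sub>R a x - indicator {0<..} x *\<^sub>R b x) powr p)"
      using AE_lborel_singleton[of "0::real"] by eventually_elim (auto simp: indicator_def)
  qed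
  show "((\<lambda>\<tau>. Lp_integral p (\<lambda>x. indicator {- \<tau><..} x *\<^sub>R GL \<tau> x - indicator {0<..} x *\<^sub>R gL x)) \<longlongrightarrow> 0) (at_right 0)"
    unfolding conv[symmetric] by (rule Lp_truncate[OF p G_measurable(1) _ G_lim(1) fin(1) _ _ _ evneg]) auto
  show "((\<lambda>\<tau>. Lp_integral p (\<lambda>x. indicator {- (\<sigma> + \<tau>)..\<sigma> + \<tau>} x *\<^sub>R GB \<tau> x - indicator {- \<sigma>..\<sigma>} x *\<^sub>R gB x)) \<longlongrightarrow> 0) (at_right 0)"
    by (rule Lp_truncate[OF p G_measurable(2) _ G_lim(2) fin(2) _ _ _ evB]) auto
  show "((\<lambda>\<tau>. Lp_integral p (\<lambda>x. indicator {- \<tau><..} x *\<^sub>R GR \<tau> x - indicator {0<..} x *\<^sub>R gR x)) \<longlongrightarrow> 0) (at_right 0)"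
    unfolding conv[symmetric] by (rule Lp_truncate[OF p G_measurable(3) _ G_lim(3) fin(3) _ _ _ evneg]) auto
qed

text \<open>On each of the three lines the integrand is the difference of \<open>G \<tau>\<close> and
  \<open>g\<close>, each cut off to its own side, except at the corners.\<close>

lemma transport_limit:
  "((\<lambda>\<tau>. Lp_norm p (lines_measure \<sigma>)
     (\<lambda>\<zeta>. transport \<sigma> (\<sigma> + \<tau>) (- \<tau>) F \<zeta> - (if \<zeta> \<in> bdry \<sigma> 0 then Fb \<zeta> else 0))) \<longlongrightarrow> 0) (at 0 within {0<..<\<sigma>})"
proof (rule Lp_norm_tendsto_0[OF p])
  define T where "T \<tau> \<zeta> = transport \<sigma> (\<sigma> + \<tau>) (- \<tau>) F \<zeta> - (if \<zeta> \<in> bdry \<sigma> 0 then Fb \<zeta> else 0)" for \<tau> \<zeta>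
  define I where "I \<tau> = (Lp_integral p (\<lambda>x. indicator {- \<tau><..} x *\<^sub>R GL \<tau> x - indicator {0<..} x *\<^sub>R gL x))
    + (Lp_integral p (\<lambda>x. indicator {- (\<sigma> + \<tau>)..\<sigma> + \<tau>} x *\<^sub>R GB \<tau> x - indicator {- \<sigma>..\<sigma>} x *\<^sub>R gB x))
    + (Lp_integral p (\<lambda>x. indicator {- \<tau><..} x *\<^sub>R GR \<tau> x - indicator {0<..} x *\<^sub>R gR x))" for \<tau>
  have "(I \<longlongrightarrow> 0 + 0 + 0) (at_right 0)" unfolding I_def by (intro tendsto_add truncated_limits)
  then have I0: "(I \<longlongrightarrow> 0) (at 0 within {0<..<\<sigma>})" by (simp add: tendsto_within_subset[where S = "{0<..}"] subset_iff)
  have eq: "I \<tau> = (\<integral>\<^sup>+ \<zeta>. ennreal (norm (T \<tau> \<zeta>) powr p) \<partial>lines_measure \<sigma>)" if \<tau>: "\<tau> > 0" for \<tau>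
  proof -
    have sets: "{z. Re z = a \<and> Im z > b} \<in> sets borel" "{z. Im z = 0 \<and> \<bar>Re z\<bar> \<le> b} \<in> sets borel"
       "{z. \<bar>Re z\<bar> \<le> a \<and> Im z = 0} \<in> sets borel" for a b :: real
      by measurable
    have bm: "bdry \<sigma> 0 \<in> sets borel" unfolding bdry_def bdry1_def bdry2_def bdry3_def using sets by (intro sets.Un) auto
    have tp: "transport_point \<sigma> (\<sigma> + \<tau>) (- \<tau>) \<zeta> \<in> Omega_minus \<sigma>"
      if "\<zeta> \<in> gamma1 \<sigma> (\<sigma> + \<tau>) (- \<tau>) \<union> gamma2 \<sigma> (\<sigma> + \<tau>) (- \<tau>) \<union> gamma3 \<sigma> (\<sigma> + \<tau>) (- \<tau>)" for \<zeta>
      using that \<tau> \<sigma> unfolding Omega_minus_eq transport_point_def by (auto simp: gamma1_def gamma2_def gamma3_def)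
    have tr: "transport \<sigma> (\<sigma> + \<tau>) (- \<tau>) F \<zeta> = transport \<sigma> (\<sigma> + \<tau>) (- \<tau>) Fz \<zeta>" for \<zeta>
      unfolding transport_def using Fz_eq[OF tp] by simp
    have "(\<lambda>\<zeta>. transport \<sigma> (\<sigma> + \<tau>) (- \<tau>) Fz \<zeta>) \<in> borel_measurable borel"
      unfolding transport_def transport_point_def gamma1_def gamma2_def gamma3_def by measurable
    then have Tm[measurable]: "T \<tau> \<in> borel_measurable borel"
      unfolding T_def tr using bm by (intro borel_measurable_diff measurable_If) (auto simp: pred_def)
    have "(\<integral>\<^sup>+ \<zeta>. ennreal (norm (T \<tau> \<zeta>) powr p) \<partial>lines_measure \<sigma>) = 
      (Lp_integral p (\<lambda>v. T \<tau> (Complex (- \<sigma>) v))) + (Lp_integral p (\<lambda>u. T \<tau> (Complex u 0)))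
      + (Lp_integral p (\<lambda>v. T \<tau> (Complex \<sigma> v)))"
      by (rule nn_integral_lines_measure) measurable
    also have "(Lp_integral p (\<lambda>v. T \<tau> (Complex (- \<sigma>) v))) = 
      (Lp_integral p (\<lambda>x. indicator {- \<tau><..} x *\<^sub>R GL \<tau> x - indicator {0<..} x *\<^sub>R gL x))"
    proof (rule nn_integral_cong_AE)
      show "AE v in lborel. ennreal (norm (T \<tau> (Complex (- \<sigma>) v)) powr p) = ennreal (norm (indicator {- \<tau><..} v *\<^sub>R GL \<tau> v - indicator {0<..} v *\<^sub>R gL v) powr p)"
        using AE_lborel_singleton[of "0::real"]
      proof eventually_elim
        case (elim v)
        have "Complex (- \<sigma>) v + complex_of_real (\<sigma> - (\<sigma> + \<tau>)) = Complex (- (\<sigma> + \<tau>)) v" by (simp add: complex_eq_iff)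
        then have "transport \<sigma> (\<sigma> + \<tau>) (- \<tau>) F (Complex (- \<sigma>) v) = indicator {- \<tau><..} v *\<^sub>R GL \<tau> v"
          using \<tau> \<sigma> elim by (auto simp: transport_def transport_point_def gamma1_def gamma2_def gamma3_def GL_def indicator_def)
        moreover have "(if Complex (- \<sigma>) v \<in> bdry \<sigma> 0 then Fb (Complex (- \<sigma>) v) else 0) = indicator {0<..} v *\<^sub>R gL v"
          using \<sigma> elim by (auto simp: bdry_def bdry1_def bdry2_def bdry3_def Fb_def indicator_def)
        ultimately show ?case unfolding T_def by simp
      qed
    qed
    also have "(Lp_integral p (\<lambda>u. T \<tau> (Complex u 0))) = 
      (Lp_integral p (\<lambda>x. indicator {- (\<sigma> + \<tau>)..\<sigma> + \<tau>} x *\<^sub>R GB \<tau> x - indicator {- \<sigma>..\<sigma>} x *\<^sub>R gB x))"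
    proof (rule nn_integral_cong_AE)
      show "AE u in lborel. ennreal (norm (T \<tau> (Complex u 0)) powr p) = ennreal (norm (indicator {- (\<sigma> + \<tau>)..\<sigma> + \<tau>} u *\<^sub>R GB \<tau> u - indicator {- \<sigma>..\<sigma>} u *\<^sub>R gB u) powr p)"
        using AE_lborel_singleton[of "\<sigma>"] AE_lborel_singleton[of "- \<sigma>"]
      proof eventually_elim
        case (elim u)
        have "Complex u 0 + \<i> * complex_of_real (- \<tau>) = Complex u (- \<tau>)" by (simp add: complex_eq_iff)
        then have "transport \<sigma> (\<sigma> + \<tau>) (- \<tau>) F (Complex u 0) = indicator {- (\<sigma> + \<tau>)..\<sigma> + \<tau>} u *\<^sub>R GB \<tau> u"
          using \<tau> \<sigma> elim by (auto simp: transport_def transport_point_def gamma1_def gamma2_def gamma3_def GB_def indicator_def abs_le_iff)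
        moreover have "(if Complex u 0 \<in> bdry \<sigma> 0 then Fb (Complex u 0) else 0) = indicator {- \<sigma>..\<sigma>} u *\<^sub>R gB u"
          using \<sigma> by (auto simp: bdry_def bdry1_def bdry2_def bdry3_def Fb_def indicator_def abs_le_iff)
        ultimately show ?case unfolding T_def by simp
      qed
    qed
    also have "(Lp_integral p (\<lambda>v. T \<tau> (Complex \<sigma> v))) = 
      (Lp_integral p (\<lambda>x. indicator {- \<tau><..} x *\<^sub>R GR \<tau> x - indicator {0<..} x *\<^sub>R gR x))"
    proof (rule nn_integral_cong_AE)
      show "AE v in lborel. ennreal (norm (T \<tau> (Complex \<sigma> v)) powr p) = ennreal (norm (indicator {- \<tau><..} v *\<^sub>R GR \<tau> v - indicator {0<..} v *\<^sub>R gR v) powr p)"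
        using AE_lborel_singleton[of "0::real"]
      proof eventually_elim
        case (elim v)
        have "Complex \<sigma> v - complex_of_real (\<sigma> - (\<sigma> + \<tau>)) = Complex (\<sigma> + \<tau>) v" by (simp add: complex_eq_iff)
        then have "transport \<sigma> (\<sigma> + \<tau>) (- \<tau>) F (Complex \<sigma> v) = indicator {- \<tau><..} v *\<^sub>R GR \<tau> v"
          using \<tau> \<sigma> elim by (auto simp: transport_def transport_point_def gamma1_def gamma2_def gamma3_def GR_def indicator_def)
        moreover have "(if Complex \<sigma> v \<in> bdry \<sigma> 0 then Fb (Complex \<sigma> v) else 0) = indicator {0<..} v *\<^sub>R gR v"
          using \<sigma> elim by (auto simp: bdry_def bdry1_def bdry2_def bdry3_def Fb_def indicator_def)
        ultimately show ?case unfolding T_def by simp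
      qed
    qed
    finally show ?thesis unfolding I_def ..
  qed
  have "\<forall>\<^sub>F \<tau> in at 0 within {0<..<\<sigma>}. I \<tau> = (\<integral>\<^sup>+ \<zeta>. ennreal (norm (T \<tau> \<zeta>) powr p) \<partial>lines_measure \<sigma>)"
    using eq by (auto simp: eventually_at_filter)
  then show "((\<lambda>\<tau>. \<integral>\<^sup>+ \<zeta>. ennreal (norm (transport \<sigma> (\<sigma> + \<tau>) (- \<tau>) F \<zeta> - (if \<zeta> \<in> bdry \<sigma> 0 then Fb \<zeta> else 0)) powr p) \<partial>lines_measure \<sigma>) \<longlongrightarrow> 0) (at 0 within {0<..<\<sigma>})"
    unfolding T_def[symmetric] by (rule Lim_transform_eventually[OF I0])
qed

text \<open>The three sides are treated as one integral over the line, so that Fatou's lemma applies to the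
  whole contour and yields the constant \<open>1\<close>.\<close>

lemma Fb_norm_le: "(\<integral>\<^sup>+ \<zeta>. ennreal (norm (Fb \<zeta>) powr p) \<partial>bdry_measure \<sigma> 0) \<le> ennreal K"
proof -
  define t where "t n = 1 / real (Suc n)" for n
  have t: "t n > 0" for n by (simp add: t_def)
  have t0: "t \<longlonglongrightarrow> 0" unfolding t_def by (rule inverse_Suc_tendsto)
  \<comment> \<open>The sum of the contributions of the three sides at one parameter value.\<close>
  define H where "H n v = ennreal (norm (GL (t n) v) powr p) * indicator {0<..} v + ennreal (norm (GB (t n) v) powr p) * indicator {-\<sigma>..\<sigma>} v
     + ennreal (norm (GR (t n) v) powr p) * indicator {0<..} v" for n v
  define H0 where "H0 v = ennreal (norm (gL v) powr p) * indicator {0<..} v + ennreal (norm (gB v) powr p) * indicator {-\<sigma>..\<sigma>} v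
     + ennreal (norm (gR v) powr p) * indicator {0<..} v" for v
  note [measurable] = G_measurable[OF t]
  have Hm: "H n \<in> borel_measurable lborel" for n unfolding H_def by measurable
  have "(\<integral>\<^sup>+ \<zeta>. ennreal (norm (Fb \<zeta>) powr p) \<partial>bdry_measure \<sigma> 0) = (\<integral>\<^sup>+ v. H0 v \<partial>lborel)"
  proof -
    have "ennreal (norm (Fb (Complex (- \<sigma>) v)) powr p) * indicator {0<..} v = ennreal (norm (gL v) powr p) * indicator {0<..} v"
      "ennreal (norm (Fb (Complex v 0)) powr p) * indicator {-\<sigma>..\<sigma>} v = ennreal (norm (gB v) powr p) * indicator {-\<sigma>..\<sigma>} v"
      "ennreal (norm (Fb (Complex \<sigma> v)) powr p) * indicator {0<..} v = ennreal (norm (gR v) powr p) * indicator {0<..} v" for v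
      using \<sigma> by (auto simp: Fb_def indicator_def)
    then show ?thesis unfolding H0_def using \<sigma> by (subst nn_integral_bdry_measure) (auto simp: nn_integral_add)
  qed
  also have "\<dots> = (\<integral>\<^sup>+ v. liminf (\<lambda>n. H n v) \<partial>lborel)"
  proof (rule nn_integral_cong_AE)
    show "AE v in lborel. H0 v = liminf (\<lambda>n. H n v)"
      using g_nt
    proof eventually_elim
      case (elim v)
      have l: "(\<lambda>n. GL (t n) v) \<longlonglongrightarrow> gL v" "(\<lambda>n. GB (t n) v) \<longlonglongrightarrow> gB v" "(\<lambda>n. GR (t n) v) \<longlonglongrightarrow> gR v"
        using nontangential_limit_vertical[OF elim(1) t t0] nontangential_limit_vertical[OF elim(2) t t0] nontangential_limit_vertical[OF elim(3) t t0]
        by (simp_all add: fL_Complex fB_Complex fR_Complex GL_def GB_def GR_def)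
      have pw: "(\<lambda>n. ennreal (norm (a n) powr p) * indicator S v) \<longlonglongrightarrow> ennreal (norm b powr p) * indicator S v" if "a \<longlonglongrightarrow> b" for a :: "nat \<Rightarrow> complex" and b and S :: "real set"
      proof (cases "v \<in> S")
        case True
        have "(\<lambda>n. ennreal (norm (a n) powr p)) \<longlonglongrightarrow> ennreal (norm b powr p)"
          using p that by (intro tendsto_ennrealI tendsto_powr' tendsto_intros) auto
        then show ?thesis using True by simp
      qed simp
      have "(\<lambda>n. H n v) \<longlonglongrightarrow> H0 v" unfolding H_def H0_def by (intro tendsto_add pw l)
      then show ?case using lim_imp_Liminf[OF sequentially_bot] by metis
    qed
  qed
  also have "\<dots> \<le> liminf (\<lambda>n. \<integral>\<^sup>+ v. H n v \<partial>lborel)" by (rule nn_integral_liminf) (rule Hm)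
  also have "\<dots> \<le> liminf (\<lambda>n::nat. ennreal K)"
  proof (rule Liminf_mono, rule always_eventually, rule allI)
    fix n
    have z: "Fz (Complex (- (\<sigma> + t n)) v) = GL (t n) v" "Fz (Complex v (- t n)) = GB (t n) v" "Fz (Complex (\<sigma> + t n) v) = GR (t n) v" for v
      unfolding GL_def GB_def GR_def using t[of n] \<sigma> by (auto intro!: Fz_eq simp: Omega_minus_eq)
    have "(\<integral>\<^sup>+ v. H n v \<partial>lborel) \<le> (\<integral>\<^sup>+ v. ennreal (norm (GL (t n) v) powr p) * indicator {- t n<..} v \<partial>lborel)
     + (\<integral>\<^sup>+ v. ennreal (norm (GB (t n) v) powr p) * indicator {-(\<sigma> + t n)..\<sigma> + t n} v \<partial>lborel)
     + (\<integral>\<^sup>+ v. ennreal (norm (GR (t n) v) powr p) * indicator {- t n<..} v \<partial>lborel)"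
      unfolding H_def
      by (simp add: nn_integral_add, intro add_mono nn_integral_mono) (use t[of n] in \<open>auto simp: indicator_def\<close>)
    also have "\<dots> \<le> ennreal K" by (rule contour_bound[of "\<sigma> + t n" "- t n", unfolded z]) (use t[of n] in auto)
    finally show "(\<integral>\<^sup>+ v. H n v \<partial>lborel) \<le> ennreal K" .
  qed
  also have "\<dots> = ennreal K" by (simp add: Liminf_const)
  finally show ?thesis .
qed

lemma Fb_nontangential: "AE \<zeta> in bdry_measure \<sigma> 0. has_nt_limit \<sigma> F \<zeta> (Fb \<zeta>)"
proof (rule AE_bdry_measure[OF \<sigma>])
  have shift: "AE x in lborel. P (a + c * x)" if "AE x in lborel. P x" "c \<noteq> 0" for P a and c :: real
  proof -
    have "AE x in density (distr lborel borel (\<lambda>x. a + c * x)) (\<lambda>_. ennreal \<bar>c\<bar>). P x"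
      by (subst lborel_real_affine[OF that(2), of a, symmetric]) (rule that(1))
    then have "AE x in distr lborel borel (\<lambda>x. a + c * x). P x"
      using that(2) by (subst (asm) AE_density) auto
    then show ?thesis by (rule AE_distrD[rotated]) simp
  qed
  have "AE x in lborel. nontangential_limit fL (- \<sigma> - x) (gL (- \<sigma> - x))"
    using shift[OF g_nt(1), of "-1" "- \<sigma>"] by simp
  moreover have "AE x in lborel. nontangential_limit fR (- (- \<sigma> + x)) (gR (- \<sigma> + x))"
    using shift[OF g_nt(3), of 1 "- \<sigma>"] by simp
  ultimately show "AE x in lborel. has_nt_limit \<sigma> F (bdry_path \<sigma> 0 x) (Fb (bdry_path \<sigma> 0 x))"
    using g_nt(2) AE_lborel_singleton[of \<sigma>] AE_lborel_singleton[of "- \<sigma>"]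
  proof eventually_elim
    case (elim x)
    consider "x < - \<sigma>" | "- \<sigma> < x" "x < \<sigma>" | "x > \<sigma>" using elim by linarith
    then show ?case
    proof cases
      case 1
      define v where "v = - \<sigma> - x"
      have v: "v > 0" using 1 by (simp add: v_def)
      have path: "bdry_path \<sigma> 0 x = Complex (- \<sigma>) v" using 1 by (simp add: bdry_path_def v_def)
      have Fbv: "Fb (Complex (- \<sigma>) v) = gL v" using v \<sigma> by (simp add: Fb_def)
      have b1: "Complex (- \<sigma>) v \<in> bdry1 \<sigma> 0" using v by (simp add: bdry1_def)
      show ?thesis unfolding has_nt_limit_def path Fbv
      proof (intro conjI allI impI)
        show "Complex (- \<sigma>) v \<in> bdry \<sigma> 0 - {- complex_of_real \<sigma>, complex_of_real \<sigma>}"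
          using b1 v by (auto simp: bdry_def complex_eq_iff)
        fix \<alpha> :: real assume \<alpha>: "\<alpha> > 0"
        show "(F \<longlongrightarrow> gL v) (at (Complex (- \<sigma>) v) within nt_region \<sigma> \<alpha> (Complex (- \<sigma>) v) \<inter> Omega_minus \<sigma>)"
        proof (rule tendsto_via_rotation[where a = "of_real (- \<sigma>)" and c = \<i> and x = v, OF _ _ _ \<alpha>])
          show "nontangential_limit (\<lambda>z. F (complex_of_real (- \<sigma>) + \<i> * z)) v (gL v)"
            using elim(1) unfolding fL_def v_def .
          show "(w - complex_of_real (- \<sigma>)) / \<i> \<in> nt_cone \<alpha> v" if "w \<in> nt_region \<sigma> \<alpha> (Complex (- \<sigma>) v) \<inter> Omega_minus \<sigma>" for w
            using that b1 by (auto simp: nt_region_def nt_cone_def Re_divide Im_divide)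
        qed (auto simp: complex_eq_iff)
      qed
    next
      case 2
      have path: "bdry_path \<sigma> 0 x = Complex x 0" using 2 by (simp add: bdry_path_def)
      have Fbv: "Fb (Complex x 0) = gB x" by (simp add: Fb_def)
      have b2: "Complex x 0 \<in> bdry2 \<sigma> 0" "Complex x 0 \<notin> bdry1 \<sigma> 0" using 2 by (auto simp: bdry2_def bdry1_def)
      show ?thesis unfolding has_nt_limit_def path Fbv
      proof (intro conjI allI impI)
        show "Complex x 0 \<in> bdry \<sigma> 0 - {- complex_of_real \<sigma>, complex_of_real \<sigma>}"
          using b2 2 by (auto simp: bdry_def complex_eq_iff)
        fix \<alpha> :: real assume \<alpha>: "\<alpha> > 0"
        show "(F \<longlongrightarrow> gB x) (at (Complex x 0) within nt_region \<sigma> \<alpha> (Complex x 0) \<inter> Omega_minus \<sigma>)"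
        proof (rule tendsto_via_rotation[where a = 0 and c = "-1" and x = "- x", OF _ _ _ \<alpha>])
          show "nontangential_limit (\<lambda>z. F (0 + (- 1) * z)) (- x) (gB x)"
            using elim(3) unfolding fB_def .
          show "(w - 0) / - 1 \<in> nt_cone \<alpha> (- x)" if "w \<in> nt_region \<sigma> \<alpha> (Complex x 0) \<inter> Omega_minus \<sigma>" for w
            using that b2 by (auto simp: nt_region_def nt_cone_def)
        qed (auto simp: complex_eq_iff)
      qed
    next
      case 3
      define v where "v = - \<sigma> + x"
      have v: "v > 0" using 3 by (simp add: v_def)
      have path: "bdry_path \<sigma> 0 x = Complex \<sigma> v" using 3 \<sigma> by (simp add: bdry_path_def v_def)
      have Fbv: "Fb (Complex \<sigma> v) = gR v" using v \<sigma> by (simp add: Fb_def)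
      have b3: "Complex \<sigma> v \<in> bdry3 \<sigma> 0" "Complex \<sigma> v \<notin> bdry1 \<sigma> 0" "Complex \<sigma> v \<notin> bdry2 \<sigma> 0"
        using v \<sigma> by (auto simp: bdry1_def bdry2_def bdry3_def)
      show ?thesis unfolding has_nt_limit_def path Fbv
      proof (intro conjI allI impI)
        show "Complex \<sigma> v \<in> bdry \<sigma> 0 - {- complex_of_real \<sigma>, complex_of_real \<sigma>}"
          using b3 v by (auto simp: bdry_def complex_eq_iff)
        fix \<alpha> :: real assume \<alpha>: "\<alpha> > 0"
        show "(F \<longlongrightarrow> gR v) (at (Complex \<sigma> v) within nt_region \<sigma> \<alpha> (Complex \<sigma> v) \<inter> Omega_minus \<sigma>)"
        proof (rule tendsto_via_rotation[where a = "of_real \<sigma>" and c = "- \<i>" and x = "- v", OF _ _ _ \<alpha>])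
          show "nontangential_limit (\<lambda>z. F (complex_of_real \<sigma> + (- \<i>) * z)) (- v) (gR v)"
            using elim(2) unfolding fR_def v_def .
          show "(w - complex_of_real \<sigma>) / - \<i> \<in> nt_cone \<alpha> (- v)" if "w \<in> nt_region \<sigma> \<alpha> (Complex \<sigma> v) \<inter> Omega_minus \<sigma>" for w
            using that b3 by (auto simp: nt_region_def nt_cone_def Re_divide Im_divide)
        qed (auto simp: complex_eq_iff)
      qed
    qed
  qed
qed

end

section \<open>The Cauchy integral over the boundary\<close>

lemma kernel_decay:
  fixes \<zeta> w :: complex
  assumes d: "d > 0" "d \<le> norm (\<zeta> - w)" and x: "\<bar>x\<bar> \<le> norm \<zeta>"
  shows "norm (1 / (\<zeta> - w)) \<le> ((1 + norm w) / d + 1) / (1 + \<bar>x\<bar>)"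
proof -
  have "norm \<zeta> \<le> norm (\<zeta> - w) + norm w" using norm_triangle_ineq[of "\<zeta> - w" w] by simp
  then have "1 + \<bar>x\<bar> \<le> (1 + norm w) * 1 + norm (\<zeta> - w)" using x by simp
  also have "(1 + norm w) * 1 \<le> (1 + norm w) * (norm (\<zeta> - w) / d)" using d by (intro mult_left_mono) auto
  finally have "1 + \<bar>x\<bar> \<le> ((1 + norm w) / d + 1) * norm (\<zeta> - w)" by (simp add: algebra_simps)
  moreover have "norm (\<zeta> - w) > 0" using d by linarith
  ultimately show ?thesis by (simp add: norm_divide field_simps)
qed

lemma set_integral_upward_limit:
  fixes f :: "real \<Rightarrow> complex"
  assumes "set_integrable lborel {t<..} f"
  shows "(\<lambda>n::nat. LINT y:{t..real n}|lborel. f y) \<longlonglongrightarrow> (LINT y:{t<..}|lborel. f y)"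
proof -
  have i: "integrable lborel (\<lambda>y. indicat_real {t<..} y *\<^sub>R f y)" using assms by (simp add: set_integrable_def)
  have eq: "(LINT y:{t..real n}|lborel. f y) = (LINT y|lborel. indicat_real {..real n} y *\<^sub>R (indicat_real {t<..} y *\<^sub>R f y))" for n
  proof -
    define L where "L y = indicat_real {t..real n} y *\<^sub>R f y" for y
    define G where "G y = indicat_real {..real n} y *\<^sub>R (indicat_real {t<..} y *\<^sub>R f y)" for y
    have [measurable]: "G \<in> borel_measurable lborel" unfolding G_def using borel_measurable_integrable[OF i] by measurable
    have eq: "L y = G y" if "y \<noteq> t" for y using that by (auto simp: L_def G_def indicator_def)
    then have "L = (\<lambda>y. if y = t then L t else G y)" by auto
    moreover have "(\<lambda>y. if y = t then L t else G y) \<in> borel_measurable lborel" by measurable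
    ultimately have [measurable]: "L \<in> borel_measurable lborel" by simp
    have "(LINT y|lborel. L y) = (LINT y|lborel. G y)"
      by (rule integral_cong_AE) (use AE_lborel_singleton[of t] eq in \<open>auto elim: eventually_mono\<close>)
    then show ?thesis unfolding L_def G_def set_lebesgue_integral_def .
  qed
  show ?thesis unfolding eq
    unfolding set_lebesgue_integral_def
  proof (rule integral_dominated_convergence[where w = "\<lambda>y. norm (indicat_real {t<..} y *\<^sub>R f y)"])
    show "AE y in lborel. (\<lambda>n. indicat_real {..real n} y *\<^sub>R (indicat_real {t<..} y *\<^sub>R f y)) \<longlonglongrightarrow> indicat_real {t<..} y *\<^sub>R f y"
    proof (rule AE_I2)
      fix y :: real
      obtain M where M: "y \<le> real M" using real_arch_simple by blast
      have "\<forall>\<^sub>F n in sequentially. indicat_real {..real n} y *\<^sub>R (indicat_real {t<..} y *\<^sub>R f y) = indicat_real {t<..} y *\<^sub>R f y"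
        using eventually_ge_at_top[of M] by eventually_elim (use M in \<open>auto simp: indicator_def\<close>)
      then show "(\<lambda>n. indicat_real {..real n} y *\<^sub>R (indicat_real {t<..} y *\<^sub>R f y)) \<longlonglongrightarrow> indicat_real {t<..} y *\<^sub>R f y" by (rule tendsto_eventually)
    qed
    show "AE y in lborel. norm (indicat_real {..real n} y *\<^sub>R (indicat_real {t<..} y *\<^sub>R f y)) \<le> norm (indicat_real {t<..} y *\<^sub>R f y)" for n
      by (rule AE_I2) (auto simp: indicator_def)
    show "integrable lborel (\<lambda>y. norm (indicat_real {t<..} y *\<^sub>R f y))" using i by (rule integrable_norm)
    show "(\<lambda>y. indicat_real {t<..} y *\<^sub>R f y) \<in> borel_measurable lborel" using i by (rule borel_measurable_integrable)
    show "(\<lambda>y. indicat_real {..real n} y *\<^sub>R (indicat_real {t<..} y *\<^sub>R f y)) \<in> borel_measurable lborel" for n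
      using borel_measurable_integrable[OF i] by measurable
  qed
qed

lemma bdry_path_vector_derivative:
  assumes s: "s > 0"
  shows "x < - s \<Longrightarrow> vector_derivative (bdry_path s t) (at x) = - \<i>"
    "- s < x \<Longrightarrow> x < s \<Longrightarrow> vector_derivative (bdry_path s t) (at x) = 1"
    "s < x \<Longrightarrow> vector_derivative (bdry_path s t) (at x) = \<i>"
proof -
  have lin: "((\<lambda>x. a + of_real x * c) has_vector_derivative c) (at x)" for a c :: complex and x :: real
    by (auto intro!: derivative_eq_intros has_vector_derivative_real_field simp: has_vector_derivative_def scaleR_conv_of_real)
  show "vector_derivative (bdry_path s t) (at x) = - \<i>" if "x < - s"
  proof (rule vector_derivative_at, rule has_vector_derivative_transform_within_open[OF lin])
    show "open {..< - s}" "x \<in> {..< - s}" using that by auto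
    show "Complex (- s) (t - s) + of_real y * (- \<i>) = bdry_path s t y" if "y \<in> {..< - s}" for y
      using that by (simp add: bdry_path_def complex_eq_iff)
  qed
  show "vector_derivative (bdry_path s t) (at x) = 1" if "- s < x" "x < s"
  proof (rule vector_derivative_at, rule has_vector_derivative_transform_within_open[OF lin])
    show "open {- s<..<s}" "x \<in> {- s<..<s}" using that by auto
    show "Complex 0 t + of_real y * 1 = bdry_path s t y" if "y \<in> {- s<..<s}" for y
      using that by (simp add: bdry_path_def complex_eq_iff)
  qed
  show "vector_derivative (bdry_path s t) (at x) = \<i>" if "s < x"
  proof (rule vector_derivative_at, rule has_vector_derivative_transform_within_open[OF lin])
    show "open {s<..}" "x \<in> {s<..}" using that by auto
    show "Complex s (t - s) + of_real y * \<i> = bdry_path s t y" if "y \<in> {s<..}" for y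
      using that s by (simp add: bdry_path_def complex_eq_iff)
  qed
qed

lemma bdry_integral_split:
  assumes s: "s > 0"
    and i1: "set_integrable lborel {t<..} (\<lambda>v. f (Complex (- s) v))" and i2: "set_integrable lborel {- s..s} (\<lambda>u. f (Complex u t))"
    and i3: "set_integrable lborel {t<..} (\<lambda>v. f (Complex s v))"
  shows "bdry_integrable s t f"
    "bdry_integral s t f = (LINT u:{- s..s}|lborel. f (Complex u t)) + \<i> * (LINT v:{t<..}|lborel. f (Complex s v)) - \<i> * (LINT v:{t<..}|lborel. f (Complex (- s) v))"
proof -
  define B1 where "B1 v = indicat_real {t<..} v *\<^sub>R f (Complex (- s) v)" for v
  define B2 where "B2 u = indicat_real {- s..s} u *\<^sub>R f (Complex u t)" for u
  define B3 where "B3 v = indicat_real {t<..} v *\<^sub>R f (Complex s v)" for v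
  have B: "integrable lborel B1" "integrable lborel B2" "integrable lborel B3"
    using i1 i2 i3 by (simp_all add: B1_def[abs_def] B2_def[abs_def] B3_def[abs_def] set_integrable_def)
  define q where "q x = B2 x + \<i> * B3 ((t - s) + 1 * x) - \<i> * B1 ((t - s) + (- 1) * x)" for x
  have iq1: "integrable lborel (\<lambda>x. B1 ((t - s) + (- 1) * x))" and iq3: "integrable lborel (\<lambda>x. B3 ((t - s) + 1 * x))"
    using lborel_integrable_real_affine[OF B(1), of "- 1" "t - s"] lborel_integrable_real_affine[OF B(3), of 1 "t - s"] by auto
  have iq: "integrable lborel q" unfolding q_def
    by (intro Bochner_Integration.integrable_add Bochner_Integration.integrable_diff integrable_mult_right B iq1 iq3)
  define h where "h x = f (bdry_path s t x) * vector_derivative (bdry_path s t) (at x)" for x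
  have hq: "h x = q x" if ne: "x \<noteq> s" "x \<noteq> - s" for x
  proof -
    consider "x < - s" | "- s < x" "x < s" | "x > s" using ne by linarith
    then show ?thesis
    proof cases
      case 1
      then show ?thesis using s bdry_path_vector_derivative(1)[OF s 1, of t]
        by (simp add: h_def q_def B1_def B2_def B3_def bdry_path_def algebra_simps)
    next
      case 2
      then show ?thesis using s bdry_path_vector_derivative(2)[OF s 2, of t]
        by (simp add: h_def q_def B1_def B2_def B3_def bdry_path_def)
    next
      case 3
      then show ?thesis using s bdry_path_vector_derivative(3)[OF s 3, of t]
        by (simp add: h_def q_def B1_def B2_def B3_def bdry_path_def algebra_simps)
    qed
  qed
  have "h = (\<lambda>x. if x = s then h s else if x = - s then h (- s) else q x)" using hq by auto
  moreover have "(\<lambda>x. if x = s then h s else if x = - s then h (- s) else q x) \<in> borel_measurable lborel"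
    using borel_measurable_integrable[OF iq] by measurable
  ultimately have hm: "h \<in> borel_measurable lborel" by simp
  have ae: "AE x in lborel. q x = h x"
    using AE_lborel_singleton[of s] AE_lborel_singleton[of "- s"] by eventually_elim (simp add: hq)
  have "integrable lborel h" by (rule integrable_cong_AE_imp[OF iq hm]) (use ae in \<open>auto elim: eventually_mono\<close>)
  then show "bdry_integrable s t f" unfolding bdry_integrable_def h_def .
  have "bdry_integral s t f = (LINT x|lborel. h x)" unfolding bdry_integral_def h_def ..
  also have "\<dots> = (LINT x|lborel. q x)"
    by (rule integral_cong_AE) (use hm iq ae in \<open>auto elim: eventually_mono\<close>)
  also have "\<dots> = (LINT x|lborel. B2 x) + \<i> * (LINT x|lborel. B3 ((t - s) + 1 * x)) - \<i> * (LINT x|lborel. B1 ((t - s) + (- 1) * x))"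
    unfolding q_def using B(2) iq1 iq3 by simp
  also have "(LINT x|lborel. B3 ((t - s) + 1 * x)) = (LINT x|lborel. B3 x)"
    using lborel_integral_real_affine[of 1 B3 "t - s"] by simp
  also have "(LINT x|lborel. B1 ((t - s) + (- 1) * x)) = (LINT x|lborel. B1 x)"
    using lborel_integral_real_affine[of "- 1" B1 "t - s"] by simp
  finally show "bdry_integral s t f = (LINT u:{- s..s}|lborel. f (Complex u t)) + \<i> * (LINT v:{t<..}|lborel. f (Complex s v)) - \<i> * (LINT v:{t<..}|lborel. f (Complex (- s) v))"
    unfolding set_lebesgue_integral_def B1_def B2_def B3_def .
qed

context exterior_hardy
begin

lemma F_vanishes:
  assumes \<tau>: "\<tau> > 0" and r: "r > 0"
  obtains R where "\<And>\<zeta>. \<bar>Re \<zeta>\<bar> \<ge> \<sigma> + \<tau> \<or> Im \<zeta> \<le> - \<tau> \<Longrightarrow> norm \<zeta> \<ge> R \<Longrightarrow> norm (F \<zeta>) < r"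
proof -
  obtain R1 where R1: "\<And>z. Im z \<ge> \<tau> \<Longrightarrow> norm z \<ge> R1 \<Longrightarrow> norm (fL z) < r" by (rule hardy_upper_vanishes[OF p hardy_fL \<tau> r]) blast
  obtain R2 where R2: "\<And>z. Im z \<ge> \<tau> \<Longrightarrow> norm z \<ge> R2 \<Longrightarrow> norm (fB z) < r" by (rule hardy_upper_vanishes[OF p hardy_fB \<tau> r]) blast
  obtain R3 where R3: "\<And>z. Im z \<ge> \<tau> \<Longrightarrow> norm z \<ge> R3 \<Longrightarrow> norm (fR z) < r" by (rule hardy_upper_vanishes[OF p hardy_fR \<tau> r]) blast
  define R where "R = max R1 (max R2 R3) + \<sigma>"
  have R: "R \<ge> R1 + \<sigma>" "R \<ge> R2 + \<sigma>" "R \<ge> R3 + \<sigma>" by (auto simp: R_def)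
  show ?thesis
  proof (rule that)
    fix \<zeta> assume \<zeta>: "\<bar>Re \<zeta>\<bar> \<ge> \<sigma> + \<tau> \<or> Im \<zeta> \<le> - \<tau>" "norm \<zeta> \<ge> R"
    then consider "Re \<zeta> \<le> - (\<sigma> + \<tau>)" | "Re \<zeta> \<ge> \<sigma> + \<tau>" | "Im \<zeta> \<le> - \<tau>" by linarith
    then show "norm (F \<zeta>) < r"
    proof cases
      case 1
      define z where "z = Complex (Im \<zeta>) (- \<sigma> - Re \<zeta>)"
      have "z = - \<i> * (\<zeta> + of_real \<sigma>)" by (simp add: z_def complex_eq_iff)
      then have "norm z = norm (\<zeta> + of_real \<sigma>)" by (simp add: norm_mult)
      moreover have "norm \<zeta> \<le> norm (\<zeta> + of_real \<sigma>) + norm (complex_of_real \<sigma>)" using norm_triangle_ineq4[of "\<zeta> + of_real \<sigma>" "of_real \<sigma>"] by simp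
      ultimately have "norm z \<ge> R1" using \<zeta>(2) R \<sigma> by simp
      then have "norm (fL z) < r" using 1 by (intro R1) (auto simp: z_def)
      then show ?thesis by (simp add: z_def fL_Complex)
    next
      case 2
      define z where "z = Complex (- Im \<zeta>) (Re \<zeta> - \<sigma>)"
      have "z = \<i> * (\<zeta> - of_real \<sigma>)" by (simp add: z_def complex_eq_iff)
      then have "norm z = norm (\<zeta> - of_real \<sigma>)" by (simp add: norm_mult)
      moreover have "norm \<zeta> \<le> norm (\<zeta> - of_real \<sigma>) + norm (complex_of_real \<sigma>)" using norm_triangle_ineq[of "\<zeta> - of_real \<sigma>" "of_real \<sigma>"] by simp
      ultimately have "norm z \<ge> R3" using \<zeta>(2) R \<sigma> by simp
      then have "norm (fR z) < r" using 2 by (intro R3) (auto simp: z_def)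
      then show ?thesis by (simp add: z_def fR_Complex)
    next
      case 3
      define z where "z = Complex (- Re \<zeta>) (- Im \<zeta>)"
      have "z = - \<zeta>" by (simp add: z_def complex_eq_iff)
      then have "norm z \<ge> R2" using \<zeta>(2) R \<sigma> by simp
      then have "norm (fB z) < r" using 3 by (intro R2) (auto simp: z_def)
      then show ?thesis by (simp add: z_def fB_Complex)
    qed
  qed
qed

lemma rectangle_contour:
  assumes ab: "a < b" "c < d" and sub: "cbox (Complex a c) (Complex b d) \<subseteq> Omega_minus \<sigma>"
    and w: "w \<in> box (Complex a c) (Complex b d) \<or> w \<notin> cbox (Complex a c) (Complex b d)"
  shows "(LINT x:{a..b}|lborel. F (Complex x c) / (Complex x c - w)) - (LINT x:{a..b}|lborel. F (Complex x d) / (Complex x d - w))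
    + \<i> * ((LINT y:{c..d}|lborel. F (Complex b y) / (Complex b y - w)) - (LINT y:{c..d}|lborel. F (Complex a y) / (Complex a y - w)))
    = (if w \<in> box (Complex a c) (Complex b d) then 2 * of_real pi * \<i> * F w else 0)"
proof (cases "w \<in> box (Complex a c) (Complex b d)")
  case True
  from Cauchy_formula_rectangle[OF ab open_Omega_minus F_holomorphic sub True] True show ?thesis by simp
next
  case False
  then have nw: "w \<notin> cbox (Complex a c) (Complex b d)" using w by blast
  have "(\<lambda>z. F z / (z - w)) holomorphic_on (Omega_minus \<sigma> - {w})"
    by (intro holomorphic_intros holomorphic_on_subset[OF F_holomorphic]) auto
  from Cauchy_theorem_rectangle[OF ab open_delete[OF open_Omega_minus] this] sub nw False show ?thesis by auto
qed

text \<open>A quantitative form of the statement that \<open>w\<close> is off the boundary: for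
  \<open>\<tau> \<le> \<tau>0\<close>, the contour shifted outwards by \<open>\<tau>\<close> keeps
  distance \<open>\<tau>0\<close> from \<open>w\<close> and has \<open>w\<close> on the same side
  as the boundary has.\<close>

definition separated :: "complex \<Rightarrow> real \<Rightarrow> bool" where
  "separated w \<tau>0 \<longleftrightarrow> \<tau>0 > 0 \<and> ((\<bar>Re w\<bar> \<le> \<sigma> - \<tau>0 \<and> Im w \<ge> \<tau>0) \<or> \<bar>Re w\<bar> \<ge> \<sigma> + 2 * \<tau>0 \<or> (\<bar>Re w\<bar> \<le> \<sigma> \<and> Im w \<le> - 2 * \<tau>0))"

lemma separated_distance:
  assumes "separated w \<tau>0" "0 \<le> \<tau>" "\<tau> \<le> \<tau>0"
    and "(\<bar>Re \<zeta>\<bar> = \<sigma> + \<tau> \<and> Im \<zeta> \<ge> - \<tau>) \<or> (\<bar>Re \<zeta>\<bar> \<le> \<sigma> + \<tau> \<and> Im \<zeta> = - \<tau>)"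
  shows "\<tau>0 \<le> norm (\<zeta> - w)"
proof -
  have "\<tau>0 \<le> \<bar>Re \<zeta> - Re w\<bar> \<or> \<tau>0 \<le> \<bar>Im \<zeta> - Im w\<bar>"
    using assms unfolding separated_def by linarith
  then show ?thesis using abs_Re_le_cmod[of "\<zeta> - w"] abs_Im_le_cmod[of "\<zeta> - w"] by auto
qed

text \<open>The parts of the Cauchy integral over the contour shifted outwards by \<open>\<tau>\<close>.\<close>

definition JL where "JL w \<tau> = (LINT v:{- \<tau><..}|lborel. F (Complex (- (\<sigma> + \<tau>)) v) / (Complex (- (\<sigma> + \<tau>)) v - w))"
definition JB where "JB w \<tau> = (LINT u:{- (\<sigma> + \<tau>)..\<sigma> + \<tau>}|lborel. F (Complex u (- \<tau>)) / (Complex u (- \<tau>) - w))"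
definition JR where "JR w \<tau> = (LINT v:{- \<tau><..}|lborel. F (Complex (\<sigma> + \<tau>) v) / (Complex (\<sigma> + \<tau>) v - w))"

text \<open>The Cauchy kernel cut off to the shifted sides, because the full lines may pass through
  \<open>w\<close>.\<close>

definition kL where "kL w \<tau> v = indicat_real {- \<tau><..} v *\<^sub>R (1 / (Complex (- (\<sigma> + \<tau>)) v - w))"
definition kB where "kB w \<tau> u = indicat_real {- (\<sigma> + \<tau>)..\<sigma> + \<tau>} u *\<^sub>R (1 / (Complex u (- \<tau>) - w))"
definition kR where "kR w \<tau> v = indicat_real {- \<tau><..} v *\<^sub>R (1 / (Complex (\<sigma> + \<tau>) v - w))"

lemma k_measurable [measurable]: "kL w \<tau> \<in> borel_measurable borel" "kB w \<tau> \<in> borel_measurable borel" "kR w \<tau> \<in> borel_measurable borel"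
proof -
  note Complex_measurable1[measurable]
  show "kL w \<tau> \<in> borel_measurable borel" "kB w \<tau> \<in> borel_measurable borel" "kR w \<tau> \<in> borel_measurable borel"
    unfolding kL_def kB_def kR_def by measurable
qed

lemma k_bound:
  assumes sep: "separated w \<tau>0" and \<tau>: "0 \<le> \<tau>" "\<tau> \<le> \<tau>0"
  defines "C \<equiv> (1 + norm w) / \<tau>0 + 1"
  shows "norm (kL w \<tau> x) \<le> C / (1 + \<bar>x\<bar>)" "norm (kB w \<tau> x) \<le> C / (1 + \<bar>x\<bar>)" "norm (kR w \<tau> x) \<le> C / (1 + \<bar>x\<bar>)"
proof -
  have t0: "\<tau>0 > 0" using sep by (simp add: separated_def)
  have C: "C / (1 + \<bar>x\<bar>) \<ge> 0" unfolding C_def using t0 by (intro divide_nonneg_nonneg add_nonneg_nonneg) auto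
  show "norm (kL w \<tau> x) \<le> C / (1 + \<bar>x\<bar>)"
  proof (cases "x > - \<tau>")
    case True
    have "norm (1 / (Complex (- (\<sigma> + \<tau>)) x - w)) \<le> C / (1 + \<bar>x\<bar>)" unfolding C_def
      by (rule kernel_decay[OF t0 separated_distance[OF sep \<tau>]]) (use True \<sigma> \<tau> abs_Im_le_cmod[of "Complex (- (\<sigma> + \<tau>)) x"] in auto)
    then show ?thesis using True by (simp add: kL_def)
  qed (use C in \<open>simp add: kL_def\<close>)
  show "norm (kR w \<tau> x) \<le> C / (1 + \<bar>x\<bar>)"
  proof (cases "x > - \<tau>")
    case True
    have "norm (1 / (Complex (\<sigma> + \<tau>) x - w)) \<le> C / (1 + \<bar>x\<bar>)" unfolding C_def
      by (rule kernel_decay[OF t0 separated_distance[OF sep \<tau>]]) (use True \<sigma> \<tau> abs_Im_le_cmod[of "Complex (\<sigma> + \<tau>) x"] in auto)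
    then show ?thesis using True by (simp add: kR_def)
  qed (use C in \<open>simp add: kR_def\<close>)
  show "norm (kB w \<tau> x) \<le> C / (1 + \<bar>x\<bar>)"
  proof (cases "x \<in> {- (\<sigma> + \<tau>)..\<sigma> + \<tau>}")
    case True
    have "norm (1 / (Complex x (- \<tau>) - w)) \<le> C / (1 + \<bar>x\<bar>)" unfolding C_def
      by (rule kernel_decay[OF t0 separated_distance[OF sep \<tau>]]) (use True \<sigma> \<tau> abs_Re_le_cmod[of "Complex x (- \<tau>)"] in auto)
    then show ?thesis using True by (simp add: kB_def)
  qed (use C in \<open>simp add: kB_def\<close>)
qed

lemma truncated_Lp:
  fixes g :: "real \<Rightarrow> complex"
  assumes "(Lp_integral p (\<lambda>x. g x)) \<le> ennreal K"
  shows "(Lp_integral p (\<lambda>x. indicat_real A x *\<^sub>R g x)) < \<infinity>"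
proof -
  have "(Lp_integral p (\<lambda>x. indicat_real A x *\<^sub>R g x)) \<le> (Lp_integral p (\<lambda>x. g x))"
    by (rule nn_integral_mono) (auto simp: indicator_def)
  also have "\<dots> < \<infinity>" using assms by (rule le_less_trans) simp
  finally show ?thesis .
qed

lemma J_eq:
  "JL w \<tau> = (LINT v|lborel. (indicat_real {- \<tau><..} v *\<^sub>R GL \<tau> v) * kL w \<tau> v)"
  "JB w \<tau> = (LINT v|lborel. (indicat_real {- (\<sigma> + \<tau>)..\<sigma> + \<tau>} v *\<^sub>R GB \<tau> v) * kB w \<tau> v)"
  "JR w \<tau> = (LINT v|lborel. (indicat_real {- \<tau><..} v *\<^sub>R GR \<tau> v) * kR w \<tau> v)"
  unfolding JL_def JB_def JR_def set_lebesgue_integral_def kL_def kB_def kR_def GL_def GB_def GR_def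
  by (intro Bochner_Integration.integral_cong; auto simp: indicator_def)+

lemma set_integrable_J:
  assumes p1: "p \<ge> 1" and sep: "separated w \<tau>0" and \<tau>: "0 < \<tau>" "\<tau> \<le> \<tau>0"
  shows "set_integrable lborel {- \<tau><..} (\<lambda>v. F (Complex (- (\<sigma> + \<tau>)) v) / (Complex (- (\<sigma> + \<tau>)) v - w))"
    "set_integrable lborel {- \<tau><..} (\<lambda>v. F (Complex (\<sigma> + \<tau>) v) / (Complex (\<sigma> + \<tau>) v - w))"
proof -
  note [measurable] = G_measurable[OF \<tau>(1)]
  have \<tau>': "0 \<le> \<tau>" using \<tau> by simp
  have "integrable lborel (\<lambda>v. (indicat_real {- \<tau><..} v *\<^sub>R GL \<tau> v) * kL w \<tau> v)"
    by (rule Lp_kernel_integrable(2)[OF p1 _ _ truncated_Lp[OF G_Lp(1)[OF \<tau>(1)]] k_bound(1)[OF sep \<tau>' \<tau>(2)]]) measurable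
  also have "?this \<longleftrightarrow> set_integrable lborel {- \<tau><..} (\<lambda>v. F (Complex (- (\<sigma> + \<tau>)) v) / (Complex (- (\<sigma> + \<tau>)) v - w))"
    unfolding set_integrable_def by (rule Bochner_Integration.integrable_cong) (auto simp: kL_def GL_def indicator_def)
  finally show "set_integrable lborel {- \<tau><..} (\<lambda>v. F (Complex (- (\<sigma> + \<tau>)) v) / (Complex (- (\<sigma> + \<tau>)) v - w))" .
  have "integrable lborel (\<lambda>v. (indicat_real {- \<tau><..} v *\<^sub>R GR \<tau> v) * kR w \<tau> v)"
    by (rule Lp_kernel_integrable(2)[OF p1 _ _ truncated_Lp[OF G_Lp(3)[OF \<tau>(1)]] k_bound(3)[OF sep \<tau>' \<tau>(2)]]) measurable
  also have "?this \<longleftrightarrow> set_integrable lborel {- \<tau><..} (\<lambda>v. F (Complex (\<sigma> + \<tau>) v) / (Complex (\<sigma> + \<tau>) v - w))"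
    unfolding set_integrable_def by (rule Bochner_Integration.integrable_cong) (auto simp: kR_def GR_def indicator_def)
  finally show "set_integrable lborel {- \<tau><..} (\<lambda>v. F (Complex (\<sigma> + \<tau>) v) / (Complex (\<sigma> + \<tau>) v - w))" .
qed

text \<open>The value of the contour integral of \<open>F \<zeta> / (\<zeta> - w)\<close> around the
  exterior.\<close>

definition cauchy_value :: "complex \<Rightarrow> complex" where
  "cauchy_value w = (if w \<in> Omega_minus \<sigma> then 2 * of_real pi * \<i> * F w else 0)"

text \<open>Each of the three rectangles lies in one of the half-planes at distance \<open>\<tau>\<close>
  from the half-strip. Edges shared by two of them cancel, and the right-hand side collects the
  edges on the outer square of side \<open>2 n\<close>. If \<open>w\<close> is in the exterior, it
  lies inside exactly one rectangle.\<close>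

lemma truncated_contour_identity:
  assumes sep: "separated w \<tau>0" and \<tau>: "0 < \<tau>" "\<tau> \<le> \<tau>0" and n: "n > norm w + \<sigma> + \<tau>"
  defines "s \<equiv> \<sigma> + \<tau>" and "t \<equiv> - \<tau>" and "g \<equiv> \<lambda>z. F z / (z - w)"
  defines "H \<equiv> \<lambda>e a b. LINT x:{a..b}|lborel. g (Complex x e)" and "V \<equiv> \<lambda>e a b. LINT y:{a..b}|lborel. g (Complex e y)"
  shows "H t (- s) s + \<i> * V s t n - \<i> * V (- s) t n =
    H (- n) (- n) (- s) - H n (- n) (- s) - \<i> * V (- n) (- n) n + H (- n) (- s) s + H (- n) s n - H n s n + \<i> * V n (- n) n - cauchy_value w"
proof -
  have t0: "\<tau>0 > 0" using sep by (simp add: separated_def)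
  have s: "s > \<sigma>" "s > 0" "t < 0" "n > s" "- n < t" "t < n" "- n < n" "- n < - s" "- s < s"
    using \<tau> n \<sigma> norm_ge_zero[of w] unfolding s_def t_def by linarith+
  have wn: "\<bar>Re w\<bar> < n" "\<bar>Im w\<bar> < n" using n \<tau> \<sigma> abs_Re_le_cmod[of w] abs_Im_le_cmod[of w] by linarith+
  note box = in_box_complex_iff in_cbox_complex_iff
  \<comment> \<open>In particular \<open>w\<close> is on none of the lines that carry edges of two rectangles.\<close>
  have loc: "(w \<notin> Omega_minus \<sigma> \<and> \<bar>Re w\<bar> < s \<and> Im w > t) \<or> (w \<in> Omega_minus \<sigma> \<and> (Re w < - s \<or> Re w > s \<or> (\<bar>Re w\<bar> < s \<and> Im w < t)))"
    using sep \<tau> t0 \<sigma> unfolding separated_def Omega_minus_eq s_def t_def by auto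
  have R1: "H (- n) (- n) (- s) - H n (- n) (- s) + \<i> * (V (- s) (- n) n - V (- n) (- n) n) = (if Re w < - s then 2 * of_real pi * \<i> * F w else 0)"
  proof -
    have "w \<in> box (Complex (- n) (- n)) (Complex (- s) n) \<longleftrightarrow> Re w < - s" using wn by (auto simp: box)
    moreover have "w \<in> cbox (Complex (- n) (- n)) (Complex (- s) n) \<longleftrightarrow> Re w < - s" using wn loc s by (auto simp: box)
    moreover have "cbox (Complex (- n) (- n)) (Complex (- s) n) \<subseteq> Omega_minus \<sigma>" using s by (auto simp: box Omega_minus_eq)
    ultimately show ?thesis using rectangle_contour[OF s(8) s(7), of w] unfolding H_def V_def g_def by simp
  qed
  have R2: "H (- n) (- s) s - H t (- s) s + \<i> * (V s (- n) t - V (- s) (- n) t) = (if \<bar>Re w\<bar> < s \<and> Im w < t then 2 * of_real pi * \<i> * F w else 0)"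
  proof -
    have "w \<in> box (Complex (- s) (- n)) (Complex s t) \<longleftrightarrow> \<bar>Re w\<bar> < s \<and> Im w < t" using wn by (auto simp: box)
    moreover have "w \<in> cbox (Complex (- s) (- n)) (Complex s t) \<longleftrightarrow> \<bar>Re w\<bar> < s \<and> Im w < t" using wn loc s by (auto simp: box)
    moreover have "cbox (Complex (- s) (- n)) (Complex s t) \<subseteq> Omega_minus \<sigma>" using s by (auto simp: box Omega_minus_eq)
    ultimately show ?thesis using rectangle_contour[OF s(9) s(5), of w] unfolding H_def V_def g_def by simp
  qed
  have R3: "H (- n) s n - H n s n + \<i> * (V n (- n) n - V s (- n) n) = (if Re w > s then 2 * of_real pi * \<i> * F w else 0)"
  proof -
    have "w \<in> box (Complex s (- n)) (Complex n n) \<longleftrightarrow> Re w > s" using wn by (auto simp: box)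
    moreover have "w \<in> cbox (Complex s (- n)) (Complex n n) \<longleftrightarrow> Re w > s" using wn loc s by (auto simp: box)
    moreover have "cbox (Complex s (- n)) (Complex n n) \<subseteq> Omega_minus \<sigma>" using s by (auto simp: box Omega_minus_eq)
    ultimately show ?thesis using rectangle_contour[OF s(4) s(7), of w] unfolding H_def V_def g_def by simp
  qed
  have split: "V e (- n) n = V e (- n) t + V e t n" if e: "\<bar>e\<bar> = s" for e
  proof -
    have ne: "Re w \<noteq> e" using loc e by auto
    have "continuous_on UNIV (\<lambda>y. g (Complex e y))" unfolding g_def
    proof (intro continuous_intros)
      show "continuous_on UNIV (\<lambda>y. F (Complex e y))"
        by (rule continuous_on_compose2[OF holomorphic_on_imp_continuous_on[OF F_holomorphic]])
          (use e s in \<open>auto intro!: continuous_intros simp: Omega_minus_eq\<close>)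
    qed (use ne in \<open>auto simp: complex_eq_iff\<close>)
    then have i: "set_integrable lborel {a..b} (\<lambda>y. g (Complex e y))" for a b
      by (intro borel_integrable_atLeastAtMost') (rule continuous_on_subset, auto)
    have "{- n..n} = {- n..t} \<union> {t..n}" using s by auto
    moreover have "AE y in lborel. \<not> (y \<in> {- n..t} \<and> y \<in> {t..n})" using AE_lborel_singleton[of t] by eventually_elim auto
    moreover have "(LINT y:{- n..t} \<union> {t..n}|lborel. g (Complex e y)) = (LINT y:{- n..t}|lborel. g (Complex e y)) + (LINT y:{t..n}|lborel. g (Complex e y))"
      if "AE y in lborel. \<not> (y \<in> {- n..t} \<and> y \<in> {t..n})"
      by (rule set_integral_Un_AE[OF that]) (use i in auto)
    ultimately show ?thesis unfolding V_def by simp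
  qed
  have "cauchy_value w = (if Re w < - s then 2 * of_real pi * \<i> * F w else 0) + (if \<bar>Re w\<bar> < s \<and> Im w < t then 2 * of_real pi * \<i> * F w else 0)
     + (if Re w > s then 2 * of_real pi * \<i> * F w else 0)"
    unfolding cauchy_value_def using loc s by auto
  then show ?thesis unfolding R1[symmetric] R2[symmetric] R3[symmetric] using split[of s] split[of "- s"] s by (simp add: algebra_simps)
qed

text \<open>The outer edges have length at most \<open>2 n\<close>, the kernel is of size \<open>1 /
  n\<close> there, and \<open>F\<close> tends to zero.\<close>

lemma contour_integral_value:
  assumes p1: "p \<ge> 1" and sep: "separated w \<tau>0" and \<tau>: "0 < \<tau>" "\<tau> \<le> \<tau>0"
  shows "JB w \<tau> + \<i> * JR w \<tau> - \<i> * JL w \<tau> = - cauchy_value w"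
proof -
  define s where "s = \<sigma> + \<tau>"
  define t where "t = - \<tau>"
  define g where "g = (\<lambda>z. F z / (z - w))"
  define H where "H = (\<lambda>e a b. LINT x:{a..b}|lborel. g (Complex x e))"
  define V where "V = (\<lambda>e a b. LINT y:{a..b}|lborel. g (Complex e y))"
  define E where "E n = H (- n) (- n) (- s) - H n (- n) (- s) - \<i> * V (- n) (- n) n + H (- n) (- s) s + H (- n) s n - H n s n + \<i> * V n (- n) n" for n
  have s: "s > 0" "s > \<sigma>" "t < 0" using \<sigma> \<tau> by (auto simp: s_def t_def)
  have id: "H t (- s) s + \<i> * V s t n - \<i> * V (- s) t n = E n - cauchy_value w" if "n > norm w + s" for n
    using truncated_contour_identity[OF sep \<tau>, of n] that unfolding E_def H_def V_def g_def s_def t_def by simp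
  have E0: "(\<lambda>n. E (real n)) \<longlonglongrightarrow> 0"
  proof (rule LIMSEQ_I)
    fix e :: real assume e: "e > 0"
    \<comment> \<open>Each of the seven outer edges contributes at most \<open>4 r\<close>, in all \<open>28 r = e /
      2\<close>.\<close>
    define r where "r = e / 56"
    have r: "r > 0" using e by (simp add: r_def)
    obtain R where R: "\<And>\<zeta>. \<bar>Re \<zeta>\<bar> \<ge> \<sigma> + \<tau> \<or> Im \<zeta> \<le> - \<tau> \<Longrightarrow> norm \<zeta> \<ge> R \<Longrightarrow> norm (F \<zeta>) < r"
      by (rule F_vanishes[OF \<tau>(1) r]) blast
    obtain M where M: "R + 2 * norm w + s + 1 - t + \<bar>R\<bar> < real M" using reals_Archimedean2 by blast
    have "norm (E (real n)) < e" if "n \<ge> M" for n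
    proof -
      have big: "R \<le> real n" "2 * norm w \<le> real n" "s < real n" "- t < real n" "real n > 0"
      proof -
        have "real n \<ge> real M" using that by simp
        then show "R \<le> real n" "2 * norm w \<le> real n" "s < real n" "- t < real n" "real n > 0"
          using M s norm_ge_zero[of w] by linarith+
      qed
      have pt: "norm (g \<zeta>) \<le> 2 * r / real n" if "\<bar>Re \<zeta>\<bar> \<ge> s \<or> Im \<zeta> \<le> t" "norm \<zeta> \<ge> real n" for \<zeta>
      proof -
        have "norm (F \<zeta>) \<le> r" using R[of \<zeta>] that big by (simp add: s_def t_def less_imp_le)
        moreover have "real n / 2 \<le> norm (\<zeta> - w)" using norm_triangle_ineq2[of \<zeta> w] that big by linarith
        ultimately have "norm (F \<zeta>) / norm (\<zeta> - w) \<le> r / (real n / 2)" using big r by (intro frac_le) auto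
        then show ?thesis by (simp add: g_def norm_divide mult.commute)
      qed
      have seg: "norm (LINT y:{a..b}|lborel. h y) \<le> 4 * r" if "a \<le> b" "b - a \<le> 2 * real n" "\<And>y. y \<in> {a..b} \<Longrightarrow> norm (h y) \<le> 2 * r / real n"
        for a b and h :: "real \<Rightarrow> complex"
      proof -
        have "norm (LINT y:{a..b}|lborel. h y) \<le> 2 * r / real n * (b - a)" by (rule norm_set_integral_le[OF that(1,3)])
        also have "\<dots> \<le> 2 * r / real n * (2 * real n)" using that(2) r big by (intro mult_left_mono) auto
        also have "\<dots> = 4 * r" using big by simp
        finally show ?thesis .
      qed
      have ReC: "\<bar>x\<bar> \<le> norm (Complex x y)" and ImC: "\<bar>y\<bar> \<le> norm (Complex x y)" for x y
        using abs_Re_le_cmod[of "Complex x y"] abs_Im_le_cmod[of "Complex x y"] by auto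
      have b1: "norm (H (- real n) (- real n) (- s)) \<le> 4 * r" unfolding H_def
        by (rule seg) (use big s ImC[of "- real n"] in \<open>auto intro!: pt\<close>)
      have b2: "norm (H (real n) (- real n) (- s)) \<le> 4 * r" unfolding H_def
        by (rule seg) (use big s ImC[of "real n"] in \<open>auto intro!: pt\<close>)
      have b3: "norm (V (- real n) (- real n) (real n)) \<le> 4 * r" unfolding V_def
        by (rule seg) (use big s ReC[of "- real n"] in \<open>auto intro!: pt\<close>)
      have b4: "norm (H (- real n) (- s) s) \<le> 4 * r" unfolding H_def
        by (rule seg) (use big s ImC[of "- real n"] in \<open>auto intro!: pt\<close>)
      have b5: "norm (H (- real n) s (real n)) \<le> 4 * r" unfolding H_def
        by (rule seg) (use big s ImC[of "- real n"] in \<open>auto intro!: pt\<close>)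
      have b6: "norm (H (real n) s (real n)) \<le> 4 * r" unfolding H_def
        by (rule seg) (use big s ImC[of "real n"] in \<open>auto intro!: pt\<close>)
      have b7: "norm (V (real n) (- real n) (real n)) \<le> 4 * r" unfolding V_def
        by (rule seg) (use big s ReC[of "real n"] in \<open>auto intro!: pt\<close>)
      have tri: "norm (a1 - a2 - \<i> * a3 + a4 + a5 - a6 + \<i> * a7) \<le> norm a1 + norm a2 + norm a3 + norm a4 + norm a5 + norm a6 + norm a7" for a1 a2 a3 a4 a5 a6 a7 :: complex
      proof -
        have i: "norm (\<i> * a3) = norm a3" "norm (\<i> * a7) = norm a7" by (simp_all add: norm_mult)
        show ?thesis
          using norm_triangle_ineq[of "a1 - a2 - \<i> * a3 + a4 + a5 - a6" "\<i> * a7"] norm_triangle_ineq4[of "a1 - a2 - \<i> * a3 + a4 + a5" a6]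
            norm_triangle_ineq[of "a1 - a2 - \<i> * a3 + a4" a5] norm_triangle_ineq[of "a1 - a2 - \<i> * a3" a4] norm_triangle_ineq4[of "a1 - a2" "\<i> * a3"] norm_triangle_ineq4[of a1 a2]
          unfolding i by linarith
      qed
      have "norm (E (real n)) \<le> 28 * r" unfolding E_def
        using tri[of "H (- real n) (- real n) (- s)" "H (real n) (- real n) (- s)" "V (- real n) (- real n) (real n)" "H (- real n) (- s) s" "H (- real n) s (real n)" "H (real n) s (real n)" "V (real n) (- real n) (real n)"] b1 b2 b3 b4 b5 b6 b7 by linarith
      then show ?thesis using e by (simp add: r_def)
    qed
    then show "\<exists>no. \<forall>n\<ge>no. norm (E (real n) - 0) < e" by auto
  qed
  have VR: "(\<lambda>n. V s t (real n)) \<longlonglongrightarrow> JR w \<tau>" unfolding V_def JR_def g_def s_def t_def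
    by (rule set_integral_upward_limit[OF set_integrable_J(2)[OF p1 sep \<tau>]])
  have VL: "(\<lambda>n. V (- s) t (real n)) \<longlonglongrightarrow> JL w \<tau>" unfolding V_def JL_def g_def s_def t_def
    by (rule set_integral_upward_limit[OF set_integrable_J(1)[OF p1 sep \<tau>]])
  have HB: "H t (- s) s = JB w \<tau>" unfolding H_def JB_def g_def s_def t_def ..
  have "(\<lambda>n. H t (- s) s + \<i> * V s t (real n) - \<i> * V (- s) t (real n)) \<longlonglongrightarrow> JB w \<tau> + \<i> * JR w \<tau> - \<i> * JL w \<tau>"
    unfolding HB by (intro tendsto_intros VR VL)
  moreover have "(\<lambda>n. H t (- s) s + \<i> * V s t (real n) - \<i> * V (- s) t (real n)) \<longlonglongrightarrow> 0 - cauchy_value w"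
  proof (rule Lim_transform_eventually)
    show "(\<lambda>n. E (real n) - cauchy_value w) \<longlonglongrightarrow> 0 - cauchy_value w" by (intro tendsto_intros E0)
    have "\<forall>\<^sub>F n in sequentially. real n > norm w + s" using filterlim_real_sequentially by (auto simp: filterlim_at_top_dense)
    then show "\<forall>\<^sub>F n in sequentially. E (real n) - cauchy_value w = H t (- s) s + \<i> * V s t (real n) - \<i> * V (- s) t (real n)"
      by eventually_elim (simp add: id)
  qed
  ultimately show ?thesis using LIMSEQ_unique by fastforce
qed

text \<open>The integral over the shifted contour has a value independent of \<open>\<tau>\<close>, and it
  converges to the integral over the boundary.\<close>

lemma boundary_contour_integral:
  assumes p1: "p \<ge> 1" and sep: "separated w \<tau>0"
  shows "bdry_integrable \<sigma> 0 (\<lambda>\<zeta>. Fb \<zeta> / (\<zeta> - w))" "bdry_integral \<sigma> 0 (\<lambda>\<zeta>. Fb \<zeta> / (\<zeta> - w)) = - cauchy_value w"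
proof -
  have t0: "\<tau>0 > 0" using sep by (simp add: separated_def)
  define C where "C = (1 + norm w) / \<tau>0 + 1"
  define T where "T n = \<tau>0 / real (Suc n)" for n
  have T: "T n > 0" "T n \<ge> 0" "T n \<le> \<tau>0" for n using t0 by (auto simp: T_def field_simps)
  have T0: "T \<longlonglongrightarrow> 0" unfolding T_def using tendsto_mult_left[OF inverse_Suc_tendsto, of \<tau>0] by simp
  have Tr: "filterlim T (at_right 0) sequentially" using T0 T(1) by (auto simp: filterlim_at less_imp_neq[symmetric])
  note [measurable] = G_measurable[OF T(1)]
  have kb: "norm (kL w \<tau> x) \<le> C / (1 + \<bar>x\<bar>)" "norm (kB w \<tau> x) \<le> C / (1 + \<bar>x\<bar>)" "norm (kR w \<tau> x) \<le> C / (1 + \<bar>x\<bar>)" if "0 \<le> \<tau>" "\<tau> \<le> \<tau>0" for \<tau> x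
    unfolding C_def using k_bound[OF sep that] by auto
  have kb0: "norm (kL w 0 x) \<le> C / (1 + \<bar>x\<bar>)" "norm (kB w 0 x) \<le> C / (1 + \<bar>x\<bar>)" "norm (kR w 0 x) \<le> C / (1 + \<bar>x\<bar>)" for x
    using kb[of 0 x] t0 by auto
  have kbT: "norm (kL w (T n) x) \<le> C / (1 + \<bar>x\<bar>)" "norm (kB w (T n) x) \<le> C / (1 + \<bar>x\<bar>)" "norm (kR w (T n) x) \<le> C / (1 + \<bar>x\<bar>)" for n x
    using kb[OF T(2) T(3)] by auto
  have klim: "(\<lambda>n. 1 / (Z n - w)) \<longlonglongrightarrow> 1 / (z - w)" if "Z \<longlonglongrightarrow> z" "\<tau>0 \<le> norm (z - w)" for Z z
    using that t0 by (intro tendsto_intros) auto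
  have limL: "(\<lambda>n. JL w (T n)) \<longlonglongrightarrow> (LINT v|lborel. (indicat_real {0<..} v *\<^sub>R gL v) * kL w 0 v)"
    unfolding J_eq
  proof (rule integral_kernel_limit[OF p1, where C = C])
    show "(\<lambda>n. Lp_integral p (\<lambda>x. indicat_real {- T n<..} x *\<^sub>R GL (T n) x - indicat_real {0<..} x *\<^sub>R gL x)) \<longlonglongrightarrow> 0"
      by (rule filterlim_compose[OF truncated_limits(1) Tr])
    fix x assume "indicat_real {0<..} x *\<^sub>R gL x \<noteq> 0"
    then have x: "x > 0" by (auto simp: indicator_def split: if_splits)
    have "x > - T n" for n using x T(2)[of n] by linarith
    then have "kL w (T n) x = 1 / (Complex (- (\<sigma> + T n)) x - w)" for n by (simp add: kL_def)
    moreover have "kL w 0 x = 1 / (Complex (- (\<sigma> + 0)) x - w)" using x by (simp add: kL_def)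
    moreover have "(\<lambda>n. 1 / (Complex (- (\<sigma> + T n)) x - w)) \<longlonglongrightarrow> 1 / (Complex (- (\<sigma> + 0)) x - w)"
    proof (rule klim)
      show "(\<lambda>n. Complex (- (\<sigma> + T n)) x) \<longlonglongrightarrow> Complex (- (\<sigma> + 0)) x" by (intro tendsto_intros T0)
      show "\<tau>0 \<le> norm (Complex (- (\<sigma> + 0)) x - w)" by (rule separated_distance[OF sep, of 0]) (use x t0 \<sigma> in auto)
    qed
    ultimately show "(\<lambda>n. kL w (T n) x) \<longlonglongrightarrow> kL w 0 x" by simp
  qed (use kb0 kbT truncated_Lp[OF g_Lp(1)] truncated_Lp[OF G_Lp(1)[OF T(1)]] in \<open>auto intro!: borel_measurable_scaleR\<close>)
  have limR: "(\<lambda>n. JR w (T n)) \<longlonglongrightarrow> (LINT v|lborel. (indicat_real {0<..} v *\<^sub>R gR v) * kR w 0 v)"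
    unfolding J_eq
  proof (rule integral_kernel_limit[OF p1, where C = C])
    show "(\<lambda>n. Lp_integral p (\<lambda>x. indicat_real {- T n<..} x *\<^sub>R GR (T n) x - indicat_real {0<..} x *\<^sub>R gR x)) \<longlonglongrightarrow> 0"
      by (rule filterlim_compose[OF truncated_limits(3) Tr])
    fix x assume "indicat_real {0<..} x *\<^sub>R gR x \<noteq> 0"
    then have x: "x > 0" by (auto simp: indicator_def split: if_splits)
    have "x > - T n" for n using x T(2)[of n] by linarith
    then have "kR w (T n) x = 1 / (Complex (\<sigma> + T n) x - w)" for n by (simp add: kR_def)
    moreover have "kR w 0 x = 1 / (Complex (\<sigma> + 0) x - w)" using x by (simp add: kR_def)
    moreover have "(\<lambda>n. 1 / (Complex (\<sigma> + T n) x - w)) \<longlonglongrightarrow> 1 / (Complex (\<sigma> + 0) x - w)"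
    proof (rule klim)
      show "(\<lambda>n. Complex (\<sigma> + T n) x) \<longlonglongrightarrow> Complex (\<sigma> + 0) x" by (intro tendsto_intros T0)
      show "\<tau>0 \<le> norm (Complex (\<sigma> + 0) x - w)" by (rule separated_distance[OF sep, of 0]) (use x t0 \<sigma> in auto)
    qed
    ultimately show "(\<lambda>n. kR w (T n) x) \<longlonglongrightarrow> kR w 0 x" by simp
  qed (use kb0 kbT truncated_Lp[OF g_Lp(3)] truncated_Lp[OF G_Lp(3)[OF T(1)]] in \<open>auto intro!: borel_measurable_scaleR\<close>)
  have limB: "(\<lambda>n. JB w (T n)) \<longlonglongrightarrow> (LINT u|lborel. (indicat_real {- \<sigma>..\<sigma>} u *\<^sub>R gB u) * kB w 0 u)"
    unfolding J_eq
  proof (rule integral_kernel_limit[OF p1, where C = C])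
    show "(\<lambda>n. Lp_integral p (\<lambda>x. indicat_real {- (\<sigma> + T n)..\<sigma> + T n} x *\<^sub>R GB (T n) x - indicat_real {- \<sigma>..\<sigma>} x *\<^sub>R gB x)) \<longlonglongrightarrow> 0"
      by (rule filterlim_compose[OF truncated_limits(2) Tr])
    fix x assume "indicat_real {- \<sigma>..\<sigma>} x *\<^sub>R gB x \<noteq> 0"
    then have x: "- \<sigma> \<le> x" "x \<le> \<sigma>" by (auto simp: indicator_def split: if_splits)
    have "x \<in> {- (\<sigma> + T n)..\<sigma> + T n}" for n using x T(2)[of n] by simp
    then have "kB w (T n) x = 1 / (Complex x (- T n) - w)" for n by (simp add: kB_def)
    moreover have "kB w 0 x = 1 / (Complex x (- 0) - w)" using x by (simp add: kB_def)
    moreover have "(\<lambda>n. 1 / (Complex x (- T n) - w)) \<longlonglongrightarrow> 1 / (Complex x (- 0) - w)"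
    proof (rule klim)
      show "(\<lambda>n. Complex x (- T n)) \<longlonglongrightarrow> Complex x (- 0)" by (intro tendsto_intros T0)
      show "\<tau>0 \<le> norm (Complex x (- 0) - w)" by (rule separated_distance[OF sep, of 0]) (use x t0 \<sigma> in auto)
    qed
    ultimately show "(\<lambda>n. kB w (T n) x) \<longlonglongrightarrow> kB w 0 x" by simp
  qed (use kb0 kbT truncated_Lp[OF g_Lp(2)] truncated_Lp[OF G_Lp(2)[OF T(1)]] in \<open>auto intro!: borel_measurable_scaleR\<close>)
  have eL: "(indicat_real {0<..} v *\<^sub>R gL v) * kL w 0 v = indicat_real {0<..} v *\<^sub>R (Fb (Complex (- \<sigma>) v) / (Complex (- \<sigma>) v - w))" for v
    using \<sigma> by (auto simp: Fb_def kL_def indicator_def)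
  have eB: "(indicat_real {- \<sigma>..\<sigma>} v *\<^sub>R gB v) * kB w 0 v = indicat_real {- \<sigma>..\<sigma>} v *\<^sub>R (Fb (Complex v 0) / (Complex v 0 - w))" for v
    by (auto simp: Fb_def kB_def indicator_def)
  have eR: "(indicat_real {0<..} v *\<^sub>R gR v) * kR w 0 v = indicat_real {0<..} v *\<^sub>R (Fb (Complex \<sigma> v) / (Complex \<sigma> v - w))" for v
    using \<sigma> by (auto simp: Fb_def kR_def indicator_def)
  have iL: "set_integrable lborel {0<..} (\<lambda>v. Fb (Complex (- \<sigma>) v) / (Complex (- \<sigma>) v - w))"
    unfolding set_integrable_def eL[symmetric]
    by (rule Lp_kernel_integrable(2)[OF p1 _ _ truncated_Lp[OF g_Lp(1)] kb0(1)]) measurable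
  have iB: "set_integrable lborel {- \<sigma>..\<sigma>} (\<lambda>v. Fb (Complex v 0) / (Complex v 0 - w))"
    unfolding set_integrable_def eB[symmetric]
    by (rule Lp_kernel_integrable(2)[OF p1 _ _ truncated_Lp[OF g_Lp(2)] kb0(2)]) measurable
  have iR: "set_integrable lborel {0<..} (\<lambda>v. Fb (Complex \<sigma> v) / (Complex \<sigma> v - w))"
    unfolding set_integrable_def eR[symmetric]
    by (rule Lp_kernel_integrable(2)[OF p1 _ _ truncated_Lp[OF g_Lp(3)] kb0(3)]) measurable
  show "bdry_integrable \<sigma> 0 (\<lambda>\<zeta>. Fb \<zeta> / (\<zeta> - w))"
    by (rule bdry_integral_split(1)[OF \<sigma> iL iB iR])
  have "(\<lambda>n. JB w (T n) + \<i> * JR w (T n) - \<i> * JL w (T n)) \<longlonglongrightarrow> bdry_integral \<sigma> 0 (\<lambda>\<zeta>. Fb \<zeta> / (\<zeta> - w))"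
    unfolding bdry_integral_split(2)[OF \<sigma> iL iB iR] set_lebesgue_integral_def
    unfolding eL[symmetric] eB[symmetric] eR[symmetric]
    by (intro tendsto_intros limL limB limR)
  moreover have "JB w (T n) + \<i> * JR w (T n) - \<i> * JL w (T n) = - cauchy_value w" for n
    by (rule contour_integral_value[OF p1 sep T(1) T(3)])
  ultimately show "bdry_integral \<sigma> 0 (\<lambda>\<zeta>. Fb \<zeta> / (\<zeta> - w)) = - cauchy_value w"
    using LIMSEQ_unique[OF _ tendsto_const] by simp
qed

lemma separated_exists:
  assumes "w \<in> Omega_plus \<sigma> \<union> Omega_minus \<sigma>"
  obtains \<tau>0 where "separated w \<tau>0"
proof (cases "w \<in> Omega_plus \<sigma>")
  case True
  then have "separated w (min (\<sigma> - \<bar>Re w\<bar>) (Im w))" by (auto simp: separated_def Omega_plus_def half_strip_def)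
  then show ?thesis using that by blast
next
  case False
  then have w: "\<bar>Re w\<bar> > \<sigma> \<or> Im w < 0" using assms by (auto simp: Omega_minus_eq)
  show ?thesis
  proof (cases "\<bar>Re w\<bar> > \<sigma>")
    case True
    define \<tau>0 where "\<tau>0 = (\<bar>Re w\<bar> - \<sigma>) / 2"
    have "\<tau>0 + \<tau>0 = \<bar>Re w\<bar> - \<sigma>" unfolding \<tau>0_def by (rule field_sum_of_halves)
    then have "\<tau>0 > 0" "\<bar>Re w\<bar> = \<sigma> + 2 * \<tau>0" using True by linarith+
    then show ?thesis by (intro that[of \<tau>0]) (auto simp: separated_def)
  next
    case False
    then show ?thesis using w by (intro that[of "- Im w / 2"]) (auto simp: separated_def)
  qed
qed

end

theorem theorem6p14:
  fixes \<sigma> p :: real and F :: "complex \<Rightarrow> complex"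
  assumes "\<sigma> > 0" and "p > 0" and "F \<in> Hp_space \<sigma> p"
  shows "\<exists>Fb :: complex \<Rightarrow> complex.
    (AE \<zeta> in bdry_measure \<sigma> 0. has_nt_limit \<sigma> F \<zeta> (Fb \<zeta>)) \<and>
    Fb \<in> Lp_space p (bdry_measure \<sigma> 0) \<and>
    Lp_norm p (bdry_measure \<sigma> 0) Fb \<le> Hp_norm \<sigma> p F \<and>
    ((\<lambda>\<tau>. Lp_norm p (lines_measure \<sigma>)
        (\<lambda>\<zeta>. transport \<sigma> (\<sigma> + \<tau>) (- \<tau>) F \<zeta> - (if \<zeta> \<in> bdry \<sigma> 0 then Fb \<zeta> else 0)))
      \<longlongrightarrow> 0) (at 0 within {0<..<\<sigma>}) \<and>
    (p \<ge> 1 \<longrightarrow>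
      (\<forall>w \<in> Omega_plus \<sigma>.
        bdry_integrable \<sigma> 0 (\<lambda>\<zeta>. Fb \<zeta> / (\<zeta> - w)) \<and>
        1 / (2 * of_real pi * \<i>) * bdry_integral \<sigma> 0 (\<lambda>\<zeta>. Fb \<zeta> / (\<zeta> - w)) = 0) \<and>
      (\<forall>w \<in> Omega_minus \<sigma>.
        bdry_integrable \<sigma> 0 (\<lambda>\<zeta>. Fb \<zeta> / (\<zeta> - w)) \<and>
        1 / (2 * of_real pi * \<i>) * bdry_integral \<sigma> 0 (\<lambda>\<zeta>. Fb \<zeta> / (\<zeta> - w)) = - F w))"
proof -
  interpret exterior_hardy \<sigma> p F by unfold_locales (fact assms)+
  have le: "Lp_norm p (bdry_measure \<sigma> 0) Fb \<le> Hp_norm \<sigma> p F"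
    by (rule Lp_norm_leI[OF p N_finite]) (use Fb_norm_le in \<open>simp add: K_def\<close>)
  have Lp: "Fb \<in> Lp_space p (bdry_measure \<sigma> 0)"
    using Fb_measurable le_less_trans[OF le N_finite] by (simp add: Lp_space_def measurable_def[of borel] measurable_def[of "bdry_measure \<sigma> 0"])
  have plus: "cauchy_value w = 0" if "w \<in> Omega_plus \<sigma>" for w
    using that by (auto simp: cauchy_value_def Omega_minus_eq Omega_plus_def half_strip_def)
  have cauchy: "bdry_integrable \<sigma> 0 (\<lambda>\<zeta>. Fb \<zeta> / (\<zeta> - w)) \<and> bdry_integral \<sigma> 0 (\<lambda>\<zeta>. Fb \<zeta> / (\<zeta> - w)) = - cauchy_value w"
    if p1: "p \<ge> 1" and w: "w \<in> Omega_plus \<sigma> \<union> Omega_minus \<sigma>" for w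
  proof -
    obtain \<tau>0 where "separated w \<tau>0" using separated_exists[OF w] by blast
    then show ?thesis using boundary_contour_integral[OF p1] by blast
  qed
  show ?thesis
  proof (intro exI[of _ Fb] conjI impI ballI)
    fix w assume w: "p \<ge> 1" "w \<in> Omega_plus \<sigma>"
    show "bdry_integrable \<sigma> 0 (\<lambda>\<zeta>. Fb \<zeta> / (\<zeta> - w))" using cauchy[of w] w by blast
    show "1 / (2 * of_real pi * \<i>) * bdry_integral \<sigma> 0 (\<lambda>\<zeta>. Fb \<zeta> / (\<zeta> - w)) = 0" using cauchy[of w] w plus[of w] by simp
  next
    fix w assume w: "p \<ge> 1" "w \<in> Omega_minus \<sigma>"
    show "bdry_integrable \<sigma> 0 (\<lambda>\<zeta>. Fb \<zeta> / (\<zeta> - w))" using cauchy[of w] w by blast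
    show "1 / (2 * of_real pi * \<i>) * bdry_integral \<sigma> 0 (\<lambda>\<zeta>. Fb \<zeta> / (\<zeta> - w)) = - F w"
      using cauchy[of w] w by (simp add: cauchy_value_def)
  qed (fact Fb_nontangential Lp le transport_limit)+
qed

end
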